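(* Let $P\in\mathbb Q[x_1,x_2,\dots]$, $d\ge2$, $i\ge1$. Then $\langle\chi_P,H^{i(d-1)}(\mathrm{Conf}(n,\mathbb R^d);\mathbb Q)\rangle_{S_n}$ is constant as a function of $n$ for $n\ge\max\{2\deg(P),\deg(P)+i\}$ when $d$ is odd, and for $n\ge\max\{2\deg(P),\deg(P)+i+1\}$ when $d$ is even.
   Context: $\chi_P$ is the class function on $S_n$ with $\chi_P(w)=P(m_1,m_2,\dots)$ when $w$ has $m_j$ cycles of length $j$; $\deg(P)$ is computed with $\deg(x_j)=j$. $\mathrm{Conf}(n,\mathbb R^d)$ is the space of ordered $n$-tuples of distinct points with $S_n$ permuting coordinates; $\langle\cdot,\cdot\rangle_{S_n}$ is the standard inner product of class functions. *)

theory Defs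
  imports "HOL-Analysis.Analysis" "HOL-Library.Poly_Mapping"
begin

definition std_simplex :: "nat \<Rightarrow> (nat \<Rightarrow> real) set" where
  "std_simplex p \<equiv>
    {x. (\<forall>i. 0 \<le> x i \<and> x i \<le> 1) \<and> (\<forall>i>p. x i = 0) \<and> (\<Sum>i\<le>p. x i) = 1}"

definition simpl_face :: "nat \<Rightarrow> (nat \<Rightarrow> real) \<Rightarrow> nat \<Rightarrow> real" where
  "simpl_face k x \<equiv> \<lambda>i. if i < k then x i else if i = k then 0 else x (i - 1)"

definition sing_simplex :: "nat \<Rightarrow> 'a topology \<Rightarrow> ((nat \<Rightarrow> real) \<Rightarrow> 'a) \<Rightarrow> bool" where
  "sing_simplex p X f \<equiv>
      continuous_map (subtopology (powertop_real UNIV) (std_simplex p)) X f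
    \<and> f \<in> extensional (std_simplex p)"

definition sing_face :: "nat \<Rightarrow> nat \<Rightarrow> ((nat \<Rightarrow> real) \<Rightarrow> 'a) \<Rightarrow> (nat \<Rightarrow> real) \<Rightarrow> 'a" where
  "sing_face p k f \<equiv> restrict (f \<circ> simpl_face k) (std_simplex (p - Suc 0))"

definition cochains :: "nat \<Rightarrow> 'a topology \<Rightarrow> (((nat \<Rightarrow> real) \<Rightarrow> 'a) \<Rightarrow> rat) set" where
  "cochains p X \<equiv> {\<phi>. \<forall>f. \<not> sing_simplex p X f \<longrightarrow> \<phi> f = 0}"

definition coboundary :: "nat \<Rightarrow> 'a topology \<Rightarrow> (((nat \<Rightarrow> real) \<Rightarrow> 'a) \<Rightarrow> rat)
     \<Rightarrow> ((nat \<Rightarrow> real) \<Rightarrow> 'a) \<Rightarrow> rat" where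
  "coboundary p X \<phi> \<equiv> \<lambda>f. if sing_simplex (Suc p) X f
      then (\<Sum>k\<le>Suc p. (-1) ^ k * \<phi> (sing_face (Suc p) k f)) else 0"

definition cocycles :: "nat \<Rightarrow> 'a topology \<Rightarrow> (((nat \<Rightarrow> real) \<Rightarrow> 'a) \<Rightarrow> rat) set" where
  "cocycles p X \<equiv> {\<phi> \<in> cochains p X. coboundary p X \<phi> = (\<lambda>f. 0)}"

definition coboundaries :: "nat \<Rightarrow> 'a topology \<Rightarrow> (((nat \<Rightarrow> real) \<Rightarrow> 'a) \<Rightarrow> rat) set" where
  "coboundaries p X \<equiv> (case p of 0 \<Rightarrow> {\<lambda>f. 0}
       | Suc q \<Rightarrow> coboundary q X ` cochains q X)"

definition cochain_pullback :: "nat \<Rightarrow> 'a topology \<Rightarrow> ('a \<Rightarrow> 'b)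
     \<Rightarrow> (((nat \<Rightarrow> real) \<Rightarrow> 'b) \<Rightarrow> rat) \<Rightarrow> ((nat \<Rightarrow> real) \<Rightarrow> 'a) \<Rightarrow> rat" where
  "cochain_pullback p X g \<phi> \<equiv> \<lambda>f. if sing_simplex p X f
      then \<phi> (restrict (g \<circ> f) (std_simplex p)) else 0"

definition lincomb :: "(nat \<Rightarrow> rat) \<Rightarrow> ('s \<Rightarrow> rat) list \<Rightarrow> 's \<Rightarrow> rat" where
  "lincomb c bs \<equiv> \<lambda>s. (\<Sum>i<length bs. c i * (bs ! i) s)"

definition quot_basis :: "('s \<Rightarrow> rat) set \<Rightarrow> ('s \<Rightarrow> rat) set \<Rightarrow> ('s \<Rightarrow> rat) list \<Rightarrow> bool" where
  "quot_basis Z B bs \<equiv> set bs \<subseteq> Z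
     \<and> (\<forall>c. lincomb c bs \<in> B \<longrightarrow> (\<forall>i<length bs. c i = 0))
     \<and> (\<forall>z\<in>Z. \<exists>c. (\<lambda>s. z s - lincomb c bs s) \<in> B)"

text \<open>Trace of the map induced on the (finite-dimensional) quotient Z/B by a linear map F
  preserving Z and B, computed in a quotient basis.\<close>
definition quot_trace :: "('s \<Rightarrow> rat) set \<Rightarrow> ('s \<Rightarrow> rat) set \<Rightarrow> (('s \<Rightarrow> rat) \<Rightarrow> ('s \<Rightarrow> rat)) \<Rightarrow> rat" where
  "quot_trace Z B F \<equiv> THE t. \<exists>bs a. quot_basis Z B bs
      \<and> (\<forall>j<length bs. (\<lambda>s. F (bs ! j) s - lincomb (\<lambda>i. a i j) bs s) \<in> B)
      \<and> t = (\<Sum>j<length bs. a j j)"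

definition cohom_trace :: "nat \<Rightarrow> 'a topology \<Rightarrow> ('a \<Rightarrow> 'a) \<Rightarrow> rat" where
  "cohom_trace p X g \<equiv> quot_trace (cocycles p X) (coboundaries p X) (cochain_pullback p X g)"

definition Conf :: "nat \<Rightarrow> nat \<Rightarrow> (nat \<Rightarrow> nat \<Rightarrow> real) topology" where
  "Conf n d \<equiv> subtopology (product_topology (\<lambda>i. Euclidean_space d) {..<n})
      {x. \<forall>i<n. \<forall>j<n. i \<noteq> j \<longrightarrow> x i \<noteq> x j}"

definition perm_action :: "nat \<Rightarrow> (nat \<Rightarrow> nat) \<Rightarrow> (nat \<Rightarrow> nat \<Rightarrow> real) \<Rightarrow> nat \<Rightarrow> nat \<Rightarrow> real" where
  "perm_action n w x \<equiv> restrict (x \<circ> w) {..<n}"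

definition conf_char :: "nat \<Rightarrow> nat \<Rightarrow> nat \<Rightarrow> (nat \<Rightarrow> nat) \<Rightarrow> rat" where
  "conf_char p n d w \<equiv> cohom_trace p (Conf n d) (perm_action n w)"

definition cycle_count :: "nat \<Rightarrow> (nat \<Rightarrow> nat) \<Rightarrow> nat \<Rightarrow> nat" where
  "cycle_count n w j \<equiv> card {C. \<exists>x<n. C = range (\<lambda>k. (w ^^ k) x) \<and> card C = j}"

text \<open>Polynomials in Q[x_1, x_2, ...]: finitely supported maps from monomials (finitely supported
  exponent vectors, x_j having exponent Poly_Mapping.lookup e j) to coefficients.\<close>
type_synonym qpoly = "(nat \<Rightarrow>\<^sub>0 nat) \<Rightarrow>\<^sub>0 rat"

definition char_poly_val :: "qpoly \<Rightarrow> nat \<Rightarrow> (nat \<Rightarrow> nat) \<Rightarrow> rat" where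
  "char_poly_val P n w \<equiv> (\<Sum>e::nat \<Rightarrow>\<^sub>0 nat \<in> Poly_Mapping.keys P. Poly_Mapping.lookup P e *
      (\<Prod>j::nat \<in> Poly_Mapping.keys e. (of_nat (cycle_count n w j) :: rat) ^ Poly_Mapping.lookup e j))"

text \<open>Weighted degree with deg x_j = j (degree of the zero polynomial taken to be 0).\<close>
definition wdeg :: "qpoly \<Rightarrow> nat" where
  "wdeg P \<equiv> Max (insert 0 ((\<lambda>e::nat \<Rightarrow>\<^sub>0 nat. \<Sum>j::nat \<in> Poly_Mapping.keys e. j * Poly_Mapping.lookup e j) ` Poly_Mapping.keys P))"

text \<open>Standard inner product of class functions on S_n (the functions here are rational-valued).\<close>
definition Sn_inner :: "nat \<Rightarrow> ((nat \<Rightarrow> nat) \<Rightarrow> rat) \<Rightarrow> ((nat \<Rightarrow> nat) \<Rightarrow> rat) \<Rightarrow> rat" where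
  "Sn_inner n f g \<equiv> (\<Sum>w\<in>{w. w permutes {..<n}}. f w * g w) / of_nat (fact n)"

end

(*
  The rational cohomology of a space is the space of additive functionals on its integral homology.
  The homology of the configurations on S + a is generated by two kinds of classes from
  configurations on S: those with the new point a far away, and those with a on a small sphere
  around a point j of S; this follows from the Thom isomorphism of the trivial bundle.
  A functional vanishing on the first kind, for every point of R, and invariant under
  permutations of R vanishes in degrees below (d - 1) |R| (d odd) or (d - 1) (|R| - 1) (d even).

  Hence for fixed m restriction along "add a point far away" is injective, in the stable range, from
  the functionals on n + 1 points invariant under the permutations of {m..n} to those on n points
  invariant under the permutations of {m..<n}. It is surjective because it has a transfer.
  So the trace of a permutation u of {..<m} on these invariants does not depend on n.
  Splitting a product of cycle counts according to the set A covered by the chosen cycles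
  writes the inner product as a combination of such traces with m = |A| at most deg P.
*)
theory Submission
  imports Defs "HOL-Homology.Homology" "HOL-Combinatorics.Permutations"
begin

section \<open>Punctured trivial bundles\<close>

text \<open>Why the two parities differ: exchanging two points that orbit each other acts through
  the antipodal map, so the dual functional is antisymmetric for odd d but symmetric for even d.
  Even d therefore keeps one symmetric primitive functional, on two points and in degree d - 1,
  which costs the extra 1 in the bound. Larger ones still vanish for even d: on nested orbits of
  three points the Jacobi relation forces 3x = 0, and two disjoint orbiting pairs cancel because
  exchanging the two sphere factors changes the sign. That sign is not computed from orientations;
  it is deduced from the braid relation between two transpositions of three points. A point of R
  that is not far away takes part in an orbit, and each orbit costs d - 1 degrees; an orbit around a
  point outside R uses up only one point of R, whence the factor (d - 1) |R|. Homotopies between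
  maps of configurations are composed of straight lines, so they reduce to checks on pairs of
  points. The orbit radii are closed formulas chosen to make these checks inequalities between
  norms.\<close>

abbreviation HI :: "int \<Rightarrow> 'a topology \<Rightarrow> 'b topology \<Rightarrow> ('a \<Rightarrow> 'b) \<Rightarrow> 'a chain set \<Rightarrow> 'b chain set"
  where "HI q X Y f \<equiv> hom_induced q X {} Y {} f"

lemma hom_induced_mult:
  "a \<in> carrier (relative_homology_group p X S) \<Longrightarrow> b \<in> carrier (relative_homology_group p X S) \<Longrightarrow>
   hom_induced p X S Y T f (a \<otimes>\<^bsub>relative_homology_group p X S\<^esub> b) =
   hom_induced p X S Y T f a \<otimes>\<^bsub>relative_homology_group p Y T\<^esub> hom_induced p X S Y T f b"
  by (meson hom_induced_hom hom_mult)

lemma hom_induced_topspace_left: "hom_induced p X (topspace X \<inter> S) Y T = hom_induced p X S Y T"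
  using hom_induced_restrict[of p X "topspace X \<inter> S" Y T] hom_induced_restrict[of p X S Y T] by simp

lemma hom_induced_topspace_right: "hom_induced p X S Y (topspace Y \<inter> T) = hom_induced p X S Y T"
  using hom_induced_restrict[of p X S Y "topspace Y \<inter> T"] hom_induced_restrict[of p X S Y T] by simp

lemma hom_induced_group_hom:
  "group_hom (relative_homology_group p X S) (relative_homology_group p Y T) (hom_induced p X S Y T f)"
  by (simp add: group_hom_axioms.intro group_hom_def hom_induced_hom)

lemma hom_boundary_group_hom:
  "group_hom (relative_homology_group p X S) (homology_group (p-1) (subtopology X S)) (hom_boundary p X S)"
  by (simp add: group_hom_axioms.intro group_hom_def hom_boundary_hom)

lemma hom_relboundary_group_hom:
  "group_hom (relative_homology_group p X S) (relative_homology_group (p-1) (subtopology X S) T)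
     (hom_relboundary p X S T)"
  by (simp add: group_hom_axioms.intro group_hom_def group_homomorphism_hom_relboundary)

lemma exact_at:
  "exact_seq ([G, K, L], [g, h]) \<Longrightarrow> x \<in> carrier K \<Longrightarrow> g x = \<one>\<^bsub>G\<^esub> \<longleftrightarrow> (\<exists>y\<in>carrier L. x = h y)"
  by (auto simp: kernel_def set_eq_iff image_iff)

section \<open>Continuity of maps into Euclidean space\<close>

lemma continuous_map_Euclidean_iff:
  "continuous_map Z (Euclidean_space d) f \<longleftrightarrow>
   (\<forall>i<d. continuous_map Z euclideanreal (\<lambda>z. f z i)) \<and> (\<forall>z\<in>topspace Z. \<forall>i\<ge>d. f z i = 0)" (is "?L = ?R")
proof
  assume L: ?L
  then have "continuous_map Z (powertop_real UNIV) f" "\<forall>z\<in>topspace Z. \<forall>i\<ge>d. f z i = 0"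
    by (auto simp: Euclidean_space_def continuous_map_in_subtopology)
  then show ?R by (simp add: continuous_map_componentwise_UNIV)
next
  assume R: ?R
  have "continuous_map Z (Euclidean_space d) (\<lambda>x i. if i < d then f x i else 0)"
    using R unfolding continuous_map_componentwise_Euclidean_space by blast
  then show ?L
    by (rule continuous_map_eq) (use R in \<open>auto simp: fun_eq_iff\<close>)
qed

lemma continuous_map_Euclidean_coord:
  "continuous_map Z (Euclidean_space d) f \<Longrightarrow> continuous_map Z euclideanreal (\<lambda>z. f z i)"
  by (cases "i < d")
    (auto simp: continuous_map_Euclidean_iff intro: continuous_map_eq[where f = "\<lambda>z. 0"])

lemma Euclidean_beyond:
  "continuous_map Z (Euclidean_space d) f \<Longrightarrow> z \<in> topspace Z \<Longrightarrow> i \<ge> d \<Longrightarrow> f z i = 0"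
  by (simp add: continuous_map_Euclidean_iff)

lemma continuous_map_Euclidean_scale:
  "continuous_map Z euclideanreal r \<Longrightarrow> continuous_map Z (Euclidean_space d) f \<Longrightarrow>
   continuous_map Z (Euclidean_space d) (\<lambda>z i. r z * f z i)"
  by (auto simp: continuous_map_Euclidean_iff intro!: continuous_intros)

lemma continuous_map_Euclidean_minus:
  "continuous_map Z (Euclidean_space d) f \<Longrightarrow>
   continuous_map Z (Euclidean_space d) (\<lambda>z i. - f z i)"
  by (auto simp: continuous_map_Euclidean_iff intro!: continuous_intros)

lemma continuous_map_Euclidean_comb:
  assumes "continuous_map Z (Euclidean_space d) f" "continuous_map Z (Euclidean_space d) g"
  shows "continuous_map (prod_topology (top_of_set {0..1}) Z) (Euclidean_space d)
     (\<lambda>(t,z) i. (1 - t) * f z i + t * g z i)"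
  unfolding case_prod_unfold
  by (intro continuous_map_Euclidean_space_add continuous_map_Euclidean_scale continuous_intros
       continuous_map_compose[OF _ assms(1), unfolded o_def] continuous_map_compose[OF _ assms(2), unfolded o_def]
       continuous_map_into_fulltopology[OF continuous_map_fst])

section \<open>The trivial bundle and the complement of its zero section\<close>

abbreviation EB :: "nat \<Rightarrow> 'a topology \<Rightarrow> ('a \<times> (nat \<Rightarrow> real)) topology"
  where "EB d B \<equiv> prod_topology B (Euclidean_space d)"

definition nz :: "('a \<times> (nat \<Rightarrow> real)) set"
  where "nz = {z. snd z \<noteq> (\<lambda>i. 0)}"

lemma nzI: "snd z i \<noteq> 0 \<Longrightarrow> z \<in> nz"
  by (auto simp: nz_def)

abbreviation PB :: "nat \<Rightarrow> 'a topology \<Rightarrow> ('a \<times> (nat \<Rightarrow> real)) topology"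
  where "PB d B \<equiv> subtopology (EB d B) nz"

text \<open>Fibres are vector spaces, so two maps over the same map to the base are joined by
  straight lines; only the avoidance of the removed set has to be checked. \<open>S\<close> and
  \<open>T\<close> make it a homotopy of pairs.\<close>

lemma homotopic_line:
  assumes f: "continuous_map Z (subtopology (EB d B) D) f" and g: "continuous_map Z (subtopology (EB d B) D) g"
    and fst: "\<And>z. z \<in> topspace Z \<Longrightarrow> fst (f z) = fst (g z)"
    and seg: "\<And>z t. z \<in> topspace Z \<Longrightarrow> 0 \<le> t \<Longrightarrow> t \<le> 1 \<Longrightarrow>
        (fst (f z), \<lambda>i. (1 - t) * snd (f z) i + t * snd (g z) i) \<in> D"
    and ST: "\<And>z t. z \<in> topspace Z \<Longrightarrow> z \<in> S \<Longrightarrow> 0 \<le> t \<Longrightarrow> t \<le> 1 \<Longrightarrow>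
        (fst (f z), \<lambda>i. (1 - t) * snd (f z) i + t * snd (g z) i) \<in> T"
  shows "homotopic_with (\<lambda>h. h \<in> topspace Z \<inter> S \<rightarrow> T) Z (subtopology (EB d B) D) f g"
proof -
  let ?h = "\<lambda>(t::real,z). (fst (f z), \<lambda>i. (1 - t) * snd (f z) i + t * snd (g z) i)"
  have cf: "continuous_map Z B (\<lambda>z. fst (f z))" "continuous_map Z (Euclidean_space d) (\<lambda>z. snd (f z))"
    using f by (auto simp: continuous_map_in_subtopology continuous_map_pairwise o_def)
  have cg: "continuous_map Z (Euclidean_space d) (\<lambda>z. snd (g z))"
    using g by (auto simp: continuous_map_in_subtopology continuous_map_pairwise o_def)
  have "continuous_map (prod_topology (top_of_set {0..1}) Z) (EB d B) ?h"
    unfolding case_prod_unfold continuous_map_pairwise o_def fst_conv snd_conv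
    using continuous_map_Euclidean_comb[OF cf(2) cg] continuous_map_compose[OF continuous_map_snd cf(1)]
    by (auto simp: case_prod_unfold o_def)
  moreover have "?h \<in> topspace (prod_topology (top_of_set {0..1}) Z) \<rightarrow> D"
    using seg by auto
  ultimately have c: "continuous_map (prod_topology (top_of_set {0..1}) Z) (subtopology (EB d B) D) ?h"
    by (simp add: continuous_map_in_subtopology image_subset_iff_funcset)
  show ?thesis
    by (subst homotopic_with, force, rule exI[of _ ?h]) (use c fst ST in \<open>auto simp: prod_eq_iff\<close>)
qed

lemma hom_induced_line:
  assumes "continuous_map Z (subtopology (EB d B) D) f" "continuous_map Z (subtopology (EB d B) D) g"
    and "\<And>z. z \<in> topspace Z \<Longrightarrow> fst (f z) = fst (g z)"
    and "\<And>z t. z \<in> topspace Z \<Longrightarrow> 0 \<le> t \<Longrightarrow> t \<le> 1 \<Longrightarrow>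
        (fst (f z), \<lambda>i. (1 - t) * snd (f z) i + t * snd (g z) i) \<in> D"
    and "\<And>z t. z \<in> topspace Z \<Longrightarrow> z \<in> S \<Longrightarrow> 0 \<le> t \<Longrightarrow> t \<le> 1 \<Longrightarrow>
        (fst (f z), \<lambda>i. (1 - t) * snd (f z) i + t * snd (g z) i) \<in> T"
  shows "hom_induced p Z S (subtopology (EB d B) D) T f = hom_induced p Z S (subtopology (EB d B) D) T g"
proof -
  have "hom_induced p Z (topspace Z \<inter> S) (subtopology (EB d B) D) T f = hom_induced p Z (topspace Z \<inter> S) (subtopology (EB d B) D) T g"
    by (rule homology_homotopy_axiom, rule homotopic_line[OF assms])
  then show ?thesis
    by (metis hom_induced_restrict inf_left_idem)
qed

text \<open>In dimension d + 1 this is the complement of the closed ray spanned by the last basis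
  vector.\<close>

definition half :: "nat \<Rightarrow> ('a \<times> (nat \<Rightarrow> real)) set"
  where "half d = {z. (\<exists>i<d. snd z i \<noteq> 0) \<or> snd z d < 0}"

lemma half_subset_nz: "half d \<subseteq> nz"
  by (auto simp: half_def nz_def)

text \<open>Pushing along the negative last axis moves the whole bundle into \<open>half d\<close>,
  and the straight line back to the identity never leaves \<open>half d\<close> when it starts at a
  point of it.\<close>

lemma trivial_half: "trivial_group (relative_homology_group p (EB (Suc d) B) (half d))"
proof -
  \<comment> \<open>The value a - 1 - |a| is at most -1 for every real a, and the segment from it to
    a negative a stays negative.\<close>
  let ?f = "\<lambda>z::'a \<times> (nat \<Rightarrow> real). (fst z, \<lambda>i. if i = d then snd z d - 1 - \<bar>snd z d\<bar> else snd z i)"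
  let ?X = "EB (Suc d) B"
  have s: "continuous_map ?X (Euclidean_space (Suc d)) snd" by (rule continuous_map_snd)
  have cs: "continuous_map ?X (Euclidean_space (Suc d)) (\<lambda>z i. if i = d then snd z d - 1 - \<bar>snd z d\<bar> else snd z i)"
    unfolding continuous_map_Euclidean_iff
    using continuous_map_Euclidean_coord[OF s] Euclidean_beyond[OF s]
    by (auto intro!: continuous_intros)
  have c0: "continuous_map ?X ?X ?f"
    unfolding continuous_map_pairwise o_def fst_conv snd_conv using cs continuous_map_fst by blast
  have c1: "continuous_map ?X (subtopology ?X (half d)) ?f"
    using c0 by (auto simp: continuous_map_in_subtopology half_def)
  have pos: "(1 - t) * (a - 1 - \<bar>a\<bar>) + t * a < 0" if "0 \<le> t" "t \<le> 1" "a < 0" for t a :: real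
  proof -
    have "(1 - t) * (a - 1 - \<bar>a\<bar>) \<le> 0" using that by (auto intro: mult_nonneg_nonpos)
    moreover have "t * a \<le> 0" using that by (auto intro: mult_nonneg_nonpos)
    moreover have "(1 - t) * (a - 1 - \<bar>a\<bar>) < 0 \<or> t * a < 0" using that
      by (cases "t = 0") (auto simp: mult_neg_pos mult_pos_neg)
    ultimately show ?thesis by linarith
  qed
  have id1: "continuous_map (subtopology ?X (half d)) (subtopology ?X (half d)) id" by simp
  have seg: "(fst (?f z), \<lambda>i. (1 - t) * snd (?f z) i + t * snd (id z) i) \<in> half d"
    if z: "z \<in> half d" and t: "0 \<le> t" "t \<le> 1" for z and t::real
  proof (cases "\<exists>i<d. snd z i \<noteq> 0")
    case True
    then obtain i where "i < d" "snd z i \<noteq> 0" by blast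
    then have "(1 - t) * snd (?f z) i + t * snd (id z) i \<noteq> 0" by (simp add: algebra_simps)
    then show ?thesis unfolding half_def using \<open>i < d\<close> by auto
  next
    case False
    then show ?thesis using z pos[OF t] by (auto simp: half_def)
  qed
  have h1: "homotopic_with (\<lambda>h. True) (subtopology ?X (half d)) (subtopology ?X (half d)) ?f id"
  proof (rule homotopic_with_mono[OF homotopic_line[where S="{}" and T = "{}"]])
    show "continuous_map (subtopology ?X (half d)) (subtopology ?X (half d)) ?f"
      using c1 by (rule continuous_map_from_subtopology)
  qed (use seg in auto)
  have h2: "homotopic_with (\<lambda>h. True) ?X ?X ?f id"
    by (rule homotopic_with_mono[OF homotopic_line[where S="{}" and T = "{}" and D = UNIV, simplified]])
      (use c0 in \<open>auto\<close>)
  show ?thesis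
    by (rule trivial_relative_homology_group_gen[OF c1 h1 h2])
qed

text \<open>Exact sequence of the triple (bundle, \<open>nz\<close>, \<open>half d\<close>): the
  neighbouring terms belong to the pair (bundle, \<open>half d\<close>) and vanish by
  \<open>trivial_half\<close>.\<close>

lemma iso_relboundary_half:
  "hom_relboundary p (EB (Suc d) B) nz (half d) \<in>
     iso (relative_homology_group p (EB (Suc d) B) nz) (relative_homology_group (p - 1) (PB (Suc d) B) (half d))"
proof -
  let ?X = "EB (Suc d) B"
  let ?a = "hom_relboundary p ?X nz (half d)"
  interpret group_hom "relative_homology_group p ?X nz" "relative_homology_group (p - 1) (PB (Suc d) B) (half d)" ?a
    by (rule hom_relboundary_group_hom)
  show ?thesis
    unfolding iso_iff
  proof (intro conjI ballI impI subsetI)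
    fix x assume x: "x \<in> carrier (relative_homology_group p ?X nz)" "?a x = \<one>\<^bsub>relative_homology_group (p - 1) (PB (Suc d) B) (half d)\<^esub>"
    then obtain y where y: "y \<in> carrier (relative_homology_group p ?X (half d))" "x = hom_induced p ?X (half d) ?X nz id y"
      using exact_at[OF homology_exactness_triple_1[OF half_subset_nz] x(1)] by auto
    then have "y = \<one>\<^bsub>relative_homology_group p ?X (half d)\<^esub>"
      using trivial_half[where p=p and d=d and B=B] by (auto simp: trivial_group_def)
    then show "x = \<one>\<^bsub>relative_homology_group p ?X nz\<^esub>"
      using y group_hom.hom_one[OF hom_induced_group_hom] by blast
  next
    fix y assume y: "y \<in> carrier (relative_homology_group (p - 1) (PB (Suc d) B) (half d))"
    have "hom_induced (p - 1) (PB (Suc d) B) (half d) ?X (half d) id y = \<one>\<^bsub>relative_homology_group (p-1) ?X (half d)\<^esub>"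
      using trivial_half[where p="p-1" and d=d and B=B] hom_induced_carrier[of "p - 1" "PB (Suc d) B" "half d" ?X "half d" id y] by (auto simp: trivial_group_def)
    then show "y \<in> ?a ` carrier (relative_homology_group p ?X nz)"
      using exact_at[OF homology_exactness_triple_2[OF half_subset_nz] y] by auto
  qed
qed

definition lift1 :: "nat \<Rightarrow> 'a \<times> (nat \<Rightarrow> real) \<Rightarrow> 'a \<times> (nat \<Rightarrow> real)"
  where "lift1 d z = (fst z, (snd z)(d := 1))"

lemma cont_lift1: "continuous_map (EB d B) (PB (Suc d) B) (lift1 d)"
proof -
  have s: "continuous_map (EB d B) (Euclidean_space d) snd" by (rule continuous_map_snd)
  have "continuous_map (EB d B) (Euclidean_space (Suc d)) (\<lambda>z. (snd z)(d := 1))"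
    unfolding continuous_map_Euclidean_iff
    using continuous_map_Euclidean_coord[OF s] Euclidean_beyond[OF s] by (auto simp: topspace_Euclidean_space)
  then have "continuous_map (EB d B) (EB (Suc d) B) (lift1 d)"
    unfolding continuous_map_pairwise o_def lift1_def fst_conv snd_conv using continuous_map_fst by blast
  then show ?thesis
    by (auto simp: continuous_map_in_subtopology nz_def lift1_def fun_eq_iff)
qed

lemma lift1_half: "lift1 d \<in> topspace (EB d B) \<inter> nz \<rightarrow> half d"
proof
  fix z assume "z \<in> topspace (EB d B) \<inter> nz"
  then obtain i where "snd z i \<noteq> 0" "i < d" by (auto simp: topspace_Euclidean_space nz_def fun_eq_iff) (meson linorder_not_less)
  then show "lift1 d z \<in> half d" by (auto simp: half_def lift1_def intro!: exI[of _ i])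
qed

text \<open>Excising the vectors with last coordinate at most 0 leaves the open upper half space,
  which deforms onto the slice at height 1. There \<open>half d\<close> becomes the condition that
  some coordinate below d is nonzero, which is \<open>nz\<close> one dimension lower.\<close>

lemma iso_lift1:
  "hom_induced p (EB d B) nz (PB (Suc d) B) (half d) (lift1 d) \<in>
     iso (relative_homology_group p (EB d B) nz) (relative_homology_group p (PB (Suc d) B) (half d))"
proof -
  let ?Y = "PB (Suc d) B"
  define U where "U = {z::'a \<times> (nat \<Rightarrow> real). snd z d \<le> 0}"
  let ?N = "subtopology ?Y (UNIV - U)"
  have cY: "continuous_map ?Y (Euclidean_space (Suc d)) snd"
    by (rule continuous_map_subtopology_snd)
  have cd: "continuous_map ?Y euclideanreal (\<lambda>z. snd z i)" for i
    using continuous_map_Euclidean_coord[OF cY] by simp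
  have clU: "closedin ?Y (topspace ?Y \<inter> U)"
    using closedin_continuous_map_preimage[OF cd[of d], of "{..0}"] by (simp add: U_def Int_def)
  have op: "openin ?Y {z \<in> topspace ?Y. snd z i \<in> - {0}}" for i
    by (rule openin_continuous_map_preimage[OF cd]) auto
  have op2: "openin ?Y {z \<in> topspace ?Y. snd z d \<in> {..<0}}"
    by (rule openin_continuous_map_preimage[OF cd]) auto
  have "topspace ?Y \<inter> half d = \<Union> ((\<lambda>i. {z \<in> topspace ?Y. snd z i \<in> - {0}}) ` {..<d}) \<union> {z \<in> topspace ?Y. snd z d \<in> {..<0}}"
    by (auto simp: half_def)
  then have opH: "openin ?Y (topspace ?Y \<inter> half d)"
    using op op2 by (metis (no_types, lifting) imageE openin_Un openin_Union)
  \<comment> \<open>The excised set is closed and contained in the open set \<open>half d\<close>: a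
    nonzero vector whose last coordinate is 0 has a nonzero earlier coordinate.\<close>
  have "?Y closure_of U \<subseteq> ?Y interior_of (half d)"
  proof -
    have "?Y closure_of U = topspace ?Y \<inter> U"
      by (metis clU closure_of_closedin closure_of_restrict)
    moreover have "?Y interior_of (half d) = topspace ?Y \<inter> half d"
      by (metis opH interior_of_openin interior_of_restrict)
    moreover have "topspace ?Y \<inter> U \<subseteq> half d"
    proof
      fix z assume z: "z \<in> topspace ?Y \<inter> U"
      then obtain i where i: "snd z i \<noteq> 0" by (auto simp: nz_def fun_eq_iff)
      then have "i < Suc d" using z by (auto simp: topspace_Euclidean_space) (meson linorder_not_less)
      then show "z \<in> half d" using i z by (cases "i = d") (auto simp: half_def U_def less_Suc_eq)
    qed
    ultimately show ?thesis by auto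
  qed
  from homology_excision_axiom[OF this, of UNIV p]
  have ex: "hom_induced p ?N (half d - U) ?Y (half d) id \<in> iso (relative_homology_group p ?N (half d - U)) (relative_homology_group p ?Y (half d))"
    by simp
  have tN: "topspace ?N = {z. fst z \<in> topspace B \<and> (\<forall>i\<ge>Suc d. snd z i = 0) \<and> snd z d > 0}"
    by (auto simp: topspace_Euclidean_space nz_def U_def fun_eq_iff intro: exI[of _ d])
  define g where "g = (\<lambda>z::'a \<times> (nat \<Rightarrow> real). (fst z, (snd z)(d := 0)))"
  have Neq: "?N = subtopology (EB (Suc d) B) (nz \<inter> (UNIV - U))"
    by (simp add: subtopology_subtopology)
  have f1: "continuous_map (EB d B) ?N (lift1 d)"
    using cont_lift1[where d=d and B=B] by (auto simp: continuous_map_in_subtopology U_def lift1_def)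
  have cN: "continuous_map ?N (Euclidean_space (Suc d)) snd"
    by (simp add: continuous_map_from_subtopology cY)
  have g1: "continuous_map ?N (EB d B) g"
  proof -
    have "continuous_map ?N (Euclidean_space d) (\<lambda>z. (snd z)(d := 0))"
      unfolding continuous_map_Euclidean_iff
      using continuous_map_Euclidean_coord[OF cN] Euclidean_beyond[OF cN] by (auto simp: topspace_Euclidean_space)
    moreover have "continuous_map ?N B fst"
      by (simp add: continuous_map_from_subtopology continuous_map_subtopology_fst)
    ultimately show ?thesis
      unfolding continuous_map_pairwise o_def g_def fst_conv snd_conv by blast
  qed
  have nzc: "topspace (EB d B) \<inter> nz = {z \<in> topspace (EB d B). \<exists>i<d. snd z i \<noteq> 0}"
    by (auto simp: topspace_Euclidean_space nz_def fun_eq_iff) (meson linorder_not_less)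
  have tE: "topspace ?N \<inter> (half d - U) = {z \<in> topspace ?N. \<exists>i<d. snd z i \<noteq> 0}"
    unfolding tN by (auto simp: half_def U_def)
  have hom: "hom_induced p (EB d B) (topspace (EB d B) \<inter> nz) ?N (topspace ?N \<inter> (half d - U)) (lift1 d) \<in>
     iso (relative_homology_group p (EB d B) (topspace (EB d B) \<inter> nz)) (relative_homology_group p ?N (topspace ?N \<inter> (half d - U)))"
  proof (rule homotopy_equivalence_relative_homology_group_isomorphism[OF f1 _ g1])
    show "lift1 d \<in> topspace (EB d B) \<inter> nz \<rightarrow> topspace ?N \<inter> (half d - U)"
      unfolding tE tN nzc by (auto simp: lift1_def topspace_Euclidean_space half_def U_def intro!: exI)
    show "g \<in> topspace ?N \<inter> (half d - U) \<rightarrow> topspace (EB d B) \<inter> nz"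
    proof
      fix z assume "z \<in> topspace ?N \<inter> (half d - U)"
      then obtain i where i: "z \<in> topspace ?N" "i < d" "snd z i \<noteq> 0" unfolding tE by auto
      have "snd (g z) i \<noteq> 0" using i by (simp add: g_def)
      moreover have "g z \<in> topspace (EB d B)" using g1 i(1) unfolding continuous_map_def by blast
      ultimately show "g z \<in> topspace (EB d B) \<inter> nz" unfolding nzc using i(2) by blast
    qed
    show "homotopic_with (\<lambda>h. h \<in> topspace (EB d B) \<inter> nz \<rightarrow> topspace (EB d B) \<inter> nz) (EB d B) (EB d B) (g \<circ> lift1 d) id"
    proof (rule homotopic_with_equal)
      show "continuous_map (EB d B) (EB d B) (g \<circ> lift1 d)"
        using continuous_map_compose[OF f1 g1] .
    qed (auto simp: g_def lift1_def topspace_Euclidean_space nz_def fun_upd_idem)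
    have "homotopic_with (\<lambda>h. h \<in> topspace ?N \<inter> (topspace ?N \<inter> (half d - U)) \<rightarrow> topspace ?N \<inter> (half d - U)) ?N (subtopology (EB (Suc d) B) (nz \<inter> (UNIV - U))) (lift1 d \<circ> g) id"
    proof (rule homotopic_line)
      show "continuous_map ?N (subtopology (EB (Suc d) B) (nz \<inter> (UNIV - U))) (lift1 d \<circ> g)"
        using continuous_map_compose[OF g1 f1] unfolding Neq .
      show "continuous_map ?N (subtopology (EB (Suc d) B) (nz \<inter> (UNIV - U))) id"
        unfolding Neq by simp
      show "fst ((lift1 d \<circ> g) z) = fst (id z)" for z by (simp add: lift1_def g_def)
      fix z and t :: real assume z: "z \<in> topspace ?N" and t: "0 \<le> t" "t \<le> 1"
      let ?p = "(fst ((lift1 d \<circ> g) z), \<lambda>i. (1 - t) * snd ((lift1 d \<circ> g) z) i + t * snd (id z) i)"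
      have pp: "snd ?p d > 0"
        using z t unfolding tN by (cases "t = 0") (auto simp: lift1_def g_def add_nonneg_pos)
      then show nn: "?p \<in> nz \<inter> (UNIV - U)" using nzI[of ?p d] unfolding U_def by auto
      assume z2: "z \<in> topspace ?N \<inter> (half d - U)"
      have "\<exists>i<d. snd ?p i \<noteq> 0" using z2 unfolding tE by (auto simp: lift1_def g_def algebra_simps)
      moreover have "?p \<in> topspace ?N" using z pp unfolding tN by (auto simp: lift1_def g_def)
      ultimately show "?p \<in> topspace ?N \<inter> (half d - U)" unfolding tE by blast
    qed
    then show "homotopic_with (\<lambda>k. k \<in> topspace ?N \<inter> (half d - U) \<rightarrow> topspace ?N \<inter> (half d - U)) ?N ?N (lift1 d \<circ> g) id"
      unfolding Neq by (simp add: Int_absorb1)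
  qed
  then have hom': "hom_induced p (EB d B) nz ?N (half d - U) (lift1 d) \<in> iso (relative_homology_group p (EB d B) nz) (relative_homology_group p ?N (half d - U))"
    by (simp only: hom_induced_restrict relative_homology_group_restrict)
  have cmp: "hom_induced p ?N (half d - U) ?Y (half d) id \<circ> hom_induced p (EB d B) (topspace (EB d B) \<inter> nz) ?N (half d - U) (lift1 d) = hom_induced p (EB d B) (topspace (EB d B) \<inter> nz) ?Y (half d) (id \<circ> lift1 d)"
    by (rule hom_induced_compose[symmetric, OF f1])
      (use lift1_half[where d=d and B=B] in \<open>auto simp: U_def lift1_def\<close>)
  have cmp': "hom_induced p ?N (half d - U) ?Y (half d) id \<circ> hom_induced p (EB d B) nz ?N (half d - U) (lift1 d) = hom_induced p (EB d B) nz ?Y (half d) (lift1 d)"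
    using cmp by (metis (no_types, lifting) hom_induced_restrict id_comp inf_left_idem)
  show ?thesis using iso_set_trans[OF hom' ex] unfolding cmp' .
qed

section \<open>The Thom isomorphism and the sphere classes\<close>

text \<open>Thom isomorphism from degree q of B to degree q + d of the pair (B x R^d, nonzero
  vectors), built as an iterated suspension: pass to the slice at height 1 and invert the boundary
  of the triple. The recursion lets naturality and the reflection sign be proved by induction on
  d.\<close>

primrec thom :: "nat \<Rightarrow> 'a topology \<Rightarrow> int \<Rightarrow> 'a chain set \<Rightarrow> ('a \<times> (nat \<Rightarrow> real)) chain set" where
  "thom 0 B q = hom_induced q B {} (EB 0 B) nz (\<lambda>b. (b, \<lambda>i. 0))"
| "thom (Suc d) B q = (\<lambda>u. inv_into (carrier (relative_homology_group (q + int (Suc d)) (EB (Suc d) B) nz))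
      (hom_relboundary (q + int (Suc d)) (EB (Suc d) B) nz (half d))
      (hom_induced (q + int d) (EB d B) nz (PB (Suc d) B) (half d) (lift1 d) (thom d B q u)))"

lemma iso_thom: "thom d B q \<in> iso (homology_group q B) (relative_homology_group (q + int d) (EB d B) nz)"
proof (induction d)
  case 0
  have e: "topspace (EB 0 B) \<inter> nz = {}"
    by (auto simp: topspace_Euclidean_space nz_def fun_eq_iff)
  have c: "continuous_map B (EB 0 B) (\<lambda>b. (b, \<lambda>i. 0))"
    by (auto simp: continuous_map_pairwise o_def continuous_map_Euclidean_iff topspace_Euclidean_space)
  have "homeomorphic_map B (EB 0 B) (\<lambda>b. (b, \<lambda>i. 0))"
  proof (rule homeomorphic_maps_imp_map)
    show "homeomorphic_maps B (EB 0 B) (\<lambda>b. (b, \<lambda>i. 0)) fst"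
      using c by (auto simp: homeomorphic_maps_def topspace_Euclidean_space continuous_map_fst fun_eq_iff)
  qed
  then have "hom_induced q B {} (EB 0 B) {} (\<lambda>b. (b, \<lambda>i. 0)) \<in> iso (homology_group q B) (homology_group q (EB 0 B))"
    by (rule homeomorphic_map_homology_iso)
  moreover have "relative_homology_group q (EB 0 B) nz = homology_group q (EB 0 B)"
    using relative_homology_group_restrict[of q "EB 0 B" nz] e by simp
  moreover have "hom_induced q B {} (EB 0 B) nz = hom_induced q B {} (EB 0 B) {}"
    using hom_induced_restrict[of q B "{}" "EB 0 B" nz] e by simp
  ultimately show ?case by simp
next
  case (Suc d)
  have q: "q + int (Suc d) - 1 = q + int d" by simp
  let ?q = "q + int (Suc d)"
  have "hom_induced (q + int d) (EB d B) nz (PB (Suc d) B) (half d) (lift1 d) \<circ> thom d B q \<in>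
      iso (homology_group q B) (relative_homology_group (q + int d) (PB (Suc d) B) (half d))"
    by (rule iso_set_trans[OF Suc iso_lift1])
  moreover have "inv_into (carrier (relative_homology_group ?q (EB (Suc d) B) nz))
     (hom_relboundary ?q (EB (Suc d) B) nz (half d)) \<in> iso (relative_homology_group (q + int d) (PB (Suc d) B) (half d)) (relative_homology_group ?q (EB (Suc d) B) nz)"
    using group.iso_set_sym[OF group_relative_homology_group iso_relboundary_half[where p="?q" and d=d and B=B]] unfolding q .
  ultimately have "inv_into (carrier (relative_homology_group ?q (EB (Suc d) B) nz))
     (hom_relboundary ?q (EB (Suc d) B) nz (half d)) \<circ> (hom_induced (q + int d) (EB d B) nz (PB (Suc d) B) (half d) (lift1 d) \<circ> thom d B q)
     \<in> iso (homology_group q B) (relative_homology_group ?q (EB (Suc d) B) nz)"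
    by (rule iso_set_trans)
  then show ?case
    unfolding thom.simps o_def .
qed

lemma thom_hom: "thom d B q \<in> hom (homology_group q B) (relative_homology_group (q + int d) (EB d B) nz)"
  using iso_thom iso_imp_homomorphism by blast

lemma thom_carrier:
  "u \<in> carrier (homology_group q B) \<Longrightarrow> thom d B q u \<in> carrier (relative_homology_group (q + int d) (EB d B) nz)"
  by (rule hom_in_carrier[OF thom_hom])

lemma relboundary_thom:
  assumes "u \<in> carrier (homology_group q B)"
  shows "hom_relboundary (q + int (Suc d)) (EB (Suc d) B) nz (half d) (thom (Suc d) B q u) =
     hom_induced (q + int d) (EB d B) nz (PB (Suc d) B) (half d) (lift1 d) (thom d B q u)"
proof -
  have q: "q + int (Suc d) - 1 = q + int d" by simp
  have "hom_relboundary (q + int (Suc d)) (EB (Suc d) B) nz (half d) ` carrier (relative_homology_group (q + int (Suc d)) (EB (Suc d) B) nz)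
     = carrier (relative_homology_group (q + int d) (PB (Suc d) B) (half d))"
    using iso_relboundary_half[where p="q + int (Suc d)" and d=d and B=B] unfolding q iso_iff by blast
  then show ?thesis
    by (simp add: f_inv_into_f hom_induced_carrier)
qed

lemma relboundary_half_inj:
  assumes "x \<in> carrier (relative_homology_group p (EB (Suc d) B) nz)" "y \<in> carrier (relative_homology_group p (EB (Suc d) B) nz)"
    "hom_relboundary p (EB (Suc d) B) nz (half d) x = hom_relboundary p (EB (Suc d) B) nz (half d) y"
  shows "x = y"
  using assms iso_relboundary_half[where p=p and d=d and B=B] unfolding iso_iff_mon_epi mon_def inj_on_def by blast

lemma continuous_map_EB:
  "continuous_map B B' f \<Longrightarrow> continuous_map (EB d B) (EB d B') (map_prod f id)"
  unfolding map_prod_def id_apply by (auto simp: case_prod_unfold continuous_map_pairwise o_def intro!: continuous_intros continuous_map_compose[OF continuous_map_fst, unfolded o_def])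

text \<open>The boundary of the triple is injective and natural, and \<open>lift1\<close> commutes
  with maps of the base; so each dimension inherits the claim from the one below.\<close>

lemma thom_natural:
  assumes f: "continuous_map B B' f" and u: "u \<in> carrier (homology_group q B)"
  shows "hom_induced (q + int d) (EB d B) nz (EB d B') nz (map_prod f id) (thom d B q u) = thom d B' q (HI q B B' f u)"
proof (induction d)
  case 0
  have c: "continuous_map B (EB 0 B) (\<lambda>b. (b, \<lambda>i. 0))" "continuous_map B' (EB 0 B') (\<lambda>b. (b, \<lambda>i. 0))"
    by (auto simp: continuous_map_pairwise o_def continuous_map_Euclidean_iff topspace_Euclidean_space)
  have "map_prod f id \<circ> (\<lambda>b. (b, \<lambda>i::nat. 0::real)) = (\<lambda>b. (b, \<lambda>i::nat. 0::real)) \<circ> f" by auto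
  then show ?case
    using c f continuous_map_EB[OF f, of 0] hom_induced_compose'[OF c(1) _ continuous_map_EB[OF f], of "{}" nz nz q u]
      hom_induced_compose'[OF f _ c(2), of "{}" "{}" nz q u] by (simp add: Pi_iff nz_def id_def)
next
  case (Suc d)
  let ?F = "map_prod f id :: 'a \<times> (nat \<Rightarrow> real) \<Rightarrow> _"
  have q: "q + int (Suc d) - 1 = q + int d" by simp
  have nzF: "?F \<in> nz \<rightarrow> nz" and hF: "?F \<in> half d \<rightarrow> half d" by (auto simp: nz_def half_def)
  have cP: "continuous_map (PB (Suc d) B) (PB (Suc d) B') ?F"
    using continuous_map_EB[OF f, of "Suc d"] nzF by (simp add: continuous_map_from_subtopology continuous_map_in_subtopology image_subset_iff Pi_iff)
  have "hom_relboundary (q + int (Suc d)) (EB (Suc d) B') nz (half d)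
      (hom_induced (q + int (Suc d)) (EB (Suc d) B) nz (EB (Suc d) B') nz ?F (thom (Suc d) B q u)) =
    hom_induced (q + int d) (PB (Suc d) B) (half d) (PB (Suc d) B') (half d) ?F
      (hom_relboundary (q + int (Suc d)) (EB (Suc d) B) nz (half d) (thom (Suc d) B q u))"
    using fun_cong[OF naturality_hom_induced_relboundary[OF continuous_map_EB[OF f, of "Suc d"] nzF hF, of "q + int (Suc d)"], of "thom (Suc d) B q u"]
    unfolding q o_apply .
  also have "\<dots> = hom_induced (q + int d) (PB (Suc d) B) (half d) (PB (Suc d) B') (half d) ?F
      (hom_induced (q + int d) (EB d B) (topspace (EB d B) \<inter> nz) (PB (Suc d) B) (half d) (lift1 d) (thom d B q u))"
    by (simp only: relboundary_thom[OF u] hom_induced_topspace_left)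
  also have "\<dots> = hom_induced (q + int d) (EB d B) (topspace (EB d B) \<inter> nz) (PB (Suc d) B') (half d) (?F \<circ> lift1 d) (thom d B q u)"
    by (rule hom_induced_compose'[OF cont_lift1 lift1_half cP hF])
  also have "?F \<circ> lift1 d = lift1 d \<circ> ?F" by (auto simp: lift1_def)
  also have "hom_induced (q + int d) (EB d B) (topspace (EB d B) \<inter> nz) (PB (Suc d) B') (half d) (lift1 d \<circ> ?F) (thom d B q u) =
     hom_induced (q + int d) (EB d B') (topspace (EB d B') \<inter> nz) (PB (Suc d) B') (half d) (lift1 d)
       (hom_induced (q + int d) (EB d B) (topspace (EB d B) \<inter> nz) (EB d B') (topspace (EB d B') \<inter> nz) ?F (thom d B q u))"
    by (rule hom_induced_compose'[symmetric, OF continuous_map_EB[OF f] _ cont_lift1 lift1_half])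
      (use f nzF in \<open>auto simp: continuous_map_def\<close>)
  also have "\<dots> = hom_induced (q + int d) (EB d B') nz (PB (Suc d) B') (half d) (lift1 d)
       (hom_induced (q + int d) (EB d B) nz (EB d B') nz ?F (thom d B q u))"
    by (simp only: hom_induced_topspace_left hom_induced_topspace_right)
  also have "\<dots> = hom_relboundary (q + int (Suc d)) (EB (Suc d) B') nz (half d) (thom (Suc d) B' q (HI q B B' f u))"
    unfolding Suc by (rule relboundary_thom[symmetric, OF hom_induced_carrier])
  finally show ?case
    by (rule relboundary_half_inj[OF hom_induced_carrier thom_carrier[OF hom_induced_carrier]])
qed

text \<open>Up to sign the cross product of u with the fundamental class of the fibre sphere of
  dimension d - 1.\<close>

definition cross :: "nat \<Rightarrow> 'a topology \<Rightarrow> int \<Rightarrow> 'a chain set \<Rightarrow> ('a \<times> (nat \<Rightarrow> real)) chain set"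
  where "cross d B q u = hom_boundary (q + int d) (EB d B) nz (thom d B q u)"

lemma cross_carrier: "cross d B q u \<in> carrier (homology_group (q + int d - 1) (PB d B))"
  by (simp add: cross_def hom_boundary_carrier)

lemma cross_hom: "cross d B q \<in> hom (homology_group q B) (homology_group (q + int d - 1) (PB d B))"
proof -
  have "hom_boundary (q + int d) (EB d B) nz \<circ> thom d B q \<in> hom (homology_group q B) (homology_group (q + int d - 1) (PB d B))"
    by (rule hom_compose[OF thom_hom hom_boundary_hom])
  then show ?thesis by (simp add: cross_def[abs_def] o_def)
qed

lemma continuous_map_PB:
  "continuous_map B B' f \<Longrightarrow> continuous_map (PB d B) (PB d B') (map_prod f id)"
  using continuous_map_EB[of B B' f d] by (auto simp: continuous_map_from_subtopology continuous_map_in_subtopology nz_def)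

lemma cross_natural:
  assumes f: "continuous_map B B' f" and u: "u \<in> carrier (homology_group q B)"
  shows "HI (q + int d - 1) (PB d B) (PB d B') (map_prod f id) (cross d B q u) = cross d B' q (HI q B B' f u)"
proof -
  have n: "(map_prod f id :: _ \<times> (nat \<Rightarrow> real) \<Rightarrow> _) \<in> nz \<rightarrow> nz" by (auto simp: nz_def)
  show ?thesis
    unfolding cross_def thom_natural[OF f u, symmetric]
    using fun_cong[OF naturality_hom_induced[OF continuous_map_EB[OF f, of d] n, of "q + int d"], of "thom d B q u"]
    unfolding o_apply by (rule sym)
qed

definition unit0 :: "nat \<Rightarrow> real" where "unit0 = (\<lambda>i. if i = 0 then 1 else 0)"

lemma continuous_map_PB_into:
  "continuous_map Z (PB d B) f \<longleftrightarrow> continuous_map Z B (\<lambda>z. fst (f z)) \<and> continuous_map Z (Euclidean_space d) (\<lambda>z. snd (f z))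
     \<and> (\<forall>z\<in>topspace Z. snd (f z) \<noteq> (\<lambda>i. 0))"
  by (auto simp: continuous_map_in_subtopology continuous_map_pairwise o_def nz_def)

lemma unit0_in: "d > 0 \<Longrightarrow> continuous_map Z (Euclidean_space d) (\<lambda>z. unit0)"
  by (auto simp: continuous_map_Euclidean_iff unit0_def topspace_Euclidean_space)

lemma unit0_nz: "unit0 \<noteq> (\<lambda>i. 0)"
  by (auto simp: unit0_def fun_eq_iff)

lemma homotopic_EB_unit0:
  assumes "d > 0"
  shows "homotopic_with (\<lambda>h. True) (EB d B) (EB d B) id (\<lambda>z. (fst z, unit0))"
  by (rule homotopic_with_mono[OF homotopic_line[where S="{}" and T = "{}" and D = UNIV, simplified]])
    (use assms unit0_in[OF assms, of "EB d B"] in \<open>auto simp: continuous_map_pairwise o_def continuous_map_fst\<close>)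

text \<open>For positive d the identity of the bundle is homotopic to a constant nonzero section, so
  the boundary map of the pair is injective; the Thom map is injective anyway.\<close>

lemma cross_inj:
  assumes "d > 0" and u: "u \<in> carrier (homology_group q B)" and e: "cross d B q u = \<one>\<^bsub>homology_group (q + int d - 1) (PB d B)\<^esub>"
  shows "u = \<one>\<^bsub>homology_group q B\<^esub>"
proof -
  have "hom_boundary (q + int d) (EB d B) nz \<in> mon (relative_homology_group (q + int d) (EB d B) nz) (homology_group (q + int d - 1) (PB d B))"
    by (rule mon_hom_boundary_inclusion[OF homotopic_EB_unit0[OF assms(1)]]) (auto simp: nz_def unit0_nz)
  moreover have "thom d B q \<in> mon (homology_group q B) (relative_homology_group (q + int d) (EB d B) nz)"
    using iso_thom iso_iff_mon_epi by blast
  ultimately have "cross d B q \<in> mon (homology_group q B) (homology_group (q + int d - 1) (PB d B))"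
    unfolding cross_def[abs_def] mon_def by (auto simp: inj_on_def hom_def Pi_iff)
  then show ?thesis using e u
    by (metis (no_types, lifting) group.is_monoid group_relative_homology_group hom_one inj_on_def mem_Collect_eq mon_def monoid.one_closed)
qed

text \<open>The projection factors through the whole bundle, where a boundary dies.\<close>

lemma cross_proj:
  "HI (q + int d - 1) (PB d B) B fst (cross d B q u) = \<one>\<^bsub>homology_group (q + int d - 1) B\<^esub>"
proof -
  have "HI (q + int d - 1) (PB d B) (EB d B) id (cross d B q u) = \<one>\<^bsub>homology_group (q + int d - 1) (EB d B)\<^esub>"
  proof (cases "thom d B q u \<in> carrier (relative_homology_group (q + int d) (EB d B) nz)")
    case True
    then show ?thesis unfolding cross_def
      using exact_at[OF homology_exactness_axiom_2[of "q + int d" "EB d B" nz], of "cross d B q u"] cross_carrier[of d B q u]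
      by (auto simp: cross_def)
  next
    case False
    then show ?thesis unfolding cross_def
      by (simp add: hom_boundary_default group_hom.hom_one[OF hom_induced_group_hom])
  qed
  then have "HI (q + int d - 1) (EB d B) B fst (HI (q + int d - 1) (PB d B) (EB d B) id (cross d B q u)) = \<one>\<^bsub>homology_group (q + int d - 1) B\<^esub>"
    by (simp add: group_hom.hom_one[OF hom_induced_group_hom])
  then show ?thesis
    by (subst (asm) hom_induced_compose') (auto simp: continuous_map_fst)
qed

text \<open>The bundle contracts onto its zero section, so a class that dies in B already dies in
  the bundle. By exactness it bounds a relative class, and the Thom isomorphism supplies u.\<close>

lemma cross_surj:
  assumes y: "y \<in> carrier (homology_group (q + int d - 1) (PB d B))"
    and e: "HI (q + int d - 1) (PB d B) B fst y = \<one>\<^bsub>homology_group (q + int d - 1) B\<^esub>"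
  obtains u where "u \<in> carrier (homology_group q B)" "y = cross d B q u"
proof -
  let ?p = "q + int d - 1"
  let ?z = "\<lambda>b::'a. (b, \<lambda>i::nat. 0::real)"
  have cz: "continuous_map B (EB d B) ?z"
    by (auto simp: continuous_map_pairwise o_def continuous_map_Euclidean_iff topspace_Euclidean_space)
  have cf: "continuous_map (PB d B) B fst" by (rule continuous_map_subtopology_fst)
  have "HI ?p (PB d B) (EB d B) id y = HI ?p (PB d B) (EB d B) (?z \<circ> fst) y"
  proof (rule fun_cong[OF hom_induced_line[where D=UNIV, simplified]])
    show "continuous_map (PB d B) (EB d B) (?z \<circ> fst)"
      by (rule continuous_map_compose[OF cf cz])
  qed auto
  also have "\<dots> = HI ?p B (EB d B) ?z (HI ?p (PB d B) B fst y)"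
    by (rule hom_induced_compose'[symmetric, OF cf _ cz]) auto
  also have "\<dots> = \<one>\<^bsub>homology_group ?p (EB d B)\<^esub>"
    unfolding e by (rule group_hom.hom_one[OF hom_induced_group_hom])
  finally have "HI ?p (PB d B) (EB d B) id y = \<one>\<^bsub>homology_group ?p (EB d B)\<^esub>" .
  then obtain z where z: "z \<in> carrier (relative_homology_group (q + int d) (EB d B) nz)" "y = hom_boundary (q + int d) (EB d B) nz z"
    using exact_at[OF homology_exactness_axiom_2[of "q + int d" "EB d B" nz] y] by auto
  moreover obtain u where "u \<in> carrier (homology_group q B)" "z = thom d B q u"
    using z(1) iso_thom[of d B q] unfolding iso_iff by blast
  ultimately show ?thesis using that by (auto simp: cross_def)
qed

section \<open>Reflections and the antipodal map on sphere classes\<close>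

definition refl0 :: "'a \<times> (nat \<Rightarrow> real) \<Rightarrow> 'a \<times> (nat \<Rightarrow> real)"
  where "refl0 z = (fst z, \<lambda>i. if i = 0 then - snd z 0 else snd z i)"

lemma refl0_nz: "refl0 z \<in> nz \<longleftrightarrow> z \<in> nz"
  by (auto simp: refl0_def nz_def fun_eq_iff) (metis neg_equal_0_iff_equal)+

lemma cont_refl0: "continuous_map (EB d B) (EB d B) refl0"
proof -
  have s: "continuous_map (EB d B) (Euclidean_space d) snd" by (rule continuous_map_snd)
  have "continuous_map (EB d B) (Euclidean_space d) (\<lambda>z i. if i = 0 then - snd z 0 else snd z i)"
    unfolding continuous_map_Euclidean_iff
    using continuous_map_Euclidean_coord[OF s] Euclidean_beyond[OF s] by (auto simp: topspace_Euclidean_space continuous_map_minus)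
  then show ?thesis unfolding refl0_def[abs_def] continuous_map_pairwise o_def fst_conv snd_conv using continuous_map_fst by blast
qed

lemma cont_refl0P: "continuous_map (PB d B) (PB d B) refl0"
  using cont_refl0[where d=d and B=B] by (auto simp: continuous_map_from_subtopology continuous_map_in_subtopology refl0_nz)

text \<open>In dimension 1 the fibre sphere is a pair of points: the sphere class is the difference
  of the sections +1 (\<open>ip\<close>) and -1 (\<open>im\<close>), and the reflection exchanges
  the two.\<close>

lemma cross_refl0_1:
  assumes u: "u \<in> carrier (homology_group q B)"
  shows "HI (q + int (Suc 0) - 1) (PB (Suc 0) B) (PB (Suc 0) B) refl0 (cross (Suc 0) B q u) = inv\<^bsub>homology_group (q + int (Suc 0) - 1) (PB (Suc 0) B)\<^esub> cross (Suc 0) B q u"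
proof -
  let ?P = "PB (Suc 0) B"
  let ?G = "homology_group q ?P"
  define ip where "ip = (\<lambda>b::'a. (b, unit0))"
  define im where "im = (\<lambda>b::'a. (b, \<lambda>i. - unit0 i))"
  have cu: "continuous_map B (Euclidean_space (Suc 0)) (\<lambda>z. unit0)" "continuous_map B (Euclidean_space (Suc 0)) (\<lambda>z i. - unit0 i)"
    by (auto simp: continuous_map_Euclidean_iff unit0_def topspace_Euclidean_space)
  have cip: "continuous_map B ?P ip" and cim: "continuous_map B ?P im"
    using cu by (auto simp: continuous_map_PB_into ip_def im_def unit0_nz) (auto simp: unit0_def fun_eq_iff split: if_splits)
  have q: "q + int (Suc 0) - 1 = q" by simp
  let ?z = "thom (Suc 0) B q u" and ?x = "cross (Suc 0) B q u"
  have x: "?x \<in> carrier ?G" using cross_carrier[of "Suc 0" B q u] unfolding q .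
  interpret G: comm_group ?G by simp
  have r: "hom_induced q ?P {} ?P (half 0) id ?x = hom_induced q B {} ?P (half 0) ip u"
  proof -
    have "hom_induced q ?P {} ?P (half 0) id ?x = hom_relboundary (q + int (Suc 0)) (EB (Suc 0) B) nz (half 0) (thom (Suc 0) B q u)"
      unfolding hom_relboundary_def cross_def by simp
    also have "\<dots> = hom_induced q (EB 0 B) nz (PB (Suc 0) B) (half 0) (lift1 0) (thom 0 B q u)"
      using relboundary_thom[OF u, of 0] by simp
    also have "\<dots> = hom_induced q (EB 0 B) (topspace (EB 0 B) \<inter> nz) (PB (Suc 0) B) (half 0) (lift1 0) (hom_induced q B {} (EB 0 B) (topspace (EB 0 B) \<inter> nz) (\<lambda>b. (b, \<lambda>i. 0)) u)"
      by (simp only: thom.simps hom_induced_topspace_left hom_induced_topspace_right of_nat_0 add_0_right)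
    also have "\<dots> = hom_induced q B {} (PB (Suc 0) B) (half 0) (lift1 0 \<circ> (\<lambda>b. (b, \<lambda>i. 0))) u"
      by (rule hom_induced_compose'[OF _ _ cont_lift1 lift1_half])
        (auto simp: continuous_map_pairwise o_def continuous_map_Euclidean_iff topspace_Euclidean_space)
    also have "lift1 0 \<circ> (\<lambda>b. (b, \<lambda>i. 0)) = ip"
      by (auto simp: lift1_def ip_def unit0_def fun_eq_iff)
    finally show ?thesis by (simp only: One_nat_def)
  qed
  \<comment> \<open>\<open>w\<close> vanishes relative to the negative half line, so it comes from
    there and equals the image of some b under \<open>im\<close>. Projecting to B, where the sphere
    class dies, shows that b is the inverse of u.\<close>
  define w where "w = ?x \<otimes>\<^bsub>?G\<^esub> inv\<^bsub>?G\<^esub> (HI q B ?P ip u)"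
  have cip': "HI q B ?P ip u \<in> carrier ?G" by (rule hom_induced_carrier)
  have w: "w \<in> carrier ?G" using x cip' by (simp add: w_def)
  interpret rel: group_hom ?G "relative_homology_group q ?P (half 0)" "hom_induced q ?P {} ?P (half 0) id"
    by (rule hom_induced_group_hom)
  have "hom_induced q ?P {} ?P (half 0) id (HI q B ?P ip u) = hom_induced q B {} ?P (half 0) ip u"
    using hom_induced_compose'[OF cip, of "{}" "{}" ?P id "half 0" q u] by simp
  then have "hom_induced q ?P {} ?P (half 0) id w = \<one>\<^bsub>relative_homology_group q ?P (half 0)\<^esub>"
    using r x cip' hom_induced_carrier[of q B "{}" ?P "half 0" ip u]
    by (simp add: w_def rel.hom_mult rel.hom_inv rel.H.r_inv)
  then obtain y where y: "y \<in> carrier (homology_group q (subtopology ?P (half 0)))" "w = HI q (subtopology ?P (half 0)) ?P id y"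
    using exact_at[OF homology_exactness_axiom_3[of q ?P "half 0"] w] by auto
  have half0: "subtopology ?P (half 0) = subtopology (EB (Suc 0) B) (nz \<inter> half 0)" by (simp add: subtopology_subtopology)
  have cH: "continuous_map (subtopology ?P (half 0)) B fst"
    by (simp add: continuous_map_from_subtopology continuous_map_subtopology_fst)
  have "HI q (subtopology ?P (half 0)) ?P id y = HI q (subtopology ?P (half 0)) ?P (im \<circ> fst) y"
  proof (rule fun_cong[OF hom_induced_line])
    show "continuous_map (subtopology ?P (half 0)) ?P (im \<circ> fst)"
      by (rule continuous_map_compose[OF cH cim])
    show "(fst (id z), \<lambda>i. (1 - t) * snd (id z) i + t * snd ((im \<circ> fst) z) i) \<in> nz" if "z \<in> topspace (subtopology ?P (half 0))" "0 \<le> t" "t \<le> 1" for z and t :: real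
    proof -
      have "snd z 0 < 0" using that by (auto simp: half_def)
      then have "(1 - t) * snd z 0 - t < 0" using that
        by (cases "t = 0") (auto intro!: add_nonpos_neg mult_nonneg_nonpos simp: diff_conv_add_uminus simp del: add_uminus_conv_diff)
      then show ?thesis by (auto simp: nz_def im_def unit0_def fun_eq_iff intro!: exI[of _ 0])
    qed
  qed (auto simp: im_def)
  also have "\<dots> = HI q B ?P im (HI q (subtopology ?P (half 0)) B fst y)"
    by (rule hom_induced_compose'[symmetric, OF cH _ cim]) auto
  finally obtain b where b: "b \<in> carrier (homology_group q B)" "w = HI q B ?P im b"
    using y(2) hom_induced_carrier by metis
  have cim': "HI q B ?P im b' \<in> carrier ?G" for b' by (rule hom_induced_carrier)
  have cP: "continuous_map ?P B fst" by (rule continuous_map_subtopology_fst)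
  interpret pr: group_hom ?G "homology_group q B" "HI q ?P B fst" by (rule hom_induced_group_hom)
  interpret B: comm_group "homology_group q B" by simp
  interpret m: group_hom "homology_group q B" ?G "HI q B ?P im" by (rule hom_induced_group_hom)
  have pip: "HI q ?P B fst (HI q B ?P ip v) = v" if "v \<in> carrier (homology_group q B)" for v
    using hom_induced_compose'[OF cip _ cP, of "{}" "{}" "{}" q v] hom_induced_id[OF that] by (simp add: ip_def o_def id_def)
  have pim: "HI q ?P B fst (HI q B ?P im v) = v" if "v \<in> carrier (homology_group q B)" for v
    using hom_induced_compose'[OF cim _ cP, of "{}" "{}" "{}" q v] hom_induced_id[OF that] by (simp add: im_def o_def id_def)
  have "HI q ?P B fst w = inv\<^bsub>homology_group q B\<^esub> u"
    using cross_proj[of q "Suc 0" B u] x cip' u by (simp add: w_def pr.hom_mult pr.hom_inv pip)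
  then have "b = inv\<^bsub>homology_group q B\<^esub> u" using b pim by simp
  then have xe: "?x = HI q B ?P ip u \<otimes>\<^bsub>?G\<^esub> inv\<^bsub>?G\<^esub> HI q B ?P im u"
    using b w_def x cip' u cim' by (simp add: m.hom_inv) (metis G.inv_closed G.m_comm G.inv_solve_right)
  interpret rf: group_hom ?G ?G "HI q ?P ?P refl0" by (rule hom_induced_group_hom)
  have rip: "HI q ?P ?P refl0 (HI q B ?P ip u) = HI q B ?P im u"
  proof -
    have "refl0 \<circ> ip = im" by (auto simp: ip_def im_def refl0_def unit0_def fun_eq_iff)
    then show ?thesis using hom_induced_compose'[OF cip _ cont_refl0P, of "{}" "{}" "{}" q u] by simp
  qed
  have rim: "HI q ?P ?P refl0 (HI q B ?P im u) = HI q B ?P ip u"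
  proof -
    have "refl0 \<circ> im = ip" by (auto simp: ip_def im_def refl0_def unit0_def fun_eq_iff)
    then show ?thesis using hom_induced_compose'[OF cim _ cont_refl0P, of "{}" "{}" "{}" q u] by simp
  qed
  have "HI q ?P ?P refl0 ?x = HI q B ?P im u \<otimes>\<^bsub>?G\<^esub> inv\<^bsub>?G\<^esub> HI q B ?P ip u"
    unfolding xe using cip' cim' by (simp add: rf.hom_mult rf.hom_inv rip rim)
  also have "\<dots> = inv\<^bsub>?G\<^esub> ?x"
    unfolding xe using cip' cim' by (simp add: G.inv_mult_group)
  finally show ?thesis unfolding q .
qed

lemma boundary_refl0:
  "hom_boundary p (EB d B) nz (hom_induced p (EB d B) nz (EB d B) nz refl0 z) =
   HI (p - 1) (PB d B) (PB d B) refl0 (hom_boundary p (EB d B) nz z)"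
  using fun_cong[OF naturality_hom_induced[OF cont_refl0[where d=d and B=B], of nz nz p], of z] by (simp add: Pi_iff refl0_nz)

text \<open>Above dimension 1 the coordinate added by \<open>lift1\<close> is not the reflected
  coordinate 0, so the sign passes from one dimension to the next. Dimension 1 is
  \<open>cross_refl0_1\<close>, pulled back along the injective boundary map.\<close>

lemma thom_refl0:
  assumes u: "u \<in> carrier (homology_group q B)"
  shows "hom_induced (q + int (Suc d)) (EB (Suc d) B) nz (EB (Suc d) B) nz refl0 (thom (Suc d) B q u) =
    inv\<^bsub>relative_homology_group (q + int (Suc d)) (EB (Suc d) B) nz\<^esub> thom (Suc d) B q u"
proof (induction d)
  case 0
  let ?R = "relative_homology_group (q + int (Suc 0)) (EB (Suc 0) B) nz"
  let ?H = "homology_group (q + int (Suc 0) - 1) (PB (Suc 0) B)"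
  have m: "hom_boundary (q + int (Suc 0)) (EB (Suc 0) B) nz \<in> mon ?R ?H"
    by (rule mon_hom_boundary_inclusion[OF homotopic_EB_unit0]) (auto simp: nz_def unit0_nz)
  interpret bd: group_hom ?R ?H "hom_boundary (q + int (Suc 0)) (EB (Suc 0) B) nz"
    by (rule hom_boundary_group_hom)
  have t: "thom (Suc 0) B q u \<in> carrier ?R" by (rule thom_carrier[OF u])
  show ?case
  proof (rule inj_onD[of "hom_boundary (q + int (Suc 0)) (EB (Suc 0) B) nz" "carrier ?R"])
    show "inj_on (hom_boundary (q + int (Suc 0)) (EB (Suc 0) B) nz) (carrier ?R)"
      using m by (simp add: mon_def)
    show "hom_boundary (q + int (Suc 0)) (EB (Suc 0) B) nz (hom_induced (q + int (Suc 0)) (EB (Suc 0) B) nz (EB (Suc 0) B) nz refl0 (thom (Suc 0) B q u)) =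
      hom_boundary (q + int (Suc 0)) (EB (Suc 0) B) nz (inv\<^bsub>?R\<^esub> thom (Suc 0) B q u)"
      using cross_refl0_1[OF u] unfolding boundary_refl0 bd.hom_inv[OF t] cross_def .
  qed (use t in \<open>auto intro: hom_induced_carrier bd.inv_closed\<close>)
next
  case (Suc d)
  let ?D = "Suc d"
  let ?p = "q + int (Suc ?D)" and ?E = "EB (Suc ?D) B" and ?P = "PB (Suc ?D) B"
  have q: "?p - 1 = q + int ?D" by simp
  have n: "(refl0 :: 'a \<times> (nat \<Rightarrow> real) \<Rightarrow> _) \<in> nz \<rightarrow> nz" by (auto simp: refl0_nz)
  have hF: "(refl0 :: 'a \<times> (nat \<Rightarrow> real) \<Rightarrow> _) \<in> half ?D \<rightarrow> half ?D"
  proof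
    fix z :: "'a \<times> (nat \<Rightarrow> real)" assume "z \<in> half ?D"
    then consider i where "i < ?D" "snd z i \<noteq> 0" | "snd z ?D < 0" by (auto simp: half_def)
    then show "refl0 z \<in> half ?D"
    proof cases
      case 1
      then have "snd (refl0 z) i \<noteq> 0" by (cases "i = 0") (auto simp: refl0_def)
      with 1 show ?thesis unfolding half_def by blast
    qed (auto simp: half_def refl0_def)
  qed
  interpret a: group_hom "relative_homology_group ?p ?E nz" "relative_homology_group (?p - 1) ?P (half ?D)" "hom_relboundary ?p ?E nz (half ?D)"
    by (rule hom_relboundary_group_hom)
  interpret b: group_hom "relative_homology_group (q + int ?D) (EB ?D B) nz" "relative_homology_group (q + int ?D) ?P (half ?D)" "hom_induced (q + int ?D) (EB ?D B) nz ?P (half ?D) (lift1 ?D)"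
    by (rule hom_induced_group_hom)
  have "hom_relboundary ?p ?E nz (half ?D) (hom_induced ?p ?E nz ?E nz refl0 (thom (Suc ?D) B q u)) =
    hom_induced (q + int ?D) ?P (half ?D) ?P (half ?D) refl0 (hom_relboundary ?p ?E nz (half ?D) (thom (Suc ?D) B q u))"
    using fun_cong[OF naturality_hom_induced_relboundary[OF cont_refl0[where d="Suc ?D" and B=B] n hF, of ?p], of "thom (Suc ?D) B q u"]
    unfolding q o_apply .
  also have "\<dots> = hom_induced (q + int ?D) ?P (half ?D) ?P (half ?D) refl0
      (hom_induced (q + int ?D) (EB ?D B) (topspace (EB ?D B) \<inter> nz) ?P (half ?D) (lift1 ?D) (thom ?D B q u))"
    by (simp only: relboundary_thom[OF u] hom_induced_topspace_left)
  also have "\<dots> = hom_induced (q + int ?D) (EB ?D B) (topspace (EB ?D B) \<inter> nz) ?P (half ?D) (refl0 \<circ> lift1 ?D) (thom ?D B q u)"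
    by (rule hom_induced_compose'[OF cont_lift1 lift1_half cont_refl0P hF])
  also have "(refl0 \<circ> lift1 ?D :: 'a \<times> (nat \<Rightarrow> real) \<Rightarrow> _) = lift1 ?D \<circ> refl0" by (auto simp: lift1_def refl0_def fun_eq_iff)
  also have "hom_induced (q + int ?D) (EB ?D B) (topspace (EB ?D B) \<inter> nz) ?P (half ?D) (lift1 ?D \<circ> refl0) (thom ?D B q u) =
     hom_induced (q + int ?D) (EB ?D B) (topspace (EB ?D B) \<inter> nz) ?P (half ?D) (lift1 ?D)
       (hom_induced (q + int ?D) (EB ?D B) (topspace (EB ?D B) \<inter> nz) (EB ?D B) (topspace (EB ?D B) \<inter> nz) refl0 (thom ?D B q u))"
    by (rule hom_induced_compose'[symmetric, OF cont_refl0 _ cont_lift1 lift1_half])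
      (use cont_refl0[where d="?D" and B=B] n in \<open>auto simp: continuous_map_def Pi_iff\<close>)
  also have "\<dots> = hom_induced (q + int ?D) (EB ?D B) nz ?P (half ?D) (lift1 ?D)
       (hom_induced (q + int ?D) (EB ?D B) nz (EB ?D B) nz refl0 (thom ?D B q u))"
    by (simp only: hom_induced_topspace_left hom_induced_topspace_right)
  also have "\<dots> = inv\<^bsub>relative_homology_group (?p - 1) ?P (half ?D)\<^esub> hom_relboundary ?p ?E nz (half ?D) (thom (Suc ?D) B q u)"
    unfolding Suc relboundary_thom[OF u] b.hom_inv[OF thom_carrier[OF u]] q ..
  also have "\<dots> = hom_relboundary ?p ?E nz (half ?D) (inv\<^bsub>relative_homology_group ?p ?E nz\<^esub> thom (Suc ?D) B q u)"
    by (rule a.hom_inv[symmetric, OF thom_carrier[OF u]])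
  finally show ?case
    by (rule relboundary_half_inj[OF hom_induced_carrier group.inv_closed[OF group_relative_homology_group thom_carrier[OF u]]])
qed

lemma cross_refl0:
  assumes u: "u \<in> carrier (homology_group q B)" and "d > 0"
  shows "HI (q + int d - 1) (PB d B) (PB d B) refl0 (cross d B q u) = inv\<^bsub>homology_group (q + int d - 1) (PB d B)\<^esub> cross d B q u"
proof -
  obtain e where d: "d = Suc e" using assms by (cases d) auto
  show ?thesis
    unfolding d cross_def boundary_refl0[symmetric] thom_refl0[OF u]
    by (rule group_hom.hom_inv[OF hom_boundary_group_hom thom_carrier[OF u]])
qed

definition negv :: "'a \<times> (nat \<Rightarrow> real) \<Rightarrow> 'a \<times> (nat \<Rightarrow> real)"
  where "negv z = (fst z, \<lambda>i. - snd z i)"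

lemma cont_negv: "continuous_map (PB d B) (PB d B) negv"
  unfolding continuous_map_PB_into negv_def fst_conv snd_conv
  by (auto intro!: continuous_map_Euclidean_minus continuous_map_subtopology_fst continuous_map_subtopology_snd)
    (auto simp: nz_def fun_eq_iff)

text \<open>The matrix (1 - t) I + t J, with J a quarter turn of the plane, has determinant (1 -
  t)^2 + t^2, which is never 0.\<close>

lemma rotation_zero:
  fixes a b t :: real
  assumes "(1 - t) * a = t * b" "(1 - t) * b = - (t * a)"
  shows "a = 0 \<and> b = 0"
proof -
  have "((1 - t)\<^sup>2 + t\<^sup>2) * a = (1 - t) * ((1 - t) * a) + t * (t * a)"
    by (simp add: power2_eq_square distrib_right mult.assoc)
  also have "\<dots> = t * ((1 - t) * b) + t * (t * a)" by (simp only: assms(1) mult.left_commute)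
  also have "\<dots> = 0" by (simp add: assms(2))
  finally have "((1 - t)\<^sup>2 + t\<^sup>2) * a = 0" .
  moreover have "((1 - t)\<^sup>2 + t\<^sup>2) * b = (1 - t) * ((1 - t) * b) + t * (t * b)"
    by (simp add: power2_eq_square distrib_right mult.assoc)
  then have "((1 - t)\<^sup>2 + t\<^sup>2) * b = - (t * ((1 - t) * a)) + t * (t * b)" by (simp add: assms(2) mult.left_commute)
  then have "((1 - t)\<^sup>2 + t\<^sup>2) * b = 0" by (simp add: assms(1))
  moreover have "(1 - t)\<^sup>2 + t\<^sup>2 \<noteq> 0" by (metis diff_zero sum_power2_eq_zero_iff zero_neq_one)
  ultimately show ?thesis by auto
qed

text \<open>Quarter turns in consecutive coordinate planes connect the antipodal map to the identity
  (even dimension) or to a reflection (odd dimension) by straight lines.\<close>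

lemma HI_negv_aux:
  assumes d: "d = p + 2 * e" and p: "p \<le> 1"
  shows "HI q (PB d B) (PB d B) negv = HI q (PB d B) (PB d B) (if p = 0 then id else refl0)"
proof -
  \<comment> \<open>With p the parity of d, \<open>s\<close> negates the first p coordinates.
    \<open>J\<close> does the same and turns the remaining consecutive pairs of coordinates by a
    right angle. The path runs along segments from \<open>s\<close> over \<open>J\<close> to the
    antipodal map.\<close>
  define s :: "'a \<times> (nat \<Rightarrow> real) \<Rightarrow> 'a \<times> (nat \<Rightarrow> real)" where "s = (if p = 0 then id else refl0)"
  define J :: "'a \<times> (nat \<Rightarrow> real) \<Rightarrow> 'a \<times> (nat \<Rightarrow> real)"
    where "J z = (fst z, \<lambda>i. if i < p then - snd z i else if even (i - p) then - snd z (Suc i) else snd z (i - 1))" for z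
  have sc: "fst (s z) = fst z" "snd (s z) i = (if i < p then - snd z i else snd z i)" for z i
    using p less_Suc0[of i] by (cases "p = 0"; auto simp: s_def refl0_def le_Suc_eq)+
  have cs: "continuous_map (PB d B) (PB d B) s"
    unfolding s_def using cont_refl0P by auto
  have zero: "snd z = (\<lambda>i. 0)" if h: "\<And>i. i < p \<Longrightarrow> snd z i = 0"
    "\<And>i. i \<ge> p \<Longrightarrow> even (i - p) \<Longrightarrow> snd z i = 0 \<and> snd z (Suc i) = 0" for z :: "'a \<times> (nat \<Rightarrow> real)"
  proof
    fix i
    consider "i < p" | "i \<ge> p" "even (i - p)" | "i - 1 \<ge> p" "even (i - 1 - p)" "Suc (i - 1) = i"
    proof (cases "i \<ge> p \<and> odd (i - p)")
      case True
      then have "i - p > 0" by (metis dvd_0_right gr0I)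
      then have "i - 1 \<ge> p" "even (i - 1 - p)" "Suc (i - 1) = i" using True by auto
      then show ?thesis using that by blast
    qed (use that in force)
    then show "snd z i = 0"
    proof cases
      case 3
      then show ?thesis using h(2)[of "i - 1"] by simp
    qed (use h in auto)
  qed
  have snd: "continuous_map (PB d B) (Euclidean_space d) snd" by (rule continuous_map_subtopology_snd)
  have cJ0: "continuous_map (PB d B) (Euclidean_space d) (\<lambda>z. snd (J z))"
    unfolding continuous_map_Euclidean_iff
  proof (intro conjI allI impI ballI)
    show "continuous_map (PB d B) euclideanreal (\<lambda>z. snd (J z) i)" for i
      unfolding J_def snd_conv using continuous_map_Euclidean_coord[OF snd] by (simp add: continuous_map_minus)
    fix z i assume z: "z \<in> topspace (PB d B)" and i: "d \<le> i"
    have v: "snd z j = 0" if "j \<ge> d" for j using Euclidean_beyond[OF snd z that] .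
    show "snd (J z) i = 0"
    proof (cases "even (i - p)")
      case True
      then show ?thesis using v i d by (simp add: J_def)
    next
      case False
      then have "i \<noteq> d" using d by auto
      then show ?thesis using v i d by (simp add: J_def)
    qed
  qed
  have cJ: "continuous_map (PB d B) (PB d B) J"
    unfolding continuous_map_PB_into
  proof (intro conjI ballI)
    show "continuous_map (PB d B) B (\<lambda>z. fst (J z))" by (simp add: J_def continuous_map_subtopology_fst)
    fix z assume z: "z \<in> topspace (PB d B)"
    show "snd (J z) \<noteq> (\<lambda>i. 0)"
    proof
      assume 0: "snd (J z) = (\<lambda>i. 0)"
      have "snd z = (\<lambda>i. 0)"
      proof (rule zero)
        show "snd z i = 0" if "i < p" for i using fun_cong[OF 0, of i] that by (simp add: J_def)
        show "snd z i = 0 \<and> snd z (Suc i) = 0" if "i \<ge> p" "even (i - p)" for i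
          using fun_cong[OF 0, of i] fun_cong[OF 0, of "Suc i"] that by (simp add: J_def Suc_diff_le)
      qed
      then show False using z by (auto simp: nz_def)
    qed
  qed (rule cJ0)
  have 1: "HI q (PB d B) (PB d B) s = HI q (PB d B) (PB d B) J"
  proof (rule hom_induced_line[OF cs cJ])
    fix z and t :: real assume z: "z \<in> topspace (PB d B)"
    show "(fst (s z), \<lambda>i. (1 - t) * snd (s z) i + t * snd (J z) i) \<in> nz"
    proof (rule ccontr)
      assume "\<not> ?thesis"
      then have 0: "(1 - t) * snd (s z) i + t * snd (J z) i = 0" for i by (auto simp: nz_def fun_eq_iff)
      have "snd z = (\<lambda>i. 0)"
      proof (rule zero)
        show "snd z i = 0" if "i < p" for i using 0[of i] that by (simp add: J_def sc algebra_simps)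
        show "snd z i = 0 \<and> snd z (Suc i) = 0" if "i \<ge> p" "even (i - p)" for i
          using 0[of i] 0[of "Suc i"] that by (intro rotation_zero[of t]) (auto simp add: J_def sc Suc_diff_le)
      qed
      then show False using z by (auto simp: nz_def)
    qed
  qed (auto simp: sc J_def)
  have 2: "HI q (PB d B) (PB d B) J = HI q (PB d B) (PB d B) negv"
  proof (rule hom_induced_line[OF cJ cont_negv])
    fix z and t :: real assume z: "z \<in> topspace (PB d B)"
    show "(fst (J z), \<lambda>i. (1 - t) * snd (J z) i + t * snd (negv z) i) \<in> nz"
    proof (rule ccontr)
      assume "\<not> ?thesis"
      then have 0: "(1 - t) * snd (J z) i + t * snd (negv z) i = 0" for i by (auto simp: nz_def fun_eq_iff)
      have "snd z = (\<lambda>i. 0)"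
      proof (rule zero)
        show "snd z i = 0" if "i < p" for i using 0[of i] that by (simp add: J_def negv_def algebra_simps)
        show "snd z i = 0 \<and> snd z (Suc i) = 0" if "i \<ge> p" "even (i - p)" for i
          using 0[of i] 0[of "Suc i"] that by (intro rotation_zero[of t]) (auto simp add: J_def negv_def Suc_diff_le)
      qed
      then show False using z by (auto simp: nz_def)
    qed
  qed (auto simp: negv_def J_def)
  show ?thesis using 1 2 by (simp add: s_def)
qed

lemma cross_negv_even:
  assumes "even d"
  shows "HI (q + int d - 1) (PB d B) (PB d B) negv (cross d B q u) = cross d B q u"
proof -
  obtain e where e: "d = 0 + 2 * e" using assms by auto
  show ?thesis using HI_negv_aux[OF e, of "q + int d - 1" B] hom_induced_id[OF cross_carrier[of d B q u]] by simp
qed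

lemma cross_negv_odd:
  assumes "odd d" and u: "u \<in> carrier (homology_group q B)"
  shows "HI (q + int d - 1) (PB d B) (PB d B) negv (cross d B q u) = inv\<^bsub>homology_group (q + int d - 1) (PB d B)\<^esub> cross d B q u"
proof -
  obtain e where e: "d = 1 + 2 * e" using assms by (metis oddE add.commute)
  then have "d > 0" by simp
  from cross_refl0[OF u this] show ?thesis using HI_negv_aux[OF e, of "q + int d - 1" B] by simp
qed

section \<open>The kernel of filling a puncture\<close>

text \<open>A class that dies when the section \<open>c\<close> is filled in is the boundary of a
  class of \<open>F\<close> relative to the complement of \<open>c\<close>. By excision and
  translation this is a class of the bundle relative to its nonzero vectors, hence a Thom class. The
  function \<open>r\<close> squeezes the whole fibre into \<open>F\<close> around \<open>c\<close>,
  so the sphere class can be mapped in from all of \<open>PB d B\<close>.\<close>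

lemma puncture_kernel:
  assumes F: "openin (EB d B) (topspace (EB d B) \<inter> F)" and c: "continuous_map B (Euclidean_space d) c"
    and r: "continuous_map (EB d B) euclideanreal r" "\<And>z. z \<in> topspace (EB d B) \<Longrightarrow> r z > 0"
    and mF: "\<And>z. z \<in> topspace (EB d B) \<Longrightarrow> (fst z, \<lambda>i. c (fst z) i + r z * snd z i) \<in> F"
    and y: "y \<in> carrier (homology_group (q + int d - 1) (subtopology (EB d B) (F \<inter> {z. snd z \<noteq> c (fst z)})))"
    and e: "HI (q + int d - 1) (subtopology (EB d B) (F \<inter> {z. snd z \<noteq> c (fst z)})) (subtopology (EB d B) F) id y =
      \<one>\<^bsub>homology_group (q + int d - 1) (subtopology (EB d B) F)\<^esub>"
  obtains u where "u \<in> carrier (homology_group q B)"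
    "y = HI (q + int d - 1) (PB d B) (subtopology (EB d B) (F \<inter> {z. snd z \<noteq> c (fst z)}))
       (\<lambda>z. (fst z, \<lambda>i. c (fst z) i + r z * snd z i)) (cross d B q u)"
proof -
  define G where "G = {z. snd z \<noteq> c (fst z)}"
  let ?X = "EB d B" and ?p = "q + int d"
  let ?F = "subtopology ?X F"
  define \<mu> where "\<mu> = (\<lambda>z. (fst z, \<lambda>i. c (fst z) i + r z * snd z i))"
  define \<tau> where "\<tau> = (\<lambda>z. (fst z, \<lambda>i. snd z i - c (fst z) i))"
  define \<sigma> where "\<sigma> = (\<lambda>z. (fst z, \<lambda>i. snd z i + c (fst z) i))"
  have cc: "continuous_map ?X (Euclidean_space d) (\<lambda>z. c (fst z))"
    using continuous_map_compose[OF continuous_map_fst c] by (simp add: o_def)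
  have cs: "continuous_map ?X (Euclidean_space d) snd" by (rule continuous_map_snd)
  have c\<mu>X: "continuous_map ?X ?X \<mu>" and c\<tau>: "continuous_map ?X ?X \<tau>" and c\<sigma>: "continuous_map ?X ?X \<sigma>"
    unfolding \<mu>_def \<tau>_def \<sigma>_def continuous_map_pairwise o_def fst_conv snd_conv
    by (auto intro!: continuous_map_fst continuous_map_Euclidean_space_add continuous_map_Euclidean_space_diff continuous_map_Euclidean_scale cc cs r)
  have c\<mu>: "continuous_map ?X ?F \<mu>"
    using c\<mu>X mF by (auto simp: continuous_map_in_subtopology \<mu>_def topspace_Euclidean_space)
  have \<mu>G: "\<mu> \<in> topspace ?X \<inter> nz \<rightarrow> G"
    using r(2) by (fastforce simp: \<mu>_def G_def nz_def fun_eq_iff)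
  have \<tau>G: "\<tau> \<in> G \<rightarrow> nz" "\<sigma> \<in> nz \<rightarrow> G"
    by (auto simp: \<tau>_def \<sigma>_def G_def nz_def fun_eq_iff)
  have subFG: "subtopology ?F G = subtopology ?X (F \<inter> G)" by (simp add: subtopology_subtopology)
  have y': "y \<in> carrier (homology_group (?p - 1) (subtopology ?F G))" using y unfolding subFG unfolding G_def .
  have e': "HI (?p - 1) (subtopology ?F G) ?F id y = \<one>\<^bsub>homology_group (?p - 1) ?F\<^esub>" using e unfolding subFG unfolding G_def .
  obtain z where z: "z \<in> carrier (relative_homology_group ?p ?F G)" "y = hom_boundary ?p ?F G z"
    using exact_at[OF homology_exactness_axiom_2[of ?p ?F G] y'] e' by auto
  have ct: "continuous_map ?X euclideanreal (\<lambda>z. snd (\<tau> z) i)" for i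
    using continuous_map_Euclidean_coord[of ?X d "\<lambda>z. snd (\<tau> z)"] c\<tau> by (simp add: continuous_map_pairwise o_def)
  have "topspace ?X \<inter> G = \<Union> ((\<lambda>i. {z \<in> topspace ?X. snd (\<tau> z) i \<in> - {0}}) ` UNIV)"
    by (auto simp: G_def \<tau>_def fun_eq_iff)
  moreover have "openin ?X {z \<in> topspace ?X. snd (\<tau> z) i \<in> - {0}}" for i
    by (rule openin_continuous_map_preimage[OF ct]) auto
  ultimately have opG: "openin ?X (topspace ?X \<inter> G)"
    by (simp only:) (rule openin_Union, blast)
  \<comment> \<open>The image of a zero vector under the squeezed embedding is a point of the
    section, so the section lies in \<open>F\<close> and misses the excised closed set.\<close>
  have "?X closure_of (UNIV - F) \<subseteq> ?X interior_of G"
  proof -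
    have "closedin ?X (topspace ?X \<inter> (UNIV - F))"
    proof -
      have "topspace ?X \<inter> (UNIV - F) = topspace ?X - topspace ?X \<inter> F" by blast
      then show ?thesis using closedin_diff[OF closedin_topspace F] by (simp only:)
    qed
    then have "?X closure_of (UNIV - F) = topspace ?X \<inter> (UNIV - F)"
      by (metis closure_of_closedin closure_of_restrict)
    moreover have "?X interior_of G = topspace ?X \<inter> G"
      by (metis opG interior_of_openin interior_of_restrict)
    moreover have "z \<in> F" if "z \<in> topspace ?X" "snd z = c (fst z)" for z
    proof -
      have "(fst z, \<lambda>i. 0) \<in> topspace ?X" using that by (auto simp: topspace_Euclidean_space)
      from mF[OF this] that show ?thesis by (cases z) auto
    qed
    ultimately show ?thesis by (auto simp: G_def)
  qed
  from homology_excision_axiom[OF this, of UNIV ?p]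
  have ex0: "hom_induced ?p (subtopology ?X (UNIV - (UNIV - F))) (G - (UNIV - F)) ?X G id \<in> iso (relative_homology_group ?p (subtopology ?X (UNIV - (UNIV - F))) (G - (UNIV - F))) (relative_homology_group ?p ?X G)"
    by simp
  have FF: "UNIV - (UNIV - F) = F" "topspace ?F \<inter> (G - (UNIV - F)) = topspace ?F \<inter> G" by auto
  have ex: "hom_induced ?p ?F G ?X G id \<in> iso (relative_homology_group ?p ?F G) (relative_homology_group ?p ?X G)"
    using ex0 unfolding FF(1)
    by (metis FF(2) hom_induced_topspace_left relative_homology_group_restrict)
  \<comment> \<open>\<open>w\<close> is the relative class translated to the zero section, and
    \<open>z'\<close> is \<open>w\<close> put back by the squeezed embedding. They match because
    squeezing followed by translating back is a positive rescaling of the fibres.\<close>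
  define w where "w = hom_induced ?p ?X G ?X nz \<tau> (hom_induced ?p ?F G ?X G id z)"
  have w: "w \<in> carrier (relative_homology_group ?p ?X nz)" by (simp add: w_def hom_induced_carrier)
  define z' where "z' = hom_induced ?p ?X nz ?F G \<mu> w"
  have z': "z' \<in> carrier (relative_homology_group ?p ?F G)" by (simp add: z'_def hom_induced_carrier)
  have \<tau>inv: "hom_induced ?p ?X nz ?X G \<sigma> (hom_induced ?p ?X G ?X nz \<tau> x) = x" if "x \<in> carrier (relative_homology_group ?p ?X G)" for x
  proof -
    have "\<sigma> \<circ> \<tau> = id" by (auto simp: \<sigma>_def \<tau>_def)
    then show ?thesis using hom_induced_compose'[OF c\<tau> \<tau>G(1) c\<sigma> \<tau>G(2), of ?p x] hom_induced_id[OF that] by simp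
  qed
  have "hom_induced ?p ?X G ?X nz \<tau> (hom_induced ?p ?F G ?X G id z') = hom_induced ?p ?X (topspace ?X \<inter> nz) ?X nz (\<tau> \<circ> (id \<circ> \<mu>)) w"
    unfolding z'_def hom_induced_topspace_left[of ?p ?X nz, symmetric]
    by (subst hom_induced_compose'[OF c\<mu> \<mu>G], simp, simp, subst hom_induced_compose'[OF _ _ c\<tau> \<tau>G(1)])
       (use c\<mu>X \<mu>G in auto)
  also have "\<dots> = hom_induced ?p ?X nz ?X nz (\<tau> \<circ> \<mu>) w" by (simp only: hom_induced_topspace_left id_comp)
  also have "\<dots> = hom_induced ?p ?X nz ?X nz id w"
  proof (rule fun_cong[OF hom_induced_line[where D=UNIV, simplified]])
    show "continuous_map ?X ?X (\<tau> \<circ> \<mu>)" by (rule continuous_map_compose[OF c\<mu>X c\<tau>])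
    show "fst ((\<tau> \<circ> \<mu>) z) = fst (id z)" for z by (simp add: \<tau>_def \<mu>_def)
    fix z and t :: real assume z: "z \<in> topspace ?X" "z \<in> nz" and t: "0 \<le> t" "t \<le> 1"
    obtain i where i: "snd z i \<noteq> 0" using z(2) by (auto simp: nz_def)
    have "(1 - t) * r z + t > 0" using r(2)[OF z(1)] t by (cases "t = 1") (auto intro: add_pos_nonneg)
    then have "((1 - t) * r z + t) * snd z i \<noteq> 0" using i by simp
    then show "(fst ((\<tau> \<circ> \<mu>) z), \<lambda>i. (1 - t) * snd ((\<tau> \<circ> \<mu>) z) i + t * snd (id z) i) \<in> nz"
      by (intro nzI[of _ i]) (simp add: \<tau>_def \<mu>_def algebra_simps)
  qed auto
  also have "\<dots> = w" by (rule hom_induced_id[OF w])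
  finally have "hom_induced ?p ?X G ?X nz \<tau> (hom_induced ?p ?F G ?X G id z') = hom_induced ?p ?X G ?X nz \<tau> (hom_induced ?p ?F G ?X G id z)"
    by (simp add: w_def)
  then have "hom_induced ?p ?F G ?X G id z' = hom_induced ?p ?F G ?X G id z"
    by (metis \<tau>inv hom_induced_carrier)
  then have zz: "z' = z"
    using ex z(1) z' unfolding iso_iff inj_on_def by blast
  obtain u where u: "u \<in> carrier (homology_group q B)" "w = thom d B q u"
    using w iso_thom[of d B q] unfolding iso_iff by blast
  have "hom_induced ?p ?X nz ?F G \<mu> = hom_induced ?p ?X (topspace ?X \<inter> nz) ?F G \<mu>" by (simp only: hom_induced_topspace_left)
  then have "y = hom_boundary ?p ?F G (hom_induced ?p ?X (topspace ?X \<inter> nz) ?F G \<mu> (thom d B q u))"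
    using z(2) zz by (simp only: z'_def u(2))
  also have "\<dots> = HI (?p - 1) (subtopology ?X (topspace ?X \<inter> nz)) (subtopology ?F G) \<mu> (hom_boundary ?p ?X (topspace ?X \<inter> nz) (thom d B q u))"
    using fun_cong[OF naturality_hom_induced[OF c\<mu> \<mu>G, of ?p], of "thom d B q u"] unfolding o_apply .
  also have "\<dots> = HI (?p - 1) (PB d B) (subtopology ?F G) \<mu> (cross d B q u)"
    by (simp only: cross_def hom_boundary_restrict subtopology_restrict[of ?X nz, symmetric])
  finally have "y = HI (?p - 1) (PB d B) (subtopology ?F G) \<mu> (cross d B q u)" .
  then show ?thesis unfolding subFG unfolding G_def \<mu>_def by (rule that[OF u(1)])
qed

section \<open>Three points in Euclidean space\<close>

definition nrm :: "nat \<Rightarrow> (nat \<Rightarrow> real) \<Rightarrow> real" where "nrm d v = (\<Sum>i<d. \<bar>v i\<bar>)"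

lemma nrm_nonneg: "nrm d v \<ge> 0" by (simp add: nrm_def sum_nonneg)

lemma nrm_scale: "nrm d (\<lambda>i. a * v i) = \<bar>a\<bar> * nrm d v"
  by (simp add: nrm_def abs_mult sum_distrib_left)

lemma nrm_minus: "nrm d (\<lambda>i. - v i) = nrm d v" by (simp add: nrm_def)

lemma nrm_minus_commute: "nrm d (\<lambda>i. u i - v i) = nrm d (\<lambda>i. v i - u i)"
  by (simp add: nrm_def abs_minus_commute)

lemma nrm_triangle: "nrm d (\<lambda>i. u i + v i) \<le> nrm d u + nrm d v"
  unfolding nrm_def sum.distrib[symmetric] by (intro sum_mono) (rule abs_triangle_ineq)

lemma nrm_pos: "v \<noteq> (\<lambda>i. 0) \<Longrightarrow> \<forall>i\<ge>d. v i = 0 \<Longrightarrow> nrm d v > 0"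
proof -
  assume v: "v \<noteq> (\<lambda>i. 0)" "\<forall>i\<ge>d. v i = 0"
  then obtain i where i: "v i \<noteq> 0" by auto
  then have "i < d" using v(2) by (meson linorder_not_less)
  then show "nrm d v > 0" unfolding nrm_def using i by (intro sum_pos2[of _ i]) auto
qed

lemma continuous_map_nrm:
  "continuous_map Z (Euclidean_space d) f \<Longrightarrow> continuous_map Z euclideanreal (\<lambda>z. nrm d (f z))"
  unfolding nrm_def by (rule continuous_map_sum, simp, rule continuous_map_real_abs, rule continuous_map_Euclidean_coord)

text \<open>Two vectors of different norm cannot cancel. Most of the segment homotopies for three
  points rest on this test.\<close>

lemma lin_nz: "\<bar>a\<bar> * nrm d v \<noteq> \<bar>c\<bar> * nrm d w \<Longrightarrow> (\<lambda>i. a * v i + c * w i) \<noteq> (\<lambda>i. 0)"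
proof
  assume h: "\<bar>a\<bar> * nrm d v \<noteq> \<bar>c\<bar> * nrm d w" and "(\<lambda>i. a * v i + c * w i) = (\<lambda>i. 0)"
  then have "a * v i = (- c) * w i" for i by (auto simp: fun_eq_iff eq_neg_iff_add_eq_0)
  then have "nrm d (\<lambda>i. a * v i) = nrm d (\<lambda>i. (- c) * w i)" by simp
  then show False using h unfolding nrm_scale by simp
qed

section \<open>The space of triples (0, v, y) and its three spheres\<close>

abbreviation PP :: "nat \<Rightarrow> 'a topology \<Rightarrow> (('a \<times> (nat \<Rightarrow> real)) \<times> (nat \<Rightarrow> real)) topology"
  where "PP d B \<equiv> PB d (PB d B)"

text \<open>Reading a point of the bundle over \<open>PB d B\<close> as (b, v, y), the subspace cut
  out consists of the configurations of three distinct points 0, v, y over b.\<close>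

definition apart :: "(('a \<times> (nat \<Rightarrow> real)) \<times> (nat \<Rightarrow> real)) set"
  where "apart = nz \<inter> {z. snd z \<noteq> snd (fst z)}"

abbreviation E2 :: "nat \<Rightarrow> 'a topology \<Rightarrow> (('a \<times> (nat \<Rightarrow> real)) \<times> (nat \<Rightarrow> real)) topology"
  where "E2 d B \<equiv> subtopology (EB d (PB d B)) apart"

lemma continuous_map_E2:
  "continuous_map Z (E2 d B) f \<longleftrightarrow> continuous_map Z B (\<lambda>z. fst (fst (f z))) \<and>
     continuous_map Z (Euclidean_space d) (\<lambda>z. snd (fst (f z))) \<and> continuous_map Z (Euclidean_space d) (\<lambda>z. snd (f z))
   \<and> (\<forall>z\<in>topspace Z. snd (fst (f z)) \<noteq> (\<lambda>i. 0) \<and> snd (f z) \<noteq> (\<lambda>i. 0) \<and> snd (f z) \<noteq> snd (fst (f z)))"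
proof -
  have "continuous_map Z (PB d B) (\<lambda>z. fst (f z)) \<longleftrightarrow> continuous_map Z B (\<lambda>z. fst (fst (f z))) \<and>
     continuous_map Z (Euclidean_space d) (\<lambda>z. snd (fst (f z))) \<and> (\<forall>z\<in>topspace Z. snd (fst (f z)) \<noteq> (\<lambda>i. 0))"
    by (rule continuous_map_PB_into)
  then show ?thesis by (auto simp: continuous_map_in_subtopology continuous_map_pairwise o_def apart_def nz_def)
qed

text \<open>The three pairwise differences of 0, v and y move along segments; the homotopy is
  admissible when none of these passes through 0.\<close>

lemma HI_line2:
  assumes f: "continuous_map Z (E2 d B) f" and g: "continuous_map Z (E2 d B) g"
    and fst: "\<And>z. z \<in> topspace Z \<Longrightarrow> fst (fst (f z)) = fst (fst (g z))"
    and seg: "\<And>z t. z \<in> topspace Z \<Longrightarrow> 0 \<le> t \<Longrightarrow> t \<le> 1 \<Longrightarrow>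
        (\<lambda>i. (1 - t) * snd (fst (f z)) i + t * snd (fst (g z)) i) \<noteq> (\<lambda>i. 0) \<and>
        (\<lambda>i. (1 - t) * snd (f z) i + t * snd (g z) i) \<noteq> (\<lambda>i. 0) \<and>
        (\<lambda>i. (1 - t) * (snd (f z) i - snd (fst (f z)) i) + t * (snd (g z) i - snd (fst (g z)) i)) \<noteq> (\<lambda>i. 0)"
  shows "HI p Z (E2 d B) f = HI p Z (E2 d B) g"
proof (rule homology_homotopy_empty)
  let ?h = "\<lambda>(t::real,z). ((fst (fst (f z)), \<lambda>i. (1 - t) * snd (fst (f z)) i + t * snd (fst (g z)) i), \<lambda>i. (1 - t) * snd (f z) i + t * snd (g z) i)"
  note F = f[unfolded continuous_map_E2] and G = g[unfolded continuous_map_E2]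
  have ne: "(\<lambda>i. (1 - t) * snd (f z) i + t * snd (g z) i) \<noteq> (\<lambda>i. (1 - t) * snd (fst (f z)) i + t * snd (fst (g z)) i)"
    if "z \<in> topspace Z" "0 \<le> t" "t \<le> 1" for t z
  proof
    assume "(\<lambda>i. (1 - t) * snd (f z) i + t * snd (g z) i) = (\<lambda>i. (1 - t) * snd (fst (f z)) i + t * snd (fst (g z)) i)"
    then have "(1 - t) * (snd (f z) i - snd (fst (f z)) i) + t * (snd (g z) i - snd (fst (g z)) i) = 0" for i
      by (auto simp: fun_eq_iff algebra_simps)
    then show False using seg[OF that] by blast
  qed
  have "continuous_map (prod_topology (top_of_set {0..1}) Z) (E2 d B) ?h"
    unfolding continuous_map_E2 case_prod_unfold fst_conv snd_conv
  proof (intro conjI ballI)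
    show "continuous_map (prod_topology (top_of_set {0..1}) Z) B (\<lambda>z. fst (fst (f (snd z))))"
      using continuous_map_compose[OF continuous_map_snd, of Z B "\<lambda>z. fst (fst (f z))"] F by (simp add: o_def)
  next
    fix z assume z: "z \<in> topspace (prod_topology (top_of_set {0..1::real}) Z)"
    then have z': "snd z \<in> topspace Z" "0 \<le> fst z" "fst z \<le> 1" by auto
    show "(\<lambda>i. (1 - fst z) * snd (fst (f (snd z))) i + fst z * snd (fst (g (snd z))) i) \<noteq> (\<lambda>i. 0)"
      "(\<lambda>i. (1 - fst z) * snd (f (snd z)) i + fst z * snd (g (snd z)) i) \<noteq> (\<lambda>i. 0)"
      using seg[OF z'] by blast+
    show "(\<lambda>i. (1 - fst z) * snd (f (snd z)) i + fst z * snd (g (snd z)) i) \<noteq> (\<lambda>i. (1 - fst z) * snd (fst (f (snd z))) i + fst z * snd (fst (g (snd z))) i)"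
      using ne[OF z'] .
  qed (use continuous_map_Euclidean_comb[of Z d "\<lambda>z. snd (fst (f z))" "\<lambda>z. snd (fst (g z))"] continuous_map_Euclidean_comb[of Z d "\<lambda>z. snd (f z)" "\<lambda>z. snd (g z)"] F G in \<open>simp_all add: case_prod_unfold\<close>)
  then show "homotopic_with (\<lambda>x. True) Z (E2 d B) f g"
    by (subst homotopic_with, simp, intro exI[of _ ?h]) (use fst in \<open>auto simp: prod_eq_iff\<close>)
qed

text \<open>Brings y within half the norm of v. It is defined and positive at y = 0 as well, since
  \<open>puncture_kernel\<close> wants a radius on the whole fibre.\<close>

definition g1 :: "nat \<Rightarrow> (('a \<times> (nat \<Rightarrow> real)) \<times> (nat \<Rightarrow> real)) \<Rightarrow> real"
  where "g1 d z = nrm d (snd (fst z)) / (2 * (1 + nrm d (snd z)))"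
definition g0 :: "nat \<Rightarrow> (('a \<times> (nat \<Rightarrow> real)) \<times> (nat \<Rightarrow> real)) \<Rightarrow> real"
  where "g0 d z = 1 + nrm d (snd (fst z)) / nrm d (snd z)"

text \<open>Writing a point of E2 as a configuration (0, v, y) of three points, \<open>b1\<close> lets y orbit 0,
  \<open>b2\<close> lets y orbit v, and \<open>b0\<close> lets y run over a sphere enclosing both.\<close>

definition b1 where "b1 d z = (fst z, \<lambda>i. g1 d z * snd z i)"
definition b2 where "b2 d z = (fst z, \<lambda>i. snd (fst z) i + g1 d z * snd z i)"
definition b0 where "b0 d z = (fst z, \<lambda>i. g0 d z * snd z i)"

lemma PP_cont:
  shows "continuous_map (PP d B) B (\<lambda>z. fst (fst z))" "continuous_map (PP d B) (Euclidean_space d) (\<lambda>z. snd (fst z))"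
    "continuous_map (PP d B) (Euclidean_space d) snd" "continuous_map (PP d B) (PB d B) fst"
    "continuous_map (EB d (PB d B)) (Euclidean_space d) (\<lambda>z. snd (fst z))" "continuous_map (EB d (PB d B)) (Euclidean_space d) snd"
proof -
  show 1: "continuous_map (PP d B) (PB d B) fst" by (rule continuous_map_subtopology_fst)
  show "continuous_map (PP d B) B (\<lambda>z. fst (fst z))" "continuous_map (PP d B) (Euclidean_space d) (\<lambda>z. snd (fst z))"
    using 1 by (auto simp: continuous_map_PB_into)
  show "continuous_map (PP d B) (Euclidean_space d) snd" by (rule continuous_map_subtopology_snd)
  show "continuous_map (EB d (PB d B)) (Euclidean_space d) snd" by (rule continuous_map_snd)
  have "continuous_map (EB d (PB d B)) (PB d B) (\<lambda>z. fst z)" by (rule continuous_map_fst)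
  then show "continuous_map (EB d (PB d B)) (Euclidean_space d) (\<lambda>z. snd (fst z))" by (simp add: continuous_map_PB_into)
qed

lemma EPB_pos: "z \<in> topspace (EB d (PB d B)) \<Longrightarrow> nrm d (snd (fst z)) > 0"
  by (auto intro!: nrm_pos simp: nz_def topspace_Euclidean_space)

lemma PP_pos: "z \<in> topspace (PP d B) \<Longrightarrow> nrm d (snd (fst z)) > 0 \<and> nrm d (snd z) > 0"
  by (auto intro!: nrm_pos simp: nz_def topspace_Euclidean_space)

lemma g1_pos: "z \<in> topspace (EB d (PB d B)) \<Longrightarrow> g1 d z > 0"
  unfolding g1_def using EPB_pos[of z B d] nrm_nonneg[of d "snd z"] by (intro divide_pos_pos) auto

lemma g1_small: "nrm d (snd (fst z)) > 0 \<Longrightarrow> g1 d z * nrm d (snd z) < nrm d (snd (fst z))"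
proof -
  assume a: "nrm d (snd (fst z)) > 0"
  have n: "nrm d (snd z) \<ge> 0" by (rule nrm_nonneg)
  have "nrm d (snd z) / (2 * (1 + nrm d (snd z))) < 1" using n by (simp add: divide_less_eq)
  then have "nrm d (snd (fst z)) * (nrm d (snd z) / (2 * (1 + nrm d (snd z)))) < nrm d (snd (fst z)) * 1"
    using a by (intro mult_strict_left_mono)
  then show ?thesis by (simp add: g1_def)
qed

lemma g0_mult: "nrm d (snd z) > 0 \<Longrightarrow> g0 d z * nrm d (snd z) = nrm d (snd z) + nrm d (snd (fst z))"
  by (simp add: g0_def field_simps)

lemma g_cont:
  "continuous_map (EB d (PB d B)) euclideanreal (g1 d)" "continuous_map (PP d B) euclideanreal (g1 d)"
  "continuous_map (PP d B) euclideanreal (g0 d)"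
proof -
  show 1: "continuous_map (EB d (PB d B)) euclideanreal (g1 d)"
    unfolding g1_def[abs_def]
    using continuous_map_nrm[OF PP_cont(5)] continuous_map_nrm[OF PP_cont(6)]
    by (intro continuous_intros) (auto simp: nrm_nonneg add_nonneg_eq_0_iff)
  show "continuous_map (PP d B) euclideanreal (g1 d)" using continuous_map_from_subtopology[OF 1] .
  show "continuous_map (PP d B) euclideanreal (g0 d)"
    unfolding g0_def[abs_def]
    by (intro continuous_intros continuous_map_nrm[OF PP_cont(2)] continuous_map_nrm[OF PP_cont(3)])
      (metis PP_pos less_irrefl)
qed

context
  fixes d :: nat and B :: "'a topology"
begin

lemma PPd:
  assumes "z \<in> topspace (PP d B)"
  shows "nrm d (snd (fst z)) > 0" "nrm d (snd z) > 0" "g1 d z > 0" "g0 d z > 1"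
    "g1 d z * nrm d (snd z) < nrm d (snd (fst z))" "g0 d z * nrm d (snd z) > nrm d (snd (fst z))"
    "snd (fst z) \<noteq> (\<lambda>i. 0)"
proof -
  show p: "nrm d (snd (fst z)) > 0" "nrm d (snd z) > 0" using PP_pos[OF assms] by auto
  show "g1 d z > 0" using g1_pos[of z B d] assms by auto
  show "g0 d z > 1" using p by (simp add: g0_def)
  show "g1 d z * nrm d (snd z) < nrm d (snd (fst z))" by (rule g1_small[OF p(1)])
  show "g0 d z * nrm d (snd z) > nrm d (snd (fst z))" using g0_mult[OF p(2)] p by simp
  show "snd (fst z) \<noteq> (\<lambda>i. 0)" using p(1) by (auto simp: nrm_def)
qed

lemma scale_nz: "c \<noteq> 0 \<Longrightarrow> nrm d w > 0 \<Longrightarrow> (\<lambda>i. c * w i) \<noteq> (\<lambda>i. 0)"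
  using lin_nz[of 0 d w c w] by simp

lemma cont_b:
  "continuous_map (PP d B) (E2 d B) (b1 d)" "continuous_map (PP d B) (E2 d B) (b2 d)" "continuous_map (PP d B) (E2 d B) (b0 d)"
proof -
  have ne1: "(\<lambda>i. g1 d z * snd z i) \<noteq> snd (fst z)" if z: "z \<in> topspace (PP d B)" for z
    using PPd[OF z] nrm_scale[of d "g1 d z" "snd z"] by auto
  have ne0: "(\<lambda>i. g0 d z * snd z i) \<noteq> snd (fst z)" if z: "z \<in> topspace (PP d B)" for z
    using PPd[OF z] nrm_scale[of d "g0 d z" "snd z"] by auto
  have ne2: "(\<lambda>i. snd (fst z) i + g1 d z * snd z i) \<noteq> (\<lambda>i. 0)" if z: "z \<in> topspace (PP d B)" for z
    using PPd[OF z] lin_nz[of 1 d "snd (fst z)" "g1 d z" "snd z"] by auto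
  have ne3: "(\<lambda>i. snd (fst z) i + g1 d z * snd z i) \<noteq> snd (fst z)" if z: "z \<in> topspace (PP d B)" for z
    using scale_nz[of "g1 d z" "snd z"] PPd[OF z] by (auto simp: fun_eq_iff)
  have nz1: "(\<lambda>i. g1 d z * snd z i) \<noteq> (\<lambda>i. 0)" "(\<lambda>i. g0 d z * snd z i) \<noteq> (\<lambda>i. 0)" if z: "z \<in> topspace (PP d B)" for z
    using scale_nz[of _ "snd z"] PPd[OF z] by auto
  note cc = PP_cont(1,2) continuous_map_Euclidean_scale[OF g_cont(2) PP_cont(3)] continuous_map_Euclidean_scale[OF g_cont(3) PP_cont(3)]
      continuous_map_Euclidean_space_add[OF PP_cont(2) continuous_map_Euclidean_scale[OF g_cont(2) PP_cont(3)]]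
  show "continuous_map (PP d B) (E2 d B) (b1 d)" "continuous_map (PP d B) (E2 d B) (b2 d)" "continuous_map (PP d B) (E2 d B) (b0 d)"
    unfolding continuous_map_E2 b1_def b2_def b0_def fst_conv snd_conv
    by (intro conjI ballI; (rule cc PPd(7) nz1 ne0 ne1 ne2 ne3; assumption?))+
qed

definition jm :: "(('a \<times> (nat \<Rightarrow> real)) \<times> (nat \<Rightarrow> real)) \<Rightarrow> (('a \<times> (nat \<Rightarrow> real)) \<times> (nat \<Rightarrow> real))"
  where "jm z = (fst z, \<lambda>i. snd z i - snd (fst z) i)"

lemma E2_cont: "continuous_map (E2 d B) B (\<lambda>z. fst (fst z))" "continuous_map (E2 d B) (Euclidean_space d) (\<lambda>z. snd (fst z))"
    "continuous_map (E2 d B) (Euclidean_space d) snd"  "continuous_map (E2 d B) (PB d B) fst"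
  using continuous_map_id[of "E2 d B"] unfolding continuous_map_E2 by (auto intro: continuous_map_subtopology_fst)

lemma E2_ne: "z \<in> topspace (E2 d B) \<Longrightarrow> snd (fst z) \<noteq> (\<lambda>i. 0) \<and> snd z \<noteq> (\<lambda>i. 0) \<and> snd z \<noteq> snd (fst z)"
  using continuous_map_id[of "E2 d B"] unfolding continuous_map_E2 by auto

lemma cont_jm: "continuous_map (E2 d B) (PP d B) jm"
  unfolding continuous_map_PB_into[of "E2 d B" "PB d B" d] jm_def fst_conv snd_conv
  using E2_ne by (auto intro!: E2_cont continuous_map_Euclidean_space_diff simp: fun_eq_iff)

lemma cont_i: "continuous_map (E2 d B) (PP d B) id"
  unfolding continuous_map_PB_into[of "E2 d B" "PB d B" d] id_apply using E2_ne by (auto intro: E2_cont)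

lemma HI_line_PP:
  assumes "continuous_map (PP d B) (PP d B) f" "continuous_map (PP d B) (PP d B) g"
    and "\<And>z. z \<in> topspace (PP d B) \<Longrightarrow> fst (f z) = fst (g z)"
    and "\<And>z t. z \<in> topspace (PP d B) \<Longrightarrow> 0 \<le> t \<Longrightarrow> t \<le> 1 \<Longrightarrow>
        (\<lambda>i. (1 - t) * snd (f z) i + t * snd (g z) i) \<noteq> (\<lambda>i. 0)"
  shows "HI p (PP d B) (PP d B) f = HI p (PP d B) (PP d B) g"
  by (rule hom_induced_line[OF assms(1-3)]) (use assms(4) in \<open>auto simp: nz_def\<close>)

text \<open>The winding table of the three spheres, where \<open>id\<close> measures winding around
  0 and \<open>jm\<close> around v: \<open>b1\<close> winds once around 0 only, \<open>b2\<close>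
  once around v only, \<open>b0\<close> once around both. A sphere that does not wind around a point
  is deformed into a map that depends on (b, v) alone.\<close>

lemma proj_compositions:
  "HI p (PP d B) (PP d B) (id \<circ> b0 d) = HI p (PP d B) (PP d B) id"
  "HI p (PP d B) (PP d B) (id \<circ> b1 d) = HI p (PP d B) (PP d B) id"
  "HI p (PP d B) (PP d B) (id \<circ> b2 d) = HI p (PP d B) (PP d B) ((\<lambda>b. (b, snd b)) \<circ> fst)"
  "HI p (PP d B) (PP d B) (jm \<circ> b0 d) = HI p (PP d B) (PP d B) id"
  "HI p (PP d B) (PP d B) (jm \<circ> b1 d) = HI p (PP d B) (PP d B) ((\<lambda>b. (b, \<lambda>i. - snd b i)) \<circ> fst)"
  "HI p (PP d B) (PP d B) (jm \<circ> b2 d) = HI p (PP d B) (PP d B) id"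
  and cont_diag: "continuous_map (PB d B) (PP d B) (\<lambda>b. (b, snd b))"
    "continuous_map (PB d B) (PP d B) (\<lambda>b. (b, \<lambda>i. - snd b i))"
proof -
  have cs: "continuous_map (PB d B) (Euclidean_space d) snd" by (rule continuous_map_subtopology_snd)
  show cd: "continuous_map (PB d B) (PP d B) (\<lambda>b. (b, snd b))" "continuous_map (PB d B) (PP d B) (\<lambda>b. (b, \<lambda>i. - snd b i))"
    unfolding continuous_map_PB_into[of "PB d B" "PB d B" d] fst_conv snd_conv
    by (intro conjI ballI cs continuous_map_Euclidean_minus continuous_map_id[unfolded id_def]; force simp: nz_def fun_eq_iff)+
  note cc = continuous_map_compose[OF cont_b(1) cont_i] continuous_map_compose[OF cont_b(2) cont_i] continuous_map_compose[OF cont_b(3) cont_i]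
    continuous_map_compose[OF cont_b(1) cont_jm] continuous_map_compose[OF cont_b(2) cont_jm] continuous_map_compose[OF cont_b(3) cont_jm]
    continuous_map_compose[OF PP_cont(4) cd(1)] continuous_map_compose[OF PP_cont(4) cd(2)] continuous_map_id
  have pos: "(1 - t) * a + t > 0" if "0 \<le> t" "t \<le> 1" "a > 0" for a t :: real
    using that by (cases "t = 1") (auto intro: add_pos_nonneg)
  have sm: "(1 - t) * (g1 d z * nrm d (snd z)) < nrm d (snd (fst z))" if z: "z \<in> topspace (PP d B)" and t: "0 \<le> t" "t \<le> 1" for z t
  proof -
    have "(1 - t) * (g1 d z * nrm d (snd z)) \<le> 1 * (g1 d z * nrm d (snd z))"
      using t PPd[OF z] by (intro mult_right_mono) auto
    then show ?thesis using PPd(5)[OF z] by simp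
  qed
  show "HI p (PP d B) (PP d B) (id \<circ> b0 d) = HI p (PP d B) (PP d B) id"
  proof (rule HI_line_PP[OF cc(3) cc(9)])
    fix z and t :: real assume z: "z \<in> topspace (PP d B)" "0 \<le> t" "t \<le> 1"
    have "(\<lambda>i. ((1 - t) * g0 d z + t) * snd z i) \<noteq> (\<lambda>i. 0)"
      by (rule scale_nz) (use pos[OF z(2,3), of "g0 d z"] PPd[OF z(1)] in auto)
    then show "(\<lambda>i. (1 - t) * snd ((id \<circ> b0 d) z) i + t * snd (id z) i) \<noteq> (\<lambda>i. 0)"
      by (simp add: b0_def algebra_simps)
  qed (auto simp: b0_def)
  show "HI p (PP d B) (PP d B) (id \<circ> b1 d) = HI p (PP d B) (PP d B) id"
  proof (rule HI_line_PP[OF cc(1) cc(9)])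
    fix z and t :: real assume z: "z \<in> topspace (PP d B)" "0 \<le> t" "t \<le> 1"
    have "(\<lambda>i. ((1 - t) * g1 d z + t) * snd z i) \<noteq> (\<lambda>i. 0)"
      by (rule scale_nz) (use pos[OF z(2,3), of "g1 d z"] PPd[OF z(1)] in auto)
    then show "(\<lambda>i. (1 - t) * snd ((id \<circ> b1 d) z) i + t * snd (id z) i) \<noteq> (\<lambda>i. 0)"
      by (simp add: b1_def algebra_simps)
  qed (auto simp: b1_def)
  show "HI p (PP d B) (PP d B) (jm \<circ> b2 d) = HI p (PP d B) (PP d B) id"
  proof (rule HI_line_PP[OF cc(5) cc(9)])
    fix z and t :: real assume z: "z \<in> topspace (PP d B)" "0 \<le> t" "t \<le> 1"
    have "(\<lambda>i. ((1 - t) * g1 d z + t) * snd z i) \<noteq> (\<lambda>i. 0)"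
      by (rule scale_nz) (use pos[OF z(2,3), of "g1 d z"] PPd[OF z(1)] in auto)
    then show "(\<lambda>i. (1 - t) * snd ((jm \<circ> b2 d) z) i + t * snd (id z) i) \<noteq> (\<lambda>i. 0)"
      by (simp add: b2_def jm_def algebra_simps)
  qed (auto simp: b2_def jm_def)
  show "HI p (PP d B) (PP d B) (id \<circ> b2 d) = HI p (PP d B) (PP d B) ((\<lambda>b. (b, snd b)) \<circ> fst)"
  proof (rule HI_line_PP[OF cc(2) cc(7)])
    fix z and t :: real assume z: "z \<in> topspace (PP d B)" "0 \<le> t" "t \<le> 1"
    have "(\<lambda>i. 1 * snd (fst z) i + ((1 - t) * g1 d z) * snd z i) \<noteq> (\<lambda>i. 0)"
      by (rule lin_nz[where d=d]) (use sm[OF z] PPd(3)[OF z(1)] z in \<open>auto simp: abs_mult\<close>)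
    then show "(\<lambda>i. (1 - t) * snd ((id \<circ> b2 d) z) i + t * snd (((\<lambda>b. (b, snd b)) \<circ> fst) z) i) \<noteq> (\<lambda>i. 0)"
      by (simp add: b2_def algebra_simps)
  qed (auto simp: b2_def)
  show "HI p (PP d B) (PP d B) (jm \<circ> b1 d) = HI p (PP d B) (PP d B) ((\<lambda>b. (b, \<lambda>i. - snd b i)) \<circ> fst)"
  proof (rule HI_line_PP[OF cc(4) cc(8)])
    fix z and t :: real assume z: "z \<in> topspace (PP d B)" "0 \<le> t" "t \<le> 1"
    have "(\<lambda>i. (- 1) * snd (fst z) i + ((1 - t) * g1 d z) * snd z i) \<noteq> (\<lambda>i. 0)"
      by (rule lin_nz[where d=d]) (use sm[OF z] PPd(3)[OF z(1)] z in \<open>auto simp: abs_mult\<close>)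
    then show "(\<lambda>i. (1 - t) * snd ((jm \<circ> b1 d) z) i + t * snd (((\<lambda>b. (b, \<lambda>i. - snd b i)) \<circ> fst) z) i) \<noteq> (\<lambda>i. 0)"
      by (simp add: b1_def jm_def algebra_simps)
  qed (auto simp: b1_def jm_def)
  show "HI p (PP d B) (PP d B) (jm \<circ> b0 d) = HI p (PP d B) (PP d B) id"
  proof (rule HI_line_PP[OF cc(6) cc(9)])
    fix z and t :: real assume z: "z \<in> topspace (PP d B)" "0 \<le> t" "t \<le> 1"
    have "((1 - t) * g0 d z + t) * nrm d (snd z) = (1 - t) * (g0 d z * nrm d (snd z)) + t * nrm d (snd z)" by (simp add: algebra_simps)
    also have "\<dots> = nrm d (snd z) + (1 - t) * nrm d (snd (fst z))"
      unfolding g0_mult[OF PPd(2)[OF z(1)]] by (simp add: algebra_simps)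
    finally have e: "((1 - t) * g0 d z + t) * nrm d (snd z) = nrm d (snd z) + (1 - t) * nrm d (snd (fst z))" .
    have "(\<lambda>i. (t - 1) * snd (fst z) i + ((1 - t) * g0 d z + t) * snd z i) \<noteq> (\<lambda>i. 0)"
      by (rule lin_nz[where d=d]) (use e pos[OF z(2,3), of "g0 d z"] PPd[OF z(1)] z in auto)
    then show "(\<lambda>i. (1 - t) * snd ((jm \<circ> b0 d) z) i + t * snd (id z) i) \<noteq> (\<lambda>i. 0)"
      by (simp add: b0_def jm_def algebra_simps)
  qed (auto simp: b0_def jm_def)
qed

text \<open>The map factors through the projection of the sphere bundle, which kills sphere classes
  by \<open>cross_proj\<close>.\<close>

lemma HI_through_proj:
  assumes "continuous_map (PB d B) Y h"
  shows "HI (q + int d - 1) (PP d B) Y (h \<circ> fst) (cross d (PB d B) q z) = \<one>\<^bsub>homology_group (q + int d - 1) Y\<^esub>"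
proof -
  have "HI (q + int d - 1) (PP d B) Y (h \<circ> fst) (cross d (PB d B) q z) =
    HI (q + int d - 1) (PB d B) Y h (HI (q + int d - 1) (PP d B) (PB d B) fst (cross d (PB d B) q z))"
    by (rule hom_induced_compose'[symmetric, OF PP_cont(4) _ assms]) auto
  then show ?thesis by (simp only: cross_proj group_hom.hom_one[OF hom_induced_group_hom])
qed

lemma openin_nz: "openin (EB d C) (topspace (EB d C) \<inter> nz)"
proof -
  have c: "continuous_map (EB d C) euclideanreal (\<lambda>z. snd z i)" for i
    using continuous_map_Euclidean_coord[OF continuous_map_snd] .
  have "topspace (EB d C) \<inter> nz = \<Union> ((\<lambda>i. {z \<in> topspace (EB d C). snd z i \<in> - {0}}) ` UNIV)"
    by (auto simp: nz_def fun_eq_iff)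
  moreover have "openin (EB d C) {z \<in> topspace (EB d C). snd z i \<in> - {0}}" for i
    by (rule openin_continuous_map_preimage[OF c]) auto
  ultimately show ?thesis by (simp only:) (rule openin_Union, blast)
qed

text \<open>Let D be the difference of the two sides. Filling the puncture v kills D by the winding
  table, so \<open>puncture_kernel\<close> places D on the small sphere around v. The map
  \<open>jm\<close> recovers such a class, and it also kills D.\<close>

lemma big_sphere:
  assumes d: "d > 0"
  shows "HI (q + int d - 1) (PP d B) (E2 d B) (b0 d) (cross d (PB d B) q z) =
    HI (q + int d - 1) (PP d B) (E2 d B) (b1 d) (cross d (PB d B) q z) \<otimes>\<^bsub>homology_group (q + int d - 1) (E2 d B)\<^esub>
    HI (q + int d - 1) (PP d B) (E2 d B) (b2 d) (cross d (PB d B) q z)"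
proof -
  let ?p = "q + int d - 1"
  let ?G = "homology_group ?p (E2 d B)" and ?K = "homology_group ?p (PP d B)"
  let ?x = "cross d (PB d B) q z"
  let ?h = "\<lambda>f. HI ?p (PP d B) (E2 d B) f ?x"
  interpret G: comm_group ?G by simp
  interpret K: comm_group ?K by simp
  interpret i: group_hom ?G ?K "HI ?p (E2 d B) (PP d B) id" by (rule hom_induced_group_hom)
  interpret j: group_hom ?G ?K "HI ?p (E2 d B) (PP d B) jm" by (rule hom_induced_group_hom)
  have x: "?x \<in> carrier ?K" by (rule cross_carrier)
  have hc: "?h f \<in> carrier ?G" for f by (rule hom_induced_carrier)
  have ii: "HI ?p (E2 d B) (PP d B) id (?h f) = HI ?p (PP d B) (PP d B) (id \<circ> f) ?x" if "continuous_map (PP d B) (E2 d B) f" for f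
    by (rule hom_induced_compose'[OF that _ cont_i]) auto
  have jj: "HI ?p (E2 d B) (PP d B) jm (HI ?p (PP d B) (E2 d B) f y) = HI ?p (PP d B) (PP d B) (jm \<circ> f) y" if "continuous_map (PP d B) (E2 d B) f" for f y
    by (rule hom_induced_compose'[OF that _ cont_jm]) auto
  define D where "D = ?h (b0 d) \<otimes>\<^bsub>?G\<^esub> inv\<^bsub>?G\<^esub> (?h (b1 d) \<otimes>\<^bsub>?G\<^esub> ?h (b2 d))"
  have D: "D \<in> carrier ?G" using hc by (simp add: D_def)
  have "HI ?p (E2 d B) (PP d B) id D = \<one>\<^bsub>?K\<^esub>"
    unfolding D_def using hc x
    by (simp add: i.hom_mult i.hom_inv ii cont_b proj_compositions hom_induced_id HI_through_proj cont_diag del: id_comp)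
  then obtain u where u: "u \<in> carrier (homology_group q (PB d B))" "D = HI ?p (PP d B) (E2 d B) (b2 d) (cross d (PB d B) q u)"
  proof -
    have mF: "(fst z, \<lambda>i. snd (fst z) i + g1 d z * snd z i) \<in> nz" if z: "z \<in> topspace (EB d (PB d B))" for z
    proof -
      have "(\<lambda>i. 1 * snd (fst z) i + g1 d z * snd z i) \<noteq> (\<lambda>i. 0)"
        by (rule lin_nz[where d=d]) (use g1_small[OF EPB_pos[OF z]] g1_pos[OF z] in auto)
      then show ?thesis by (simp add: nz_def)
    qed
    have cs: "continuous_map (PB d B) (Euclidean_space d) snd" by (rule continuous_map_subtopology_snd)
    from puncture_kernel[where B="PB d B" and F=nz and c=snd and r="g1 d" and d=d and q=q and y=D, OF openin_nz cs g_cont(1) g1_pos[where B=B] mF]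
    obtain u where "u \<in> carrier (homology_group q (PB d B))" "D = HI ?p (PP d B) (subtopology (EB d (PB d B)) (nz \<inter> {z. snd z \<noteq> snd (fst z)}))
      (\<lambda>z. (fst z, \<lambda>i. snd (fst z) i + g1 d z * snd z i)) (cross d (PB d B) q u)"
      using D \<open>HI ?p (E2 d B) (PP d B) id D = \<one>\<^bsub>?K\<^esub>\<close> unfolding apart_def by blast
    then show thesis by (intro that) (simp_all only: apart_def b2_def[abs_def])
  qed
  have "HI ?p (E2 d B) (PP d B) jm D = \<one>\<^bsub>?K\<^esub>"
    unfolding D_def using hc x
    by (simp add: j.hom_mult j.hom_inv jj cont_b proj_compositions hom_induced_id HI_through_proj cont_diag)
  moreover have "HI ?p (E2 d B) (PP d B) jm D = cross d (PB d B) q u"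
    unfolding u(2) jj[OF cont_b(2)] proj_compositions by (rule hom_induced_id[OF cross_carrier])
  ultimately have "D = \<one>\<^bsub>?G\<^esub>" unfolding u(2) by (simp add: group_hom.hom_one[OF hom_induced_group_hom])
  then show ?thesis unfolding D_def using hc by (metis G.inv_equality G.inv_inv G.inv_closed G.m_closed G.r_inv)
qed

text \<open>Exchanges the points 0 and v and translates the new first point back to the origin;
  \<open>swp\<close> exchanges v and y.\<close>

definition lam :: "(('a \<times> (nat \<Rightarrow> real)) \<times> (nat \<Rightarrow> real)) \<Rightarrow> (('a \<times> (nat \<Rightarrow> real)) \<times> (nat \<Rightarrow> real))"
  where "lam z = ((fst (fst z), \<lambda>i. - snd (fst z) i), \<lambda>i. snd z i - snd (fst z) i)"

definition swp :: "(('a \<times> (nat \<Rightarrow> real)) \<times> (nat \<Rightarrow> real)) \<Rightarrow> (('a \<times> (nat \<Rightarrow> real)) \<times> (nat \<Rightarrow> real))"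
  where "swp z = ((fst (fst z), snd z), snd (fst z))"

lemma cont_lam: "continuous_map (E2 d B) (E2 d B) lam"
  unfolding continuous_map_E2 lam_def fst_conv snd_conv
proof (intro conjI ballI)
  fix z assume "z \<in> topspace (E2 d B)"
  note n = E2_ne[OF this]
  show "(\<lambda>i. - snd (fst z) i) \<noteq> (\<lambda>i. 0)" using n by (auto simp: fun_eq_iff)
  show "(\<lambda>i. snd z i - snd (fst z) i) \<noteq> (\<lambda>i. 0)" using n by (auto simp: fun_eq_iff)
  show "(\<lambda>i. snd z i - snd (fst z) i) \<noteq> (\<lambda>i. - snd (fst z) i)" using n by (auto simp: fun_eq_iff)
qed (intro E2_cont continuous_map_Euclidean_minus continuous_map_Euclidean_space_diff)+

lemma cont_swp_E2: "continuous_map (E2 d B) (E2 d B) swp"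
  unfolding continuous_map_E2 swp_def fst_conv snd_conv
  using E2_ne by (intro conjI ballI E2_cont) metis+

lemma cont_swp: "continuous_map (PP d B) (PP d B) swp"
proof -
  have "continuous_map (PP d B) (PB d B) (\<lambda>z. (fst (fst z), snd z))"
    unfolding continuous_map_PB_into fst_conv snd_conv by (intro conjI PP_cont) (auto simp: nz_def)
  then show ?thesis
    unfolding continuous_map_PB_into[of "PP d B" "PB d B" d] swp_def fst_conv snd_conv
    by (intro conjI PP_cont) (auto simp: nz_def)
qed

lemma cont_negP: "continuous_map (PP d B) (PP d B) (map_prod negv id)"
  by (rule continuous_map_PB[OF cont_negv])

lemma cross2_carrier:
  "cross d (PB d B) (q + int d - 1) (cross d B q u) \<in> carrier (homology_group (q + int d - 1 + int d - 1) (PP d B))"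
  by (rule cross_carrier)

text \<open>Both coordinate projections kill the swapped class, so two uses of
  \<open>cross_surj\<close> write it as a double sphere class again. Which u' occurs is settled only
  for even d, by \<open>cross_swap\<close>.\<close>

lemma swap_exists:
  assumes d: "d > 0" and u: "u \<in> carrier (homology_group q B)"
  obtains u' where "u' \<in> carrier (homology_group q B)"
    "HI (q + int d - 1 + int d - 1) (PP d B) (PP d B) swp (cross d (PB d B) (q + int d - 1) (cross d B q u)) =
      cross d (PB d B) (q + int d - 1) (cross d B q u')"
    "HI (q + int d - 1 + int d - 1) (PP d B) (PP d B) swp (cross d (PB d B) (q + int d - 1) (cross d B q u')) =
      cross d (PB d B) (q + int d - 1) (cross d B q u)"
proof -
  let ?q = "q + int d - 1" let ?p = "q + int d - 1 + int d - 1"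
  let ?X = "cross d (PB d B) ?q" and ?x = "cross d B q"
  let ?f = "map_prod fst id :: ('a \<times> (nat \<Rightarrow> real)) \<times> (nat \<Rightarrow> real) \<Rightarrow> 'a \<times> (nat \<Rightarrow> real)"
  have cf: "continuous_map (PB d B) B fst" by (rule continuous_map_subtopology_fst)
  have cF: "continuous_map (PP d B) (PB d B) ?f" by (rule continuous_map_PB[OF cf])
  have xc: "?x v \<in> carrier (homology_group ?q (PB d B))" for v by (rule cross_carrier)
  define y1 where "y1 = HI ?p (PP d B) (PP d B) swp (?X (?x u))"
  have y1: "y1 \<in> carrier (homology_group ?p (PP d B))" unfolding y1_def by (rule hom_induced_carrier)
  have f_X: "HI ?p (PP d B) (PB d B) ?f (?X z) = cross d B ?q (HI ?q (PB d B) B fst z)" if "z \<in> carrier (homology_group ?q (PB d B))" for z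
    by (rule cross_natural[OF cf that])
  have x1: "cross d B ?q \<one>\<^bsub>homology_group ?q B\<^esub> = \<one>\<^bsub>homology_group ?p (PB d B)\<^esub>"
    by (rule hom_one[OF cross_hom]) auto
  have "HI ?p (PP d B) (PB d B) fst y1 = HI ?p (PP d B) (PB d B) (fst \<circ> swp) (?X (?x u))"
    unfolding y1_def by (rule hom_induced_compose'[OF cont_swp _ PP_cont(4)]) auto
  also have "(fst \<circ> swp) = ?f" by (auto simp: swp_def)
  also have "HI ?p (PP d B) (PB d B) ?f (?X (?x u)) = \<one>\<^bsub>homology_group ?p (PB d B)\<^esub>"
    unfolding f_X[OF xc] cross_proj x1 ..
  finally obtain y2 where y2: "y2 \<in> carrier (homology_group ?q (PB d B))" "y1 = ?X y2"
    using cross_surj[OF y1] by blast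
  have "cross d B ?q (HI ?q (PB d B) B fst y2) = HI ?p (PP d B) (PB d B) ?f y1"
    unfolding y2(2) f_X[OF y2(1)] ..
  also have "\<dots> = HI ?p (PP d B) (PB d B) (?f \<circ> swp) (?X (?x u))"
    unfolding y1_def by (rule hom_induced_compose'[OF cont_swp _ cF]) auto
  also have "(?f \<circ> swp) = fst" by (auto simp: swp_def)
  also have "HI ?p (PP d B) (PB d B) fst (?X (?x u)) = \<one>\<^bsub>homology_group ?p (PB d B)\<^esub>" by (rule cross_proj)
  finally have "HI ?q (PB d B) B fst y2 = \<one>\<^bsub>homology_group ?q B\<^esub>"
    using cross_inj[OF d hom_induced_carrier] by blast
  then obtain u' where u': "u' \<in> carrier (homology_group q B)" "y2 = ?x u'"
    using cross_surj[OF y2(1)] by blast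
  have "HI ?p (PP d B) (PP d B) swp y1 = HI ?p (PP d B) (PP d B) (swp \<circ> swp) (?X (?x u))"
    unfolding y1_def by (rule hom_induced_compose'[OF cont_swp _ cont_swp]) auto
  also have "(swp \<circ> swp) = (id :: ('a \<times> (nat \<Rightarrow> real)) \<times> (nat \<Rightarrow> real) \<Rightarrow> _)" by (auto simp: swp_def)
  also have "HI ?p (PP d B) (PP d B) id (?X (?x u)) = ?X (?x u)" by (rule hom_induced_id[OF cross_carrier])
  finally show ?thesis using that[OF u'(1)] y2(2) u'(2) y1_def by metis
qed

lemma braid: "lam \<circ> (swp \<circ> lam) = swp \<circ> (lam \<circ> swp)"
  by (auto simp: lam_def swp_def fun_eq_iff)

lemma lam_b1: "lam \<circ> b1 d = b2 d \<circ> map_prod negv id"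
  by (auto simp: lam_def b1_def b2_def g1_def negv_def fun_eq_iff nrm_minus)

lemma lam_b2: "lam \<circ> b2 d = b1 d \<circ> map_prod negv id"
  by (auto simp: lam_def b1_def b2_def g1_def negv_def fun_eq_iff nrm_minus)

text \<open>If y is on a small sphere around v, then after renaming v is on a small sphere around y,
  in the opposite direction.\<close>

lemma swp_b2: "HI p (PP d B) (E2 d B) (swp \<circ> b2 d) = HI p (PP d B) (E2 d B) (b2 d \<circ> negv)"
proof (rule HI_line2)
  show "continuous_map (PP d B) (E2 d B) (swp \<circ> b2 d)" by (rule continuous_map_compose[OF cont_b(2) cont_swp_E2])
  show "continuous_map (PP d B) (E2 d B) (b2 d \<circ> negv)" by (rule continuous_map_compose[OF cont_negv cont_b(2)])
  fix z and t :: real assume z: "z \<in> topspace (PP d B)" and t: "0 \<le> t" "t \<le> 1"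
  have le: "\<bar>c\<bar> * (g1 d z * nrm d (snd z)) < nrm d (snd (fst z))" if "\<bar>c\<bar> \<le> 1" for c
  proof -
    have "\<bar>c\<bar> * (g1 d z * nrm d (snd z)) \<le> 1 * (g1 d z * nrm d (snd z))"
      using that PPd[OF z] by (intro mult_right_mono) auto
    then show ?thesis using PPd(5)[OF z] by simp
  qed
  have gn: "g1 d (negv z) = g1 d z" by (simp add: g1_def negv_def nrm_minus)
  have 1: "(\<lambda>i. 1 * snd (fst z) i + (c * g1 d z) * snd z i) \<noteq> (\<lambda>i. 0)" if "\<bar>c\<bar> \<le> 1" for c
    by (rule lin_nz[where d=d]) (use le[OF that] PPd(3)[OF z] in \<open>auto simp: abs_mult mult.assoc\<close>)
  have e1: "(1 - t) * snd (fst ((swp \<circ> b2 d) z)) i + t * snd (fst ((b2 d \<circ> negv) z)) i = 1 * snd (fst z) i + ((1 - t) * g1 d z) * snd z i" for i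
    by (simp add: swp_def b2_def gn) (simp add: negv_def algebra_simps)
  have e2: "(1 - t) * snd ((swp \<circ> b2 d) z) i + t * snd ((b2 d \<circ> negv) z) i = 1 * snd (fst z) i + (- t * g1 d z) * snd z i" for i
    by (simp add: swp_def b2_def gn) (simp add: negv_def algebra_simps)
  have e3: "(1 - t) * (snd ((swp \<circ> b2 d) z) i - snd (fst ((swp \<circ> b2 d) z)) i) + t * (snd ((b2 d \<circ> negv) z) i - snd (fst ((b2 d \<circ> negv) z)) i) = - g1 d z * snd z i" for i
    by (simp add: swp_def b2_def gn) (simp add: negv_def algebra_simps)
  show "(\<lambda>i. (1 - t) * snd (fst ((swp \<circ> b2 d) z)) i + t * snd (fst ((b2 d \<circ> negv) z)) i) \<noteq> (\<lambda>i. 0) \<and>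
        (\<lambda>i. (1 - t) * snd ((swp \<circ> b2 d) z) i + t * snd ((b2 d \<circ> negv) z) i) \<noteq> (\<lambda>i. 0) \<and>
        (\<lambda>i. (1 - t) * (snd ((swp \<circ> b2 d) z) i - snd (fst ((swp \<circ> b2 d) z)) i) + t * (snd ((b2 d \<circ> negv) z) i - snd (fst ((b2 d \<circ> negv) z)) i)) \<noteq> (\<lambda>i. 0)"
    unfolding e1 e2 e3 using 1[of "1 - t"] 1[of "- t"] scale_nz[of "- g1 d z" "snd z"] PPd[OF z] t by (intro conjI) auto
qed (simp add: swp_def b2_def negv_def)

text \<open>If y is close to 0 in comparison with v, then after renaming the last point runs over a
  sphere enclosing the other two, so that \<open>b0\<close> appears.\<close>

lemma swp_b1: "HI p (PP d B) (E2 d B) (swp \<circ> b1 d) = HI p (PP d B) (E2 d B) (b0 d \<circ> swp)"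
proof (rule HI_line2)
  show "continuous_map (PP d B) (E2 d B) (swp \<circ> b1 d)" by (rule continuous_map_compose[OF cont_b(1) cont_swp_E2])
  show "continuous_map (PP d B) (E2 d B) (b0 d \<circ> swp)" by (rule continuous_map_compose[OF cont_swp cont_b(3)])
  fix z and t :: real assume z: "z \<in> topspace (PP d B)" and t: "0 \<le> t" "t \<le> 1"
  define a where "a = g0 d (swp z)"
  have a: "a > 0" "a * nrm d (snd (fst z)) = nrm d (snd (fst z)) + nrm d (snd z)"
    using g0_mult[of d "swp z"] PPd(1,2)[OF z] by (auto simp: a_def swp_def g0_def add_pos_pos)
  let ?v = "snd (fst z)" and ?w = "snd z"
  have c1: "(1 - t) * g1 d z + t > 0" and c2: "(1 - t) + t * a > 0"
    using t PPd(3)[OF z] a by (cases "t = 1"; auto intro: add_pos_nonneg)+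
  have "((1 - t) * g1 d z + t) * nrm d ?w = (1 - t) * (g1 d z * nrm d ?w) + t * nrm d ?w" by (simp add: algebra_simps)
  also have "\<dots> < nrm d ?v + t * nrm d ?w"
  proof -
    have "(1 - t) * (g1 d z * nrm d ?w) \<le> 1 * (g1 d z * nrm d ?w)"
      using t PPd[OF z] by (intro mult_right_mono) auto
    then show ?thesis using PPd(5)[OF z] by simp
  qed
  also have "\<dots> = ((1 - t) + t * a) * nrm d ?v"
    using a(2) by (simp add: distrib_right mult.assoc) (simp add: algebra_simps)
  finally have lt: "((1 - t) * g1 d z + t) * nrm d ?w < ((1 - t) + t * a) * nrm d ?v" .
  have e1: "(1 - t) * snd (fst ((swp \<circ> b1 d) z)) i + t * snd (fst ((b0 d \<circ> swp) z)) i = ((1 - t) * g1 d z + t) * ?w i" for i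
    by (simp add: b1_def b0_def a_def[symmetric]) (simp add: swp_def algebra_simps)
  have e2: "(1 - t) * snd ((swp \<circ> b1 d) z) i + t * snd ((b0 d \<circ> swp) z) i = ((1 - t) + t * a) * ?v i" for i
    by (simp add: b1_def b0_def a_def[symmetric]) (simp add: swp_def algebra_simps)
  have e3: "(1 - t) * (snd ((swp \<circ> b1 d) z) i - snd (fst ((swp \<circ> b1 d) z)) i) + t * (snd ((b0 d \<circ> swp) z) i - snd (fst ((b0 d \<circ> swp) z)) i) = ((1 - t) + t * a) * ?v i + (- ((1 - t) * g1 d z + t)) * ?w i" for i
    by (simp add: b1_def b0_def a_def[symmetric]) (simp add: swp_def algebra_simps)
  have "(\<lambda>i. ((1 - t) + t * a) * ?v i + (- ((1 - t) * g1 d z + t)) * ?w i) \<noteq> (\<lambda>i. 0)"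
    by (rule lin_nz[where d=d], simp only: abs_minus_cancel abs_of_pos[OF c1] abs_of_pos[OF c2]) (use lt in linarith)
  then show "(\<lambda>i. (1 - t) * snd (fst ((swp \<circ> b1 d) z)) i + t * snd (fst ((b0 d \<circ> swp) z)) i) \<noteq> (\<lambda>i. 0) \<and>
        (\<lambda>i. (1 - t) * snd ((swp \<circ> b1 d) z) i + t * snd ((b0 d \<circ> swp) z) i) \<noteq> (\<lambda>i. 0) \<and>
        (\<lambda>i. (1 - t) * (snd ((swp \<circ> b1 d) z) i - snd (fst ((swp \<circ> b1 d) z)) i) + t * (snd ((b0 d \<circ> swp) z) i - snd (fst ((b0 d \<circ> swp) z)) i)) \<noteq> (\<lambda>i. 0)"
    unfolding e1 e2 e3 using scale_nz[of _ ?w] scale_nz[of _ ?v] c1 c2 PPd(1,2)[OF z] by (intro conjI) auto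
qed (simp add: swp_def b1_def b0_def)

section \<open>The sign of the swap and the Jacobi relation\<close>

text \<open>Double sphere class in which v runs around 0 and y runs around 0 closer in; in
  \<open>T2\<close> the point y runs around v instead.\<close>

definition T1 where "T1 q u = HI (q + int d - 1 + int d - 1) (PP d B) (E2 d B) (b1 d) (cross d (PB d B) (q + int d - 1) (cross d B q u))"
definition T2 where "T2 q u = HI (q + int d - 1 + int d - 1) (PP d B) (E2 d B) (b2 d) (cross d (PB d B) (q + int d - 1) (cross d B q u))"

context
  fixes q :: int
  assumes ev: "even d" and dpos: "d > 0"
begin

abbreviation (input) dd :: int where "dd \<equiv> q + int d - 1 + int d - 1"
abbreviation (input) XX where "XX u \<equiv> cross d (PB d B) (q + int d - 1) (cross d B q u)"

lemma neg_XX: "HI dd (PP d B) (PP d B) (map_prod negv id) (XX u) = XX u"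
  unfolding cross_natural[OF cont_negv cross_carrier] cross_negv_even[OF ev] ..

lemma lam_T1: "HI dd (E2 d B) (E2 d B) lam (T1 q u) = T2 q u"
proof -
  have "HI dd (E2 d B) (E2 d B) lam (T1 q u) = HI dd (PP d B) (E2 d B) (lam \<circ> b1 d) (XX u)"
    unfolding T1_def by (rule hom_induced_compose'[OF cont_b(1) _ cont_lam]) auto
  also have "\<dots> = HI dd (PP d B) (E2 d B) (b2 d) (HI dd (PP d B) (PP d B) (map_prod negv id) (XX u))"
    unfolding lam_b1 by (rule hom_induced_compose'[symmetric, OF cont_negP _ cont_b(2)]) auto
  finally show ?thesis unfolding neg_XX T2_def .
qed

lemma lam_T2: "HI dd (E2 d B) (E2 d B) lam (T2 q u) = T1 q u"
proof -
  have "HI dd (E2 d B) (E2 d B) lam (T2 q u) = HI dd (PP d B) (E2 d B) (lam \<circ> b2 d) (XX u)"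
    unfolding T2_def by (rule hom_induced_compose'[OF cont_b(2) _ cont_lam]) auto
  also have "\<dots> = HI dd (PP d B) (E2 d B) (b1 d) (HI dd (PP d B) (PP d B) (map_prod negv id) (XX u))"
    unfolding lam_b2 by (rule hom_induced_compose'[symmetric, OF cont_negP _ cont_b(1)]) auto
  finally show ?thesis unfolding neg_XX T1_def .
qed

lemma swp_T2: "HI dd (E2 d B) (E2 d B) swp (T2 q u) = T2 q u"
proof -
  have "HI dd (E2 d B) (E2 d B) swp (T2 q u) = HI dd (PP d B) (E2 d B) (swp \<circ> b2 d) (XX u)"
    unfolding T2_def by (rule hom_induced_compose'[OF cont_b(2) _ cont_swp_E2]) auto
  also have "\<dots> = HI dd (PP d B) (E2 d B) (b2 d) (HI dd (PP d B) (PP d B) negv (XX u))"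
    unfolding swp_b2 by (rule hom_induced_compose'[symmetric, OF cont_negv _ cont_b(2)]) auto
  finally show ?thesis unfolding cross_negv_even[OF ev] T2_def .
qed

lemma swp_T1:
  assumes "HI dd (PP d B) (PP d B) swp (XX u) = XX u'"
  shows "HI dd (E2 d B) (E2 d B) swp (T1 q u) = T1 q u' \<otimes>\<^bsub>homology_group dd (E2 d B)\<^esub> T2 q u'"
proof -
  have "HI dd (E2 d B) (E2 d B) swp (T1 q u) = HI dd (PP d B) (E2 d B) (swp \<circ> b1 d) (XX u)"
    unfolding T1_def by (rule hom_induced_compose'[OF cont_b(1) _ cont_swp_E2]) auto
  also have "\<dots> = HI dd (PP d B) (E2 d B) (b0 d) (HI dd (PP d B) (PP d B) swp (XX u))"
    unfolding swp_b1 by (rule hom_induced_compose'[symmetric, OF cont_swp _ cont_b(3)]) auto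
  finally show ?thesis unfolding assms big_sphere[OF dpos] T1_def T2_def .
qed

lemma T_carrier: "T1 q u \<in> carrier (homology_group dd (E2 d B))" "T2 q u \<in> carrier (homology_group dd (E2 d B))"
  unfolding T1_def T2_def by (rule hom_induced_carrier)+

lemma XX_hom: "(\<lambda>u. XX u) \<in> hom (homology_group q B) (homology_group dd (PP d B))"
  using hom_compose[OF cross_hom[of d B q] cross_hom[of d "PB d B" "q + int d - 1"]] unfolding o_def .

text \<open>\<open>lam\<close> and \<open>swp\<close> transpose pairs of the three points, so they satisfy the braid relation;
  applied to the class \<open>T1 u\<close> it forces the sign of the swap for even d.\<close>

lemma cross_swap:
  assumes u: "u \<in> carrier (homology_group q B)"
  shows "HI dd (PP d B) (PP d B) swp (XX u) = XX (inv\<^bsub>homology_group q B\<^esub> u)"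
proof -
  let ?G = "homology_group dd (E2 d B)" and ?H = "homology_group q B" and ?K = "homology_group dd (PP d B)"
  let ?l = "HI dd (E2 d B) (E2 d B) lam" and ?s = "HI dd (E2 d B) (E2 d B) swp"
  interpret G: comm_group ?G by simp
  interpret H: comm_group ?H by simp
  interpret K: comm_group ?K by simp
  interpret s: group_hom ?G ?G ?s by (rule hom_induced_group_hom)
  interpret l: group_hom ?G ?G ?l by (rule hom_induced_group_hom)
  interpret j: group_hom ?G ?K "HI dd (E2 d B) (PP d B) jm" by (rule hom_induced_group_hom)
  obtain u' where u': "u' \<in> carrier ?H" "HI dd (PP d B) (PP d B) swp (XX u) = XX u'" "HI dd (PP d B) (PP d B) swp (XX u') = XX u"
    using swap_exists[OF dpos u] by blast
  have cmp: "HI dd (E2 d B) (E2 d B) f (HI dd (E2 d B) (E2 d B) g y) = HI dd (E2 d B) (E2 d B) (f \<circ> g) y"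
    if "continuous_map (E2 d B) (E2 d B) g" "continuous_map (E2 d B) (E2 d B) f" for f g y
    by (rule hom_induced_compose'[OF that(1) _ that(2)]) auto
  note c2 = continuous_map_compose[OF cont_lam cont_swp_E2] continuous_map_compose[OF cont_swp_E2 cont_lam]
  \<comment> \<open>One side of the braid relation collapses to \<open>T1 q u\<close>, the other to
    the sum of \<open>T2 q u'\<close>, \<open>T1 q u\<close> and \<open>T2 q u\<close>. Cancelling
    \<open>T1 q u\<close> leaves a relation between u and u' alone, which \<open>jm\<close> and
    injectivity of the sphere classes transfer to B.\<close>
  have "?l (?s (?l (T1 q u))) = HI dd (E2 d B) (E2 d B) (lam \<circ> (swp \<circ> lam)) (T1 q u)"
    by (simp only: cmp cont_lam cont_swp_E2 c2)
  also have "\<dots> = ?s (?l (?s (T1 q u)))"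
    unfolding braid by (simp only: cmp cont_lam cont_swp_E2 c2)
  also have "\<dots> = T2 q u' \<otimes>\<^bsub>?G\<^esub> (T1 q u \<otimes>\<^bsub>?G\<^esub> T2 q u)"
    unfolding swp_T1[OF u'(2)] by (simp only: T_carrier l.hom_mult s.hom_mult lam_T1 lam_T2 swp_T2 swp_T1[OF u'(3)])
  finally have "T1 q u = T2 q u' \<otimes>\<^bsub>?G\<^esub> (T1 q u \<otimes>\<^bsub>?G\<^esub> T2 q u)"
    unfolding lam_T1 lam_T2 swp_T2 .
  then have "T1 q u \<otimes>\<^bsub>?G\<^esub> (T2 q u' \<otimes>\<^bsub>?G\<^esub> T2 q u) = T1 q u"
    using G.m_lcomm[OF T_carrier(1) T_carrier(2) T_carrier(2)] by metis
  then have 1: "T2 q u' \<otimes>\<^bsub>?G\<^esub> T2 q u = \<one>\<^bsub>?G\<^esub>"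
    by (meson G.l_cancel_one' G.m_closed G.r_cancel_one T_carrier G.l_cancel_one)
  have j2: "HI dd (E2 d B) (PP d B) jm (T2 q v) = XX v" for v
  proof -
    have "HI dd (E2 d B) (PP d B) jm (T2 q v) = HI dd (PP d B) (PP d B) (jm \<circ> b2 d) (XX v)"
      unfolding T2_def by (rule hom_induced_compose'[OF cont_b(2) _ cont_jm]) auto
    then show ?thesis unfolding proj_compositions using hom_induced_id[OF cross2_carrier] by simp
  qed
  have "XX u' \<otimes>\<^bsub>?K\<^esub> XX u = \<one>\<^bsub>?K\<^esub>"
    using arg_cong[OF 1, of "HI dd (E2 d B) (PP d B) jm"] unfolding j.hom_mult[OF T_carrier(2) T_carrier(2)] j2 j.hom_one .
  then have "XX (u' \<otimes>\<^bsub>?H\<^esub> u) = \<one>\<^bsub>?K\<^esub>"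
    using hom_mult[OF XX_hom u'(1) u] by simp
  then have "u' \<otimes>\<^bsub>?H\<^esub> u = \<one>\<^bsub>?H\<^esub>"
    using cross_inj[OF dpos cross_carrier] cross_inj[OF dpos] u u'(1) by (metis H.m_closed)
  then have "u' = inv\<^bsub>?H\<^esub> u" using u u'(1) H.inv_equality by metis
  then show ?thesis using u'(2) by simp
qed

text \<open>Invariance under \<open>lam\<close> gives the same value x on \<open>T1 q u\<close> and
  \<open>T2 q u\<close>. Invariance under \<open>swp\<close>, with the sign from
  \<open>cross_swap\<close>, gives x = -2x. Hence 3x = 0 in the rationals.\<close>

lemma jacobi_functional:
  fixes \<phi> :: "(('a \<times> (nat \<Rightarrow> real)) \<times> (nat \<Rightarrow> real)) chain set \<Rightarrow> rat"
  assumes add: "\<And>a b. a \<in> carrier (homology_group dd (E2 d B)) \<Longrightarrow> b \<in> carrier (homology_group dd (E2 d B)) \<Longrightarrow>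
      \<phi> (a \<otimes>\<^bsub>homology_group dd (E2 d B)\<^esub> b) = \<phi> a + \<phi> b"
    and l: "\<And>a. a \<in> carrier (homology_group dd (E2 d B)) \<Longrightarrow> \<phi> (HI dd (E2 d B) (E2 d B) lam a) = \<phi> a"
    and s: "\<And>a. a \<in> carrier (homology_group dd (E2 d B)) \<Longrightarrow> \<phi> (HI dd (E2 d B) (E2 d B) swp a) = \<phi> a"
    and u: "u \<in> carrier (homology_group q B)"
  shows "\<phi> (T2 q u) = 0"
proof -
  let ?G = "homology_group dd (E2 d B)" and ?H = "homology_group q B"
  interpret G: comm_group ?G by simp
  interpret H: comm_group ?H by simp
  have T12: "\<phi> (T1 q v) = \<phi> (T2 q v)" for v using l[OF T_carrier(1), of v] unfolding lam_T1 by simp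
  have "\<phi> \<one>\<^bsub>?G\<^esub> = 0" using add[OF G.one_closed G.one_closed] unfolding G.l_one[OF G.one_closed] by linarith
  moreover have T2h: "T2 q (a \<otimes>\<^bsub>?H\<^esub> b) = T2 q a \<otimes>\<^bsub>?G\<^esub> T2 q b" if "a \<in> carrier ?H" "b \<in> carrier ?H" for a b
    unfolding T2_def hom_mult[OF XX_hom that] by (rule hom_induced_mult) (rule cross_carrier)+
  have "T2 q \<one>\<^bsub>?H\<^esub> = \<one>\<^bsub>?G\<^esub>" using T2h[OF H.one_closed H.one_closed] T_carrier(2) by (metis G.l_cancel_one' H.one_closed H.r_one)
  ultimately have inv: "\<phi> (T2 q (inv\<^bsub>?H\<^esub> u)) = - \<phi> (T2 q u)"
    using T2h[OF H.inv_closed[OF u] u] add[OF T_carrier(2) T_carrier(2), of "inv\<^bsub>?H\<^esub> u" u] H.l_inv[OF u] by simp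
  have "\<phi> (T1 q u) = \<phi> (HI dd (E2 d B) (E2 d B) swp (T1 q u))" using s[OF T_carrier(1)] by simp
  also have "\<dots> = \<phi> (T1 q (inv\<^bsub>?H\<^esub> u)) + \<phi> (T2 q (inv\<^bsub>?H\<^esub> u))"
    unfolding swp_T1[OF cross_swap[OF u]] by (rule add[OF T_carrier])
  finally show ?thesis unfolding T12 inv by simp
qed

end

end

section \<open>Configuration spaces\<close>

text \<open>The labels form an arbitrary set instead of an initial segment, so that any single point
  can be added, removed or renamed without renumbering the others.\<close>

definition conf :: "nat \<Rightarrow> nat set \<Rightarrow> (nat \<Rightarrow> nat \<Rightarrow> real) topology" where
  "conf d S = subtopology (product_topology (\<lambda>i. Euclidean_space d) S) {x. inj_on x S}"

lemma continuous_map_conf: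
  "continuous_map Z (conf d S) f \<longleftrightarrow> (\<forall>i\<in>S. continuous_map Z (Euclidean_space d) (\<lambda>z. f z i)) \<and>
     (\<forall>z\<in>topspace Z. f z \<in> extensional S \<and> inj_on (f z) S)"
  by (auto simp: conf_def continuous_map_in_subtopology continuous_map_componentwise Pi_iff)

lemma topspace_confD:
  assumes "x \<in> topspace (conf d S)"
  shows "i \<in> S \<Longrightarrow> m \<ge> d \<Longrightarrow> x i m = 0" "x \<in> extensional S" "inj_on x S"
proof -
  have x: "x \<in> PiE S (\<lambda>i. topspace (Euclidean_space d))" "inj_on x S" using assms by (auto simp: conf_def)
  show "i \<in> S \<Longrightarrow> m \<ge> d \<Longrightarrow> x i m = 0" using x(1) by (auto simp: PiE_def Pi_iff topspace_Euclidean_space)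
  show "x \<in> extensional S" "inj_on x S" using x by (auto simp: PiE_def)
qed

lemma cont_conf_coord: "i \<in> S \<Longrightarrow> continuous_map (conf d S) (Euclidean_space d) (\<lambda>x. x i)"
  using continuous_map_id[of "conf d S"] unfolding continuous_map_conf by simp

lemma conf_nrm_pos:
  assumes "x \<in> topspace (conf d S)" "i \<in> S" "j \<in> S" "i \<noteq> j"
  shows "nrm d (\<lambda>m. x i m - x j m) > 0"
proof (rule nrm_pos)
  have "x i \<noteq> x j" using topspace_confD(3)[OF assms(1)] assms(2-) by (auto dest: inj_onD)
  then show "(\<lambda>m. x i m - x j m) \<noteq> (\<lambda>i. 0)" by (auto simp: fun_eq_iff)
  show "\<forall>m\<ge>d. x i m - x j m = 0" using topspace_confD(1)[OF assms(1)] assms by simp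
qed

text \<open>For nonzero vectors this says that they do not point in opposite directions.\<close>

definition nonopp :: "(nat \<Rightarrow> real) \<Rightarrow> (nat \<Rightarrow> real) \<Rightarrow> bool"
  where "nonopp p q \<longleftrightarrow> (\<forall>t. 0 \<le> t \<and> t \<le> 1 \<longrightarrow> (\<lambda>m. (1 - t) * p m + t * q m) \<noteq> (\<lambda>m. 0))"

text \<open>The balls around a e of radius a |e|, for all a > 0, together form a cone that misses 0
  and is convex by the triangle inequality; both vectors lie in it.\<close>

lemma nonopp_near:
  assumes "a > 0" "b > 0" "nrm d (\<lambda>m. p m - a * e m) < a * nrm d e" "nrm d (\<lambda>m. q m - b * e m) < b * nrm d e"
  shows "nonopp p q"
  unfolding nonopp_def
proof (intro allI impI notI)
  fix t :: real assume t: "0 \<le> t \<and> t \<le> 1" and z: "(\<lambda>m. (1 - t) * p m + t * q m) = (\<lambda>m. 0)"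
  let ?c = "(1 - t) * a + t * b"
  have c: "?c > 0" using t assms by (cases "t = 1") (auto intro: add_pos_nonneg)
  have e: "(1 - t) * (p m - a * e m) + t * (q m - b * e m) = - ?c * e m" for m
    using fun_cong[OF z, of m] by (simp add: algebra_simps)
  have "?c * nrm d e = nrm d (\<lambda>m. - ?c * e m)" using c by (simp only: nrm_scale abs_minus_cancel abs_of_pos)
  also have "\<dots> \<le> nrm d (\<lambda>m. (1 - t) * (p m - a * e m)) + nrm d (\<lambda>m. t * (q m - b * e m))"
    unfolding e[symmetric] by (rule nrm_triangle)
  also have "\<dots> = (1 - t) * nrm d (\<lambda>m. p m - a * e m) + t * nrm d (\<lambda>m. q m - b * e m)" using t by (simp add: nrm_scale)
  also have "\<dots> < (1 - t) * (a * nrm d e) + t * (b * nrm d e)"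
  proof (cases "t = 0")
    case False
    then have "t * nrm d (\<lambda>m. q m - b * e m) < t * (b * nrm d e)" using t assms by simp
    moreover have "(1 - t) * nrm d (\<lambda>m. p m - a * e m) \<le> (1 - t) * (a * nrm d e)" using t assms by (intro mult_left_mono) auto
    ultimately show ?thesis by linarith
  qed (use assms in simp)
  finally show False by (simp add: algebra_simps)
qed

lemma nonopp_near1:
  "nrm d (\<lambda>m. p m - e m) < nrm d e \<Longrightarrow> nrm d (\<lambda>m. q m - e m) < nrm d e \<Longrightarrow> nonopp p q"
  using nonopp_near[of 1 1 d p e q] by simp

lemma nonopp_coord: "p m > 0 \<Longrightarrow> q m > 0 \<Longrightarrow> nonopp p q"
  unfolding nonopp_def
proof (intro allI impI notI)
  fix t :: real assume a: "p m > 0" "q m > 0" and t: "0 \<le> t \<and> t \<le> 1" and z: "(\<lambda>m. (1 - t) * p m + t * q m) = (\<lambda>m. 0)"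
  have "(1 - t) * p m + t * q m > 0" using t a by (cases "t = 1") (auto intro: add_pos_nonneg)
  then show False using fun_cong[OF z, of m] by simp
qed

lemma nonopp_scale: "r > 0 \<Longrightarrow> s > 0 \<Longrightarrow> nrm d e > 0 \<Longrightarrow> (\<And>m. p m = r * e m) \<Longrightarrow> (\<And>m. q m = s * e m) \<Longrightarrow> nonopp p q"
  by (rule nonopp_near[of r s d p e q]) (auto simp: nrm_def[of d "\<lambda>m. 0"])

lemma nonopp_commute: "nonopp (\<lambda>m. a m - b m) (\<lambda>m. a' m - b' m) \<Longrightarrow> nonopp (\<lambda>m. b m - a m) (\<lambda>m. b' m - a' m)"
  unfolding nonopp_def
proof (intro allI impI notI)
  fix t :: real assume h: "\<forall>t. 0 \<le> t \<and> t \<le> 1 \<longrightarrow> (\<lambda>m. (1 - t) * (a m - b m) + t * (a' m - b' m)) \<noteq> (\<lambda>m. 0)"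
    and t: "0 \<le> t \<and> t \<le> 1" and z: "(\<lambda>m. (1 - t) * (b m - a m) + t * (b' m - a' m)) = (\<lambda>m. 0)"
  have "(1 - t) * (a m - b m) + t * (a' m - b' m) = 0" for m using fun_cong[OF z, of m] by (simp add: algebra_simps)
  then show False using h t by blast
qed

text \<open>The second alternative is for two points that both stand still; their distinctness then
  comes from the configuration itself and needs no estimate.\<close>

definition okp :: "(nat \<Rightarrow> nat \<Rightarrow> real) \<Rightarrow> (nat \<Rightarrow> nat \<Rightarrow> real) \<Rightarrow> nat \<Rightarrow> nat \<Rightarrow> bool"
  where "okp f g i j \<longleftrightarrow> nonopp (\<lambda>m. f i m - f j m) (\<lambda>m. g i m - g j m) \<or> (f i = g i \<and> f j = g j)"

lemma okp_sym: "okp f g i j \<Longrightarrow> okp f g j i"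
  unfolding okp_def using nonopp_commute by blast

lemma okp1: "nonopp (\<lambda>m. f i m - f j m) (\<lambda>m. g i m - g j m) \<Longrightarrow> okp f g i j"
  unfolding okp_def by blast

lemma okp3: "f i = g i \<Longrightarrow> f j = g j \<Longrightarrow> okp f g i j"
  unfolding okp_def by blast

lemma okp_insert1:
  assumes "k \<in> insert a S" "l \<in> insert a S" "k \<noteq> l" "\<And>b c. b \<in> S \<Longrightarrow> c \<in> S \<Longrightarrow> b \<noteq> c \<Longrightarrow> okp f g b c" "\<And>b. b \<in> S \<Longrightarrow> okp f g a b"
  shows "okp f g k l"
  using assms okp_sym[of f g] by blast

lemma okp_insert2:
  assumes "k \<in> insert a (insert b S)" "l \<in> insert a (insert b S)" "k \<noteq> l" "\<And>b c. b \<in> S \<Longrightarrow> c \<in> S \<Longrightarrow> b \<noteq> c \<Longrightarrow> okp f g b c"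
    "\<And>i. i \<in> S \<Longrightarrow> okp f g a i" "\<And>i. i \<in> S \<Longrightarrow> okp f g b i" "okp f g a b"
  shows "okp f g k l"
  using assms okp_sym[of f g] by blast

lemma okp_insert3:
  assumes "k \<in> insert a (insert b (insert c S))" "l \<in> insert a (insert b (insert c S))" "k \<noteq> l" "\<And>b c. b \<in> S \<Longrightarrow> c \<in> S \<Longrightarrow> b \<noteq> c \<Longrightarrow> okp f g b c"
    "\<And>i. i \<in> S \<Longrightarrow> okp f g a i" "\<And>i. i \<in> S \<Longrightarrow> okp f g b i"  "\<And>i. i \<in> S \<Longrightarrow> okp f g c i" "okp f g a b" "okp f g a c" "okp f g b c"
  shows "okp f g k l"
proof (rule okp_insert1[OF assms(1-3)])
  show "okp f g i j" if "i \<in> insert b (insert c S)" "j \<in> insert b (insert c S)" "i \<noteq> j" for i j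
    by (rule okp_insert2[OF that]) (use assms in auto)
qed (use assms in auto)

text \<open>Along a straight-line homotopy the difference of two points runs along the segment
  between its end values, so collisions can be excluded pair by pair.\<close>

lemma HI_conf:
  assumes f: "continuous_map Z (conf d T) f" and g: "continuous_map Z (conf d T) g"
    and ok: "\<And>z i j. z \<in> topspace Z \<Longrightarrow> i \<in> T \<Longrightarrow> j \<in> T \<Longrightarrow> i \<noteq> j \<Longrightarrow> okp (f z) (g z) i j"
  shows "HI p Z (conf d T) f = HI p Z (conf d T) g"
proof (rule homology_homotopy_empty)
  let ?h = "\<lambda>(t::real,z). \<lambda>i. if i \<in> T then (\<lambda>m. (1 - t) * f z i m + t * g z i m) else undefined"
  note F = f[unfolded continuous_map_conf] and G = g[unfolded continuous_map_conf]
  have ne: "(\<lambda>m. (1 - t) * f z i m + t * g z i m) \<noteq> (\<lambda>m. (1 - t) * f z j m + t * g z j m)"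
    if z: "z \<in> topspace Z" and t: "0 \<le> t" "t \<le> 1" and ij: "i \<in> T" "j \<in> T" "i \<noteq> j" for t z i j
  proof
    assume e: "(\<lambda>m. (1 - t) * f z i m + t * g z i m) = (\<lambda>m. (1 - t) * f z j m + t * g z j m)"
    show False
    proof (cases "f z i = g z i \<and> f z j = g z j")
      case True
      then have "f z i = f z j" using e by (simp add: fun_eq_iff algebra_simps)
      then show False using F z ij by (auto dest: inj_onD)
    next
      case False
      then have "nonopp (\<lambda>m. f z i m - f z j m) (\<lambda>m. g z i m - g z j m)"
        using ok[OF z ij] False unfolding okp_def by blast
      moreover have "(1 - t) * (f z i m - f z j m) + t * (g z i m - g z j m) = 0" for m
        using fun_cong[OF e, of m] by (simp add: algebra_simps)
      ultimately show False using t by (auto simp: nonopp_def)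
    qed
  qed
  have "continuous_map (prod_topology (top_of_set {0..1}) Z) (conf d T) ?h"
    unfolding continuous_map_conf case_prod_unfold
  proof (intro conjI ballI)
    fix i assume i: "i \<in> T"
    show "continuous_map (prod_topology (top_of_set {0..1}) Z) (Euclidean_space d) (\<lambda>z. if i \<in> T then (\<lambda>m. (1 - fst z) * f (snd z) i m + fst z * g (snd z) i m) else undefined)"
      using continuous_map_Euclidean_comb[of Z d "\<lambda>z. f z i" "\<lambda>z. g z i"] F G i by (simp add: case_prod_unfold)
  next
    fix z assume z: "z \<in> topspace (prod_topology (top_of_set {0..1::real}) Z)"
    show "inj_on (\<lambda>i. if i \<in> T then (\<lambda>m. (1 - fst z) * f (snd z) i m + fst z * g (snd z) i m) else undefined) T"
    proof (rule inj_onI, rule ccontr)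
      fix i j assume "i \<in> T" "j \<in> T" "i \<noteq> j" and "(if i \<in> T then (\<lambda>m. (1 - fst z) * f (snd z) i m + fst z * g (snd z) i m) else undefined) =
        (if j \<in> T then (\<lambda>m. (1 - fst z) * f (snd z) j m + fst z * g (snd z) j m) else undefined)"
      then show False using ne[of "snd z" "fst z" i j] z by auto
    qed
  qed (auto simp: extensional_def)
  moreover have "?h (0, z) = f z" "?h (1, z) = g z" if "z \<in> topspace Z" for z
    using F G that by (auto simp: extensional_def fun_eq_iff)
  ultimately show "homotopic_with (\<lambda>x. True) Z (conf d T) f g"
    by (subst homotopic_with, simp, intro exI[of _ ?h]) auto
qed

text \<open>Contravariant in \<sigma>. A permutation relabels, and an injection that is not onto
  also forgets the points outside its image.\<close>

definition ren :: "(nat \<Rightarrow> nat) \<Rightarrow> nat set \<Rightarrow> (nat \<Rightarrow> nat \<Rightarrow> real) \<Rightarrow> (nat \<Rightarrow> nat \<Rightarrow> real)"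
  where "ren \<sigma> S x = restrict (x \<circ> \<sigma>) S"

lemma cont_ren: "inj_on \<sigma> S' \<Longrightarrow> \<sigma> ` S' \<subseteq> S \<Longrightarrow> continuous_map (conf d S) (conf d S') (ren \<sigma> S')"
  unfolding continuous_map_conf ren_def
proof (intro conjI ballI)
  assume s: "inj_on \<sigma> S'" "\<sigma> ` S' \<subseteq> S"
  show "continuous_map (conf d S) (Euclidean_space d) (\<lambda>z. restrict (z \<circ> \<sigma>) S' i)" if "i \<in> S'" for i
    using cont_conf_coord[of "\<sigma> i" S d] that s by (auto simp: image_subset_iff)
  show "inj_on (restrict (x \<circ> \<sigma>) S') S'" if "x \<in> topspace (conf d S)" for x
    using topspace_confD(3)[OF that] s by (auto simp: inj_on_def image_subset_iff)
qed auto

section \<open>Far points and orbiting points\<close>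

text \<open>The sum dominates every single 0-coordinate, so the new point lies at least 1 beyond all
  the others. The margin 1 is what absorbs a small orbit in \<open>oH_sH\<close>.\<close>

definition far :: "nat set \<Rightarrow> (nat \<Rightarrow> nat \<Rightarrow> real) \<Rightarrow> nat \<Rightarrow> real"
  where "far S x = (\<lambda>m. if m = 0 then 1 + (\<Sum>b\<in>S. \<bar>x b 0\<bar>) else 0)"

text \<open>\<open>addfar\<close> inserts a new point a far out on the axis of coordinate 0; \<open>orb\<close> below inserts it close
  to the point j, in the direction of the second component of z.\<close>

definition addfar :: "nat \<Rightarrow> nat set \<Rightarrow> (nat \<Rightarrow> nat \<Rightarrow> real) \<Rightarrow> nat \<Rightarrow> nat \<Rightarrow> real"
  where "addfar a S x = x(a := far S x)"

lemma far_gt: "finite S \<Longrightarrow> b \<in> S \<Longrightarrow> far S x 0 \<ge> x b 0 + 1"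
proof -
  assume "finite S" "b \<in> S"
  then have "\<bar>x b 0\<bar> \<le> (\<Sum>b\<in>S. \<bar>x b 0\<bar>)" by (intro member_le_sum) auto
  then show ?thesis by (auto simp: far_def)
qed

lemma cont_far:
  assumes "finite S" "d > 0"
  shows "continuous_map (conf d S) (Euclidean_space d) (far S)"
  unfolding continuous_map_Euclidean_iff
proof (intro conjI allI impI ballI)
  fix i
  show "continuous_map (conf d S) euclideanreal (\<lambda>z. far S z i)"
    unfolding far_def using assms(1) by (cases "i = 0")
     (auto intro!: continuous_intros continuous_map_sum continuous_map_Euclidean_coord[OF cont_conf_coord])
qed (use assms in \<open>auto simp: far_def\<close>)

lemma cont_addfar:
  assumes "finite S" "d > 0" "a \<notin> S"
  shows "continuous_map (conf d S) (conf d (insert a S)) (addfar a S)"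
  unfolding continuous_map_conf
proof (intro conjI ballI)
  show "continuous_map (conf d S) (Euclidean_space d) (\<lambda>z. addfar a S z i)" if "i \<in> insert a S" for i
    using that cont_far[OF assms(1,2)] cont_conf_coord[of i S d] by (cases "i = a") (auto simp: addfar_def)
  fix x assume x: "x \<in> topspace (conf d S)"
  show "addfar a S x \<in> extensional (insert a S)" using topspace_confD(2)[OF x] by (auto simp: addfar_def extensional_def)
  have ne: "far S x \<noteq> x b" if "b \<in> S" for b using far_gt[OF assms(1) that, of x] by auto
  show "inj_on (addfar a S x) (insert a S)"
    using topspace_confD(3)[OF x] ne assms(3) by (auto simp: addfar_def inj_on_def) metis+
qed

text \<open>A continuous lower bound for a third of the distance from point j to its nearest
  neighbour, with a sum of reciprocals in place of a minimum. The summand 1 handles the absence of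
  neighbours and keeps the value at most 1/3; the factor 3 leaves room for two displacements at
  once.\<close>

definition sep :: "nat \<Rightarrow> nat set \<Rightarrow> nat \<Rightarrow> (nat \<Rightarrow> nat \<Rightarrow> real) \<Rightarrow> real"
  where "sep d S j x = 1 / (3 * (1 + (\<Sum>b\<in>S - {j}. 1 / nrm d (\<lambda>m. x b m - x j m))))"

lemma inverse_one_plus_le: "1 / n \<le> s \<Longrightarrow> n > 0 \<Longrightarrow> s \<ge> 0 \<Longrightarrow> 1 / (1 + s) \<le> (n::real)"
  by (simp add: field_simps)

lemma sep_bounds:
  assumes S: "finite S" and x: "x \<in> topspace (conf d S)" and j: "j \<in> S"
  shows "sep d S j x > 0" "sep d S j x \<le> 1 / 3" "b \<in> S \<Longrightarrow> b \<noteq> j \<Longrightarrow> 3 * sep d S j x \<le> nrm d (\<lambda>m. x b m - x j m)"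
proof -
  let ?s = "\<Sum>b\<in>S - {j}. 1 / nrm d (\<lambda>m. x b m - x j m)"
  have s: "?s \<ge> 0" by (intro sum_nonneg divide_nonneg_nonneg nrm_nonneg) simp
  show "sep d S j x > 0" "sep d S j x \<le> 1 / 3" using s by (auto simp: sep_def divide_simps)
  assume b: "b \<in> S" "b \<noteq> j"
  let ?n = "nrm d (\<lambda>m. x b m - x j m)"
  have n: "?n > 0" by (rule conf_nrm_pos[OF x b(1) j b(2)])
  have "1 / ?n \<le> ?s" using b S by (intro member_le_sum) (auto intro: nrm_nonneg)
  moreover have "3 * sep d S j x = 1 / (1 + ?s)"
    unfolding sep_def by (rule trans[OF times_divide_eq_right]) (rule mult_divide_mult_cancel_left, simp)
  ultimately show "3 * sep d S j x \<le> ?n" using inverse_one_plus_le[OF _ n s] by metis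
qed

lemma cont_sep:
  assumes S: "finite S" and j: "j \<in> S"
  shows "continuous_map (conf d S) euclideanreal (sep d S j)"
proof -
  have "continuous_map (conf d S) euclideanreal (\<lambda>x. 1 / nrm d (\<lambda>m. x b m - x j m))" if b: "b \<in> S - {j}" for b
    using conf_nrm_pos[of _ d S b j] b j
    by (intro continuous_map_real_divide continuous_map_nrm continuous_map_Euclidean_space_diff cont_conf_coord) force+
  moreover have "3 * (1 + (\<Sum>b\<in>S - {j}. 1 / nrm d (\<lambda>m. x b m - x j m))) \<noteq> 0" for x
  proof -
    have "(\<Sum>b\<in>S - {j}. 1 / nrm d (\<lambda>m. x b m - x j m)) \<ge> 0" by (intro sum_nonneg divide_nonneg_nonneg nrm_nonneg) simp
    then show ?thesis by simp
  qed
  moreover have "continuous_map (conf d S) euclideanreal (\<lambda>x. \<Sum>b\<in>S - {j}. 1 / nrm d (\<lambda>m. x b m - x j m))"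
    using S calculation(1) by (intro continuous_map_sum) auto
  ultimately show ?thesis unfolding sep_def[abs_def] using S
    by (intro continuous_map_real_divide continuous_map_real_mult continuous_map_add) auto
qed

text \<open>Dividing by 1 plus the norm squeezes the entire fibre, its zero vector included, into
  the ball of radius \<open>sep d S j\<close>; this is the radius function fed to
  \<open>puncture_kernel\<close>.\<close>

definition rho :: "nat \<Rightarrow> nat set \<Rightarrow> nat \<Rightarrow> (nat \<Rightarrow> nat \<Rightarrow> real) \<times> (nat \<Rightarrow> real) \<Rightarrow> real"
  where "rho d S j z = sep d S j (fst z) / (1 + nrm d (snd z))"

definition orb :: "nat \<Rightarrow> nat set \<Rightarrow> nat \<Rightarrow> nat \<Rightarrow> (nat \<Rightarrow> nat \<Rightarrow> real) \<times> (nat \<Rightarrow> real) \<Rightarrow> nat \<Rightarrow> nat \<Rightarrow> real"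
  where "orb d S a j z = (fst z)(a := (\<lambda>m. fst z j m + rho d S j z * snd z m))"

lemma rho_bounds:
  assumes S: "finite S" and x: "fst z \<in> topspace (conf d S)" and j: "j \<in> S"
  shows "rho d S j z > 0" "rho d S j z * nrm d (snd z) < sep d S j (fst z)"
    "b \<in> S \<Longrightarrow> b \<noteq> j \<Longrightarrow> 3 * (rho d S j z * nrm d (snd z)) < nrm d (\<lambda>m. fst z b m - fst z j m)"
    "rho d S j z * nrm d (snd z) < 1 / 3"
proof -
  note s = sep_bounds[OF S x j]
  have n: "nrm d (snd z) \<ge> 0" by (rule nrm_nonneg)
  show "rho d S j z > 0" using s n by (simp add: rho_def)
  have "nrm d (snd z) / (1 + nrm d (snd z)) < 1" using n by simp
  then have "sep d S j (fst z) * (nrm d (snd z) / (1 + nrm d (snd z))) < sep d S j (fst z) * 1"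
    using s(1) by (intro mult_strict_left_mono)
  then show l: "rho d S j z * nrm d (snd z) < sep d S j (fst z)" by (simp add: rho_def)
  show "b \<in> S \<Longrightarrow> b \<noteq> j \<Longrightarrow> 3 * (rho d S j z * nrm d (snd z)) < nrm d (\<lambda>m. fst z b m - fst z j m)"
    using s(3)[of b] l by simp
  show "rho d S j z * nrm d (snd z) < 1 / 3" using s(2) l by simp
qed

lemma cont_rho:
  assumes S: "finite S" and j: "j \<in> S"
  shows "continuous_map (EB d (conf d S)) euclideanreal (rho d S j)"
proof -
  have "1 + nrm d v \<noteq> 0" for v using nrm_nonneg[of d v] by simp
  then show ?thesis unfolding rho_def[abs_def]
    using continuous_map_compose[OF continuous_map_fst cont_sep[OF S j]]
    by (intro continuous_map_real_divide continuous_map_add continuous_map_nrm continuous_map_snd) (auto simp: o_def)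
qed

lemma PB_D:
  assumes "z \<in> topspace (PB d B)"
  shows "fst z \<in> topspace B" "nrm d (snd z) > 0" "\<And>i. i \<ge> d \<Longrightarrow> snd z i = 0"
  using assms by (auto intro!: nrm_pos simp: nz_def topspace_Euclidean_space)

lemma orb_ne:
  assumes S: "finite S" and x: "fst z \<in> topspace (conf d S)" and v: "nrm d (snd z) > 0" and j: "j \<in> S" and b: "b \<in> S"
  shows "(\<lambda>m. fst z j m + rho d S j z * snd z m) \<noteq> fst z b"
proof
  assume e: "(\<lambda>m. fst z j m + rho d S j z * snd z m) = fst z b"
  then have "fst z b m - fst z j m = rho d S j z * snd z m" for m by (metis add_diff_cancel_left')
  then have "nrm d (\<lambda>m. fst z b m - fst z j m) = rho d S j z * nrm d (snd z)"
    using rho_bounds(1)[OF S x j] by (simp add: nrm_scale)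
  moreover have "rho d S j z * nrm d (snd z) > 0" using rho_bounds(1)[OF S x j] v by simp
  ultimately show False
  proof (cases "b = j")
    case False
    show False using rho_bounds(3)[OF S x j b False] \<open>nrm d (\<lambda>m. fst z b m - fst z j m) = _\<close> \<open>rho d S j z * nrm d (snd z) > 0\<close> by linarith
  qed (auto simp: nrm_def[of d "\<lambda>m. 0"])
qed

lemma cont_orb:
  assumes "finite S" "a \<notin> S" "j \<in> S"
  shows "continuous_map (PB d (conf d S)) (conf d (insert a S)) (orb d S a j)"
  unfolding continuous_map_conf
proof (intro conjI ballI)
  have cf: "continuous_map (PB d (conf d S)) (Euclidean_space d) (\<lambda>z. fst z i)" if "i \<in> S" for i
    using continuous_map_compose[OF continuous_map_subtopology_fst cont_conf_coord[OF that]] by (simp add: o_def)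
  have "continuous_map (PB d (conf d S)) (Euclidean_space d) (\<lambda>z m. fst z j m + rho d S j z * snd z m)"
    by (intro continuous_map_Euclidean_space_add continuous_map_Euclidean_scale cf assms continuous_map_subtopology_snd
      continuous_map_from_subtopology cont_rho)
  then show "continuous_map (PB d (conf d S)) (Euclidean_space d) (\<lambda>z. orb d S a j z i)" if "i \<in> insert a S" for i
    using cf[of i] that by (cases "i = a") (auto simp: orb_def)
  fix z assume z: "z \<in> topspace (PB d (conf d S))"
  note zz = PB_D[OF z]
  show "orb d S a j z \<in> extensional (insert a S)" using topspace_confD(2)[OF zz(1)] by (auto simp: orb_def extensional_def)
  show "inj_on (orb d S a j z) (insert a S)"
    using topspace_confD(3)[OF zz(1)] orb_ne[OF assms(1) zz(1,2) assms(3)] assms(2) by (auto simp: orb_def inj_on_def) metis+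
qed

definition sH :: "nat \<Rightarrow> int \<Rightarrow> nat set \<Rightarrow> nat \<Rightarrow> (nat \<Rightarrow> nat \<Rightarrow> real) chain set \<Rightarrow> (nat \<Rightarrow> nat \<Rightarrow> real) chain set"
  where "sH d q S a = HI q (conf d S) (conf d (insert a S)) (addfar a S)"

definition oH :: "nat \<Rightarrow> int \<Rightarrow> nat set \<Rightarrow> nat \<Rightarrow> nat \<Rightarrow> (nat \<Rightarrow> nat \<Rightarrow> real) chain set \<Rightarrow> (nat \<Rightarrow> nat \<Rightarrow> real) chain set"
  where "oH d q S a j u = HI (q + int d - 1) (PB d (conf d S)) (conf d (insert a S)) (orb d S a j) (cross d (conf d S) q u)"

definition rH :: "nat \<Rightarrow> int \<Rightarrow> nat set \<Rightarrow> nat set \<Rightarrow> (nat \<Rightarrow> nat) \<Rightarrow> (nat \<Rightarrow> nat \<Rightarrow> real) chain set \<Rightarrow> (nat \<Rightarrow> nat \<Rightarrow> real) chain set"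
  where "rH d q S S' \<sigma> = HI q (conf d S) (conf d S') (ren \<sigma> S')"

abbreviation HC :: "nat \<Rightarrow> int \<Rightarrow> nat set \<Rightarrow> (nat \<Rightarrow> nat \<Rightarrow> real) chain set monoid"
  where "HC d q S \<equiv> homology_group q (conf d S)"

lemma sH_carrier: "sH d q S a u \<in> carrier (HC d q (insert a S))" by (simp add: sH_def hom_induced_carrier)
lemma oH_carrier: "oH d q S a j u \<in> carrier (HC d (q + int d - 1) (insert a S))" by (simp add: oH_def hom_induced_carrier)
lemma rH_carrier: "rH d q S S' \<sigma> u \<in> carrier (HC d q S')" by (simp add: rH_def hom_induced_carrier)

lemma sH_hom: "sH d q S a \<in> hom (HC d q S) (HC d q (insert a S))" by (simp add: sH_def hom_induced_hom)
lemma oH_hom: "oH d q S a j \<in> hom (HC d q S) (HC d (q + int d - 1) (insert a S))"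
proof -
  have "HI (q + int d - 1) (PB d (conf d S)) (conf d (insert a S)) (orb d S a j) \<circ> cross d (conf d S) q \<in> hom (HC d q S) (HC d (q + int d - 1) (insert a S))"
    by (rule hom_compose[OF cross_hom hom_induced_hom])
  then show ?thesis by (simp add: oH_def[abs_def] o_def)
qed

lemma HI_comp:
  assumes "continuous_map X Y f" "continuous_map Y Z g"
  shows "HI q Y Z g (HI q X Y f x) = HI q X Z (g \<circ> f) x"
  by (rule hom_induced_compose'[OF assms(1) _ assms(2)]) auto

section \<open>Relations between adding, orbiting and relabelling\<close>

lemma rH_id: "u \<in> carrier (HC d q S) \<Longrightarrow> (\<And>i. i \<in> S \<Longrightarrow> \<sigma> i = i) \<Longrightarrow> rH d q S S \<sigma> u = u"
  unfolding rH_def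
proof (rule hom_induced_id_gen)
  assume s: "\<And>i. i \<in> S \<Longrightarrow> \<sigma> i = i"
  show "continuous_map (conf d S) (conf d S) (ren \<sigma> S)"
    by (rule cont_ren) (use s in \<open>auto simp: inj_on_def\<close>)
  show "ren \<sigma> S x = x" if "x \<in> topspace (conf d S)" for x
    using topspace_confD(2)[OF that] s by (auto simp: ren_def restrict_def extensional_def fun_eq_iff)
qed

lemma rH_comp:
  assumes "inj_on \<sigma> S'" "\<sigma> ` S' \<subseteq> S" "inj_on \<tau> S''" "\<tau> ` S'' \<subseteq> S'"
  shows "rH d q S' S'' \<tau> (rH d q S S' \<sigma> u) = rH d q S S'' (\<sigma> \<circ> \<tau>) u"
proof -
  have "ren \<tau> S'' \<circ> ren \<sigma> S' = ren (\<sigma> \<circ> \<tau>) S''"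
    using assms(4) by (auto simp: ren_def fun_eq_iff restrict_def)
  then show ?thesis unfolding rH_def HI_comp[OF cont_ren[OF assms(1,2)] cont_ren[OF assms(3,4)]] by simp
qed

lemma rH_cong: "(\<And>i. i \<in> S' \<Longrightarrow> \<sigma> i = \<tau> i) \<Longrightarrow> rH d q S S' \<sigma> = rH d q S S' \<tau>"
  unfolding rH_def ren_def[abs_def] by (rule arg_cong[where f="HI q (conf d S) (conf d S')"]) (auto simp: fun_eq_iff restrict_def)

lemma rH_forget_sH:
  assumes "finite S" "d > 0" "a \<notin> S" "inj_on \<sigma> S'" "\<sigma> ` S' \<subseteq> S"
  shows "rH d q (insert a S) S' \<sigma> (sH d q S a u) = rH d q S S' \<sigma> u"
proof -
  have "ren \<sigma> S' \<circ> addfar a S = ren \<sigma> S'"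
    using assms(3,5) by (auto simp: ren_def addfar_def fun_eq_iff restrict_def)
  then show ?thesis
    unfolding rH_def sH_def using HI_comp[OF cont_addfar[OF assms(1-3)] cont_ren[OF assms(4), of "insert a S" d]] assms(5) by auto
qed

text \<open>The position of the far point depends on which labels are present, but in both versions
  its 0-coordinate exceeds all others, so the segment between the two positions is free.\<close>

lemma rH_sH:
  assumes S: "finite S" "a \<notin> S" and S': "finite S'" "a' \<notin> S'" and d: "d > 0"
    and i: "inj_on \<sigma> (insert a' S')" "\<sigma> a' = a" "\<sigma> ` S' \<subseteq> S"
  shows "rH d q (insert a S) (insert a' S') \<sigma> (sH d q S a u) = sH d q S' a' (rH d q S S' \<sigma> u)"
proof -
  have i': "inj_on \<sigma> S'" "\<sigma> ` insert a' S' \<subseteq> insert a S" using i by (auto intro: inj_on_subset)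
  have c1: "continuous_map (conf d S) (conf d (insert a' S')) (ren \<sigma> (insert a' S') \<circ> addfar a S)"
    by (rule continuous_map_compose[OF cont_addfar[OF S(1) d S(2)] cont_ren[OF i(1) i'(2)]])
  have c2: "continuous_map (conf d S) (conf d (insert a' S')) (addfar a' S' \<circ> ren \<sigma> S')"
    by (rule continuous_map_compose[OF cont_ren[OF i'(1) i(3)] cont_addfar[OF S'(1) d S'(2)]])
  have "HI q (conf d S) (conf d (insert a' S')) (ren \<sigma> (insert a' S') \<circ> addfar a S) = HI q (conf d S) (conf d (insert a' S')) (addfar a' S' \<circ> ren \<sigma> S')"
  proof (rule HI_conf[OF c1 c2])
    fix z and k l
    assume z: "z \<in> topspace (conf d S)" and kl: "k \<in> insert a' S'" "l \<in> insert a' S'" "k \<noteq> l"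
    let ?f = "ren \<sigma> (insert a' S') \<circ> addfar a S" and ?g = "addfar a' S' \<circ> ren \<sigma> S'"
    have S'v: "?f z b = z (\<sigma> b)" "?g z b = z (\<sigma> b)" if "b \<in> S'" for b
      using that S(2) S'(2) i(3) by (auto simp: ren_def addfar_def)
    have a'v: "?f z a' = far S z" "?g z a' = far S' (ren \<sigma> S' z)"
      using i(2) by (auto simp: ren_def addfar_def)
    have far: "nonopp (\<lambda>m. ?f z a' m - ?f z b m) (\<lambda>m. ?g z a' m - ?g z b m)" if b: "b \<in> S'" for b
      unfolding S'v[OF b] a'v
    proof (rule nonopp_coord[of _ 0])
      show "far S z 0 - z (\<sigma> b) 0 > 0" using far_gt[OF S(1), of "\<sigma> b" z] i(3) b by auto
      show "far S' (ren \<sigma> S' z) 0 - z (\<sigma> b) 0 > 0" using far_gt[OF S'(1) b, of "ren \<sigma> S' z"] b by (simp add: ren_def)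
    qed
    show "okp (?f z) (?g z) k l"
      by (rule okp_insert1[OF kl], (rule okp3; simp only: S'v), (rule okp1, rule far, assumption))
  qed
  then show ?thesis
    unfolding rH_def sH_def using HI_comp[OF cont_addfar[OF S(1) d S(2)] cont_ren[OF i(1) i'(2)]]
      HI_comp[OF cont_ren[OF i'(1) i(3)] cont_addfar[OF S'(1) d S'(2)]] by metis
qed

text \<open>Only the orbit radius depends on the remaining points. Both radii stay below the
  distance to every other point, and naturality of the sphere class moves the relabelling past
  it.\<close>

lemma rH_oH:
  assumes S: "finite S" "a \<notin> S" and S': "finite S'" "a' \<notin> S'"
    and i: "inj_on \<sigma> (insert a' S')" "\<sigma> a' = a" "\<sigma> ` S' \<subseteq> S" and j: "j' \<in> S'" "\<sigma> j' = j"
    and u: "u \<in> carrier (HC d q S)"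
  shows "rH d (q + int d - 1) (insert a S) (insert a' S') \<sigma> (oH d q S a j u) = oH d q S' a' j' (rH d q S S' \<sigma> u)"
proof -
  let ?p = "q + int d - 1" and ?P = "PB d (conf d S)"
  have jS: "j \<in> S" using i j by auto
  have i': "inj_on \<sigma> S'" "\<sigma> ` insert a' S' \<subseteq> insert a S" using i by (auto intro: inj_on_subset)
  note cr = cont_ren[OF i'(1) i(3)]
  have c1: "continuous_map ?P (conf d (insert a' S')) (ren \<sigma> (insert a' S') \<circ> orb d S a j)"
    by (rule continuous_map_compose[OF cont_orb[OF S jS] cont_ren[OF i(1) i'(2)]])
  have c2: "continuous_map ?P (conf d (insert a' S')) (orb d S' a' j' \<circ> map_prod (ren \<sigma> S') id)"
    by (rule continuous_map_compose[OF continuous_map_PB[OF cr] cont_orb[OF S' j(1)]])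
  have "HI ?p ?P (conf d (insert a' S')) (ren \<sigma> (insert a' S') \<circ> orb d S a j) = HI ?p ?P (conf d (insert a' S')) (orb d S' a' j' \<circ> map_prod (ren \<sigma> S') id)"
  proof (rule HI_conf[OF c1 c2])
    fix z and k l
    assume z: "z \<in> topspace ?P" and kl: "k \<in> insert a' S'" "l \<in> insert a' S'" "k \<noteq> l"
    let ?f = "ren \<sigma> (insert a' S') \<circ> orb d S a j" and ?g = "orb d S' a' j' \<circ> map_prod (ren \<sigma> S') id"
    let ?z = "map_prod (ren \<sigma> S') id z"
    have z': "fst ?z \<in> topspace (conf d S')" using PB_D(1)[OF z] cr by (auto simp: continuous_map_def)
    note r1 = rho_bounds[OF S(1) PB_D(1)[OF z] jS] and r2 = rho_bounds[OF S'(1) z' j(1)]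
    have S'v: "?f z b = fst z (\<sigma> b)" "?g z b = fst z (\<sigma> b)" if "b \<in> S'" for b
      using that S(2) S'(2) i(3) by (auto simp: ren_def orb_def)
    have a'v: "?f z a' = (\<lambda>m. fst z j m + rho d S j z * snd z m)" "?g z a' = (\<lambda>m. fst z j m + rho d S' j' ?z * snd z m)"
      using i(2) j by (auto simp: ren_def orb_def)
    have near: "nonopp (\<lambda>m. ?f z a' m - ?f z b m) (\<lambda>m. ?g z a' m - ?g z b m)" if b: "b \<in> S'" for b
    proof (cases "b = j'")
      case True
      show ?thesis unfolding S'v[OF b] a'v
        by (rule nonopp_scale[OF r1(1) r2(1) PB_D(2)[OF z]]) (use True j in auto)
    next
      case False
      then have sb: "\<sigma> b \<noteq> j" "\<sigma> b \<in> S" using i'(1) i(3) b j by (auto simp: inj_on_def)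
      have "nrm d (\<lambda>m. fst ?z b m - fst ?z j' m) = nrm d (\<lambda>m. fst z (\<sigma> b) m - fst z j m)"
        using b j by (simp add: ren_def)
      then have b2: "rho d S' j' ?z * nrm d (snd z) < nrm d (\<lambda>m. fst z (\<sigma> b) m - fst z j m)"
        using r2(3)[OF b False] r2(1) PB_D(2)[OF z] by (auto intro: order.strict_trans1[rotated])
      have b1: "rho d S j z * nrm d (snd z) < nrm d (\<lambda>m. fst z (\<sigma> b) m - fst z j m)"
        using r1(3)[OF sb(2,1)] r1(1) PB_D(2)[OF z] by (auto intro: order.strict_trans1[rotated])
      show ?thesis unfolding S'v[OF b] a'v
        by (rule nonopp_near1[of d _ "\<lambda>m. fst z j m - fst z (\<sigma> b) m"])
          (use b1 b2 r1(1) r2(1) nrm_minus_commute[of d "fst z j" "fst z (\<sigma> b)"] in \<open>auto simp: nrm_scale\<close>)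
    qed
    show "okp (?f z) (?g z) k l"
      by (rule okp_insert1[OF kl], (rule okp3; simp only: S'v), (rule okp1, rule near, assumption))
  qed
  then show ?thesis
    unfolding rH_def oH_def HI_comp[OF cont_orb[OF S jS] cont_ren[OF i(1) i'(2)]] cross_natural[OF cr u, symmetric]
      HI_comp[OF continuous_map_PB[OF cr] cont_orb[OF S' j(1)]] by simp
qed

text \<open>The far point affects only the radius of the orbit, and the orbiting point affects only
  how far out the far point is placed; neither adjustment meets another point.\<close>

lemma oH_sH:
  assumes S: "finite S" "a \<notin> S" "b \<notin> insert a S" and d: "d > 0" and j: "j \<in> S" and u: "u \<in> carrier (HC d q S)"
  shows "oH d q (insert b S) a j (sH d q S b u) = sH d (q + int d - 1) (insert a S) b (oH d q S a j u)"
proof -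
  let ?p = "q + int d - 1" and ?P = "PB d (conf d S)" and ?T = "insert a (insert b S)"
  have bS: "b \<notin> S" "a \<notin> insert b S" "j \<in> insert b S" "finite (insert b S)" "finite (insert a S)" using S j by auto
  have T: "insert b (insert a S) = ?T" by auto
  note ca = cont_addfar[OF S(1) d bS(1)]
  note co = cont_orb[OF bS(4,2,3), of d]
  have ca2: "continuous_map (conf d (insert a S)) (conf d ?T) (addfar b (insert a S))"
    using cont_addfar[OF bS(5) d S(3)] unfolding T .
  have c1: "continuous_map ?P (conf d ?T) (orb d (insert b S) a j \<circ> map_prod (addfar b S) id)"
    by (rule continuous_map_compose[OF continuous_map_PB[OF ca] co])
  have c2: "continuous_map ?P (conf d ?T) (addfar b (insert a S) \<circ> orb d S a j)"
    by (rule continuous_map_compose[OF cont_orb[OF S(1,2) j] ca2])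
  have "HI ?p ?P (conf d ?T) (orb d (insert b S) a j \<circ> map_prod (addfar b S) id) = HI ?p ?P (conf d ?T) (addfar b (insert a S) \<circ> orb d S a j)"
  proof (rule HI_conf[OF c1 c2])
    fix z and k l
    assume z: "z \<in> topspace ?P" and kl: "k \<in> ?T" "l \<in> ?T" "k \<noteq> l"
    let ?f = "orb d (insert b S) a j \<circ> map_prod (addfar b S) id" and ?g = "addfar b (insert a S) \<circ> orb d S a j"
    let ?z = "map_prod (addfar b S) id z"
    have z': "fst ?z \<in> topspace (conf d (insert b S))" using PB_D(1)[OF z] ca by (auto simp: continuous_map_def)
    note r1 = rho_bounds[OF S(1) PB_D(1)[OF z] j] and r2 = rho_bounds[OF bS(4) z' bS(3)]
    have ba: "b \<noteq> a" using S by auto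
    have Sv: "?f z i = fst z i" "?g z i = fst z i" if "i \<in> S" for i
      using that bS S by (auto simp: orb_def addfar_def)
    have av: "?f z a = (\<lambda>m. fst z j m + rho d (insert b S) j ?z * snd z m)" "?g z a = (\<lambda>m. fst z j m + rho d S j z * snd z m)"
      using bS j ba by (auto simp: orb_def addfar_def)
    have bv: "?f z b = far S (fst z)" "?g z b = far (insert a S) (orb d S a j z)"
      using ba by (auto simp: orb_def addfar_def)
    have near: "nonopp (\<lambda>m. ?f z a m - ?f z i m) (\<lambda>m. ?g z a m - ?g z i m)" if i: "i \<in> S" for i
    proof (cases "i = j")
      case True
      show ?thesis unfolding Sv[OF i] av
        by (rule nonopp_scale[OF r2(1) r1(1) PB_D(2)[OF z]]) (use True in auto)
    next
      case False
      have "nrm d (\<lambda>m. fst ?z i m - fst ?z j m) = nrm d (\<lambda>m. fst z i m - fst z j m)"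
        using i j bS by (auto simp: addfar_def)
      then have b2: "rho d (insert b S) j ?z * nrm d (snd z) < nrm d (\<lambda>m. fst z i m - fst z j m)"
        using r2(3)[of i] i False r2(1) PB_D(2)[OF z] by (auto intro: order.strict_trans1[rotated])
      have b1: "rho d S j z * nrm d (snd z) < nrm d (\<lambda>m. fst z i m - fst z j m)"
        using r1(3)[OF i False] r1(1) PB_D(2)[OF z] by (auto intro: order.strict_trans1[rotated])
      show ?thesis unfolding Sv[OF i] av
        by (rule nonopp_near1[of d _ "\<lambda>m. fst z j m - fst z i m"])
          (use b1 b2 r1(1) r2(1) nrm_minus_commute[of d "fst z j" "fst z i"] in \<open>auto simp: nrm_scale\<close>)
    qed
    have farS: "nonopp (\<lambda>m. ?f z b m - ?f z i m) (\<lambda>m. ?g z b m - ?g z i m)" if i: "i \<in> S" for i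
      unfolding Sv[OF i] bv
    proof (rule nonopp_coord[of _ 0])
      show "far S (fst z) 0 - fst z i 0 > 0" using far_gt[OF S(1) i, of "fst z"] by auto
      show "far (insert a S) (orb d S a j z) 0 - fst z i 0 > 0" using far_gt[OF bS(5), of i "orb d S a j z"] i S(2) by (cases "i = a") (auto simp: orb_def)
    qed
    have c0: "\<bar>v 0\<bar> \<le> nrm d v" for v using d unfolding nrm_def by (intro member_le_sum) auto
    have farA: "nonopp (\<lambda>m. ?f z b m - ?f z a m) (\<lambda>m. ?g z b m - ?g z a m)"
    proof (rule nonopp_coord[of _ 0])
      \<comment> \<open>The orbiting point is displaced by less than 1/3, while the far point is at
        least 1 beyond its centre in coordinate 0.\<close>
      have "rho d (insert b S) j ?z * snd z 0 \<le> rho d (insert b S) j ?z * nrm d (snd z)"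
        using c0[of "snd z"] r2(1) by (intro mult_left_mono) auto
      also have "\<dots> < 1" using r2(4) by simp
      finally show "?f z b 0 - ?f z a 0 > 0" unfolding bv av using far_gt[OF S(1) j, of "fst z"] by auto
      show "?g z b 0 - ?g z a 0 > 0" using far_gt[OF bS(5), of a "orb d S a j z"] ba by (auto simp: addfar_def)
    qed
    show "okp (?f z) (?g z) k l"
    proof (rule okp_insert2[OF kl])
      show "okp (?f z) (?g z) i l" if "i \<in> S" "l \<in> S" for i l by (rule okp3) (simp_all only: Sv that)
      show "okp (?f z) (?g z) a i" if "i \<in> S" for i by (rule okp1) (rule near[OF that])
      show "okp (?f z) (?g z) b i" if "i \<in> S" for i by (rule okp1) (rule farS[OF that])
      show "okp (?f z) (?g z) a b" by (rule okp_sym, rule okp1) (rule farA)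
    qed
  qed
  then show ?thesis
    unfolding oH_def sH_def T HI_comp[OF cont_orb[OF S(1,2) j] ca2] cross_natural[OF ca u, symmetric]
      HI_comp[OF continuous_map_PB[OF ca] co] by simp
qed

text \<open>To change their order, two far points have to pass each other off the axis; this takes a
  second coordinate, hence d at least 2.\<close>

lemma sH_commute:
  assumes S: "finite S" "a \<notin> S" "b \<notin> insert a S" and d: "d \<ge> 2"
  shows "sH d q (insert b S) a (sH d q S b u) = sH d q (insert a S) b (sH d q S a u)"
proof -
  let ?T = "insert a (insert b S)"
  \<comment> \<open>Half-way configuration: b at the usual far point, a beside it, displaced by 1 in
    coordinate 1. It is reached by a segment from either order.\<close>
  define mid where "mid x = (x(b := far S x))(a := (far S x)(1 := 1))" for x
  have d0: "d > 0" using d by simp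
  have bS: "b \<notin> S" "a \<notin> insert b S" "finite (insert b S)" "finite (insert a S)" "a \<noteq> b" using S by auto
  have T: "insert b (insert a S) = ?T" by auto
  note f1 = cont_addfar[OF S(1) d0 bS(1)] cont_addfar[OF bS(3) d0 bS(2)]
  note g1 = cont_addfar[OF S(1) d0 S(2)] cont_addfar[OF bS(4) d0 S(3), unfolded T]
  let ?f = "addfar a (insert b S) \<circ> addfar b S" and ?g = "addfar b (insert a S) \<circ> addfar a S"
  have cf: "continuous_map (conf d S) (conf d ?T) ?f" by (rule continuous_map_compose[OF f1])
  have cg: "continuous_map (conf d S) (conf d ?T) ?g" by (rule continuous_map_compose[OF g1])
  have cfar: "continuous_map (conf d S) (Euclidean_space d) (\<lambda>x. (far S x)(1 := c))" for c
    using cont_far[OF S(1) d0] d unfolding continuous_map_Euclidean_iff by (auto simp: fun_upd_def)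
  have gt: "far S x 0 > x i 0" if "i \<in> S" for x i using far_gt[OF S(1) that, of x] by simp
  have cm: "continuous_map (conf d S) (conf d ?T) mid"
    unfolding continuous_map_conf
  proof (intro conjI ballI)
    show "continuous_map (conf d S) (Euclidean_space d) (\<lambda>z. mid z i)" if iT: "i \<in> ?T" for i
    proof -
      consider "i = a" | "i = b" | "i \<in> S" "i \<noteq> a" "i \<noteq> b" using iT S by blast
      then show ?thesis
      proof cases
        case 1
        have "(\<lambda>z. mid z i) = (\<lambda>z. (far S z)(1 := 1))" unfolding mid_def 1 by (rule ext) (rule fun_upd_same)
        then show ?thesis using cfar[of 1] by (simp only:)
      next
        case 2
        have "(\<lambda>z. mid z i) = far S" using bS(5) unfolding mid_def 2 by (intro ext) (simp only: fun_upd_other[OF bS(5)[symmetric]] fun_upd_same)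
        then show ?thesis using cont_far[OF S(1) d0] by (simp only:)
      next
        case 3
        have "(\<lambda>z. mid z i) = (\<lambda>z. z i)" unfolding mid_def by (intro ext) (simp only: fun_upd_other[OF 3(2)] fun_upd_other[OF 3(3)])
        then show ?thesis using cont_conf_coord[OF 3(1)] by (simp only:)
      qed
    qed
    fix x assume x: "x \<in> topspace (conf d S)"
    show "mid x \<in> extensional ?T" using topspace_confD(2)[OF x] by (auto simp: mid_def extensional_def)
    have 1: "far S x \<noteq> x i" "(far S x)(1 := 1) \<noteq> x i" if "i \<in> S" for i
      using gt[OF that, of x] by (auto simp: fun_eq_iff fun_upd_def intro!: exI[of _ 0])
    have 2: "(far S x)(1 := 1) \<noteq> far S x" by (auto simp: far_def fun_eq_iff intro!: exI[of _ 1])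
    show "inj_on (mid x) ?T"
      using topspace_confD(3)[OF x] 1 2 bS S by (auto simp: mid_def inj_on_def) metis+
  qed
  have A: "HI q (conf d S) (conf d ?T) ?f = HI q (conf d S) (conf d ?T) mid"
  proof (rule HI_conf[OF cf cm])
    fix z k l assume z: "z \<in> topspace (conf d S)" and kl: "k \<in> ?T" "l \<in> ?T" "k \<noteq> l"
    have Sv: "?f z i = z i" "mid z i = z i" if "i \<in> S" for i using that bS S by (auto simp: addfar_def mid_def)
    have bv: "?f z b = far S z" "mid z b = far S z" using bS by (auto simp: addfar_def mid_def)
    have av: "?f z a = far (insert b S) (addfar b S z)" "mid z a = (far S z)(1 := 1)" by (auto simp: addfar_def mid_def)
    have aS: "nonopp (\<lambda>m. ?f z a m - ?f z i m) (\<lambda>m. mid z a m - mid z i m)" if i: "i \<in> S" for i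
      unfolding av Sv[OF i] using far_gt[OF bS(3), of i "addfar b S z"] gt[OF i, of z] i bS by (cases "i = b"; intro nonopp_coord[of _ 0]) (auto simp: addfar_def)
    \<comment> \<open>The difference of a and b turns from the axis of coordinate 0 to the axis of
      coordinate 1, and such directions are never opposite.\<close>
    have ab: "nonopp (\<lambda>m. ?f z a m - ?f z b m) (\<lambda>m. mid z a m - mid z b m)"
      unfolding av bv nonopp_def
    proof (intro allI impI notI)
      fix t :: real assume t: "0 \<le> t \<and> t \<le> 1" and e: "(\<lambda>m. (1 - t) * (far (insert b S) (addfar b S z) m - far S z m) + t * (((far S z)(1 := 1)) m - far S z m)) = (\<lambda>m. 0)"
      have "far (insert b S) (addfar b S z) 0 > far S z 0" using far_gt[OF bS(3), of b "addfar b S z"] by (simp add: addfar_def)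
      then have "t = 1" using fun_cong[OF e, of 0] by simp
      moreover have "t = 0" using fun_cong[OF e, of 1] by (simp add: far_def)
      ultimately show False by simp
    qed
    show "okp (?f z) (mid z) k l"
    proof (rule okp_insert2[OF kl])
      show "okp (?f z) (mid z) i l" if "i \<in> S" "l \<in> S" for i l by (rule okp3) (simp_all only: Sv that)
      show "okp (?f z) (mid z) a i" if "i \<in> S" for i by (rule okp1) (rule aS[OF that])
      show "okp (?f z) (mid z) b i" if "i \<in> S" for i by (rule okp3) (simp_all only: Sv bv that)
      show "okp (?f z) (mid z) a b" by (rule okp1) (rule ab)
    qed
  qed
  have B: "HI q (conf d S) (conf d ?T) mid = HI q (conf d S) (conf d ?T) ?g"
  proof (rule HI_conf[OF cm cg])
    fix z k l assume z: "z \<in> topspace (conf d S)" and kl: "k \<in> ?T" "l \<in> ?T" "k \<noteq> l"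
    have Sv: "?g z i = z i" "mid z i = z i" if "i \<in> S" for i using that bS S by (auto simp: addfar_def mid_def)
    have bv: "?g z b = far (insert a S) (addfar a S z)" "mid z b = far S z" using bS by (auto simp: addfar_def mid_def)
    have av: "?g z a = far S z" "mid z a = (far S z)(1 := 1)" using bS by (auto simp: addfar_def mid_def)
    have aS: "nonopp (\<lambda>m. mid z a m - mid z i m) (\<lambda>m. ?g z a m - ?g z i m)" if i: "i \<in> S" for i
      unfolding av Sv[OF i] using gt[OF i, of z] by (intro nonopp_coord[of _ 0]) auto
    have bSn: "nonopp (\<lambda>m. mid z b m - mid z i m) (\<lambda>m. ?g z b m - ?g z i m)" if i: "i \<in> S" for i
      unfolding bv Sv[OF i] using far_gt[OF bS(4), of i "addfar a S z"] gt[OF i, of z] i S by (cases "i = a"; intro nonopp_coord[of _ 0]) (auto simp: addfar_def)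
    have ab: "nonopp (\<lambda>m. mid z a m - mid z b m) (\<lambda>m. ?g z a m - ?g z b m)"
      unfolding av bv nonopp_def
    proof (intro allI impI notI)
      fix t :: real assume t: "0 \<le> t \<and> t \<le> 1" and e: "(\<lambda>m. (1 - t) * (((far S z)(1 := 1)) m - far S z m) + t * (far S z m - far (insert a S) (addfar a S z) m)) = (\<lambda>m. 0)"
      have "far (insert a S) (addfar a S z) 0 > far S z 0" using far_gt[OF bS(4), of a "addfar a S z"] by (simp add: addfar_def)
      then have "t = 0" using fun_cong[OF e, of 0] by simp
      moreover have "t = 1" using fun_cong[OF e, of 1] by (simp add: far_def)
      ultimately show False by simp
    qed
    show "okp (mid z) (?g z) k l"
    proof (rule okp_insert2[OF kl])
      show "okp (mid z) (?g z) i l" if "i \<in> S" "l \<in> S" for i l by (rule okp3) (simp_all only: Sv that)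
      show "okp (mid z) (?g z) a i" if "i \<in> S" for i by (rule okp1) (rule aS[OF that])
      show "okp (mid z) (?g z) b i" if "i \<in> S" for i by (rule okp1) (rule bSn[OF that])
      show "okp (mid z) (?g z) a b" by (rule okp1) (rule ab)
    qed
  qed
  show ?thesis unfolding sH_def T HI_comp[OF f1] HI_comp[OF g1] A B ..
qed

text \<open>Exchanging the orbiting point with its centre reverses the displacement between them.
  The remaining shift of the pair is small compared with the distance to the other points and is
  removed by a homotopy.\<close>

lemma oH_symmetric:
  assumes S: "finite S" "a \<notin> S" and j: "j \<in> S"
  shows "rH d (q + int d - 1) (insert a S) (insert a S) (Transposition.transpose a j) (oH d q S a j u) =
    HI (q + int d - 1) (PB d (conf d S)) (conf d (insert a S)) (orb d S a j)
      (HI (q + int d - 1) (PB d (conf d S)) (PB d (conf d S)) negv (cross d (conf d S) q u))"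
proof -
  let ?p = "q + int d - 1" and ?P = "PB d (conf d S)" and ?T = "insert a S"
  have aj: "a \<noteq> j" using S j by auto
  have i: "inj_on (Transposition.transpose a j) ?T" "Transposition.transpose a j ` ?T \<subseteq> ?T" using j by (auto simp: inj_on_def Transposition.transpose_def)
  let ?f = "ren (Transposition.transpose a j) ?T \<circ> orb d S a j" and ?g = "orb d S a j \<circ> negv"
  have c1: "continuous_map ?P (conf d ?T) ?f" by (rule continuous_map_compose[OF cont_orb[OF S j] cont_ren[OF i]])
  have c2: "continuous_map ?P (conf d ?T) ?g" by (rule continuous_map_compose[OF cont_negv cont_orb[OF S j]])
  have "HI ?p ?P (conf d ?T) ?f = HI ?p ?P (conf d ?T) ?g"
  proof (rule HI_conf[OF c1 c2])
    fix z k l assume z: "z \<in> topspace ?P" and kl: "k \<in> ?T" "l \<in> ?T" "k \<noteq> l"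
    note r = rho_bounds[OF S(1) PB_D(1)[OF z] j]
    have rn: "rho d S j (negv z) = rho d S j z" by (simp add: rho_def negv_def nrm_minus)
    have Sv: "?f z i = fst z i" "?g z i = fst z i" if "i \<in> S - {j}" for i
      using that S by (auto simp: ren_def orb_def negv_def Transposition.transpose_def)
    have jv: "?f z j = (\<lambda>m. fst z j m + rho d S j z * snd z m)" "?g z j = fst z j"
      using aj j by (auto simp: ren_def orb_def negv_def)
    have av: "?f z a = fst z j" "?g z a = (\<lambda>m. fst z j m - rho d S j z * snd z m)"
      using aj by (auto simp: ren_def orb_def rn) (simp add: negv_def)
    have b1: "rho d S j z * nrm d (snd z) < nrm d (\<lambda>m. fst z j m - fst z i m)" if i: "i \<in> S - {j}" for i
      using r(3)[of i] i r(1) PB_D(2)[OF z] nrm_minus_commute[of d "fst z j" "fst z i"] by (auto intro: order.strict_trans1[rotated])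
    have aS: "nonopp (\<lambda>m. ?f z a m - ?f z i m) (\<lambda>m. ?g z a m - ?g z i m)" if i: "i \<in> S - {j}" for i
      unfolding Sv[OF i] av
      by (rule nonopp_near1[of d _ "\<lambda>m. fst z j m - fst z i m"])
        (use b1[OF i] r(1) PB_D(2)[OF z] nrm_minus[of d "\<lambda>m. rho d S j z * snd z m"] in \<open>auto simp: nrm_scale nrm_def[of d "\<lambda>m. 0"] intro: order.strict_trans1[rotated]\<close>)
    have jS: "nonopp (\<lambda>m. ?f z j m - ?f z i m) (\<lambda>m. ?g z j m - ?g z i m)" if i: "i \<in> S - {j}" for i
      unfolding Sv[OF i] jv
      by (rule nonopp_near1[of d _ "\<lambda>m. fst z j m - fst z i m"])
        (use b1[OF i] r(1) PB_D(2)[OF z] in \<open>auto simp: nrm_scale nrm_def[of d "\<lambda>m. 0"] intro: order.strict_trans1[rotated]\<close>)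
    have ja: "nonopp (\<lambda>m. ?f z j m - ?f z a m) (\<lambda>m. ?g z j m - ?g z a m)"
      unfolding av jv by (rule nonopp_scale[OF r(1) r(1) PB_D(2)[OF z]]) auto
    have kl': "k \<in> insert a (insert j (S - {j}))" "l \<in> insert a (insert j (S - {j}))" "k \<noteq> l" using kl by auto
    show "okp (?f z) (?g z) k l"
    proof (rule okp_insert2[OF kl'])
      show "okp (?f z) (?g z) i l" if "i \<in> S - {j}" "l \<in> S - {j}" for i l by (rule okp3) (simp_all only: Sv that)
      show "okp (?f z) (?g z) a i" if "i \<in> S - {j}" for i by (rule okp1) (rule aS[OF that])
      show "okp (?f z) (?g z) j i" if "i \<in> S - {j}" for i by (rule okp1) (rule jS[OF that])
      show "okp (?f z) (?g z) a j" by (rule okp_sym, rule okp1) (rule ja)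
    qed
  qed
  then show ?thesis
    unfolding rH_def oH_def HI_comp[OF cont_orb[OF S j] cont_ren[OF i]] HI_comp[OF cont_negv cont_orb[OF S j]] by simp
qed

lemma rho_lt:
  assumes S: "finite S" and x: "fst z \<in> topspace (conf d S)" and j: "j \<in> S" and b: "b \<in> S" "b \<noteq> j"
  shows "rho d S j z * nrm d (snd z) < nrm d (\<lambda>m. fst z j m - fst z b m) / 3"
  using rho_bounds(3)[OF S x j b] nrm_minus_commute[of d "fst z j" "fst z b"] by simp

text \<open>Orbits around different centres do not interfere: up to homotopy both sides are a
  product of two spheres over \<open>conf d S\<close>, taken in opposite order. The inverse is the
  sign from \<open>cross_swap\<close>.\<close>

lemma oH_swap:
  assumes S: "finite S" "a \<notin> S" "b \<notin> insert a S" and lj: "l \<in> S" "j \<in> S" "l \<noteq> j"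
    and d: "even d" "d > 0" and u: "u \<in> carrier (HC d q S)"
  shows "oH d (q + int d - 1) (insert b S) a l (oH d q S b j u) =
    oH d (q + int d - 1) (insert a S) b j (oH d q S a l (inv\<^bsub>HC d q S\<^esub> u))"
proof -
  let ?p = "q + int d - 1 + int d - 1" and ?C = "conf d S" and ?T = "insert a (insert b S)"
  have bS: "b \<notin> S" "a \<notin> insert b S" "l \<in> insert b S" "j \<in> insert a S" "finite (insert b S)" "finite (insert a S)" "a \<noteq> b" using S lj by auto
  have T: "insert b (insert a S) = ?T" by auto
  note cb = cont_orb[OF S(1) bS(1) lj(2), of d] and ca = cont_orb[OF S(1,2) lj(1), of d]
  note cal = cont_orb[OF bS(5,2,3), of d] and cbj = cont_orb[OF bS(6) S(3) bS(4), of d, unfolded T]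
  let ?f = "orb d (insert b S) a l \<circ> map_prod (orb d S b j) id"
  let ?g = "orb d (insert a S) b j \<circ> map_prod (orb d S a l) id"
  have cf: "continuous_map (PP d ?C) (conf d ?T) ?f"
    by (rule continuous_map_compose[OF continuous_map_PB[OF cb] cal])
  have cg: "continuous_map (PP d ?C) (conf d ?T) ?g"
    by (rule continuous_map_compose[OF continuous_map_PB[OF ca] cbj])
  have cgs: "continuous_map (PP d ?C) (conf d ?T) (?g \<circ> swp)"
    by (rule continuous_map_compose[OF cont_swp cg])
  have fg: "HI ?p (PP d ?C) (conf d ?T) ?f = HI ?p (PP d ?C) (conf d ?T) (?g \<circ> swp)"
  proof (rule HI_conf[OF cf cgs])
    fix z k i assume z: "z \<in> topspace (PP d ?C)" and ki: "k \<in> ?T" "i \<in> ?T" "k \<noteq> i"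
    let ?x = "fst (fst z)" and ?w = "snd (fst z)" and ?v = "snd z"
    have zf: "fst z \<in> topspace (PB d ?C)" using PB_D(1)[OF z] .
    note x = PB_D(1)[OF zf] and w = PB_D(2)[OF zf] and v = PB_D(2)[OF z]
    have sz: "swp z \<in> topspace (PP d ?C)" using z cont_swp[where d=d and B="?C"] by (auto simp: continuous_map_def)
    have szf: "fst (swp z) \<in> topspace (PB d ?C)" using PB_D(1)[OF sz] .
    let ?zb = "map_prod (orb d S b j) id z" and ?za = "map_prod (orb d S a l) id (swp z)"
    have zb: "fst ?zb \<in> topspace (conf d (insert b S))" using zf cb by (auto simp: continuous_map_def)
    have za: "fst ?za \<in> topspace (conf d (insert a S))" using szf ca by (auto simp: continuous_map_def)
    let ?r1 = "rho d S j (fst z)" and ?r2 = "rho d (insert b S) l ?zb"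
    let ?r3 = "rho d S l (fst (swp z))" and ?r4 = "rho d (insert a S) j ?za"
    have sx: "fst (fst (swp z)) = ?x" "snd (fst (swp z)) = ?v" "snd (swp z) = ?w" by (auto simp: swp_def)
    have pos: "?r1 > 0" "?r2 > 0" "?r3 > 0" "?r4 > 0"
      using rho_bounds(1)[OF S(1) x lj(2)] rho_bounds(1)[OF bS(5) zb bS(3)] rho_bounds(1)[OF S(1) _ lj(1), of "fst (swp z)" d] rho_bounds(1)[OF bS(6) za bS(4)] x sx by auto
    have lt1: "?r1 * nrm d ?w < nrm d (\<lambda>m. ?x j m - ?x i m) / 3" if "i \<in> S" "i \<noteq> j" for i
      using rho_lt[OF S(1) x lj(2) that] .
    have lt2: "?r2 * nrm d ?v < nrm d (\<lambda>m. ?x l m - ?x i m) / 3" if i: "i \<in> S" "i \<noteq> l" for i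
      using rho_lt[OF bS(5) zb bS(3), of i] i lj bS by (simp add: orb_def) (auto split: if_splits)
    have lt3: "?r3 * nrm d ?v < nrm d (\<lambda>m. ?x l m - ?x i m) / 3" if "i \<in> S" "i \<noteq> l" for i
      using rho_lt[OF S(1) _ lj(1) that, of "fst (swp z)" d] x sx by auto
    have lt4: "?r4 * nrm d ?w < nrm d (\<lambda>m. ?x j m - ?x i m) / 3" if i: "i \<in> S" "i \<noteq> j" for i
      using rho_lt[OF bS(6) za bS(4), of i] i lj S sx by (simp add: orb_def) (auto split: if_splits)
    have Sv: "?f z i = ?x i" "(?g \<circ> swp) z i = ?x i" if "i \<in> S" for i
      using that S bS sx by (auto simp: orb_def)
    have av: "?f z a = (\<lambda>m. ?x l m + ?r2 * ?v m)" "(?g \<circ> swp) z a = (\<lambda>m. ?x l m + ?r3 * ?v m)"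
      using bS lj sx by (auto simp: orb_def)
    have bv: "?f z b = (\<lambda>m. ?x j m + ?r1 * ?w m)" "(?g \<circ> swp) z b = (\<lambda>m. ?x j m + ?r4 * ?w m)"
      using bS S lj sx by (auto simp: orb_def)
    have near: "nonopp (\<lambda>m. (?x c m + r * y m) - ?x i m) (\<lambda>m. (?x c m + r' * y m) - ?x i m)"
      if r: "r > 0" "r' > 0" "nrm d y > 0" and lt: "i \<noteq> c \<Longrightarrow> r * nrm d y < nrm d (\<lambda>m. ?x c m - ?x i m) / 3" "i \<noteq> c \<Longrightarrow> r' * nrm d y < nrm d (\<lambda>m. ?x c m - ?x i m) / 3" for c i r r' and y :: "nat \<Rightarrow> real"
    proof (cases "i = c")
      case True
      then show ?thesis by (intro nonopp_scale[OF r]) auto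
    next
      case False
      have p: "nrm d (\<lambda>m. ?x c m - ?x i m) > 0" using lt(1)[OF False] mult_pos_pos[OF r(1,3)] by linarith
      show ?thesis by (rule nonopp_near1[of d _ "\<lambda>m. ?x c m - ?x i m"]) (use lt[OF False] r p in \<open>auto simp: nrm_scale\<close>)
    qed
    show "okp (?f z) ((?g \<circ> swp) z) k i"
    proof (rule okp_insert2[OF ki])
      show "okp (?f z) ((?g \<circ> swp) z) i l" if "i \<in> S" "l \<in> S" for i l by (rule okp3) (simp_all only: Sv that)
      show "okp (?f z) ((?g \<circ> swp) z) a i" if i: "i \<in> S" for i
        by (rule okp1) (unfold av Sv[OF i], rule near[OF pos(2,3) v lt2[OF i] lt3[OF i]])
      show "okp (?f z) ((?g \<circ> swp) z) b i" if i: "i \<in> S" for i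
        by (rule okp1) (unfold bv Sv[OF i], rule near[OF pos(1,4) w lt1[OF i] lt4[OF i]])
      have c: "nrm d (\<lambda>m. (?x l m + r * ?v m - (?x j m + r' * ?w m)) - (?x l m - ?x j m)) < nrm d (\<lambda>m. ?x l m - ?x j m)"
        if "r > 0" "r' > 0" "r * nrm d ?v < nrm d (\<lambda>m. ?x l m - ?x j m) / 3" "r' * nrm d ?w < nrm d (\<lambda>m. ?x j m - ?x l m) / 3" for r r'
      proof -
        have "nrm d (\<lambda>m. (?x l m + r * ?v m - (?x j m + r' * ?w m)) - (?x l m - ?x j m)) = nrm d (\<lambda>m. r * ?v m + (- r') * ?w m)"
          by (rule arg_cong[where f="nrm d"]) (auto simp: fun_eq_iff)
        also have "\<dots> \<le> nrm d (\<lambda>m. r * ?v m) + nrm d (\<lambda>m. (- r') * ?w m)" by (rule nrm_triangle)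
        also have "\<dots> = r * nrm d ?v + r' * nrm d ?w" using that by (simp only: nrm_scale abs_minus_cancel abs_of_pos)
        also have "\<dots> < nrm d (\<lambda>m. ?x l m - ?x j m)"
          using that nrm_minus_commute[of d "?x l" "?x j"] mult_nonneg_nonneg[OF less_imp_le[OF that(1)] nrm_nonneg[of d ?v]] by linarith
        finally show ?thesis .
      qed
      show "okp (?f z) ((?g \<circ> swp) z) a b"
        by (rule okp1, unfold av bv, rule nonopp_near1[of d _ "\<lambda>m. ?x l m - ?x j m"])
          (rule c[OF pos(2) pos(1) lt2[OF lj(2) lj(3)[symmetric]] lt1[OF lj(1,3)]] c[OF pos(3) pos(4) lt3[OF lj(2) lj(3)[symmetric]] lt4[OF lj(1,3)]])+
    qed
  qed
  have "oH d (q + int d - 1) (insert b S) a l (oH d q S b j u) = HI ?p (PP d ?C) (conf d ?T) ?f (cross d (PB d ?C) (q + int d - 1) (cross d ?C q u))"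
    unfolding oH_def cross_natural[OF cb cross_carrier, symmetric] by (rule HI_comp[OF continuous_map_PB[OF cb] cal])
  also have "\<dots> = HI ?p (PP d ?C) (conf d ?T) ?g (HI ?p (PP d ?C) (PP d ?C) swp (cross d (PB d ?C) (q + int d - 1) (cross d ?C q u)))"
    unfolding fg by (rule HI_comp[symmetric, OF cont_swp cg])
  also have "\<dots> = HI ?p (PP d ?C) (conf d ?T) ?g (cross d (PB d ?C) (q + int d - 1) (cross d ?C q (inv\<^bsub>HC d q S\<^esub> u)))"
    unfolding cross_swap[OF d u] ..
  also have "\<dots> = oH d (q + int d - 1) (insert a S) b j (oH d q S a l (inv\<^bsub>HC d q S\<^esub> u))"
    unfolding oH_def T cross_natural[OF ca cross_carrier, symmetric] by (rule HI_comp[symmetric, OF continuous_map_PB[OF ca] cbj])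
  finally show ?thesis .
qed

section \<open>Clusters of three points\<close>

text \<open>One scale for both displacements, so that the cluster at l is similar to the triple (0,
  v, y). It is symmetric in v and y, so that on configurations \<open>cluster_swp\<close> compares
  equal maps and needs no homotopy.\<close>

definition tau :: "nat \<Rightarrow> nat set \<Rightarrow> nat \<Rightarrow> (((nat \<Rightarrow> nat \<Rightarrow> real) \<times> (nat \<Rightarrow> real)) \<times> (nat \<Rightarrow> real)) \<Rightarrow> real"
  where "tau d S l z = sep d S l (fst (fst z)) / (1 + (nrm d (snd (fst z)) + nrm d (snd z)))"

definition cluster :: "nat \<Rightarrow> nat set \<Rightarrow> nat \<Rightarrow> nat \<Rightarrow> nat \<Rightarrow> (((nat \<Rightarrow> nat \<Rightarrow> real) \<times> (nat \<Rightarrow> real)) \<times> (nat \<Rightarrow> real)) \<Rightarrow> nat \<Rightarrow> nat \<Rightarrow> real"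
  where "cluster d S l n n' z = (fst (fst z))(n := (\<lambda>m. fst (fst z) l m + tau d S l z * snd (fst z) m), n' := (\<lambda>m. fst (fst z) l m + tau d S l z * snd z m))"

lemma tau_bounds:
  assumes S: "finite S" and x: "fst (fst z) \<in> topspace (conf d S)" and j: "l \<in> S"
  shows "tau d S l z > 0" "b \<in> S \<Longrightarrow> b \<noteq> l \<Longrightarrow> tau d S l z * nrm d (snd z) < nrm d (\<lambda>m. fst (fst z) l m - fst (fst z) b m) / 3"
    "b \<in> S \<Longrightarrow> b \<noteq> l \<Longrightarrow> tau d S l z * nrm d (snd (fst z)) < nrm d (\<lambda>m. fst (fst z) l m - fst (fst z) b m) / 3"
proof -
  note s = sep_bounds[OF S x j]
  let ?n = "nrm d (snd (fst z)) + nrm d (snd z)"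
  have n: "nrm d (snd z) \<ge> 0" "nrm d (snd (fst z)) \<ge> 0" by (rule nrm_nonneg)+
  show "tau d S l z > 0" using s n by (simp add: tau_def)
  have *: "tau d S l z * y < sep d S l (fst (fst z))" if "0 \<le> y" "y \<le> ?n" for y
  proof -
    have "y / (1 + ?n) < 1" using that by simp
    then have "sep d S l (fst (fst z)) * (y / (1 + ?n)) < sep d S l (fst (fst z)) * 1"
      using s(1) by (intro mult_strict_left_mono)
    then show ?thesis by (simp add: tau_def)
  qed
  show "b \<in> S \<Longrightarrow> b \<noteq> l \<Longrightarrow> tau d S l z * nrm d (snd z) < nrm d (\<lambda>m. fst (fst z) l m - fst (fst z) b m) / 3"
    using s(3)[of b] *[of "nrm d (snd z)"] n nrm_minus_commute[of d "fst (fst z) l" "fst (fst z) b"] by simp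
  show "b \<in> S \<Longrightarrow> b \<noteq> l \<Longrightarrow> tau d S l z * nrm d (snd (fst z)) < nrm d (\<lambda>m. fst (fst z) l m - fst (fst z) b m) / 3"
    using s(3)[of b] *[of "nrm d (snd (fst z))"] n nrm_minus_commute[of d "fst (fst z) l" "fst (fst z) b"] by simp
qed

lemma E2_D:
  assumes "z \<in> topspace (E2 d B)"
  shows "fst (fst z) \<in> topspace B" "nrm d (snd (fst z)) > 0" "nrm d (snd z) > 0" "nrm d (\<lambda>m. snd z m - snd (fst z) m) > 0"
proof -
  have f: "fst z \<in> topspace (PB d B)" using assms E2_cont(4)[where d=d and B=B] by (auto simp: continuous_map_def)
  have b: "snd z i = 0" if "i \<ge> d" for i using Euclidean_beyond[OF E2_cont(3) assms that] .
  show "fst (fst z) \<in> topspace B" "nrm d (snd (fst z)) > 0" using PB_D[OF f] by auto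
  show "nrm d (snd z) > 0" using E2_ne[OF assms] b by (intro nrm_pos) auto
  show "nrm d (\<lambda>m. snd z m - snd (fst z) m) > 0" using E2_ne[OF assms] b PB_D(3)[OF f] by (intro nrm_pos) (auto simp: fun_eq_iff)
qed

context
  fixes d :: nat and S :: "nat set" and l n n' :: nat
  assumes S: "finite S" "n \<notin> S" "n' \<notin> insert n S" and l: "l \<in> S"
begin

abbreviation (input) TT where "TT \<equiv> insert n' (insert n S)"

lemma cluster_vals:
  "i \<in> S \<Longrightarrow> cluster d S l n n' z i = fst (fst z) i"
  "cluster d S l n n' z n = (\<lambda>m. fst (fst z) l m + tau d S l z * snd (fst z) m)"
  "cluster d S l n n' z n' = (\<lambda>m. fst (fst z) l m + tau d S l z * snd z m)"
  using S by (auto simp: cluster_def)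

lemma cluster_ne:
  assumes "r > 0" "nrm d y > 0" "b \<in> S" "b \<noteq> l \<Longrightarrow> r * nrm d y < nrm d (\<lambda>m. x l m - x b m) / 3"
  shows "(\<lambda>m. x l m + r * y m) \<noteq> x b"
proof
  assume e: "(\<lambda>m. x l m + r * y m) = x b"
  have "nrm d (\<lambda>m. x l m - x b m) = nrm d (\<lambda>m. (- r) * y m)" unfolding e[symmetric] by simp
  also have "\<dots> = r * nrm d y" using assms(1) by (simp only: nrm_scale abs_minus_cancel abs_of_pos)
  finally have e2: "nrm d (\<lambda>m. x l m - x b m) = r * nrm d y" .
  have "r * nrm d y > 0" using assms by simp
  then show False using e2 assms(4) by (cases "b = l") (auto simp: nrm_def[of d "\<lambda>m. 0"])
qed

lemma cont_cluster: "continuous_map (E2 d (conf d S)) (conf d TT) (cluster d S l n n')"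
  unfolding continuous_map_conf
proof (intro conjI ballI)
  let ?E = "E2 d (conf d S)"
  have cx: "continuous_map ?E (Euclidean_space d) (\<lambda>z. fst (fst z) i)" if "i \<in> S" for i
    using continuous_map_compose[OF E2_cont(1) cont_conf_coord[OF that]] by (simp add: o_def)
  have n0: "1 + (nrm d v + nrm d w) \<noteq> 0" for v w using nrm_nonneg[of d v] nrm_nonneg[of d w] by linarith
  have ct: "continuous_map ?E euclideanreal (tau d S l)"
    unfolding tau_def[abs_def]
    using continuous_map_compose[OF E2_cont(1) cont_sep[OF S(1) l]] n0
    by (intro continuous_map_real_divide continuous_map_add continuous_map_nrm E2_cont) (auto simp: o_def)
  show "continuous_map ?E (Euclidean_space d) (\<lambda>z. cluster d S l n n' z i)" if i: "i \<in> TT" for i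
  proof -
    consider "i \<in> S" | "i = n" | "i = n'" using i by blast
    then show ?thesis
      by cases (simp_all only: cluster_vals, (intro continuous_map_Euclidean_space_add continuous_map_Euclidean_scale cx l ct E2_cont; assumption?)+)
  qed
  fix z assume z: "z \<in> topspace ?E"
  note zz = E2_D[OF z]
  note t = tau_bounds[OF S(1) zz(1) l]
  show "cluster d S l n n' z \<in> extensional TT" using topspace_confD(2)[OF zz(1)] by (auto simp: cluster_def extensional_def)
  have 1: "(\<lambda>m. fst (fst z) l m + tau d S l z * snd z m) \<noteq> fst (fst z) b" if "b \<in> S" for b
    by (rule cluster_ne[OF t(1) zz(3) that t(2)[OF that]])
  have 2: "(\<lambda>m. fst (fst z) l m + tau d S l z * snd (fst z) m) \<noteq> fst (fst z) b" if "b \<in> S" for b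
    by (rule cluster_ne[OF t(1) zz(2) that t(3)[OF that]])
  have 3: "(\<lambda>m. fst (fst z) l m + tau d S l z * snd z m) \<noteq> (\<lambda>m. fst (fst z) l m + tau d S l z * snd (fst z) m)"
  proof
    assume "(\<lambda>m. fst (fst z) l m + tau d S l z * snd z m) = (\<lambda>m. fst (fst z) l m + tau d S l z * snd (fst z) m)"
    then have "snd z m - snd (fst z) m = 0" for m using t(1) by (auto simp: fun_eq_iff)
    then show False using zz(4) by (simp add: nrm_def)
  qed
  have "inj_on (cluster d S l n n' z) S" using topspace_confD(3)[OF zz(1)] cluster_vals(1) by (simp add: inj_on_def)
  moreover have "cluster d S l n n' z n \<notin> cluster d S l n n' z ` S"
  proof
    assume "cluster d S l n n' z n \<in> cluster d S l n n' z ` S"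
    then obtain b where b: "b \<in> S" "cluster d S l n n' z n = cluster d S l n n' z b" by blast
    show False using 2[OF b(1)] b(2) unfolding cluster_vals(1)[OF b(1)] cluster_vals(2) by blast
  qed
  moreover have "cluster d S l n n' z n' \<notin> cluster d S l n n' z ` insert n S"
  proof
    assume "cluster d S l n n' z n' \<in> cluster d S l n n' z ` insert n S"
    then consider "cluster d S l n n' z n' = cluster d S l n n' z n" | b where "b \<in> S" "cluster d S l n n' z n' = cluster d S l n n' z b" by blast
    then show False
    proof cases
      case 1
      then show False using 3 unfolding cluster_vals(2,3) by blast
    next
      case (2 b)
      show False using 1[OF 2(1)] 2(2) unfolding cluster_vals(1)[OF 2(1)] cluster_vals(3) by blast
    qed
  qed
  ultimately show "inj_on (cluster d S l n n' z) TT" using S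
    by (simp add: inj_on_insert del: insert_iff)
qed

lemma cluster_swp:
  "HI p (E2 d (conf d S)) (conf d TT) (ren (Transposition.transpose n n') TT \<circ> cluster d S l n n') = HI p (E2 d (conf d S)) (conf d TT) (cluster d S l n n' \<circ> swp)"
proof (rule hom_induced_eq)
  fix z assume z: "z \<in> topspace (E2 d (conf d S))"
  have t: "tau d S l (swp z) = tau d S l z" by (simp add: tau_def swp_def add.commute)
  have sx: "fst (fst (swp z)) = fst (fst z)" "snd (fst (swp z)) = snd z" "snd (swp z) = snd (fst z)" by (auto simp: swp_def)
  show "(ren (Transposition.transpose n n') TT \<circ> cluster d S l n n') z = (cluster d S l n n' \<circ> swp) z"
  proof
    fix i
    consider "i = n" | "i = n'" | "i \<in> S" "i \<noteq> n" "i \<noteq> n'" | "i \<notin> TT" by blast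
    then show "(ren (Transposition.transpose n n') TT \<circ> cluster d S l n n') z i = (cluster d S l n n' \<circ> swp) z i"
    proof cases
      case 4
      then show ?thesis using topspace_confD(2)[OF E2_D(1)[OF z]] by (auto simp: ren_def cluster_def sx extensional_def)
    qed (use S in \<open>auto simp: ren_def cluster_vals t sx Transposition.transpose_def\<close>)
  qed
qed

text \<open>Renaming n and l moves the base point of the cluster, which is what \<open>lam\<close>
  does to a triple. Inside the cluster, corresponding differences are positive multiples of the same
  vector; outside, the cluster is too small to matter.\<close>

lemma cluster_lam:
  "HI p (E2 d (conf d S)) (conf d TT) (ren (Transposition.transpose n l) TT \<circ> cluster d S l n n') = HI p (E2 d (conf d S)) (conf d TT) (cluster d S l n n' \<circ> lam)"
proof (rule HI_conf)
  have nl: "n \<noteq> l" "n' \<noteq> l" "n \<noteq> n'" using S l by auto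
  have i: "inj_on (Transposition.transpose n l) TT" "Transposition.transpose n l ` TT \<subseteq> TT" using l by (auto simp: inj_on_def Transposition.transpose_def)
  let ?E = "E2 d (conf d S)"
  let ?f = "ren (Transposition.transpose n l) TT \<circ> cluster d S l n n'" and ?g = "cluster d S l n n' \<circ> lam"
  show "continuous_map ?E (conf d TT) ?f" by (rule continuous_map_compose[OF cont_cluster cont_ren[OF i]])
  show "continuous_map ?E (conf d TT) ?g" by (rule continuous_map_compose[OF cont_lam cont_cluster])
  fix z k i assume z: "z \<in> topspace ?E" and ki: "k \<in> TT" "i \<in> TT" "k \<noteq> i"
  note zz = E2_D[OF z]
  let ?x = "fst (fst z)" and ?v = "snd (fst z)" and ?y = "snd z"
  have lz: "lam z \<in> topspace ?E" using z cont_lam[where d=d and B="conf d S"] by (auto simp: continuous_map_def)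
  have lx: "fst (fst (lam z)) = ?x" "snd (fst (lam z)) = (\<lambda>m. - ?v m)" "snd (lam z) = (\<lambda>m. ?y m - ?v m)" by (auto simp: lam_def)
  let ?s = "tau d S l z" and ?t = "tau d S l (lam z)"
  note s = tau_bounds[OF S(1) zz(1) l] and t = tau_bounds[OF S(1) E2_D(1)[OF lz] l, unfolded lx]
  let ?R = "S - {l}"
  have Sv: "?f z i = ?x i" "?g z i = ?x i" if "i \<in> ?R" for i
    using that S by (auto simp: ren_def cluster_vals lx Transposition.transpose_def)
  have nv: "?f z n = ?x l" "?g z n = (\<lambda>m. ?x l m - ?t * ?v m)"
    using l nl by (auto simp: ren_def cluster_vals lx)
  have lv: "?f z l = (\<lambda>m. ?x l m + ?s * ?v m)" "?g z l = ?x l"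
    using l nl by (auto simp: ren_def cluster_vals lx)
  have n'v: "?f z n' = (\<lambda>m. ?x l m + ?s * ?y m)" "?g z n' = (\<lambda>m. ?x l m + ?t * (?y m - ?v m))"
    using l nl by (auto simp: ren_def cluster_vals lx Transposition.transpose_def)
  have near: "nonopp p q" if i: "i \<in> ?R" and p: "nrm d (\<lambda>m. p m - (?x l m - ?x i m)) < nrm d (\<lambda>m. ?x l m - ?x i m)"
    and q: "nrm d (\<lambda>m. q m - (?x l m - ?x i m)) < nrm d (\<lambda>m. ?x l m - ?x i m)" for i p q
    by (rule nonopp_near1[OF p q])
  have pos: "nrm d (\<lambda>m. ?x l m - ?x i m) > 0" if "i \<in> ?R" for i using conf_nrm_pos[OF zz(1) l, of i] that by auto
  have z0: "nrm d (\<lambda>m. 0) = 0" by (simp add: nrm_def)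
  have t3: "?t * nrm d ?v < nrm d (\<lambda>m. ?x l m - ?x i m) / 3" if "i \<in> ?R" for i using t(3)[of i] that nrm_minus[of d ?v] by auto
  have TT': "k \<in> insert n (insert l (insert n' ?R))" "i \<in> insert n (insert l (insert n' ?R))" using ki l by auto
  show "okp (?f z) (?g z) k i"
  proof (rule okp_insert3[OF TT' ki(3)])
    show "okp (?f z) (?g z) i j" if "i \<in> ?R" "j \<in> ?R" for i j by (rule okp3) (simp_all only: Sv that)
    show "okp (?f z) (?g z) n i" if i: "i \<in> ?R" for i
      by (rule okp1, unfold nv Sv[OF i], rule near[OF i])
        (use t3[OF i] pos[OF i] t(1) z0 nrm_minus[of d "\<lambda>m. ?t * ?v m"] in \<open>auto simp: nrm_scale\<close>)
    show "okp (?f z) (?g z) l i" if i: "i \<in> ?R" for i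
      by (rule okp1, unfold lv Sv[OF i], rule near[OF i])
        (use s(3)[of i] i pos[OF i] s(1) z0 in \<open>auto simp: nrm_scale\<close>)
    show "okp (?f z) (?g z) n' i" if i: "i \<in> ?R" for i
      by (rule okp1, unfold n'v Sv[OF i], rule near[OF i])
        (use s(2)[of i] t(2)[of i] i pos[OF i] s(1) t(1) in \<open>auto simp: nrm_scale\<close>)
    show "okp (?f z) (?g z) n l" unfolding okp_def nv lv
      by (rule disjI1, rule nonopp_scale[OF s(1) t(1), of d "\<lambda>m. - ?v m"]) (use zz(2) in \<open>auto simp: nrm_minus\<close>)
    show "okp (?f z) (?g z) n n'"
      by (rule okp_sym, rule okp1, unfold nv n'v, rule nonopp_scale[OF s(1) t(1) zz(3)]) (auto simp: algebra_simps)
    show "okp (?f z) (?g z) l n'"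
      by (rule okp_sym, rule okp1, unfold lv n'v, rule nonopp_scale[OF s(1) t(1) zz(4)]) (auto simp: algebra_simps)
  qed
qed

text \<open>On the sphere \<open>b2\<close> the point n' stays near n while n runs around l. This is
  a nested orbit, with radii that differ only by positive factors from those in
  \<open>orb\<close>.\<close>

lemma cluster_b2:
  assumes u: "u \<in> carrier (HC d q S)"
  shows "HI (q + int d - 1 + int d - 1) (E2 d (conf d S)) (conf d TT) (cluster d S l n n') (T2 d (conf d S) q u) =
     oH d (q + int d - 1) (insert n S) n' n (oH d q S n l u)"
proof -
  let ?p = "q + int d - 1 + int d - 1" and ?C = "conf d S"
  have nS: "finite (insert n S)" "n \<in> insert n S" using S by auto
  note cn = cont_orb[OF S(1,2) l, of d] and cn' = cont_orb[OF nS(1) S(3) nS(2), of d]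
  let ?f = "cluster d S l n n' \<circ> b2 d" and ?g = "orb d (insert n S) n' n \<circ> map_prod (orb d S n l) id"
  have cf: "continuous_map (PP d ?C) (conf d TT) ?f" by (rule continuous_map_compose[OF cont_b(2) cont_cluster])
  have cg: "continuous_map (PP d ?C) (conf d TT) ?g" by (rule continuous_map_compose[OF continuous_map_PB[OF cn] cn'])
  have "HI ?p (PP d ?C) (conf d TT) ?f = HI ?p (PP d ?C) (conf d TT) ?g"
  proof (rule HI_conf[OF cf cg])
    fix z k i assume z: "z \<in> topspace (PP d ?C)" and ki: "k \<in> TT" "i \<in> TT" "k \<noteq> i"
    let ?x = "fst (fst z)" and ?v = "snd (fst z)" and ?w = "snd z"
    have zf: "fst z \<in> topspace (PB d ?C)" using PB_D(1)[OF z] .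
    note x = PB_D(1)[OF zf] and v = PB_D(2)[OF zf] and w = PB_D(2)[OF z]
    have bz: "b2 d z \<in> topspace (E2 d ?C)" using z cont_b(2)[where d=d and B="?C"] by (auto simp: continuous_map_def)
    have bx: "fst (fst (b2 d z)) = ?x" "snd (fst (b2 d z)) = ?v" "snd (b2 d z) = (\<lambda>m. ?v m + g1 d z * ?w m)" by (auto simp: b2_def)
    let ?z = "map_prod (orb d S n l) id z"
    have z': "fst ?z \<in> topspace (conf d (insert n S))" using zf cn by (auto simp: continuous_map_def)
    let ?t = "tau d S l (b2 d z)" and ?r = "rho d S l (fst z)" and ?r' = "rho d (insert n S) n ?z"
    note t = tau_bounds[OF S(1) E2_D(1)[OF bz] l, unfolded bx]
    note r = rho_bounds(1)[OF S(1) x l] and r' = rho_bounds(1)[OF nS(1) z' nS(2)]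
    have rl: "?r * nrm d ?v < nrm d (\<lambda>m. ?x l m - ?x i m) / 3" if "i \<in> S" "i \<noteq> l" for i using rho_lt[OF S(1) x l that] .
    have nl: "n \<noteq> l" "n' \<noteq> l" "n \<noteq> n'" using S l by auto
    \<comment> \<open>From n, the centre l is one of the points to be avoided; hence the inner
      displacement is below a third of the outer one.\<close>
    have r'l: "?r' * nrm d ?w < ?r * nrm d ?v / 3"
    proof -
      have "?r' * nrm d (snd ?z) < nrm d (\<lambda>m. fst ?z n m - fst ?z l m) / 3" by (rule rho_lt[OF nS(1) z' nS(2)]) (use l nl in auto)
      moreover have "nrm d (\<lambda>m. fst ?z n m - fst ?z l m) = nrm d (\<lambda>m. ?r * ?v m)"
        using nl by (simp add: orb_def)
      ultimately show ?thesis using r by (simp add: nrm_scale)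
    qed
    have Sv: "?f z i = ?x i" "?g z i = ?x i" if "i \<in> S" for i
      using that S by (auto simp: cluster_vals bx orb_def)
    have nv: "?f z n = (\<lambda>m. ?x l m + ?t * ?v m)" "?g z n = (\<lambda>m. ?x l m + ?r * ?v m)"
      using nl by (auto simp: cluster_vals bx orb_def)
    have n'v: "?f z n' = (\<lambda>m. ?x l m + ?t * (?v m + g1 d z * ?w m))" "?g z n' = (\<lambda>m. (?x l m + ?r * ?v m) + ?r' * ?w m)"
      using nl by (auto simp: cluster_vals bx orb_def)
    note g = PPd(3,5)[OF z]
    have z0: "nrm d (\<lambda>m. 0) = 0" by (simp add: nrm_def)
    have rr: "nrm d (\<lambda>m. ?r * ?v m + ?r' * ?w m) \<le> ?r * nrm d ?v + ?r' * nrm d ?w"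
      using nrm_triangle[of d "\<lambda>m. ?r * ?v m" "\<lambda>m. ?r' * ?w m"] r r' by (simp add: nrm_scale)
    show "okp (?f z) (?g z) k i"
    proof (rule okp_insert2[OF ki])
      show "okp (?f z) (?g z) i j" if "i \<in> S" "j \<in> S" for i j by (rule okp3) (simp_all only: Sv that)
      show "okp (?f z) (?g z) n i" if i: "i \<in> S" for i
      proof (cases "i = l")
        case True
        show ?thesis by (rule okp1, unfold nv Sv[OF i], rule nonopp_scale[OF t(1) r v]) (use True in auto)
      next
        case False
        have p: "nrm d (\<lambda>m. ?x l m - ?x i m) > 0" using conf_nrm_pos[OF x l i] False by auto
        show ?thesis by (rule okp1, unfold nv Sv[OF i], rule nonopp_near1[of d _ "\<lambda>m. ?x l m - ?x i m"])
          (use t(1) t(3)[OF i False] r rl[OF i False] p in \<open>auto simp: nrm_scale\<close>)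
      qed
      show "okp (?f z) (?g z) n' i" if i: "i \<in> S" for i
      proof (cases "i = l")
        case True
        have "nrm d (\<lambda>m. ?t * (?v m + g1 d z * ?w m) - ?t * ?v m) = ?t * (g1 d z * nrm d ?w)"
          using t(1) g nrm_scale[of d "?t * g1 d z" ?w] by (simp add: algebra_simps abs_mult)
        then have 1: "nrm d (\<lambda>m. ?t * (?v m + g1 d z * ?w m) - ?t * ?v m) < ?t * nrm d ?v" using g(2) t(1) by simp
        have "?r' * nrm d ?w < ?r * nrm d ?v" using r'l mult_pos_pos[OF r v] by linarith
        then have 2: "nrm d (\<lambda>m. ?r * ?v m + ?r' * ?w m - ?r * ?v m) < ?r * nrm d ?v" using r' by (simp add: nrm_scale)
        show ?thesis unfolding okp_def n'v True Sv[OF l]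
          using nonopp_near[OF t(1) r 1 2] by (simp add: algebra_simps)
      next
        case False
        have p: "nrm d (\<lambda>m. ?x l m - ?x i m) > 0" using conf_nrm_pos[OF x l i] False by auto
        have 1: "nrm d (\<lambda>m. ?x l m + ?t * (?v m + g1 d z * ?w m) - ?x i m - (?x l m - ?x i m)) < nrm d (\<lambda>m. ?x l m - ?x i m)"
          using t(2)[OF i False] t(1) p by (simp add: nrm_scale)
        have "nrm d (\<lambda>m. ?x l m + ?r * ?v m + ?r' * ?w m - ?x i m - (?x l m - ?x i m)) = nrm d (\<lambda>m. ?r * ?v m + ?r' * ?w m)"
          by (rule arg_cong[where f="nrm d"]) (auto simp: fun_eq_iff)
        then have 2: "nrm d (\<lambda>m. ?x l m + ?r * ?v m + ?r' * ?w m - ?x i m - (?x l m - ?x i m)) < nrm d (\<lambda>m. ?x l m - ?x i m)"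
          using rr r'l rl[OF i False] p by linarith
        show ?thesis by (rule okp1, unfold n'v Sv[OF i], rule nonopp_near1[OF 1 2])
      qed
      show "okp (?f z) (?g z) n' n"
        by (rule okp1, unfold n'v nv, rule nonopp_scale[of "?t * g1 d z" ?r' d ?w]) (use t(1) g r' w in \<open>auto simp: algebra_simps\<close>)
    qed
  qed
  then show ?thesis
    unfolding oH_def T2_def cross_natural[OF cn cross_carrier, symmetric] HI_comp[OF cont_b(2) cont_cluster]
      HI_comp[OF continuous_map_PB[OF cn] cn'] by simp
qed

text \<open>The cluster map turns the transpositions of n, n' and of n, l into \<open>swp\<close>
  and \<open>lam\<close>, so a symmetric functional pulls back to one covered by
  \<open>jacobi_functional\<close>.\<close>

lemma oH_jacobi:
  fixes \<phi> :: "(nat \<Rightarrow> nat \<Rightarrow> real) chain set \<Rightarrow> rat"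
  assumes d: "even d" "d > 0" and u: "u \<in> carrier (HC d q S)"
    and add: "\<And>a b. a \<in> carrier (HC d (q + int d - 1 + int d - 1) TT) \<Longrightarrow> b \<in> carrier (HC d (q + int d - 1 + int d - 1) TT) \<Longrightarrow>
      \<phi> (a \<otimes>\<^bsub>HC d (q + int d - 1 + int d - 1) TT\<^esub> b) = \<phi> a + \<phi> b"
    and inv: "\<And>\<sigma> a. \<sigma> permutes TT \<Longrightarrow> a \<in> carrier (HC d (q + int d - 1 + int d - 1) TT) \<Longrightarrow>
       \<phi> (rH d (q + int d - 1 + int d - 1) TT TT \<sigma> a) = \<phi> a"
  shows "\<phi> (oH d (q + int d - 1) (insert n S) n' n (oH d q S n l u)) = 0"
proof -
  let ?p = "q + int d - 1 + int d - 1" and ?C = "conf d S"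
  let ?c = "HI ?p (E2 d ?C) (conf d TT) (cluster d S l n n')"
  have p1: "Transposition.transpose n n' permutes TT" "Transposition.transpose n l permutes TT"
    using l by (auto intro: permutes_swap_id)
  have i1: "inj_on (Transposition.transpose n n') TT" "Transposition.transpose n n' ` TT \<subseteq> TT"
    "inj_on (Transposition.transpose n l) TT" "Transposition.transpose n l ` TT \<subseteq> TT"
    by (rule permutes_inj_on[OF p1(1)], rule equalityD1[OF permutes_image[OF p1(1)]], rule permutes_inj_on[OF p1(2)], rule equalityD1[OF permutes_image[OF p1(2)]])
  have "\<phi> (?c (T2 d ?C q u)) = 0"
  proof (rule jacobi_functional[OF d, where \<phi>="\<lambda>a. \<phi> (?c a)"])
    show "\<phi> (?c (a \<otimes>\<^bsub>homology_group ?p (E2 d ?C)\<^esub> b)) = \<phi> (?c a) + \<phi> (?c b)"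
      if "a \<in> carrier (homology_group ?p (E2 d ?C))" "b \<in> carrier (homology_group ?p (E2 d ?C))" for a b
      unfolding hom_induced_mult[OF that] by (rule add) (rule hom_induced_carrier)+
    show "\<phi> (?c (HI ?p (E2 d ?C) (E2 d ?C) lam a)) = \<phi> (?c a)" for a
      unfolding HI_comp[OF cont_lam cont_cluster] cluster_lam[symmetric] HI_comp[OF cont_cluster cont_ren[OF i1(3,4)], symmetric]
      using inv[OF p1(2) hom_induced_carrier] unfolding rH_def .
    show "\<phi> (?c (HI ?p (E2 d ?C) (E2 d ?C) swp a)) = \<phi> (?c a)" for a
      unfolding HI_comp[OF cont_swp_E2 cont_cluster] cluster_swp[symmetric] HI_comp[OF cont_cluster cont_ren[OF i1(1,2)], symmetric]
      using inv[OF p1(1) hom_induced_carrier] unfolding rH_def .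
  qed (rule u)
  then show ?thesis unfolding cluster_b2[OF u] .
qed

end

section \<open>Vanishing of symmetric primitive functionals\<close>

text \<open>The base keeps all points of S, while the extra point has to avoid only those in L. Thus
  L can grow one label at a time, up to L = S, where a configuration on one more point
  results.\<close>

definition sepd :: "nat set \<Rightarrow> ((nat \<Rightarrow> nat \<Rightarrow> real) \<times> (nat \<Rightarrow> real)) set"
  where "sepd L = {z. \<forall>j\<in>L. snd z \<noteq> fst z j}"

lemma EBc_coord: "i \<in> S \<Longrightarrow> continuous_map (EB d (conf d S)) (Euclidean_space d) (\<lambda>z. fst z i)"
  using continuous_map_compose[OF continuous_map_fst cont_conf_coord] by (simp add: o_def)

lemma openin_sepd:
  assumes "finite L" "L \<subseteq> S"
  shows "openin (EB d (conf d S)) (topspace (EB d (conf d S)) \<inter> sepd L)"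
  using assms
proof (induction L rule: finite_induct)
  case (insert j L)
  let ?X = "EB d (conf d S)"
  have c: "continuous_map ?X euclideanreal (\<lambda>z. snd z m - fst z j m)" for m
    using continuous_map_Euclidean_coord[OF continuous_map_Euclidean_space_diff[OF continuous_map_snd EBc_coord[of j S d]]] insert by auto
  have "topspace ?X \<inter> {z. snd z \<noteq> fst z j} = \<Union> ((\<lambda>m. {z \<in> topspace ?X. snd z m - fst z j m \<in> - {0}}) ` UNIV)"
    by (auto simp: fun_eq_iff)
  moreover have "openin ?X {z \<in> topspace ?X. snd z m - fst z j m \<in> - {0}}" for m
    by (rule openin_continuous_map_preimage[OF c]) auto
  ultimately have o1: "openin ?X (topspace ?X \<inter> {z. snd z \<noteq> fst z j})" by (simp only:) (rule openin_Union, blast)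
  have o2: "openin ?X (topspace ?X \<inter> sepd L)" using insert.IH insert.prems by blast
  have "topspace ?X \<inter> sepd (insert j L) = (topspace ?X \<inter> {z. snd z \<noteq> fst z j}) \<inter> (topspace ?X \<inter> sepd L)" by (auto simp: sepd_def)
  then show ?case using openin_Int[OF o1 o2] by (simp only:)
qed (simp add: sepd_def del: topspace_prod_topology)

definition farp where "farp S x = (x, far S x)"
definition orbp where "orbp d S j z = (fst z, \<lambda>m. fst z j m + rho d S j z * snd z m)"

lemma cont_farp: "finite S \<Longrightarrow> d > 0 \<Longrightarrow> L \<subseteq> S \<Longrightarrow> continuous_map (conf d S) (subtopology (EB d (conf d S)) (sepd L)) (farp S)"
proof -
  assume a: "finite S" "d > 0" "L \<subseteq> S"
  have "far S x \<noteq> x j" if "j \<in> S" for x j using far_gt[OF a(1) that, of x] by auto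
  then show ?thesis using cont_far[OF a(1,2)] a(3)
    by (auto simp: continuous_map_in_subtopology continuous_map_pairwise o_def farp_def sepd_def)
qed

lemma orb_ne2:
  assumes S: "finite S" and x: "fst z \<in> topspace (conf d S)" and j: "j \<in> S" and b: "b \<in> S" "b \<noteq> j"
  shows "(\<lambda>m. fst z j m + rho d S j z * snd z m) \<noteq> fst z b"
proof
  assume e: "(\<lambda>m. fst z j m + rho d S j z * snd z m) = fst z b"
  then have "fst z b m - fst z j m = rho d S j z * snd z m" for m by (metis add_diff_cancel_left')
  then have "nrm d (\<lambda>m. fst z b m - fst z j m) = rho d S j z * nrm d (snd z)"
    using rho_bounds(1)[OF S x j] by (simp add: nrm_scale)
  then show False using rho_bounds(3)[OF S x j b] conf_nrm_pos[OF x b(1) j b(2)] by linarith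
qed

lemma cont_orbp:
  assumes "finite S" "j \<in> S" "L \<subseteq> S"
  shows "continuous_map (PB d (conf d S)) (subtopology (EB d (conf d S)) (sepd L)) (orbp d S j)"
proof -
  have cf: "continuous_map (PB d (conf d S)) (Euclidean_space d) (\<lambda>z. fst z j)"
    using continuous_map_compose[OF continuous_map_subtopology_fst cont_conf_coord[OF assms(2)]] by (simp add: o_def)
  have "continuous_map (PB d (conf d S)) (Euclidean_space d) (\<lambda>z m. fst z j m + rho d S j z * snd z m)"
    by (intro continuous_map_Euclidean_space_add continuous_map_Euclidean_scale cf assms continuous_map_subtopology_snd
      continuous_map_from_subtopology cont_rho)
  then have "continuous_map (PB d (conf d S)) (EB d (conf d S)) (orbp d S j)"
    using continuous_map_subtopology_fst by (auto simp: continuous_map_pairwise o_def orbp_def)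
  moreover have "orbp d S j z \<in> sepd L" if z: "z \<in> topspace (PB d (conf d S))" for z
    using orb_ne[OF assms(1) PB_D(1,2)[OF z] assms(2)] assms(3) by (auto simp: sepd_def orbp_def)
  ultimately show ?thesis by (auto simp: continuous_map_in_subtopology)
qed

text \<open>Without punctures the fibre is contractible and the far section carries all classes.
  Each new puncture enlarges the homology by a kernel, which \<open>puncture_kernel\<close>
  identifies with orbit classes around the puncture. K varies in the induction because it is pushed
  forward when a puncture is filled.\<close>

lemma generation_sepd:
  assumes S: "finite S" and d: "d > 0" and L: "finite L" "L \<subseteq> S"
    and K: "subgroup K (homology_group (q + int d - 1) (subtopology (EB d (conf d S)) (sepd L)))"
    and s: "\<And>u. u \<in> carrier (HC d (q + int d - 1) S) \<Longrightarrow> HI (q + int d - 1) (conf d S) (subtopology (EB d (conf d S)) (sepd L)) (farp S) u \<in> K"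
    and o: "\<And>j u. j \<in> L \<Longrightarrow> u \<in> carrier (HC d q S) \<Longrightarrow> HI (q + int d - 1) (PB d (conf d S)) (subtopology (EB d (conf d S)) (sepd L)) (orbp d S j) (cross d (conf d S) q u) \<in> K"
  shows "carrier (homology_group (q + int d - 1) (subtopology (EB d (conf d S)) (sepd L))) \<subseteq> K"
  using L K s o
proof (induction L arbitrary: K rule: finite_induct)
  case empty
  let ?X = "EB d (conf d S)" and ?p = "q + int d - 1"
  have e: "subtopology ?X (sepd {}) = ?X" by (simp add: sepd_def)
  have cfar: "continuous_map (conf d S) ?X (farp S)" using cont_farp[OF S d, of "{}"] unfolding e by simp
  show ?case
  proof
    fix z assume z: "z \<in> carrier (homology_group ?p (subtopology ?X (sepd {})))"
    have "HI ?p ?X ?X id = HI ?p ?X ?X (farp S \<circ> fst)"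
    proof (rule hom_induced_line[where D=UNIV, simplified])
      show "continuous_map ?X ?X (farp S \<circ> fst)" by (rule continuous_map_compose[OF continuous_map_fst cfar])
    qed (auto simp: farp_def)
    then have "z = HI ?p (conf d S) ?X (farp S) (HI ?p ?X (conf d S) fst z)"
      using hom_induced_id z unfolding e HI_comp[OF continuous_map_fst cfar] by metis
    then show "z \<in> K" using empty(3)[OF hom_induced_carrier] unfolding e by metis
  qed
next
  case (insert j L)
  let ?X = "EB d (conf d S)" and ?p = "q + int d - 1" and ?L = "insert j L"
  let ?Y' = "subtopology ?X (sepd ?L)" and ?Y = "subtopology ?X (sepd L)"
  let ?i = "HI ?p ?Y' ?Y id"
  have j: "j \<in> S" "L \<subseteq> S" using insert.prems by auto
  interpret G': comm_group "homology_group ?p ?Y'" by simp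
  interpret i: group_hom "homology_group ?p ?Y'" "homology_group ?p ?Y" ?i by (rule hom_induced_group_hom)
  interpret K: subgroup K "homology_group ?p ?Y'" by (rule insert.prems(2))
  have ci: "continuous_map ?Y' ?Y id"
    by (auto simp: continuous_map_in_subtopology sepd_def)
  \<comment> \<open>By induction K already maps onto everything after puncture j is filled, so any z
    differs from some element of K by a class in the kernel.\<close>
  have "carrier (homology_group ?p ?Y) \<subseteq> ?i ` K"
  proof (rule insert.IH[OF j(2)])
    show "subgroup (?i ` K) (homology_group ?p ?Y)" by (rule i.subgroup_img_is_subgroup[OF insert.prems(2)])
    show "HI ?p (conf d S) ?Y (farp S) u \<in> ?i ` K" if "u \<in> carrier (HC d ?p S)" for u
      using insert.prems(3)[OF that] HI_comp[OF cont_farp[OF S d insert.prems(1)] ci, of ?p u] by (metis id_comp image_eqI)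
    show "HI ?p (PB d (conf d S)) ?Y (orbp d S k) (cross d (conf d S) q u) \<in> ?i ` K" if k: "k \<in> L" "u \<in> carrier (HC d q S)" for k u
    proof -
      have kS: "k \<in> S" using k j by auto
      show ?thesis using insert.prems(4)[of k u] k HI_comp[OF cont_orbp[OF S kS insert.prems(1)] ci, of ?p "cross d (conf d S) q u"] by (metis id_comp image_eqI insertI2)
    qed
  qed
  show ?case
  proof
    fix z assume z: "z \<in> carrier (homology_group ?p ?Y')"
    then obtain k where k: "k \<in> K" "?i z = ?i k" using \<open>carrier _ \<subseteq> ?i ` K\<close> i.hom_closed[OF z] by blast
    have kc: "k \<in> carrier (homology_group ?p ?Y')" using k K.mem_carrier by blast
    let ?w = "z \<otimes>\<^bsub>homology_group ?p ?Y'\<^esub> inv\<^bsub>homology_group ?p ?Y'\<^esub> k"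
    have w: "?w \<in> carrier (homology_group ?p ?Y')" using z kc by simp
    have iw: "?i ?w = \<one>\<^bsub>homology_group ?p ?Y\<^esub>" using z kc k(2) by (simp add: i.hom_inv i.H.r_inv)
    have se: "sepd L \<inter> {z. snd z \<noteq> fst z j} = sepd ?L" by (auto simp: sepd_def)
    have "?w \<in> K"
    proof (rule puncture_kernel[where B="conf d S" and F="sepd L" and c="\<lambda>x. x j" and r="rho d S j" and d=d and q=q and y="?w", unfolded se])
      show "openin ?X (topspace ?X \<inter> sepd L)" by (rule openin_sepd[OF insert.hyps(1) j(2)])
      show "continuous_map (conf d S) (Euclidean_space d) (\<lambda>x. x j)" by (rule cont_conf_coord[OF j(1)])
      show "continuous_map ?X euclideanreal (rho d S j)" by (rule cont_rho[OF S j(1)])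
      show "rho d S j z > 0" if "z \<in> topspace ?X" for z using rho_bounds(1)[OF S _ j(1)] that by auto
      show "(fst z, \<lambda>i. fst z j i + rho d S j z * snd z i) \<in> sepd L" if z: "z \<in> topspace ?X" for z
        unfolding sepd_def
      proof (intro CollectI ballI)
        fix b assume "b \<in> L"
        then have b: "b \<in> S" "b \<noteq> j" using j(2) insert.hyps(2) by auto
        show "snd (fst z, \<lambda>i. fst z j i + rho d S j z * snd z i) \<noteq> fst (fst z, \<lambda>i. fst z j i + rho d S j z * snd z i) b"
          using orb_ne2[OF S _ j(1) b, of z d] z by auto
      qed
      show "?w \<in> carrier (homology_group ?p ?Y')" by (rule w)
      show "?i ?w = \<one>\<^bsub>homology_group ?p ?Y\<^esub>" by (rule iw)
      show "?w \<in> K" if u: "u \<in> carrier (HC d q S)" and e: "?w = HI ?p (PB d (conf d S)) ?Y' (\<lambda>z. (fst z, \<lambda>i. fst z j i + rho d S j z * snd z i)) (cross d (conf d S) q u)" for u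
        using insert.prems(4)[of j u] u unfolding e orbp_def[abs_def] by simp
    qed
    moreover have "z = ?w \<otimes>\<^bsub>homology_group ?p ?Y'\<^esub> k" using z kc by (simp add: G'.m_assoc)
    ultimately show "z \<in> K" using K.m_closed k(1) by metis
  qed
qed

definition additive :: "('g, 'm) monoid_scheme \<Rightarrow> ('g \<Rightarrow> rat) \<Rightarrow> bool"
  where "additive G \<phi> \<longleftrightarrow> (\<forall>a\<in>carrier G. \<forall>b\<in>carrier G. \<phi> (a \<otimes>\<^bsub>G\<^esub> b) = \<phi> a + \<phi> b)"

lemma additiveD: "additive G \<phi> \<Longrightarrow> a \<in> carrier G \<Longrightarrow> b \<in> carrier G \<Longrightarrow> \<phi> (a \<otimes>\<^bsub>G\<^esub> b) = \<phi> a + \<phi> b"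
  by (simp add: additive_def)

lemma additive_one: "additive G \<phi> \<Longrightarrow> group G \<Longrightarrow> \<phi> \<one>\<^bsub>G\<^esub> = 0"
proof -
  assume a: "additive G \<phi>" "group G"
  interpret group G by fact
  show ?thesis using additiveD[OF a(1) one_closed one_closed] by simp
qed

lemma additive_inv: "additive G \<phi> \<Longrightarrow> group G \<Longrightarrow> a \<in> carrier G \<Longrightarrow> \<phi> (inv\<^bsub>G\<^esub> a) = - \<phi> a"
proof -
  assume a: "additive G \<phi>" "group G" "a \<in> carrier G"
  interpret group G by fact
  show ?thesis using additiveD[OF a(1) inv_closed[OF a(3)] a(3)] additive_one[OF a(1,2)] a(3) by simp
qed

lemma additive_comp: "additive H \<phi> \<Longrightarrow> f \<in> hom G H \<Longrightarrow> additive G (\<lambda>x. \<phi> (f x))"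
  by (auto simp: additive_def hom_def Pi_iff)

text \<open>Splitting off point a identifies the configurations on one more point with the bundle
  punctured at all of S. The zeros of \<phi> form a subgroup there, so it is enough that the
  generators belong to it.\<close>

lemma conf_generation:
  assumes S: "finite S" "a \<notin> S" and d: "d > 0"
    and add: "additive (HC d (q + int d - 1) (insert a S)) \<phi>"
    and s: "\<And>u. u \<in> carrier (HC d (q + int d - 1) S) \<Longrightarrow> \<phi> (sH d (q + int d - 1) S a u) = 0"
    and o: "\<And>j u. j \<in> S \<Longrightarrow> u \<in> carrier (HC d q S) \<Longrightarrow> \<phi> (oH d q S a j u) = 0"
    and z: "z \<in> carrier (HC d (q + int d - 1) (insert a S))"
  shows "\<phi> z = 0"
proof -
  let ?p = "q + int d - 1" and ?T = "insert a S"
  let ?Y = "subtopology (EB d (conf d S)) (sepd S)"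
  define h where "h = (\<lambda>z. (fst z)(a := snd z) :: nat \<Rightarrow> nat \<Rightarrow> real)"
  define g where "g = (\<lambda>z::nat \<Rightarrow> nat \<Rightarrow> real. (restrict z S, z a))"
  have ch: "continuous_map ?Y (conf d ?T) h"
    unfolding continuous_map_conf
  proof (intro conjI ballI)
    show "continuous_map ?Y (Euclidean_space d) (\<lambda>z. h z i)" if "i \<in> ?T" for i
      using that EBc_coord[of i S d] continuous_map_subtopology_snd by (cases "i = a") (auto simp: h_def continuous_map_from_subtopology)
    fix z assume "z \<in> topspace ?Y"
    then have z: "fst z \<in> topspace (conf d S)" "z \<in> sepd S" by auto
    show "h z \<in> extensional ?T" using topspace_confD(2)[OF z(1)] by (auto simp: h_def extensional_def)
    show "inj_on (h z) ?T" using topspace_confD(3)[OF z(1)] z(2) S(2) by (auto simp: h_def inj_on_def sepd_def)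
  qed
  have cg: "continuous_map (conf d ?T) ?Y g"
  proof -
    have "continuous_map (conf d ?T) (conf d S) (\<lambda>z. restrict z S)"
      unfolding continuous_map_conf using cont_conf_coord[of _ ?T d] topspace_confD(3)[of _ d ?T] by (auto simp: inj_on_def)
    then have "continuous_map (conf d ?T) (EB d (conf d S)) g"
      using cont_conf_coord[of a ?T d] by (auto simp: continuous_map_pairwise o_def g_def)
    moreover have "g z \<in> sepd S" if "z \<in> topspace (conf d ?T)" for z
      using topspace_confD(3)[OF that] S(2) by (auto simp: g_def sepd_def inj_on_def)
    ultimately show ?thesis by (auto simp: continuous_map_in_subtopology)
  qed
  let ?G = "homology_group ?p ?Y"
  let ?\<psi> = "\<lambda>x. \<phi> (HI ?p ?Y (conf d ?T) h x)"
  have add': "additive ?G ?\<psi>" by (rule additive_comp[OF add hom_induced_hom])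
  interpret G: comm_group ?G by simp
  define K where "K = {x \<in> carrier ?G. ?\<psi> x = 0}"
  have "carrier ?G \<subseteq> K"
  proof (rule generation_sepd[OF S(1) d S(1) order_refl])
    show "subgroup K ?G"
    proof (rule G.subgroupI)
      show "K \<subseteq> carrier ?G" by (auto simp: K_def)
      have "\<one>\<^bsub>?G\<^esub> \<in> K" using additive_one[OF add' G.group_axioms] unfolding K_def by blast
      then show "K \<noteq> {}" by blast
      show "inv\<^bsub>?G\<^esub> x \<in> K" if "x \<in> K" for x using that additive_inv[OF add' G.group_axioms] by (auto simp: K_def)
      show "x \<otimes>\<^bsub>?G\<^esub> y \<in> K" if "x \<in> K" "y \<in> K" for x y using that additiveD[OF add'] by (auto simp: K_def)
    qed
    show "HI ?p (conf d S) ?Y (farp S) u \<in> K" if u: "u \<in> carrier (HC d ?p S)" for u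
    proof -
      have "h \<circ> farp S = addfar a S" by (auto simp: h_def farp_def addfar_def)
      then have "HI ?p ?Y (conf d ?T) h (HI ?p (conf d S) ?Y (farp S) u) = sH d ?p S a u"
        unfolding sH_def HI_comp[OF cont_farp[OF S(1) d order_refl] ch] by simp
      then show ?thesis using s[OF u] by (simp add: K_def hom_induced_carrier)
    qed
    show "HI ?p (PB d (conf d S)) ?Y (orbp d S j) (cross d (conf d S) q u) \<in> K" if j: "j \<in> S" and u: "u \<in> carrier (HC d q S)" for j u
    proof -
      have "h \<circ> orbp d S j = orb d S a j" by (auto simp: h_def orbp_def orb_def)
      then have "HI ?p ?Y (conf d ?T) h (HI ?p (PB d (conf d S)) ?Y (orbp d S j) (cross d (conf d S) q u)) = oH d q S a j u"
        unfolding oH_def HI_comp[OF cont_orbp[OF S(1) j order_refl] ch] by simp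
      then show ?thesis using o[OF j u] by (simp add: K_def hom_induced_carrier)
    qed
  qed
  moreover have "HI ?p ?Y (conf d ?T) h (HI ?p (conf d ?T) ?Y g z) = z"
  proof -
    have "HI ?p (conf d ?T) (conf d ?T) (h \<circ> g) z = z"
    proof (rule hom_induced_id_gen[OF continuous_map_compose[OF cg ch] _ z])
      show "(h \<circ> g) x = x" if "x \<in> topspace (conf d ?T)" for x
        using topspace_confD(2)[OF that] by (auto simp: h_def g_def fun_eq_iff extensional_def restrict_def)
    qed
    then show ?thesis unfolding HI_comp[OF cg ch] .
  qed
  ultimately show ?thesis using hom_induced_carrier[of ?p "conf d ?T" "{}" ?Y "{}" g z] unfolding K_def by force
qed

section \<open>Symmetric and primitive functionals\<close>

definition sym_on :: "nat \<Rightarrow> int \<Rightarrow> nat set \<Rightarrow> nat set \<Rightarrow> ((nat \<Rightarrow> nat \<Rightarrow> real) chain set \<Rightarrow> rat) \<Rightarrow> bool"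
  where "sym_on d q S R \<phi> \<longleftrightarrow> (\<forall>\<sigma>. \<sigma> permutes R \<longrightarrow> (\<forall>z\<in>carrier (HC d q S). \<phi> (rH d q S S \<sigma> z) = \<phi> z))"

text \<open>T is S without b, written through \<open>insert\<close> because the target of
  \<open>sH\<close> has that form.\<close>

definition primitive :: "nat \<Rightarrow> int \<Rightarrow> nat set \<Rightarrow> nat set \<Rightarrow> ((nat \<Rightarrow> nat \<Rightarrow> real) chain set \<Rightarrow> rat) \<Rightarrow> bool"
  where "primitive d q S R \<phi> \<longleftrightarrow> (\<forall>b T. b \<in> R \<longrightarrow> b \<notin> T \<longrightarrow> S = insert b T \<longrightarrow> (\<forall>u\<in>carrier (HC d q T). \<phi> (sH d q T b u) = 0))"

lemma permutes_restrict:
  assumes "\<sigma> permutes R" "R \<subseteq> S"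
  shows "inj_on \<sigma> S" "\<sigma> ` S \<subseteq> S"
proof -
  have "\<sigma> permutes S" by (rule permutes_subset[OF assms])
  then show "inj_on \<sigma> S" "\<sigma> ` S \<subseteq> S" by (rule permutes_inj_on, rule equalityD1[OF permutes_image])
qed

lemma sym_on_sH:
  assumes S: "finite S" "a \<notin> S" and d: "d > 0" and R: "R \<subseteq> S" and sy: "sym_on d q (insert a S) R \<phi>"
  shows "sym_on d q S R (\<lambda>u. \<phi> (sH d q S a u))"
  unfolding sym_on_def
proof (intro allI impI ballI)
  fix \<sigma> u assume s: "\<sigma> permutes R" and u: "u \<in> carrier (HC d q S)"
  have sa: "\<sigma> a = a" using s S R by (meson permutes_not_in subsetD)
  have "sH d q S a (rH d q S S \<sigma> u) = rH d q (insert a S) (insert a S) \<sigma> (sH d q S a u)"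
    by (rule rH_sH[symmetric, OF S S d _ sa permutes_restrict(2)[OF s R]]) (use permutes_restrict(1)[OF s, of "insert a S"] R in auto)
  then show "\<phi> (sH d q S a (rH d q S S \<sigma> u)) = \<phi> (sH d q S a u)"
    using sy s sH_carrier by (simp add: sym_on_def)
qed

text \<open>The relabelling has to fix the centre j for \<open>rH_oH\<close> to apply; a centre
  inside R is handled by shrinking R beforehand.\<close>

lemma sym_on_oH:
  assumes S: "finite S" "a \<notin> S" and R: "R \<subseteq> S" "j \<notin> R" "j \<in> S" and sy: "sym_on d (q + int d - 1) (insert a S) R \<phi>"
  shows "sym_on d q S R (\<lambda>u. \<phi> (oH d q S a j u))"
  unfolding sym_on_def
proof (intro allI impI ballI)
  fix \<sigma> u assume s: "\<sigma> permutes R" and u: "u \<in> carrier (HC d q S)"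
  have sa: "\<sigma> a = a" "\<sigma> j = j" using s S R by (meson permutes_not_in subsetD)+
  have "oH d q S a j (rH d q S S \<sigma> u) = rH d (q + int d - 1) (insert a S) (insert a S) \<sigma> (oH d q S a j u)"
    by (rule rH_oH[symmetric, OF S S _ sa(1) permutes_restrict(2)[OF s R(1)] R(3) sa(2) u]) (use permutes_restrict(1)[OF s, of "insert a S"] R in auto)
  then show "\<phi> (oH d q S a j (rH d q S S \<sigma> u)) = \<phi> (oH d q S a j u)"
    using sy s oH_carrier by (simp add: sym_on_def)
qed

lemma sym_on_mono: "sym_on d q S R \<phi> \<Longrightarrow> R' \<subseteq> R \<Longrightarrow> sym_on d q S R' \<phi>"
  unfolding sym_on_def using permutes_subset by metis

lemma primitive_mono: "primitive d q S R \<phi> \<Longrightarrow> R' \<subseteq> R \<Longrightarrow> primitive d q S R' \<phi>"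
  unfolding primitive_def by blast

lemma primitiveD: "primitive d q S R \<phi> \<Longrightarrow> b \<in> R \<Longrightarrow> b \<notin> T \<Longrightarrow> S = insert b T \<Longrightarrow> u \<in> carrier (HC d q T) \<Longrightarrow> \<phi> (sH d q T b u) = 0"
  unfolding primitive_def by blast

text \<open>Far points commute, so a point of R that was far before a was added counts as far
  afterwards. This is where d at least 2 enters.\<close>

lemma primitive_sH:
  assumes S: "finite S" "a \<notin> S" and d: "d \<ge> 2" and R: "R \<subseteq> S" and pr: "primitive d q (insert a S) R \<phi>"
  shows "primitive d q S R (\<lambda>u. \<phi> (sH d q S a u))"
  unfolding primitive_def
proof (intro allI impI ballI)
  fix b T u assume b: "b \<in> R" "b \<notin> T" "S = insert b T" and u: "u \<in> carrier (HC d q T)"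
  have T: "finite T" "a \<notin> T" "b \<notin> insert a T" using S b by auto
  have "sH d q S a (sH d q T b u) = sH d q (insert a T) b (sH d q T a u)"
    using sH_commute[OF T d] b(3) by simp
  then show "\<phi> (sH d q S a (sH d q T b u)) = 0"
    using primitiveD[OF pr b(1) T(3) _ sH_carrier] b(3) by (simp add: insert_commute)
qed

lemma primitive_oH:
  assumes S: "finite S" "a \<notin> S" and d: "d > 0" and R: "R \<subseteq> S" "j \<notin> R" "j \<in> S" and pr: "primitive d (q + int d - 1) (insert a S) R \<phi>"
  shows "primitive d q S R (\<lambda>u. \<phi> (oH d q S a j u))"
  unfolding primitive_def
proof (intro allI impI ballI)
  fix b T u assume b: "b \<in> R" "b \<notin> T" "S = insert b T" and u: "u \<in> carrier (HC d q T)"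
  have T: "finite T" "a \<notin> T" "b \<notin> insert a T" "j \<in> T" using S b R by auto
  have "oH d q S a j (sH d q T b u) = sH d (q + int d - 1) (insert a T) b (oH d q T a j u)"
    using oH_sH[OF T(1-3) d T(4) u] b(3) by simp
  then show "\<phi> (oH d q S a j (sH d q T b u)) = 0"
    using primitiveD[OF pr b(1) T(3) _ oH_carrier] b(3) by (simp add: insert_commute)
qed

text \<open>Two disjoint pairs orbit, a around j and l around m. Exchanging the pairs is a
  relabelling, which \<phi> does not notice, but it reverses the order of the two spheres, which
  costs a sign for even d. So the value equals its own negative.\<close>

lemma top_classes_swap:
  assumes d: "even d" "d \<ge> 2" and dist: "distinct [a, j, l, m]"
    and add: "additive (HC d (q + int d - 1 + int d - 1) {a, l, j, m}) \<phi>"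
    and sy: "sym_on d (q + int d - 1 + int d - 1) {a, l, j, m} {a, l, j, m} \<phi>"
    and c: "c \<in> carrier (HC d q {})"
  shows "\<phi> (oH d (q + int d - 1) {l, j, m} a j (oH d q {j, m} l m (sH d q {m} j (sH d q {} m c)))) = 0"
proof -
  have d0: "d > 0" using d by simp
  let ?p = "q + int d - 1 + int d - 1"
  let ?\<sigma> = "Transposition.transpose a l \<circ> Transposition.transpose j m"
  have sp: "?\<sigma> permutes {a, l, j, m}" by (intro permutes_compose permutes_swap_id) auto
  have sv: "?\<sigma> a = l" "?\<sigma> l = a" "?\<sigma> j = m" "?\<sigma> m = j" using dist by (auto simp: Transposition.transpose_def)
  have inj: "inj_on ?\<sigma> A" for A using permutes_inj[OF sp] by (rule inj_on_subset) auto
  let ?G = "HC d q {j, m}"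
  interpret G: comm_group ?G by simp
  define y where "y = sH d q {m} j (sH d q {} m c)"
  have y: "y \<in> carrier ?G" using sH_carrier[of d q "{m}" j] by (simp add: y_def)
  \<comment> \<open>The two centres are far points over the empty configuration, and far points
    commute; hence their class is unchanged by the exchange.\<close>
  have ry: "rH d q {j, m} {j, m} ?\<sigma> y = y"
  proof -
    have "rH d q (insert j {m}) (insert m {j}) ?\<sigma> y = sH d q {j} m (rH d q {m} {j} ?\<sigma> (sH d q {} m c))"
      unfolding y_def by (rule rH_sH) (use dist d0 inj sv in auto)
    also have "rH d q (insert m {}) (insert j {}) ?\<sigma> (sH d q {} m c) = sH d q {} j (rH d q {} {} ?\<sigma> c)"
      by (rule rH_sH) (use dist d0 inj sv in auto)
    also have "rH d q {} {} ?\<sigma> c = c" by (rule rH_id[OF c]) auto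
    also have "sH d q {j} m (sH d q {} j c) = sH d q {m} j (sH d q {} m c)"
      by (rule sH_commute[of "{}" m j d q c]) (use dist d in auto)
    finally show ?thesis by (simp only: insert_commute[of m j] y_def)
  qed
  let ?i = "inv\<^bsub>?G\<^esub> y"
  have ri: "rH d q {j, m} {j, m} ?\<sigma> ?i = ?i"
    using group_hom.hom_inv[OF hom_induced_group_hom, of y q "conf d {j, m}" "{}" "conf d {j, m}" "{}" "ren ?\<sigma> {j, m}"] y ry by (simp add: rH_def)
  have iv: "?i \<in> carrier ?G" using y by simp
  have "oH d (q + int d - 1) (insert l {j, m}) a j (oH d q {j, m} l m y) = oH d (q + int d - 1) (insert a {j, m}) l m (oH d q {j, m} a j ?i)"
    by (rule oH_swap) (use dist d d0 y in auto)
  then have "\<phi> (oH d (q + int d - 1) {l, j, m} a j (oH d q {j, m} l m y)) = \<phi> (oH d (q + int d - 1) {a, j, m} l m (oH d q {j, m} a j ?i))" by simp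
  also have "\<dots> = \<phi> (rH d ?p {a, l, j, m} {a, l, j, m} ?\<sigma> (oH d (q + int d - 1) {a, j, m} l m (oH d q {j, m} a j ?i)))"
    using sy sp oH_carrier[of d "q + int d - 1" "{a, j, m}" l m] by (simp add: sym_on_def insert_commute)
  also have "rH d ?p {a, l, j, m} {a, l, j, m} ?\<sigma> (oH d (q + int d - 1) {a, j, m} l m (oH d q {j, m} a j ?i)) =
    oH d (q + int d - 1) (insert l {j, m}) a j (rH d (q + int d - 1) (insert a {j, m}) (insert l {j, m}) ?\<sigma> (oH d q {j, m} a j ?i))"
  proof -
    have "rH d ?p (insert l (insert a {j, m})) (insert a (insert l {j, m})) ?\<sigma> (oH d (q + int d - 1) (insert a {j, m}) l m (oH d q {j, m} a j ?i)) =
      oH d (q + int d - 1) (insert l {j, m}) a j (rH d (q + int d - 1) (insert a {j, m}) (insert l {j, m}) ?\<sigma> (oH d q {j, m} a j ?i))"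
      by (rule rH_oH) (use dist inj sv oH_carrier in auto)
    then show ?thesis by (simp only: insert_commute[of l a])
  qed
  also have "rH d (q + int d - 1) (insert a {j, m}) (insert l {j, m}) ?\<sigma> (oH d q {j, m} a j ?i) = oH d q {j, m} l m (rH d q {j, m} {j, m} ?\<sigma> ?i)"
    by (rule rH_oH) (use dist inj sv iv in auto)
  also have "\<phi> (oH d (q + int d - 1) (insert l {j, m}) a j (oH d q {j, m} l m (rH d q {j, m} {j, m} ?\<sigma> ?i))) = - \<phi> (oH d (q + int d - 1) {l, j, m} a j (oH d q {j, m} l m y))"
    unfolding ri
    using additive_inv[OF additive_comp[OF additive_comp[OF add oH_hom[of d "q + int d - 1" "{l, j, m}" a j]] oH_hom[of d q "{j, m}" l m]] G.group_axioms y] by simp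
  finally show ?thesis unfolding y_def by simp
qed

lemma HC_negative: "q < 0 \<Longrightarrow> additive (HC d q S) \<phi> \<Longrightarrow> z \<in> carrier (HC d q S) \<Longrightarrow> \<phi> z = 0"
proof -
  assume q: "q < 0" and a: "additive (HC d q S) \<phi>" and z: "z \<in> carrier (HC d q S)"
  have "z = \<one>\<^bsub>HC d q S\<^esub>" using trivial_homology_group[OF q, of "conf d S"] z by (auto simp: trivial_group_def)
  then show "\<phi> z = 0" using additive_one[OF a] by simp
qed

text \<open>The degree is an arbitrary q here, and the degree q0 of the orbit classes is solved for;
  q0 may be negative, where homology vanishes.\<close>

lemma conf_generation':
  assumes S: "finite S" "a \<notin> S" and d: "d > 0"
    and add: "additive (HC d q (insert a S)) \<phi>"
    and s: "\<And>u. u \<in> carrier (HC d q S) \<Longrightarrow> \<phi> (sH d q S a u) = 0"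
    and o: "\<And>q0 j u. q = q0 + int d - 1 \<Longrightarrow> j \<in> S \<Longrightarrow> u \<in> carrier (HC d q0 S) \<Longrightarrow> \<phi> (oH d q0 S a j u) = 0"
    and z: "z \<in> carrier (HC d q (insert a S))"
  shows "\<phi> z = 0"
proof -
  obtain q0 where q: "q = q0 + int d - 1" by (rule that[of "q - int d + 1"]) simp
  show ?thesis
    using conf_generation[OF S d, of q0 \<phi> z] add s o z unfolding q by blast
qed

text \<open>Only classes with a orbiting some j matter. If j in turn orbits a third point,
  \<open>oH_jacobi\<close> applies. If j is far, a symmetric primitive functional on the points
  other than a and j remains: three or more are left to the induction, a single one has nothing to
  orbit, and for two the other orbit is killed by \<open>top_classes_swap\<close>.\<close>

lemma symmetric_primitive_even:
  assumes d: "even d" "d \<ge> 2" and "finite S" "card S \<ge> 3" "additive (HC d q S) \<phi>" "sym_on d q S S \<phi>" "primitive d q S S \<phi>"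
    "z \<in> carrier (HC d q S)"
  shows "\<phi> z = 0"
  using assms(3-)
proof (induction "card S" arbitrary: S q \<phi> z rule: less_induct)
  case less
  have d0: "d > 0" using d by simp
  obtain a where aS: "a \<in> S" using less.prems(2) by fastforce
  define S1 where "S1 = S - {a}"
  have a: "S = insert a S1" "a \<notin> S1" "finite S1"
    using aS less.prems(1) unfolding S1_def by auto
  have S1: "card S1 \<ge> 2" using less.prems(2) a by simp
  show ?case
  proof (rule conf_generation'[OF a(3,2) d0])
    show "additive (HC d q (insert a S1)) \<phi>" "z \<in> carrier (HC d q (insert a S1))" using less.prems a by auto
    show "\<phi> (sH d q S1 a u) = 0" if "u \<in> carrier (HC d q S1)" for u
      using primitiveD[OF less.prems(5) _ a(2,1) that] a(1) by simp
    fix q0 j u assume q: "q = q0 + int d - 1" and j: "j \<in> S1" and u: "u \<in> carrier (HC d q0 S1)"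
    have add: "additive (HC d (q0 + int d - 1) (insert a S1)) \<phi>" using less.prems(3) q a(1) by simp
    define S2 where "S2 = S1 - {j}"
    have S2: "S1 = insert j S2" "j \<notin> S2" "finite S2" using j a(3) unfolding S2_def by auto
    have aS: "a \<notin> S2" "a \<notin> insert j S2" "a \<noteq> j" using a S2 by auto
    have cS2: "card S = card S2 + 2" using a S2 by simp
    have add1: "additive (HC d q0 (insert j S2)) (\<lambda>u. \<phi> (oH d q0 S1 a j u))"
      using additive_comp[OF add oH_hom] unfolding S2(1) .
    show "\<phi> (oH d q0 S1 a j u) = 0"
    proof (rule conf_generation'[OF S2(3,2) d0 add1])
      show "u \<in> carrier (HC d q0 (insert j S2))" using u S2 by simp
    next
      fix q1 l w assume q1: "q0 = q1 + int d - 1" and l: "l \<in> S2" and w: "w \<in> carrier (HC d q1 S2)"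
      show "\<phi> (oH d q0 S1 a j (oH d q1 S2 j l w)) = 0"
        unfolding q1 S2(1)
      proof (rule oH_jacobi[OF S2(3,2) aS(2) l d(1) d0 w])
        show "\<phi> (x \<otimes>\<^bsub>HC d (q1 + int d - 1 + int d - 1) (insert a (insert j S2))\<^esub> y) = \<phi> x + \<phi> y"
          if "x \<in> carrier (HC d (q1 + int d - 1 + int d - 1) (insert a (insert j S2)))" "y \<in> carrier (HC d (q1 + int d - 1 + int d - 1) (insert a (insert j S2)))" for x y
          using additiveD[OF add, of x y] that unfolding q1 S2(1) by blast
        show "\<phi> (rH d (q1 + int d - 1 + int d - 1) (insert a (insert j S2)) (insert a (insert j S2)) \<sigma> x) = \<phi> x"
          if "\<sigma> permutes insert a (insert j S2)" "x \<in> carrier (HC d (q1 + int d - 1 + int d - 1) (insert a (insert j S2)))" for \<sigma> x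
          using less.prems(4) that unfolding sym_on_def q q1 a(1) S2(1) by blast
      qed
    next
      fix w assume w: "w \<in> carrier (HC d q0 S2)"
      define \<psi> where "\<psi> = (\<lambda>w. \<phi> (oH d q0 S1 a j (sH d q0 S2 j w)))"
      have add2: "additive (HC d q0 S2) \<psi>" unfolding \<psi>_def by (rule additive_comp[OF add1 sH_hom])
      have sy0: "sym_on d (q0 + int d - 1) (insert a S1) S2 \<phi>" using sym_on_mono[OF less.prems(4), of S2] unfolding q a(1) S2(1) by blast
      have pr0: "primitive d (q0 + int d - 1) (insert a S1) S2 \<phi>" using primitive_mono[OF less.prems(5), of S2] unfolding q a(1) S2(1) by blast
      have sy1: "sym_on d q0 (insert j S2) S2 (\<lambda>u. \<phi> (oH d q0 S1 a j u))"
        using sym_on_oH[OF a(3,2) _ S2(2) j sy0] unfolding S2(1) by blast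
      have pr1: "primitive d q0 (insert j S2) S2 (\<lambda>u. \<phi> (oH d q0 S1 a j u))"
        using primitive_oH[OF a(3,2) d0 _ S2(2) j pr0] unfolding S2(1) by blast
      have sy2: "sym_on d q0 S2 S2 \<psi>" unfolding \<psi>_def by (rule sym_on_sH[OF S2(3,2) d0 order_refl sy1])
      have pr2: "primitive d q0 S2 S2 \<psi>" unfolding \<psi>_def by (rule primitive_sH[OF S2(3,2) d(2) order_refl pr1])
      consider "card S2 \<ge> 3" | "card S2 = 1" | "card S2 = 2" using cS2 less.prems(2) by linarith
      then have "\<psi> w = 0"
      proof cases
        case 1
        show ?thesis by (rule less.hyps[OF _ S2(3) 1 add2 sy2 pr2 w]) (simp add: cS2)
      next
        case 2
        then obtain l where l: "S2 = {l}" by (auto simp: card_1_singleton_iff)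
        show ?thesis
          by (rule conf_generation'[of "{}" l d q0 \<psi> w]) (use d0 add2 w primitiveD[OF pr2, of l "{}"] l in auto)
      next
        case 3
        then obtain l m where lm: "S2 = {l, m}" "l \<noteq> m" by (auto simp: card_2_iff)
        have T: "{m} \<union> {l} = S2" using lm by auto
        have z2: "\<psi> (oH d q1 {m} l m v) = 0" if q1: "q0 = q1 + int d - 1" and v: "v \<in> carrier (HC d q1 {m})" for q1 v
        proof -
          have add3: "additive (HC d q1 {m}) (\<lambda>v. \<psi> (oH d q1 {m} l m v))"
            using additive_comp[of "HC d q0 S2" \<psi> "oH d q1 {m} l m" "HC d q1 {m}"] add2 oH_hom[of d q1 "{m}" l m] unfolding q1 lm(1) by blast
          show ?thesis
          proof (rule conf_generation'[of "{}" m d q1 "\<lambda>v. \<psi> (oH d q1 {m} l m v)" v])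
            fix c assume c: "c \<in> carrier (HC d q1 {})"
            have dist: "distinct [a, j, l, m]" using aS S2 lm by auto
            have st: "sym_on d (q1 + int d - 1 + int d - 1) {a, l, j, m} {a, l, j, m} \<phi>" "additive (HC d (q1 + int d - 1 + int d - 1) {a, l, j, m}) \<phi>"
            proof -
              have "S = {a, l, j, m}" using a S2 lm by auto
              then show "sym_on d (q1 + int d - 1 + int d - 1) {a, l, j, m} {a, l, j, m} \<phi>" "additive (HC d (q1 + int d - 1 + int d - 1) {a, l, j, m}) \<phi>"
                using less.prems(3,4) unfolding q q1 by simp_all
            qed
            have "sH d q0 S2 j (oH d q1 {m} l m (sH d q1 {} m c)) = oH d q1 (insert j {m}) l m (sH d q1 {m} j (sH d q1 {} m c))"
              unfolding q1 lm(1) by (rule oH_sH[symmetric]) (use dist d0 sH_carrier in auto)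
            then have "\<psi> (oH d q1 {m} l m (sH d q1 {} m c)) = \<phi> (oH d (q1 + int d - 1) {l, j, m} a j (oH d q1 {j, m} l m (sH d q1 {m} j (sH d q1 {} m c))))"
              unfolding \<psi>_def q1 S2(1) lm(1) by (simp add: insert_commute)
            also have "\<dots> = 0" by (rule top_classes_swap[OF d dist st(2,1) c])
            finally show "\<psi> (oH d q1 {m} l m (sH d q1 {} m c)) = 0" .
          qed (use d0 v add3 in auto)
        qed
        show ?thesis
        proof (rule conf_generation'[of "{m}" l d q0 \<psi> w])
          show "\<psi> (sH d q0 {m} l u) = 0" if "u \<in> carrier (HC d q0 {m})" for u
            using primitiveD[OF pr2 _ _ _ that, of l] lm by auto
          show "\<psi> (oH d q1 {m} l i u) = 0" if "q0 = q1 + int d - 1" "i \<in> {m}" "u \<in> carrier (HC d q1 {m})" for q1 i u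
            using z2[of q1 u] that by simp
        qed (use lm d0 add2 w in auto)
      qed
      then show "\<phi> (oH d q0 S1 a j (sH d q0 S2 j w)) = 0" by (simp add: \<psi>_def)
    qed
  qed
qed

text \<open>For odd d the fibre sphere has even dimension, and its antipodal map has degree
  -1.\<close>

lemma oH_symmetric_odd:
  assumes "odd d" and S: "finite S" "a \<notin> S" and j: "j \<in> S" and u: "u \<in> carrier (HC d q S)"
  shows "rH d (q + int d - 1) (insert a S) (insert a S) (Transposition.transpose a j) (oH d q S a j u) =
    inv\<^bsub>HC d (q + int d - 1) (insert a S)\<^esub> oH d q S a j u"
  unfolding oH_symmetric[OF S j] cross_negv_odd[OF assms(1) u] unfolding oH_def
  by (rule group_hom.hom_inv[OF hom_induced_group_hom cross_carrier])

text \<open>Removing a point outside R lowers the size of S and, for the orbit classes, either the degree by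
  d - 1 at the cost of one point of R, or only the degree. When R = S the orbit classes are killed by
  the sign of the antipodal map for odd d, and by the Jacobi relation for even d.\<close>

lemma primitive_vanishes:
  assumes d: "d \<ge> 2" and "finite S" "R \<subseteq> S" "additive (HC d q S) \<phi>" "sym_on d q S R \<phi>" "primitive d q S R \<phi>"
    "q < (int d - 1) * (int (card R) - (if odd d then 0 else 1))" "z \<in> carrier (HC d q S)"
  shows "\<phi> z = 0"
  using assms(2-)
proof (induction "card S" arbitrary: S R q \<phi> z rule: less_induct)
  case less
  have d0: "d > 0" using d by simp
  let ?e = "if odd d then 0 else 1 :: int"
  show ?case
  proof (cases "q < 0")
    case True
    then show ?thesis using HC_negative less.prems by blast
  next
    case q: False
    have cR: "card R > 0"
    proof (rule ccontr)
      assume "\<not> card R > 0"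
      then have "(int d - 1) * (int (card R) - ?e) \<le> 0" using d by (intro mult_nonneg_nonpos) auto
      then show False using q less.prems(6) by linarith
    qed
    show ?thesis
    proof (cases "R = S")
      case False
      then obtain a where aR: "a \<in> S" "a \<notin> R" using less.prems(2) by blast
      define S1 where "S1 = S - {a}"
      have a: "S = insert a S1" "a \<notin> S1" "finite S1" "R \<subseteq> S1"
        using aR less.prems(1,2) unfolding S1_def by auto
      have cS: "card S1 < card S" using a by simp
      note add = less.prems(3)[unfolded a(1)] and sy = less.prems(4)[unfolded a(1)] and pr = less.prems(5)[unfolded a(1)]
      show ?thesis
      proof (rule conf_generation'[OF a(3,2) d0 add])
        show "z \<in> carrier (HC d q (insert a S1))" using less.prems(7) a(1) by simp
        show "\<phi> (sH d q S1 a u) = 0" if u: "u \<in> carrier (HC d q S1)" for u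
          by (rule less.hyps[OF cS a(3,4) additive_comp[OF add sH_hom] sym_on_sH[OF a(3,2) d0 a(4) sy] primitive_sH[OF a(3,2) d a(4) pr] less.prems(6) u])
        fix q0 j u assume q0: "q = q0 + int d - 1" and j: "j \<in> S1" and u: "u \<in> carrier (HC d q0 S1)"
        have R: "R - {j} \<subseteq> S1" "j \<notin> R - {j}" "R - {j} \<subseteq> R" using a(4) by auto
        have "int (card (R - {j})) \<ge> int (card R) - 1"
          using cR by (simp add: card_Diff_singleton_if of_nat_diff)
        then have "(int d - 1) * (int (card (R - {j})) - ?e) \<ge> (int d - 1) * (int (card R) - 1 - ?e)"
          using d by (intro mult_left_mono) auto
        moreover have "(int d - 1) * (int (card R) - 1 - ?e) = (int d - 1) * (int (card R) - ?e) - (int d - 1)" by (simp add: algebra_simps)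
        ultimately have b: "q0 < (int d - 1) * (int (card (R - {j})) - ?e)" using less.prems(6) q0 by linarith
        show "\<phi> (oH d q0 S1 a j u) = 0"
          by (rule less.hyps[OF cS a(3) R(1) additive_comp[OF add[unfolded q0] oH_hom]
              sym_on_oH[OF a(3,2) R(1,2) j sym_on_mono[OF sy[unfolded q0] R(3)]] primitive_oH[OF a(3,2) d0 R(1,2) j primitive_mono[OF pr[unfolded q0] R(3)]] b u])
      qed
    next
      case RS: True
      obtain a where aS: "a \<in> S" using cR RS by (metis card.empty ex_in_conv less_irrefl)
      define S1 where "S1 = S - {a}"
      have a: "S = insert a S1" "a \<notin> S1" "finite S1"
        using aS less.prems(1) unfolding S1_def by auto
      note add = less.prems(3)[unfolded a(1)]
      have prim: "\<phi> (sH d q S1 a u) = 0" if "u \<in> carrier (HC d q S1)" for u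
        using primitiveD[OF less.prems(5) _ a(2,1) that] a(1) RS by simp
      have z: "z \<in> carrier (HC d q (insert a S1))" using less.prems(7) a(1) by simp
      show ?thesis
      proof (cases "odd d")
        case True
        show ?thesis
        proof (rule conf_generation'[OF a(3,2) d0 add prim _ z])
          fix q0 j u assume q0: "q = q0 + int d - 1" and j: "j \<in> S1" and u: "u \<in> carrier (HC d q0 S1)"
          have p: "Transposition.transpose a j permutes R" using j a RS by (intro permutes_swap_id) auto
          have "\<phi> (oH d q0 S1 a j u) = \<phi> (rH d q S S (Transposition.transpose a j) (oH d q0 S1 a j u))"
            using less.prems(4) p oH_carrier[of d q0 S1 a j u] unfolding sym_on_def a(1) q0 by metis
          also have "\<dots> = - \<phi> (oH d q0 S1 a j u)"
            unfolding a(1) q0 oH_symmetric_odd[OF True a(3,2) j u]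
            by (rule additive_inv[OF add[unfolded q0]]) (simp_all add: oH_carrier)
          finally show "\<phi> (oH d q0 S1 a j u) = 0" by simp
        qed
      next
        case False
        then have ev: "even d" by simp
        have "card S > 0" using cR RS by simp
        then consider "card S \<ge> 3" | "card S = 2" | "card S = 1" by linarith
        then show ?thesis
        proof cases
          case 1
          show ?thesis by (rule symmetric_primitive_even[OF ev d less.prems(1) 1 less.prems(3) _ _ less.prems(7)]) (use less.prems RS in auto)
        next
          case 2
          show ?thesis
          proof (rule conf_generation'[OF a(3,2) d0 add prim _ z])
            fix q0 j u assume q0: "q = q0 + int d - 1" and u: "u \<in> carrier (HC d q0 S1)"
            \<comment> \<open>For two points and even d the bound reads q < d - 1, so an orbit class
              would have to come from negative degree.\<close>
            have "q0 < 0" using less.prems(6) q0 2 RS ev by simp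
            then show "\<phi> (oH d q0 S1 a j u) = 0" using HC_negative[OF _ additive_comp[OF add[unfolded q0] oH_hom] u] by simp
          qed
        next
          case 3
          \<comment> \<open>For one point and even d the bound reads q < 0, which is excluded
            here.\<close>
          then show ?thesis using less.prems(6) q RS ev by simp
        qed
      qed
    qed
  qed
qed

section \<open>Traces on subquotients\<close>

definition subsp :: "('s \<Rightarrow> rat) set \<Rightarrow> bool"
  where "subsp V \<longleftrightarrow> (\<lambda>s. 0) \<in> V \<and> (\<forall>f\<in>V. \<forall>g\<in>V. \<forall>r. (\<lambda>s. f s + r * g s) \<in> V)"

lemma subsp_comb: "subsp V \<Longrightarrow> f \<in> V \<Longrightarrow> g \<in> V \<Longrightarrow> (\<lambda>s. f s + r * g s) \<in> V" by (simp add: subsp_def)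
lemma subsp_zero: "subsp V \<Longrightarrow> (\<lambda>s. 0) \<in> V" by (simp add: subsp_def)
lemma subsp_diff: "subsp V \<Longrightarrow> f \<in> V \<Longrightarrow> g \<in> V \<Longrightarrow> (\<lambda>s. f s - g s) \<in> V"
  using subsp_comb[of V f g "-1"] by simp
lemma subsp_scale: "subsp V \<Longrightarrow> g \<in> V \<Longrightarrow> (\<lambda>s. r * g s) \<in> V"
  using subsp_comb[of V "\<lambda>s. 0" g r] subsp_zero by auto
lemma subsp_add: "subsp V \<Longrightarrow> f \<in> V \<Longrightarrow> g \<in> V \<Longrightarrow> (\<lambda>s. f s + g s) \<in> V"
  using subsp_comb[of V f g 1] by simp

lemma subsp_sum:
  assumes "finite A" "subsp V" "\<And>a. a \<in> A \<Longrightarrow> f a \<in> V"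
  shows "(\<lambda>s. \<Sum>a\<in>A. f a s) \<in> V"
  using assms
proof (induction A rule: finite_induct)
  case (insert a A)
  then show ?case using subsp_add[of V "f a" "\<lambda>s. \<Sum>a\<in>A. f a s"] by simp
qed (simp add: subsp_zero)

lemma lincomb_in: "subsp V \<Longrightarrow> set bs \<subseteq> V \<Longrightarrow> lincomb c bs \<in> V"
  unfolding lincomb_def by (rule subsp_sum) (auto intro!: subsp_scale nth_mem dest: subsetD)

definition qfun :: "('s \<Rightarrow> rat) set \<Rightarrow> ('s \<Rightarrow> rat) set \<Rightarrow> (('s \<Rightarrow> rat) \<Rightarrow> rat) \<Rightarrow> bool"
  where "qfun Z B l \<longleftrightarrow> (\<forall>z\<in>Z. \<forall>z'\<in>Z. \<forall>r. l (\<lambda>s. z s + r * z' s) = l z + r * l z') \<and> (\<forall>b\<in>B. l b = 0)"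

text \<open>A linear map of quotients, represented by a function that has to be linear only modulo
  the target subspace. This admits lifts picked by choice, as in
  \<open>quot_trace_transfer\<close>.\<close>

definition qlin :: "('s \<Rightarrow> rat) set \<Rightarrow> ('s \<Rightarrow> rat) set \<Rightarrow> ('t \<Rightarrow> rat) set \<Rightarrow> ('t \<Rightarrow> rat) set \<Rightarrow> (('s \<Rightarrow> rat) \<Rightarrow> ('t \<Rightarrow> rat)) \<Rightarrow> bool"
  where "qlin Z B Z' B' G \<longleftrightarrow> (\<forall>z\<in>Z. G z \<in> Z') \<and> (\<forall>b\<in>B. G b \<in> B') \<and>
    (\<forall>z\<in>Z. \<forall>z'\<in>Z. \<forall>r. (\<lambda>s. G (\<lambda>t. z t + r * z' t) s - (G z s + r * G z' s)) \<in> B')"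

definition coord :: "('s \<Rightarrow> rat) set \<Rightarrow> ('s \<Rightarrow> rat) list \<Rightarrow> ('s \<Rightarrow> rat) \<Rightarrow> nat \<Rightarrow> rat"
  where "coord B bs z = (SOME c. (\<lambda>s. z s - lincomb c bs s) \<in> B)"

definition qtr :: "('s \<Rightarrow> rat) set \<Rightarrow> ('s \<Rightarrow> rat) list \<Rightarrow> (('s \<Rightarrow> rat) \<Rightarrow> ('s \<Rightarrow> rat)) \<Rightarrow> rat"
  where "qtr B bs F = (\<Sum>j<length bs. coord B bs (F (bs ! j)) j)"

locale quot =
  fixes Z B :: "('s \<Rightarrow> rat) set" and bs :: "('s \<Rightarrow> rat) list"
  assumes Z: "subsp Z" and B: "subsp B" "B \<subseteq> Z" and basis: "quot_basis Z B bs"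
begin

lemma bs_Z: "i < length bs \<Longrightarrow> bs ! i \<in> Z"
  using basis by (auto simp: quot_basis_def)

lemma lc_Z: "lincomb c bs \<in> Z" using lincomb_in[OF Z] basis by (auto simp: quot_basis_def)

lemma coord: "z \<in> Z \<Longrightarrow> (\<lambda>s. z s - lincomb (coord B bs z) bs s) \<in> B"
proof -
  assume "z \<in> Z"
  then have "\<exists>c. (\<lambda>s. z s - lincomb c bs s) \<in> B" using basis by (auto simp: quot_basis_def)
  then show ?thesis unfolding coord_def by (rule someI_ex)
qed

lemma lc_add: "lincomb (\<lambda>i. c i + r * c' i) bs = (\<lambda>s. lincomb c bs s + r * lincomb c' bs s)"
  by (auto simp: lincomb_def fun_eq_iff sum.distrib sum_distrib_left algebra_simps)

lemma coord_unique:
  assumes "z \<in> Z" "(\<lambda>s. z s - lincomb c bs s) \<in> B" "i < length bs"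
  shows "coord B bs z i = c i"
proof -
  have "(\<lambda>s. (z s - lincomb c bs s) - (z s - lincomb (coord B bs z) bs s)) \<in> B"
    by (rule subsp_diff[OF B(1) assms(2) coord[OF assms(1)]])
  then have "lincomb (\<lambda>i. coord B bs z i + (-1) * c i) bs \<in> B" unfolding lc_add by (simp add: algebra_simps)
  then have "coord B bs z i + (-1) * c i = 0" using basis assms(3) unfolding quot_basis_def by blast
  then show ?thesis by simp
qed

lemma coord_qfun: "i < length bs \<Longrightarrow> qfun Z B (\<lambda>z. coord B bs z i)"
  unfolding qfun_def
proof (intro conjI ballI allI)
  assume i: "i < length bs"
  fix z z' r assume z: "z \<in> Z" "z' \<in> Z"
  have "(\<lambda>s. (z s - lincomb (coord B bs z) bs s) + r * (z' s - lincomb (coord B bs z') bs s)) \<in> B"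
    by (rule subsp_comb[OF B(1) coord[OF z(1)] coord[OF z(2)]])
  then have "(\<lambda>s. (z s + r * z' s) - lincomb (\<lambda>i. coord B bs z i + r * coord B bs z' i) bs s) \<in> B"
    unfolding lc_add by (simp add: algebra_simps)
  then show "coord B bs (\<lambda>s. z s + r * z' s) i = coord B bs z i + r * coord B bs z' i"
    by (rule coord_unique[OF subsp_comb[OF Z z] _ i])
next
  assume i: "i < length bs"
  fix b assume b: "b \<in> B"
  then have "(\<lambda>s. b s - lincomb (\<lambda>i. 0) bs s) \<in> B" by (simp add: lincomb_def)
  then show "coord B bs b i = 0" using coord_unique[of b "\<lambda>i. 0"] b B i by blast
qed

lemma qfun_cong: "qfun Z B l \<Longrightarrow> z \<in> Z \<Longrightarrow> z' \<in> Z \<Longrightarrow> (\<lambda>s. z s - z' s) \<in> B \<Longrightarrow> l z = l z'"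
proof -
  assume l: "qfun Z B l" and z: "z \<in> Z" "z' \<in> Z" "(\<lambda>s. z s - z' s) \<in> B"
  have "l (\<lambda>s. z s + (-1) * z' s) = l z + (-1) * l z'" using l z unfolding qfun_def by blast
  moreover have "l (\<lambda>s. z s + (-1) * z' s) = 0" using l z(3) unfolding qfun_def by auto
  ultimately show ?thesis by simp
qed

lemma qfun_lincomb:
  assumes l: "qfun Z B l"
  shows "l (lincomb c bs) = (\<Sum>j<length bs. c j * l (bs ! j))"
proof -
  have l0: "l (\<lambda>s. 0) = 0" using l subsp_zero[OF B(1)] by (auto simp: qfun_def)
  have "n \<le> length bs \<Longrightarrow> (\<lambda>s. \<Sum>j<n. c j * (bs ! j) s) \<in> Z \<and> l (\<lambda>s. \<Sum>j<n. c j * (bs ! j) s) = (\<Sum>j<n. c j * l (bs ! j))" for n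
  proof (induction n)
    case (Suc n)
    then have h: "(\<lambda>s. \<Sum>j<n. c j * (bs ! j) s) \<in> Z" "bs ! n \<in> Z" using bs_Z by auto
    then have "l (\<lambda>s. (\<Sum>j<n. c j * (bs ! j) s) + c n * (bs ! n) s) = l (\<lambda>s. \<Sum>j<n. c j * (bs ! j) s) + c n * l (bs ! n)"
      by (intro l[unfolded qfun_def, THEN conjunct1, rule_format])
    then show ?case using Suc subsp_comb[OF Z h] by simp
  qed (use l0 Z in \<open>simp add: subsp_zero\<close>)
  then show ?thesis by (simp add: lincomb_def)
qed

lemma qfun_expand:
  assumes l: "qfun Z B l" and z: "z \<in> Z"
  shows "l z = (\<Sum>j<length bs. coord B bs z j * l (bs ! j))"
  using qfun_cong[OF l z lc_Z coord[OF z]] qfun_lincomb[OF l] by simp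

end

lemma qfun_qlin:
  assumes "qlin Z B Z' B' G" "quot Z' B' bs'" "qfun Z' B' l" "subsp Z"
  shows "qfun Z B (\<lambda>z. l (G z))"
  unfolding qfun_def
proof (intro conjI ballI allI)
  interpret quot Z' B' bs' by fact
  fix z z' r assume z: "z \<in> Z" "z' \<in> Z"
  have zz: "G (\<lambda>t. z t + r * z' t) \<in> Z'" "G z \<in> Z'" "G z' \<in> Z'"
    using assms(1) z subsp_comb[OF assms(4) z, of r] by (auto simp: qlin_def)
  have "l (G (\<lambda>t. z t + r * z' t)) = l (\<lambda>s. G z s + r * G z' s)"
    by (rule qfun_cong[OF assms(3) zz(1) subsp_comb[OF Z zz(2,3)]]) (use assms(1) z in \<open>auto simp: qlin_def\<close>)
  also have "\<dots> = l (G z) + r * l (G z')" using assms(3) zz by (auto simp: qfun_def)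
  finally show "l (G (\<lambda>s. z s + r * z' s)) = l (G z) + r * l (G z')" .
next
  show "l (G b) = 0" if "b \<in> B" for b using assms(1,3) that by (auto simp: qlin_def qfun_def)
qed

text \<open>The trace of YX and of XY are the same double sum of matrix entries. Since the two
  quotients may differ, the identity serves both for change of basis and for moving a trace along an
  isomorphism.\<close>

lemma qtr_cyclic:
  assumes q: "quot Z B bs" and q': "quot Z' B' bs'" and X: "qlin Z B Z' B' X" and Y: "qlin Z' B' Z B Y"
  shows "qtr B bs (\<lambda>z. Y (X z)) = qtr B' bs' (\<lambda>z. X (Y z))"
proof -
  interpret q: quot Z B bs by fact
  interpret q': quot Z' B' bs' by fact
  have "coord B bs (Y (X (bs ! j))) j = (\<Sum>l<length bs'. coord B' bs' (X (bs ! j)) l * coord B bs (Y (bs' ! l)) j)" if j: "j < length bs" for j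
  proof (rule q'.qfun_expand)
    show "qfun Z' B' (\<lambda>z. coord B bs (Y z) j)" by (rule qfun_qlin[OF Y q q.coord_qfun[OF j] q'.Z])
    show "X (bs ! j) \<in> Z'" using X q.bs_Z[OF j] by (auto simp: qlin_def)
  qed
  then have "qtr B bs (\<lambda>z. Y (X z)) = (\<Sum>j<length bs. \<Sum>l<length bs'. coord B' bs' (X (bs ! j)) l * coord B bs (Y (bs' ! l)) j)"
    by (simp add: qtr_def)
  also have "\<dots> = (\<Sum>l<length bs'. \<Sum>j<length bs. coord B bs (Y (bs' ! l)) j * coord B' bs' (X (bs ! j)) l)"
    by (subst sum.swap) (simp add: mult.commute)
  also have "\<dots> = qtr B' bs' (\<lambda>z. X (Y z))"
  proof -
    have "coord B' bs' (X (Y (bs' ! l))) l = (\<Sum>j<length bs. coord B bs (Y (bs' ! l)) j * coord B' bs' (X (bs ! j)) l)" if l: "l < length bs'" for l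
    proof (rule q.qfun_expand)
      show "qfun Z B (\<lambda>z. coord B' bs' (X z) l)" by (rule qfun_qlin[OF X q' q'.coord_qfun[OF l] q.Z])
      show "Y (bs' ! l) \<in> Z" using Y q'.bs_Z[OF l] by (auto simp: qlin_def)
    qed
    then show ?thesis by (simp add: qtr_def)
  qed
  finally show ?thesis .
qed

lemma qlin_id: "subsp Z \<Longrightarrow> subsp B \<Longrightarrow> qlin Z B Z B (\<lambda>z. z)"
  by (auto simp: qlin_def subsp_zero)

text \<open>Independence of the basis is cyclicity applied to F and the identity, taken between two
  bases of the same quotient. It makes the definite description well defined.\<close>

lemma quot_trace_eq:
  assumes q: "quot Z B bs" and F: "qlin Z B Z B F"
  shows "quot_trace Z B F = qtr B bs F"
  unfolding quot_trace_def
proof (rule the_equality)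
  interpret q: quot Z B bs by fact
  have "(\<lambda>s. F (bs ! j) s - lincomb (\<lambda>i. coord B bs (F (bs ! j)) i) bs s) \<in> B" if "j < length bs" for j
    using q.coord F q.bs_Z[OF that] by (auto simp: qlin_def)
  then show "\<exists>bs' a. quot_basis Z B bs' \<and> (\<forall>j<length bs'. (\<lambda>s. F (bs' ! j) s - lincomb (\<lambda>i. a i j) bs' s) \<in> B) \<and> qtr B bs F = (\<Sum>j<length bs'. a j j)"
    using q.basis by (intro exI[of _ bs] exI[of _ "\<lambda>i j. coord B bs (F (bs ! j)) i"]) (auto simp: qtr_def)
  fix t assume "\<exists>bs a. quot_basis Z B bs \<and> (\<forall>j<length bs. (\<lambda>s. F (bs ! j) s - lincomb (\<lambda>i. a i j) bs s) \<in> B) \<and> t = (\<Sum>j<length bs. a j j)"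
  then obtain bs' a where a: "quot_basis Z B bs'" "\<And>j. j < length bs' \<Longrightarrow> (\<lambda>s. F (bs' ! j) s - lincomb (\<lambda>i. a i j) bs' s) \<in> B" "t = (\<Sum>j<length bs'. a j j)" by blast
  have q': "quot Z B bs'" using a(1) q.Z q.B by unfold_locales
  interpret q': quot Z B bs' by fact
  have "t = qtr B bs' F"
    unfolding a(3) qtr_def
  proof (rule sum.cong[OF refl])
    fix j assume "j \<in> {..<length bs'}"
    then have j: "j < length bs'" by simp
    have "F (bs' ! j) \<in> Z" using F q'.bs_Z[OF j] by (auto simp: qlin_def)
    then show "a j j = coord B bs' (F (bs' ! j)) j" using q'.coord_unique[OF _ a(2)[OF j] j] by simp
  qed
  also have "\<dots> = qtr B bs F" by (rule qtr_cyclic[OF q' q F qlin_id[OF q.Z q.B(1)]])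
  finally show "t = qtr B bs F" .
qed

text \<open>A finite separating set bounds the dimension: evaluation at t has a kernel that is
  separated by the remaining points, and at most one further basis vector is needed.\<close>

lemma quot_basis_exists:
  assumes "finite T" "subsp V" "\<And>f. f \<in> V \<Longrightarrow> (\<And>t. t \<in> T \<Longrightarrow> f t = 0) \<Longrightarrow> f = (\<lambda>s. 0)"
  shows "\<exists>bs. quot_basis V {\<lambda>s. 0} bs"
  using assms
proof (induction T arbitrary: V rule: finite_induct)
  case empty
  then have "V = {\<lambda>s. 0}" using subsp_zero by blast
  then show ?case by (intro exI[of _ "[]"]) (auto simp: quot_basis_def lincomb_def)
next
  case (insert t T)
  let ?W = "{f \<in> V. f t = 0}"
  have W: "subsp ?W" using insert.prems(1) by (auto simp: subsp_def)
  obtain bs where bs: "quot_basis ?W {\<lambda>s. 0} bs" using insert.IH[OF W] insert.prems(2) by auto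
  show ?case
  proof (cases "V = ?W")
    case True
    then show ?thesis using bs by metis
  next
    case False
    then obtain g where g: "g \<in> V" "g t \<noteq> 0" by auto
    have lc: "lincomb c (bs @ [g]) = (\<lambda>s. lincomb c bs s + c (length bs) * g s)" for c
      by (auto simp: lincomb_def nth_append fun_eq_iff)
    have lt: "lincomb c bs t = 0" for c
      using lincomb_in[OF W, of bs c] bs by (auto simp: quot_basis_def)
    have "quot_basis V {\<lambda>s. 0} (bs @ [g])"
      unfolding quot_basis_def
    proof (intro conjI ballI allI impI)
      show "set (bs @ [g]) \<subseteq> V" using g bs by (auto simp: quot_basis_def)
      fix c i assume "lincomb c (bs @ [g]) \<in> {\<lambda>s. 0}" and i: "i < length (bs @ [g])"
      then have e: "lincomb c bs s + c (length bs) * g s = 0" for s unfolding lc by (auto simp: fun_eq_iff)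
      have c0: "c (length bs) = 0" using e[of t] lt g(2) by simp
      then have "lincomb c bs \<in> {\<lambda>s. 0}" using e by auto
      then have "\<forall>i<length bs. c i = 0" using bs unfolding quot_basis_def by blast
      then show "c i = 0" using i c0 by (cases "i = length bs") auto
    next
      fix f assume f: "f \<in> V"
      define r where "r = f t / g t"
      have "(\<lambda>s. f s + (- r) * g s) \<in> ?W" using subsp_comb[OF insert.prems(1) f g(1), of "- r"] g(2) by (simp add: r_def)
      from bs[unfolded quot_basis_def, THEN conjunct2, THEN conjunct2, rule_format, OF this]
      obtain c where "(\<lambda>s. (f s + (- r) * g s) - lincomb c bs s) \<in> {\<lambda>s. 0}" by blast
      then have "f s + (- r) * g s - lincomb c bs s = 0" for s by (auto simp: fun_eq_iff)
      then have c: "lincomb c bs s + r * g s = f s" for s by (simp add: algebra_simps eq_diff_eq)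
      have "lincomb (c(length bs := r)) bs = lincomb c bs" by (auto simp: lincomb_def fun_eq_iff)
      then have "(\<lambda>s. f s - lincomb (c(length bs := r)) (bs @ [g]) s) \<in> {\<lambda>s. 0}" unfolding lc using c by simp
      then show "\<exists>c. (\<lambda>s. f s - lincomb c (bs @ [g]) s) \<in> {\<lambda>s. 0}" by blast
    qed
    then show ?thesis by blast
  qed
qed

lemma subsp_zero_space: "subsp {\<lambda>s. 0}" by (simp add: subsp_def)

text \<open>\<open>ev\<close> induces an isomorphism from Z/B onto P that carries F to F'. The
  section \<open>e\<close> is merely chosen, but it is linear modulo B because B is the kernel of
  \<open>ev\<close>; cyclicity then compares the traces.\<close>

lemma quot_trace_transfer:
  assumes Z: "subsp Z" "subsp B" "B \<subseteq> Z" and P: "subsp P" and bs: "quot_basis P {\<lambda>s. 0} bs"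
    and ev: "\<And>z. z \<in> Z \<Longrightarrow> ev z \<in> P" "\<And>z z' r. z \<in> Z \<Longrightarrow> z' \<in> Z \<Longrightarrow> ev (\<lambda>s. z s + r * z' s) = (\<lambda>s. ev z s + r * ev z' s)"
      "\<And>z. z \<in> Z \<Longrightarrow> z \<in> B \<longleftrightarrow> ev z = (\<lambda>s. 0)" "\<And>\<phi>. \<phi> \<in> P \<Longrightarrow> \<exists>z\<in>Z. ev z = \<phi>"
    and F: "\<And>z. z \<in> Z \<Longrightarrow> F z \<in> Z" "\<And>z. z \<in> Z \<Longrightarrow> ev (F z) = F' (ev z)"
    and F': "qlin P {\<lambda>s. 0} P {\<lambda>s. 0} F'"
  shows "quot_trace Z B F = qtr {\<lambda>s. 0} bs F'"
proof -
  define e where "e = (\<lambda>\<phi>. SOME z. z \<in> Z \<and> ev z = \<phi>)"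
  have e: "e \<phi> \<in> Z" "ev (e \<phi>) = \<phi>" if "\<phi> \<in> P" for \<phi>
    using someI_ex[of "\<lambda>z. z \<in> Z \<and> ev z = \<phi>"] ev(4)[OF that] unfolding e_def by blast+
  have P0: "{\<lambda>s. 0} \<subseteq> P" using subsp_zero[OF P] by simp
  interpret p: quot P "{\<lambda>s. 0}" bs using P bs subsp_zero_space P0 by unfold_locales
  have evd: "(\<lambda>s. z s - z' s) \<in> B" if "z \<in> Z" "z' \<in> Z" "ev z = ev z'" for z z'
    using ev(3)[OF subsp_diff[OF Z(1) that(1,2)]] ev(2)[OF that(1,2), of "-1"] that(3) by (simp add: algebra_simps)
  have s: "set (map e bs) \<subseteq> Z" using e p.bs_Z by (auto simp: in_set_conv_nth)
  have evl: "ev (lincomb c (map e bs)) = lincomb c bs" for c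
  proof -
    have "n \<le> length bs \<Longrightarrow> (\<lambda>s. \<Sum>j<n. c j * (map e bs ! j) s) \<in> Z \<and> ev (\<lambda>s. \<Sum>j<n. c j * (map e bs ! j) s) = (\<lambda>s. \<Sum>j<n. c j * (bs ! j) s)" for n
    proof (induction n)
      case 0
      have "ev (\<lambda>s. 0) = (\<lambda>s. 0)" using ev(3)[OF subsp_zero[OF Z(1)]] subsp_zero[OF Z(2)] by simp
      then show ?case using subsp_zero[OF Z(1)] by simp
    next
      case (Suc n)
      then have n: "n < length bs" and h: "(\<lambda>s. \<Sum>j<n. c j * (map e bs ! j) s) \<in> Z" "map e bs ! n \<in> Z"
        using e(1) p.bs_Z by auto
      show ?case using ev(2)[OF h, of "c n"] Suc n subsp_comb[OF Z(1) h, of "c n"] e(2)[OF p.bs_Z[OF n]] by simp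
    qed
    then show ?thesis by (simp add: lincomb_def)
  qed
  have qbs: "quot_basis Z B (map e bs)"
    unfolding quot_basis_def
  proof (intro conjI ballI allI impI)
    show "set (map e bs) \<subseteq> Z" by (rule s)
    fix c i assume c: "lincomb c (map e bs) \<in> B" and i: "i < length (map e bs)"
    have "ev (lincomb c (map e bs)) = (\<lambda>s. 0)" using ev(3)[OF lincomb_in[OF Z(1) s]] c by blast
    then have "lincomb c bs \<in> {\<lambda>s. 0}" using evl by simp
    then show "c i = 0" using bs i unfolding quot_basis_def by auto
  next
    fix z assume z: "z \<in> Z"
    obtain c where c: "(\<lambda>s. ev z s - lincomb c bs s) \<in> {\<lambda>s. 0}" using bs ev(1)[OF z] unfolding quot_basis_def by blast
    then have "ev z = ev (lincomb c (map e bs))" unfolding evl by (auto simp: fun_eq_iff)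
    then show "\<exists>c. (\<lambda>s. z s - lincomb c (map e bs) s) \<in> B" using evd[OF z lincomb_in[OF Z(1) s]] by blast
  qed
  have q: "quot Z B (map e bs)" using Z qbs by unfold_locales
  interpret q: quot Z B "map e bs" by fact
  have ql: "qlin Z B Z B F"
    unfolding qlin_def
  proof (intro conjI ballI allI)
    show "F z \<in> Z" if "z \<in> Z" for z using F(1)[OF that] .
    show "F b \<in> B" if b: "b \<in> B" for b
    proof -
      have "ev (F b) = F' (\<lambda>s. 0)" using F(2)[of b] ev(3)[of b] Z(3) b by auto
      also have "\<dots> = (\<lambda>s. 0)" using F' by (auto simp: qlin_def)
      finally show ?thesis using ev(3)[OF F(1)] b Z(3) by auto
    qed
    fix z z' r assume z: "z \<in> Z" "z' \<in> Z"
    have "(\<lambda>s. F' (\<lambda>t. ev z t + r * ev z' t) s - (F' (ev z) s + r * F' (ev z') s)) \<in> {\<lambda>s. 0}"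
      using F' ev(1)[OF z(1)] ev(1)[OF z(2)] by (auto simp: qlin_def)
    then have "ev (F (\<lambda>t. z t + r * z' t)) = ev (\<lambda>s. F z s + r * F z' s)"
      using F(2)[OF subsp_comb[OF Z(1) z]] ev(2)[OF z] ev(2)[OF F(1)[OF z(1)] F(1)[OF z(2)]] F(2)[OF z(1)] F(2)[OF z(2)] by (simp add: fun_eq_iff)
    then show "(\<lambda>s. F (\<lambda>t. z t + r * z' t) s - (F z s + r * F z' s)) \<in> B"
      by (intro evd) (use F(1) z subsp_comb[OF Z(1)] in auto)
  qed
  have le: "qlin P {\<lambda>s. 0} Z B e"
    unfolding qlin_def
  proof (intro conjI ballI allI)
    show "e z \<in> Z" if "z \<in> P" for z using e[OF that] by simp
    show "e b \<in> B" if "b \<in> {\<lambda>s. 0}" for b using that ev(3)[OF e(1)] e(2) subsp_zero[OF P] by auto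
    fix z z' r assume z: "z \<in> P" "z' \<in> P"
    show "(\<lambda>s. e (\<lambda>t. z t + r * z' t) s - (e z s + r * e z' s)) \<in> B"
      by (rule evd) (use e z subsp_comb[OF P z] subsp_comb[OF Z(1)] ev(2) in auto)
  qed
  have lev: "qlin Z B P {\<lambda>s. 0} (\<lambda>z. F' (ev z))"
  proof -
    have "F' (ev b) = (\<lambda>s. 0)" if "b \<in> B" for b using ev(3)[of b] that Z(3) F' by (auto simp: qlin_def)
    moreover have "F' (ev z) \<in> P" if "z \<in> Z" for z using ev(1)[OF that] F' by (auto simp: qlin_def)
    moreover have "(\<lambda>s. F' (\<lambda>t. ev z t + r * ev z' t) s - (F' (ev z) s + r * F' (ev z') s)) = (\<lambda>s. 0)" if "z \<in> Z" "z' \<in> Z" for z z' r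
      using F' ev(1)[OF that(1)] ev(1)[OF that(2)] by (auto simp: qlin_def)
    ultimately show ?thesis by (auto simp: qlin_def ev(2))
  qed
  have "quot_trace Z B F = qtr B (map e bs) F" by (rule quot_trace_eq[OF q ql])
  also have "\<dots> = qtr B (map e bs) (\<lambda>z. e (F' (ev z)))"
    unfolding qtr_def
  proof (rule sum.cong[OF refl])
    fix j assume "j \<in> {..<length (map e bs)}"
    then have j: "j < length (map e bs)" by simp
    let ?z = "map e bs ! j"
    have z: "?z \<in> Z" by (rule q.bs_Z[OF j])
    have P: "F' (ev ?z) \<in> P" using ev(1)[OF z] F' by (auto simp: qlin_def)
    show "coord B (map e bs) (F ?z) j = coord B (map e bs) (e (F' (ev ?z))) j"
      by (rule q.qfun_cong[OF q.coord_qfun[OF j] F(1)[OF z] e(1)[OF P]], rule evd[OF F(1)[OF z] e(1)[OF P]]) (simp add: F(2)[OF z] e(2)[OF P])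
  qed
  also have "\<dots> = qtr {\<lambda>s. 0} bs (\<lambda>\<phi>. F' (ev (e \<phi>)))" by (rule qtr_cyclic[OF q p.quot_axioms lev le])
  also have "\<dots> = qtr {\<lambda>s. 0} bs F'" unfolding qtr_def using e(2)[OF p.bs_Z] by (intro sum.cong) auto
  finally show ?thesis .
qed

section \<open>Rational cohomology as functionals on integral homology\<close>

definition pair :: "('b \<Rightarrow> rat) \<Rightarrow> ('b \<Rightarrow>\<^sub>0 int) \<Rightarrow> rat"
  where "pair \<phi> c = (\<Sum>x\<in>Poly_Mapping.keys c. of_int (Poly_Mapping.lookup c x) * \<phi> x)"

lemma pair_superset: "finite A \<Longrightarrow> Poly_Mapping.keys c \<subseteq> A \<Longrightarrow> pair \<phi> c = (\<Sum>x\<in>A. of_int (Poly_Mapping.lookup c x) * \<phi> x)"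
  unfolding pair_def by (rule sum.mono_neutral_left) (auto simp: in_keys_iff)

lemma pair_add: "pair \<phi> (a + b) = pair \<phi> a + pair \<phi> b"
proof -
  let ?A = "Poly_Mapping.keys a \<union> Poly_Mapping.keys b"
  have "pair \<phi> (a + b) = (\<Sum>x\<in>?A. of_int (Poly_Mapping.lookup (a + b) x) * \<phi> x)"
    by (rule pair_superset) (use keys_add[of a b] in auto)
  also have "\<dots> = (\<Sum>x\<in>?A. of_int (Poly_Mapping.lookup a x) * \<phi> x) + (\<Sum>x\<in>?A. of_int (Poly_Mapping.lookup b x) * \<phi> x)"
    by (simp add: lookup_add distrib_right sum.distrib)
  finally show ?thesis using pair_superset[of ?A a \<phi>] pair_superset[of ?A b \<phi>] by simp
qed

lemma pair_zero [simp]: "pair \<phi> 0 = 0" by (simp add: pair_def)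
lemma pair_minus: "pair \<phi> (- a) = - pair \<phi> a" using pair_add[of \<phi> a "- a"] by simp
lemma pair_diff: "pair \<phi> (a - b) = pair \<phi> a - pair \<phi> b" using pair_add[of \<phi> a "- b"] by (simp add: pair_minus)
lemma pair_of [simp]: "pair \<phi> (frag_of x) = \<phi> x" by (simp add: pair_def)
lemma pair_cmul: "pair \<phi> (frag_cmul k c) = of_int k * pair \<phi> c"
proof -
  have "pair \<phi> (frag_cmul k c) = (\<Sum>x\<in>Poly_Mapping.keys c. of_int (Poly_Mapping.lookup (frag_cmul k c) x) * \<phi> x)"
    by (rule pair_superset) (use keys_cmul[of k c] in auto)
  then show ?thesis by (simp add: pair_def sum_distrib_left mult.assoc)
qed
lemma pair_sum: "pair \<phi> (\<Sum>i\<in>I. g i) = (\<Sum>i\<in>I. pair \<phi> (g i))"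
  by (induction I rule: infinite_finite_induct) (auto simp: pair_add)

lemma pair_comb: "pair (\<lambda>s. z s + r * z' s) c = pair z c + r * pair z' c"
  by (simp add: pair_def sum.distrib sum_distrib_left algebra_simps)

lemma common_denominator:
  assumes "finite T"
  shows "\<exists>N::int. N > 0 \<and> (\<forall>b\<in>T. \<exists>n::int. of_int N * (r b :: rat) = of_int n)"
  using assms
proof (induction T rule: finite_induct)
  case (insert b T)
  then obtain N :: int where N: "N > 0" "\<forall>b\<in>T. \<exists>n::int. of_int N * r b = of_int n" by blast
  obtain m k where q: "quotient_of (r b) = (m, k)" by fastforce
  have mk: "r b = of_int m / of_int k" "k > 0" using quotient_of_div[OF q] quotient_of_denom_pos[OF q] by auto
  have "of_int (N * k) * r b = of_int (N * m)" using mk by simp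
  moreover have "\<exists>n::int. of_int (N * k) * r c = of_int n" if cT: "c \<in> T" for c
  proof -
    obtain n :: int where "of_int N * r c = of_int n" using N cT by blast
    then have "of_int (N * k) * r c = of_int (n * k)" by (simp add: mult.assoc mult.left_commute)
    then show ?thesis by blast
  qed
  ultimately have "\<forall>c\<in>insert b T. \<exists>n::int. of_int (N * k) * r c = of_int n" by blast
  moreover have "N * k > 0" using N mk by simp
  ultimately show ?case by blast
qed (auto intro: exI[of _ 1])

definition rsc :: "rat \<Rightarrow> ('b \<Rightarrow>\<^sub>0 rat) \<Rightarrow> ('b \<Rightarrow>\<^sub>0 rat)" where "rsc r f = Poly_Mapping.map (\<lambda>x. r * x) f"

lemma lookup_rsc: "Poly_Mapping.lookup (rsc r f) k = r * Poly_Mapping.lookup f k"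
  by (simp add: rsc_def map.rep_eq when_def)

text \<open>Integral combinations viewed as vectors of a rational vector space, so that bases and
  linear extension become available.\<close>

definition emb :: "('b \<Rightarrow>\<^sub>0 int) \<Rightarrow> ('b \<Rightarrow>\<^sub>0 rat)" where "emb c = Poly_Mapping.map rat_of_int c"

lemma lookup_emb: "Poly_Mapping.lookup (emb c) k = of_int (Poly_Mapping.lookup c k)"
  by (simp add: emb_def map.rep_eq when_def)

text \<open>This replaces the universal coefficient theorem: since the rationals are divisible, no Ext term
  arises and rational cohomology is the space of additive functionals on integral homology.\<close>

lemma extend_functional:
  fixes A :: "('b \<Rightarrow>\<^sub>0 int) set" and l :: "('b \<Rightarrow>\<^sub>0 int) \<Rightarrow> rat"
  assumes A0: "0 \<in> A" and Aadd: "\<And>a b. a \<in> A \<Longrightarrow> b \<in> A \<Longrightarrow> a + b \<in> A" and Acm: "\<And>k a. a \<in> A \<Longrightarrow> frag_cmul k a \<in> A"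
    and l: "\<And>a b. a \<in> A \<Longrightarrow> b \<in> A \<Longrightarrow> l (a + b) = l a + l b"
  obtains \<phi> where "\<And>c. c \<in> A \<Longrightarrow> pair \<phi> c = l c"
proof -
  interpret vs: vector_space "rsc :: rat \<Rightarrow> ('b \<Rightarrow>\<^sub>0 rat) \<Rightarrow> _"
    by unfold_locales (auto intro!: poly_mapping_eqI simp: lookup_rsc lookup_add algebra_simps)
  interpret v2: vector_space "(*) :: rat \<Rightarrow> rat \<Rightarrow> rat"
    by unfold_locales (auto simp: algebra_simps)
  interpret vp: vector_space_pair "rsc :: rat \<Rightarrow> ('b \<Rightarrow>\<^sub>0 rat) \<Rightarrow> _" "(*) :: rat \<Rightarrow> rat \<Rightarrow> rat" by unfold_locales
  \<comment> \<open>A basis of the rational span of A that consists of elements of A itself; l can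
    be prescribed on it and extended linearly.\<close>
  obtain Bs where Bs: "Bs \<subseteq> emb ` A" "vs.independent Bs" "emb ` A \<subseteq> vs.span Bs"
    using vs.maximal_independent_subset by blast
  have emb_inj: "emb a = emb b \<Longrightarrow> a = b" for a b :: "'b \<Rightarrow>\<^sub>0 int"
    by (rule poly_mapping_eqI) (metis lookup_emb of_int_eq_iff)
  define inve where "inve = (\<lambda>x. SOME a. a \<in> A \<and> emb a = x)"
  have inve: "inve x \<in> A \<and> emb (inve x) = x" if "x \<in> Bs" for x
    unfolding inve_def by (rule someI_ex) (use Bs(1) that in auto)
  obtain g where g: "Vector_Spaces.linear rsc (*) g" "\<And>x. x \<in> Bs \<Longrightarrow> g x = l (inve x)"
    using vp.linear_independent_extend[OF Bs(2), of "\<lambda>x. l (inve x)"] by blast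
  interpret g: Vector_Spaces.linear rsc "(*)" g by fact
  have l0: "l 0 = 0" using l[OF A0 A0] by simp
  have lcm: "l (frag_cmul k a) = of_int k * l a" if a: "a \<in> A" for k a
  proof -
    have nat: "l (frag_cmul (int n) a) = of_nat n * l a" for n
    proof (induction n)
      case (Suc n)
      have "frag_cmul (int (Suc n)) a = frag_cmul (int n) a + a" using frag_cmul_distrib[of "int n" 1 a] by (simp add: add.commute)
      then show ?case using l[OF Acm[OF a] a] Suc by (simp add: algebra_simps)
    qed (simp add: l0)
    show ?thesis
    proof (cases "k \<ge> 0")
      case True
      then show ?thesis using nat[of "nat k"] by simp
    next
      case False
      have "frag_cmul k a + frag_cmul (int (nat (- k))) a = 0" using False frag_cmul_distrib[of k "- k" a] by simp
      then have "l (frag_cmul k a) + l (frag_cmul (int (nat (- k))) a) = 0" using l[OF Acm[OF a] Acm[OF a]] l0 by metis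
      then show ?thesis using nat[of "nat (- k)"] False by simp
    qed
  qed
  have asum: "finite T \<Longrightarrow> (\<And>b. b \<in> T \<Longrightarrow> f b \<in> A) \<Longrightarrow> (\<Sum>b\<in>T. f b) \<in> A \<and> l (\<Sum>b\<in>T. f b) = (\<Sum>b\<in>T. l (f b))" for T :: "('b \<Rightarrow>\<^sub>0 rat) set" and f
    by (induction T rule: finite_induct) (auto simp: A0 l0 Aadd l)
  define \<phi> where "\<phi> = (\<lambda>b. g (Poly_Mapping.single b 1))"
  have gp: "g (emb c) = pair \<phi> c" for c
  proof -
    have "emb c = (\<Sum>x\<in>Poly_Mapping.keys c. rsc (of_int (Poly_Mapping.lookup c x)) (Poly_Mapping.single x 1))"
    proof (rule poly_mapping_eqI)
      fix k
      have "(\<Sum>x\<in>Poly_Mapping.keys c. of_int (Poly_Mapping.lookup c x) * Poly_Mapping.lookup (Poly_Mapping.single x 1) k) = (of_int (Poly_Mapping.lookup c k) :: rat)"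
        by (simp add: lookup_single when_def if_distrib sum.delta' in_keys_iff cong: if_cong)
      then show "Poly_Mapping.lookup (emb c) k = Poly_Mapping.lookup (\<Sum>x\<in>Poly_Mapping.keys c. rsc (of_int (Poly_Mapping.lookup c x)) (Poly_Mapping.single x 1)) k"
        by (simp add: lookup_emb lookup_sum lookup_rsc)
    qed
    then show ?thesis by (simp add: g.sum g.scale pair_def \<phi>_def)
  qed
  show thesis
  proof (rule that)
    fix c assume c: "c \<in> A"
    then have "emb c \<in> vs.span Bs" using Bs(3) by blast
    then obtain T r where T: "finite T" "T \<subseteq> Bs" "emb c = (\<Sum>b\<in>T. rsc (r b) b)" unfolding vs.span_explicit by blast
    obtain N :: int where N: "N > 0" "\<forall>b\<in>T. \<exists>n::int. of_int N * r b = of_int n" using common_denominator[OF T(1)] by blast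
    then obtain n where n: "\<And>b. b \<in> T \<Longrightarrow> of_int N * r b = of_int (n b)" by metis
    \<comment> \<open>Clearing denominators turns the rational expansion into an identity between
      elements of A, where additivity of l can be used. The factor N is divided out at the end, in
      the rationals.\<close>
    have "frag_cmul N c = (\<Sum>b\<in>T. frag_cmul (n b) (inve b))"
    proof (rule emb_inj, rule poly_mapping_eqI)
      fix k
      have "of_int N * Poly_Mapping.lookup (emb c) k = (\<Sum>b\<in>T. of_int (n b) * Poly_Mapping.lookup b k)"
        unfolding T(3) using n by (simp add: lookup_sum lookup_rsc sum_distrib_left mult.assoc[symmetric])
      also have "\<dots> = (\<Sum>b\<in>T. of_int (n b) * Poly_Mapping.lookup (emb (inve b)) k)" using inve T(2) by (intro sum.cong) auto
      finally show "Poly_Mapping.lookup (emb (frag_cmul N c)) k = Poly_Mapping.lookup (emb (\<Sum>b\<in>T. frag_cmul (n b) (inve b))) k"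
        by (simp add: lookup_emb lookup_sum)
    qed
    then have "of_int N * l c = (\<Sum>b\<in>T. of_int (n b) * l (inve b))"
      using asum[OF T(1), of "\<lambda>b. frag_cmul (n b) (inve b)"] inve T(2) Acm lcm[OF c, of N] by (simp add: lcm subset_iff)
    also have "\<dots> = (\<Sum>b\<in>T. of_int N * (r b * g b))" using n g(2) T(2) by (intro sum.cong) (auto simp: mult.assoc[symmetric])
    also have "\<dots> = of_int N * g (emb c)" unfolding T(3) by (simp add: g.sum g.scale sum_distrib_left)
    finally show "pair \<phi> c = l c" using N(1) gp by simp
  qed
qed

lemma std_simplex_eq: "std_simplex = standard_simplex" by (rule ext) (simp add: std_simplex_def standard_simplex_def)
lemma sing_simplex_eq: "sing_simplex = singular_simplex" by (intro ext) (simp add: sing_simplex_def singular_simplex_def std_simplex_eq)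
lemma sing_face_eq: "sing_face = singular_face"
  by (intro ext) (simp add: sing_face_def singular_face_def std_simplex_eq simpl_face_def[abs_def] simplical_face_def[abs_def])

lemma pair_chain_boundary_of:
  "pair \<phi> (chain_boundary (Suc p) (frag_of f)) = (\<Sum>k\<le>Suc p. (-1) ^ k * \<phi> (singular_face (Suc p) k f))"
  by (simp add: chain_boundary_of pair_sum pair_cmul del: sum.atMost_Suc)

lemma pair_coboundary:
  assumes "singular_chain (Suc p) X c"
  shows "pair (coboundary p X \<phi>) c = pair \<phi> (chain_boundary (Suc p) c)"
  using assms[unfolded singular_chain_def]
proof (induction c rule: frag_induction)
  case (one x)
  then show ?case by (simp add: pair_chain_boundary_of coboundary_def sing_simplex_eq sing_face_eq del: sum.atMost_Suc)
next
  case (diff a b)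
  then show ?case by (simp add: chain_boundary_diff pair_diff)
qed simp

lemma coboundary_zero_iff: "coboundary p X \<phi> = (\<lambda>f. 0) \<longleftrightarrow> (\<forall>c. singular_chain (Suc p) X c \<longrightarrow> pair \<phi> (chain_boundary (Suc p) c) = 0)"
proof
  assume z: "coboundary p X \<phi> = (\<lambda>f. 0)"
  have "pair (\<lambda>f. 0) c = 0" for c :: "'a chain" by (simp add: pair_def)
  then show "\<forall>c. singular_chain (Suc p) X c \<longrightarrow> pair \<phi> (chain_boundary (Suc p) c) = 0"
    using pair_coboundary[of p X _ \<phi>] unfolding z by simp
next
  assume h: "\<forall>c. singular_chain (Suc p) X c \<longrightarrow> pair \<phi> (chain_boundary (Suc p) c) = 0"
  show "coboundary p X \<phi> = (\<lambda>f. 0)"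
  proof
    fix f
    show "coboundary p X \<phi> f = 0"
    proof (cases "singular_simplex (Suc p) X f")
      case True
      then have "singular_chain (Suc p) X (frag_of f)" by (simp add: singular_chain_of)
      then show ?thesis using h pair_coboundary[of p X "frag_of f" \<phi>] by simp
    qed (simp add: coboundary_def sing_simplex_eq)
  qed
qed

section \<open>Cohomology classes as functionals on homology\<close>

text \<open>Functionals are made 0 off the carrier so that equal functionals are equal functions and
  the zero functional is the zero function.\<close>

definition hmf :: "int \<Rightarrow> 'a topology \<Rightarrow> ('a chain set \<Rightarrow> rat) set"
  where "hmf p X = {\<phi>. additive (homology_group p X) \<phi> \<and> (\<forall>x. x \<notin> carrier (homology_group p X) \<longrightarrow> \<phi> x = 0)}"

text \<open>For a cocycle the chosen representative is irrelevant, by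
  \<open>evc_class\<close>.\<close>

definition evc :: "nat \<Rightarrow> 'a topology \<Rightarrow> (((nat \<Rightarrow> real) \<Rightarrow> 'a) \<Rightarrow> rat) \<Rightarrow> 'a chain set \<Rightarrow> rat"
  where "evc p X \<phi> h = (if h \<in> carrier (homology_group (int p) X) then pair \<phi> (SOME c. singular_relcycle p X {} c \<and> homologous_rel_set p X {} c = h) else 0)"

lemma cocycle_iff: "\<phi> \<in> cocycles p X \<longleftrightarrow> \<phi> \<in> cochains p X \<and> (\<forall>c. singular_chain (Suc p) X c \<longrightarrow> pair \<phi> (chain_boundary (Suc p) c) = 0)"
  by (simp add: cocycles_def coboundary_zero_iff)

lemma class_carrier: "singular_relcycle p X {} c \<Longrightarrow> homologous_rel_set p X {} c \<in> carrier (homology_group (int p) X)"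
  by (simp add: carrier_relative_homology_group)

lemma class_add:
  assumes "singular_relcycle p X {} a" "singular_relcycle p X {} b"
  shows "homologous_rel_set p X {} (a + b) = homologous_rel_set p X {} a \<otimes>\<^bsub>homology_group (int p) X\<^esub> homologous_rel_set p X {} b"
proof -
  have "(\<lambda>a. r_coset (relcycle_group p X {}) (singular_relboundary_set p X {}) a) \<in> hom (relcycle_group p X {}) (relcycle_group p X {} Mod singular_relboundary_set p X {})"
    by (rule normal.r_coset_hom_Mod[OF normal_subgroup_singular_relboundary_relcycle])
  from hom_mult[OF this, of a b] assms show ?thesis
    by (simp add: right_coset_singular_relboundary nontrivial_relative_homology_group)
qed

lemma evc_class:
  assumes \<phi>: "\<phi> \<in> cocycles p X" and c: "singular_relcycle p X {} c"
  shows "evc p X \<phi> (homologous_rel_set p X {} c) = pair \<phi> c"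
proof -
  let ?d = "SOME d. singular_relcycle p X {} d \<and> homologous_rel_set p X {} d = homologous_rel_set p X {} c"
  have "\<exists>d. singular_relcycle p X {} d \<and> homologous_rel_set p X {} d = homologous_rel_set p X {} c" using c by blast
  then have d: "singular_relcycle p X {} ?d \<and> homologous_rel_set p X {} ?d = homologous_rel_set p X {} c" by (rule someI_ex)
  then have "homologous_rel p X {} ?d c" by (simp add: homologous_rel_set_eq)
  then have "singular_relboundary p X {} (?d - c)" by (simp add: homologous_rel_def)
  then obtain e where e: "singular_chain (Suc p) X e" "chain_boundary (Suc p) e = ?d - c" by (auto simp: singular_boundary)
  then have "pair \<phi> (?d - c) = 0" using \<phi> unfolding cocycle_iff by metis
  then show ?thesis using class_carrier[OF c] by (simp add: evc_def pair_diff)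
qed

lemma carrier_class: "h \<in> carrier (homology_group (int p) X) \<Longrightarrow> \<exists>c. singular_relcycle p X {} c \<and> h = homologous_rel_set p X {} c"
  by (auto simp: carrier_relative_homology_group)

lemma evc_hmf: "\<phi> \<in> cocycles p X \<Longrightarrow> evc p X \<phi> \<in> hmf (int p) X"
  unfolding hmf_def additive_def
proof (intro CollectI conjI ballI)
  fix a b assume \<phi>: "\<phi> \<in> cocycles p X" and ab: "a \<in> carrier (homology_group (int p) X)" "b \<in> carrier (homology_group (int p) X)"
  obtain c e where c: "singular_relcycle p X {} c" "a = homologous_rel_set p X {} c" and e: "singular_relcycle p X {} e" "b = homologous_rel_set p X {} e"
    using carrier_class[OF ab(1)] carrier_class[OF ab(2)] by blast
  show "evc p X \<phi> (a \<otimes>\<^bsub>homology_group (int p) X\<^esub> b) = evc p X \<phi> a + evc p X \<phi> b"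
    unfolding c(2) e(2) class_add[OF c(1) e(1), symmetric]
    by (simp add: evc_class[OF \<phi>] c e singular_relcycle_add pair_add)
qed (simp add: evc_def)

lemma subsp_hmf: "subsp (hmf p X)"
  by (auto simp: subsp_def hmf_def additive_def algebra_simps)

lemma subsp_cocycles: "subsp (cocycles p X)"
  by (auto simp: subsp_def cocycle_iff cochains_def pair_comb) (simp add: pair_def)

lemma pair_cochain_zero: "\<phi> \<in> cochains p X \<Longrightarrow> (\<And>f. singular_simplex p X f \<Longrightarrow> \<phi> f = 0) \<Longrightarrow> \<phi> = (\<lambda>f. 0)"
  by (auto simp: cochains_def sing_simplex_eq fun_eq_iff)

text \<open>If the functional is zero, \<phi> vanishes on cycles, so its value on a chain depends
  only on the boundary of the chain. This additive function on boundaries is extended by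
  \<open>extend_functional\<close> to a cochain one degree lower, of which \<phi> is the
  coboundary.\<close>

lemma coboundaries_iff:
  assumes \<phi>: "\<phi> \<in> cocycles p X"
  shows "\<phi> \<in> coboundaries p X \<longleftrightarrow> evc p X \<phi> = (\<lambda>h. 0)"
proof
  assume B: "\<phi> \<in> coboundaries p X"
  have "pair \<phi> c = 0" if c: "singular_relcycle p X {} c" for c
  proof (cases p)
    case 0
    then show ?thesis using B by (simp add: coboundaries_def pair_def)
  next
    case (Suc q)
    then obtain \<psi> where "\<phi> = coboundary q X \<psi>" using B by (auto simp: coboundaries_def)
    then show ?thesis using pair_coboundary[of q X c \<psi>] c Suc by (simp add: singular_cycle)
  qed
  then have "evc p X \<phi> h = 0" if "h \<in> carrier (homology_group (int p) X)" for h
    using carrier_class[OF that] evc_class[OF \<phi>] by auto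
  then show "evc p X \<phi> = (\<lambda>h. 0)" by (auto simp: fun_eq_iff evc_def[of p X \<phi>])
next
  assume e: "evc p X \<phi> = (\<lambda>h. 0)"
  have z: "pair \<phi> c = 0" if c: "singular_relcycle p X {} c" for c
    using evc_class[OF \<phi> c] e by simp
  have coch: "\<phi> \<in> cochains p X" using \<phi> by (simp add: cocycle_iff)
  show "\<phi> \<in> coboundaries p X"
  proof (cases p)
    case 0
    \<comment> \<open>In degree 0 the only coboundary is 0, and every single simplex is a cycle, so
      \<phi> itself has to vanish.\<close>
    have "\<phi> = (\<lambda>f. 0)"
    proof (rule pair_cochain_zero[OF coch])
      fix f assume "singular_simplex p X f"
      then have "singular_relcycle p X {} (frag_of f)" using 0 by (simp add: singular_cycle singular_chain_of chain_boundary_def)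
      then show "\<phi> f = 0" using z by fastforce
    qed
    then show ?thesis using 0 by (simp add: coboundaries_def)
  next
    case (Suc q)
    let ?A = "chain_boundary p ` {c. singular_chain p X c}"
    define l where "l = (\<lambda>b. pair \<phi> (SOME c. singular_chain p X c \<and> chain_boundary p c = b))"
    have l: "l (chain_boundary p c) = pair \<phi> c" if c: "singular_chain p X c" for c
    proof -
      let ?d = "SOME d. singular_chain p X d \<and> chain_boundary p d = chain_boundary p c"
      have d: "singular_chain p X ?d \<and> chain_boundary p ?d = chain_boundary p c" by (rule someI_ex) (use c in blast)
      then have "singular_relcycle p X {} (?d - c)" using c by (simp add: singular_cycle chain_boundary_diff singular_chain_diff)
      then have "pair \<phi> (?d - c) = 0" by (rule z)
      then show ?thesis by (simp add: l_def pair_diff)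
    qed
    obtain \<psi> where \<psi>: "\<And>c. c \<in> ?A \<Longrightarrow> pair \<psi> c = l c"
    proof (rule extend_functional[of ?A l])
      show "0 \<in> ?A" by (rule image_eqI[of _ _ 0]) auto
      show "a + b \<in> ?A" if "a \<in> ?A" "b \<in> ?A" for a b
        using that by (auto simp: chain_boundary_add[symmetric] intro!: imageI singular_chain_add)
      show "frag_cmul k a \<in> ?A" if "a \<in> ?A" for k a
        using that by (auto simp: chain_boundary_cmul[symmetric] intro!: imageI singular_chain_cmul)
      show "l (a + b) = l a + l b" if "a \<in> ?A" "b \<in> ?A" for a b
        using that l by (auto simp: chain_boundary_add[symmetric] singular_chain_add pair_add)
    qed (use that in blast)
    define \<psi>' where "\<psi>' = (\<lambda>f. if singular_simplex q X f then \<psi> f else 0)"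
    have "\<phi> f = coboundary q X \<psi>' f" for f
    proof (cases "singular_simplex p X f")
      case True
      then have cf: "singular_chain (Suc q) X (frag_of f)" using Suc by (simp add: singular_chain_of)
      have sub: "Poly_Mapping.keys (chain_boundary (Suc q) (frag_of f)) \<subseteq> Collect (singular_simplex q X)"
        using singular_chain_boundary[OF cf] by (simp add: singular_chain_def)
      have "\<phi> f = pair \<psi> (chain_boundary (Suc q) (frag_of f))"
        using \<psi>[of "chain_boundary p (frag_of f)"] l[of "frag_of f"] cf Suc by auto
      also have "\<dots> = pair \<psi>' (chain_boundary (Suc q) (frag_of f))"
        unfolding pair_def using sub by (intro sum.cong) (auto simp: \<psi>'_def)
      also have "\<dots> = coboundary q X \<psi>' f" using pair_coboundary[OF cf, of \<psi>'] by simp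
      finally show ?thesis .
    next
      case False
      then show ?thesis using coch Suc by (simp add: cochains_def coboundary_def sing_simplex_eq)
    qed
    moreover have "\<psi>' \<in> cochains q X" by (simp add: cochains_def \<psi>'_def sing_simplex_eq)
    ultimately show ?thesis using Suc by (auto simp: coboundaries_def)
  qed
qed

lemma coboundaries_subset: "coboundaries p X \<subseteq> cocycles p X"
proof (cases p)
  case 0
  then show ?thesis using subsp_zero[OF subsp_cocycles] by (auto simp: coboundaries_def)
next
  case (Suc q)
  show ?thesis
  proof
    fix \<phi> assume "\<phi> \<in> coboundaries p X"
    then obtain \<psi> where \<phi>: "\<phi> = coboundary q X \<psi>" using Suc by (auto simp: coboundaries_def)
    have "\<phi> \<in> cochains p X" unfolding \<phi> using Suc by (simp add: cochains_def coboundary_def)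
    moreover have "pair \<phi> (chain_boundary (Suc p) c) = 0" if c: "singular_chain (Suc p) X c" for c
    proof -
      have "singular_chain (Suc q) X (chain_boundary (Suc p) c)" using singular_chain_boundary[OF c] Suc by simp
      then have "pair \<phi> (chain_boundary (Suc p) c) = pair \<psi> (chain_boundary (Suc q) (chain_boundary (Suc p) c))"
        unfolding \<phi> by (rule pair_coboundary)
      then show ?thesis using chain_boundary_boundary_alt[of p X c] c Suc by simp
    qed
    ultimately show "\<phi> \<in> cocycles p X" unfolding cocycle_iff by blast
  qed
qed

text \<open>By \<open>coboundaries_iff\<close> they are the kernel of evaluation, which is linear in
  the cocycle.\<close>

lemma subsp_coboundaries: "subsp (coboundaries p X)"
proof -
  have "(\<lambda>s. f s + r * g s) \<in> coboundaries p X" if fg: "f \<in> coboundaries p X" "g \<in> coboundaries p X" for f g r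
  proof -
    have Z: "f \<in> cocycles p X" "g \<in> cocycles p X" using fg coboundaries_subset by auto
    note h = subsp_comb[OF subsp_cocycles Z, of r]
    have "evc p X (\<lambda>s. f s + r * g s) x = evc p X f x + r * evc p X g x" for x
    proof (cases "x \<in> carrier (homology_group (int p) X)")
      case True
      then obtain c where c: "singular_relcycle p X {} c" "x = homologous_rel_set p X {} c" using carrier_class by blast
      then show ?thesis using evc_class[OF h c(1)] evc_class[OF Z(1) c(1)] evc_class[OF Z(2) c(1)] by (simp add: pair_comb)
    qed (simp add: evc_def)
    then show ?thesis using fg unfolding coboundaries_iff[OF h] coboundaries_iff[OF Z(1)] coboundaries_iff[OF Z(2)] by auto
  qed
  moreover have "(\<lambda>s. 0) \<in> coboundaries p X"
    unfolding coboundaries_iff[OF subsp_zero[OF subsp_cocycles]] by (auto simp: evc_def pair_def)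
  ultimately show ?thesis by (simp add: subsp_def)
qed

text \<open>Read on cycles, the functional kills boundaries; an extension to all simplices is
  therefore a cocycle.\<close>

lemma evc_surj:
  assumes "\<phi> \<in> hmf (int p) X"
  shows "\<exists>z\<in>cocycles p X. evc p X z = \<phi>"
proof -
  let ?A = "{c. singular_relcycle p X {} c}"
  obtain \<psi> where \<psi>: "\<And>c. c \<in> ?A \<Longrightarrow> pair \<psi> c = \<phi> (homologous_rel_set p X {} c)"
  proof (rule extend_functional[of ?A "\<lambda>c. \<phi> (homologous_rel_set p X {} c)"])
    show "\<phi> (homologous_rel_set p X {} (a + b)) = \<phi> (homologous_rel_set p X {} a) + \<phi> (homologous_rel_set p X {} b)" if "a \<in> ?A" "b \<in> ?A" for a b
      using assms that class_add[of p X a b] class_carrier[of p X a] class_carrier[of p X b] by (simp add: hmf_def additive_def)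
  qed (auto simp: singular_relcycle_add singular_relcycle_cmul that)
  define z where "z = (\<lambda>f. if singular_simplex p X f then \<psi> f else 0)"
  have pz: "pair z c = pair \<psi> c" if "singular_chain p X c" for c
    unfolding pair_def using that by (intro sum.cong) (auto simp: z_def singular_chain_def)
  have "pair z (chain_boundary (Suc p) c) = 0" if c: "singular_chain (Suc p) X c" for c
  proof -
    have b: "singular_relboundary p X {} (chain_boundary (Suc p) c)" using c by (auto simp: singular_boundary)
    have cy: "singular_relcycle p X {} (chain_boundary (Suc p) c)" by (rule singular_relboundary_imp_relcycle[OF b])
    have "homologous_rel_set p X {} (chain_boundary (Suc p) c) = \<one>\<^bsub>homology_group (int p) X\<^esub>"
      using b by (simp add: homologous_rel_set_eq_relboundary)
    then have "\<phi> (homologous_rel_set p X {} (chain_boundary (Suc p) c)) = 0"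
      using assms additive_one[of "homology_group (int p) X" \<phi>] by (simp add: hmf_def del: one_relative_homology_group)
    then show ?thesis using pz[of "chain_boundary (Suc p) c"] \<psi> cy by (simp add: singular_cycle)
  qed
  then have zc: "z \<in> cocycles p X" by (simp add: cocycle_iff cochains_def z_def sing_simplex_eq)
  have "evc p X z x = \<phi> x" for x
  proof (cases "x \<in> carrier (homology_group (int p) X)")
    case True
    then obtain c where c: "singular_relcycle p X {} c" "x = homologous_rel_set p X {} c" using carrier_class by blast
    then show ?thesis using evc_class[OF zc c(1)] pz[of c] \<psi>[of c] by (simp add: singular_cycle)
  next
    case False
    then show ?thesis using assms by (simp add: hmf_def evc_def)
  qed
  then show ?thesis using zc by blast
qed

definition pbh :: "int \<Rightarrow> 'a topology \<Rightarrow> 'b topology \<Rightarrow> ('a \<Rightarrow> 'b) \<Rightarrow> ('b chain set \<Rightarrow> rat) \<Rightarrow> 'a chain set \<Rightarrow> rat"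
  where "pbh p X Y g \<phi> = (\<lambda>h. if h \<in> carrier (homology_group p X) then \<phi> (HI p X Y g h) else 0)"

lemma pbh_hmf: "\<phi> \<in> hmf p Y \<Longrightarrow> pbh p X Y g \<phi> \<in> hmf p X"
  using additive_comp[OF _ hom_induced_hom, of p Y "{}" \<phi> X "{}" g]
  by (auto simp: hmf_def pbh_def additive_def group.is_monoid monoid.m_closed)

lemma pbh_comb: "pbh p X Y g (\<lambda>s. z s + r * z' s) = (\<lambda>s. pbh p X Y g z s + r * pbh p X Y g z' s)"
  by (auto simp: pbh_def)

lemma pbh_qlin: "qlin (hmf p Y) {\<lambda>s. 0} (hmf p X) {\<lambda>s. 0} (pbh p X Y g)"
  by (auto simp: qlin_def pbh_hmf pbh_comb) (auto simp: pbh_def)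

text \<open>Evaluation identifies cocycles modulo coboundaries with functionals on homology and
  turns the pullback of cochains into \<open>pbh\<close>, so the trace can be computed on
  functionals.\<close>

lemma cohom_trace_eq:
  assumes g: "continuous_map X X g" and bs: "quot_basis (hmf (int p) X) {\<lambda>s. 0} bs"
  shows "cohom_trace p X g = qtr {\<lambda>s. 0} bs (pbh (int p) X X g)"
  unfolding cohom_trace_def
proof (rule quot_trace_transfer[OF subsp_cocycles subsp_coboundaries coboundaries_subset subsp_hmf bs, where ev="evc p X"])
  have pp: "pair (cochain_pullback p X g \<phi>) c = pair \<phi> (chain_map p g c)" if "singular_chain p X c" for \<phi> c
    using that[unfolded singular_chain_def]
  proof (induction c rule: frag_induction)
    case (one x)
    then show ?case by (simp add: cochain_pullback_def sing_simplex_eq std_simplex_eq simplex_map_def)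
  next
    case (diff a b)
    then show ?case by (simp add: chain_map_diff pair_diff)
  qed simp
  show F: "cochain_pullback p X g z \<in> cocycles p X" if z: "z \<in> cocycles p X" for z
    unfolding cocycle_iff
  proof (intro conjI allI impI)
    show "cochain_pullback p X g z \<in> cochains p X" by (simp add: cochains_def cochain_pullback_def)
    fix c assume c: "singular_chain (Suc p) X c"
    have "pair (cochain_pullback p X g z) (chain_boundary (Suc p) c) = pair z (chain_boundary (Suc p) (chain_map (Suc p) g c))"
      using pp[OF singular_chain_boundary_alt[OF c]] chain_boundary_chain_map[OF c, of g] by simp
    then show "pair (cochain_pullback p X g z) (chain_boundary (Suc p) c) = 0"
      using z singular_chain_chain_map[OF c g] by (simp add: cocycle_iff)
  qed
  show "evc p X (cochain_pullback p X g z) = pbh (int p) X X g (evc p X z)" if z: "z \<in> cocycles p X" for z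
  proof
    fix x
    show "evc p X (cochain_pullback p X g z) x = pbh (int p) X X g (evc p X z) x"
    proof (cases "x \<in> carrier (homology_group (int p) X)")
      case True
      then obtain c where c: "singular_relcycle p X {} c" "x = homologous_rel_set p X {} c" using carrier_class by blast
      have cm: "singular_relcycle p X {} (chain_map p g c)" by (rule singular_relcycle_chain_map[OF c(1) g]) auto
      have h: "HI (int p) X X g x = homologous_rel_set p X {} (chain_map p g c)"
        unfolding c(2) by (rule hom_induced_chain_map[OF g _ c(1)]) auto
      show ?thesis using True evc_class[OF F[OF z] c(1)] pp[of c z] c evc_class[OF z cm] h by (simp add: pbh_def singular_cycle)
    qed (simp add: evc_def pbh_def)
  qed
  show "evc p X (\<lambda>s. z s + r * z' s) = (\<lambda>s. evc p X z s + r * evc p X z' s)" if z: "z \<in> cocycles p X" "z' \<in> cocycles p X" for z z' r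
    by (auto simp: evc_def pair_comb)
qed (auto intro: evc_hmf evc_surj pbh_qlin simp: coboundaries_iff)

section \<open>Stability of invariants\<close>

text \<open>Strict linearity on all functions, available because the maps in question are
  precompositions, cut off outside a carrier.\<close>

definition plin :: "(('s \<Rightarrow> rat) \<Rightarrow> ('t \<Rightarrow> rat)) \<Rightarrow> bool"
  where "plin G \<longleftrightarrow> (\<forall>z z' r. G (\<lambda>s. z s + r * z' s) = (\<lambda>s. G z s + r * G z' s))"

lemma plinD: "plin G \<Longrightarrow> G (\<lambda>s. z s + r * z' s) = (\<lambda>s. G z s + r * G z' s)"
  unfolding plin_def by blast
lemma plin_zero: "plin G \<Longrightarrow> G (\<lambda>s. 0) = (\<lambda>s. 0)"
  using plinD[of G "\<lambda>s. 0" "-1" "\<lambda>s. 0"] by simp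
lemma plin_scale: "plin G \<Longrightarrow> G (\<lambda>s. r * z s) = (\<lambda>s. r * G z s)"
  using plinD[of G "\<lambda>s. 0" r z] plin_zero[of G] by simp
lemma plin_add: "plin G \<Longrightarrow> G (\<lambda>s. z s + z' s) = (\<lambda>s. G z s + G z' s)"
  using plinD[of G z 1 z'] by simp
lemma plin_diff: "plin G \<Longrightarrow> G (\<lambda>s. z s - z' s) = (\<lambda>s. G z s - G z' s)"
  using plinD[of G z "-1" z'] by simp
lemma plin_sum:
  assumes "plin G"
  shows "G (\<lambda>s. \<Sum>a\<in>A. f a s) = (\<lambda>s. \<Sum>a\<in>A. G (f a) s)"
proof (induction A rule: infinite_finite_induct)
  case (insert a A)
  then show ?case using plin_add[OF assms, of "f a" "\<lambda>s. \<Sum>a\<in>A. f a s"] by simp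
qed (use plin_zero[OF assms] in simp_all)

lemma plin_qlin:
  assumes "plin G" "\<And>z. z \<in> Z \<Longrightarrow> G z \<in> Z'"
  shows "qlin Z {\<lambda>s. 0} Z' {\<lambda>s. 0} G"
  unfolding qlin_def using assms(2) plin_zero[OF assms(1)] plinD[OF assms(1)] by simp

context quot begin

lemma qfun_sum:
  assumes "qfun Z B l" "finite A" "\<And>a. a \<in> A \<Longrightarrow> f a \<in> Z"
  shows "l (\<lambda>s. r * (\<Sum>a\<in>A. f a s)) = r * (\<Sum>a\<in>A. l (f a))"
proof -
  have l0: "l (\<lambda>s. 0) = 0" using assms(1) subsp_zero[OF B(1)] by (auto simp: qfun_def)
  have lc: "l (\<lambda>s. z s + r * z' s) = l z + r * l z'" if "z \<in> Z" "z' \<in> Z" for z z' r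
    by (rule assms(1)[unfolded qfun_def, THEN conjunct1, rule_format, OF that])
  have "(\<lambda>s. \<Sum>a\<in>A. f a s) \<in> Z \<and> l (\<lambda>s. \<Sum>a\<in>A. f a s) = (\<Sum>a\<in>A. l (f a))"
    using assms(2,3)
  proof (induction A rule: finite_induct)
    case (insert a A)
    then have h: "f a \<in> Z" "(\<lambda>s. \<Sum>a\<in>A. f a s) \<in> Z" by auto
    show ?case using lc[OF h, of 1] subsp_add[OF Z h] insert by simp
  qed (use l0 subsp_zero[OF Z] in simp)
  then show ?thesis using lc[OF subsp_zero[OF Z], of "\<lambda>s. \<Sum>a\<in>A. f a s" r] l0 by simp
qed

lemma qtr_cong: "(\<And>z. z \<in> Z \<Longrightarrow> F z = G z) \<Longrightarrow> qtr B bs F = qtr B bs G"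
  unfolding qtr_def using bs_Z by (intro sum.cong) auto

lemma qtr_sum:
  assumes "finite A" "\<And>a z. a \<in> A \<Longrightarrow> z \<in> Z \<Longrightarrow> F a z \<in> Z"
  shows "qtr B bs (\<lambda>z s. r * (\<Sum>a\<in>A. F a z s)) = r * (\<Sum>a\<in>A. qtr B bs (F a))"
proof -
  have "qtr B bs (\<lambda>z s. r * (\<Sum>a\<in>A. F a z s)) = (\<Sum>j<length bs. r * (\<Sum>a\<in>A. coord B bs (F a (bs ! j)) j))"
    unfolding qtr_def
  proof (rule sum.cong[OF refl])
    fix j assume "j \<in> {..<length bs}"
    then have j: "j < length bs" by simp
    show "coord B bs (\<lambda>s. r * (\<Sum>a\<in>A. F a (bs ! j) s)) j = r * (\<Sum>a\<in>A. coord B bs (F a (bs ! j)) j)"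
      by (rule qfun_sum[OF coord_qfun[OF j] assms(1)]) (rule assms(2)[OF _ bs_Z[OF j]])
  qed
  also have "\<dots> = r * (\<Sum>a\<in>A. qtr B bs (F a))"
    unfolding qtr_def sum_distrib_left[symmetric] by (subst sum.swap) simp
  finally show ?thesis .
qed

end

section \<open>Restriction, transfer and traces on invariants\<close>

text \<open>A dual form of an FI-sharp module. \<open>R n n' \<sigma>\<close> is pullback along
  relabelling by an injection of the labels below n' into those below n, and \<open>st n\<close> is
  pullback along adding a far point labelled n. The last two assumptions treat an injection that
  misses the far label and one that sends the last label to it.\<close>

locale fi_sharp =
  fixes V :: "nat \<Rightarrow> ('s \<Rightarrow> rat) set" and bs :: "nat \<Rightarrow> ('s \<Rightarrow> rat) list"
    and R :: "nat \<Rightarrow> nat \<Rightarrow> (nat \<Rightarrow> nat) \<Rightarrow> ('s \<Rightarrow> rat) \<Rightarrow> ('s \<Rightarrow> rat)"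
    and st :: "nat \<Rightarrow> ('s \<Rightarrow> rat) \<Rightarrow> ('s \<Rightarrow> rat)"
  assumes V: "\<And>n. subsp (V n)" and basis: "\<And>n. quot_basis (V n) {\<lambda>s. 0} (bs n)"
    and R_V: "\<And>n n' \<sigma> \<phi>. \<phi> \<in> V n' \<Longrightarrow> R n n' \<sigma> \<phi> \<in> V n" and R_plin: "\<And>n n' \<sigma>. plin (R n n' \<sigma>)"
    and st_V: "\<And>n \<phi>. \<phi> \<in> V (Suc n) \<Longrightarrow> st n \<phi> \<in> V n" and st_plin: "\<And>n. plin (st n)"
    and R_comp: "\<And>n n' n'' \<sigma> \<tau> \<phi>. \<phi> \<in> V n'' \<Longrightarrow> inj_on \<sigma> {..<n'} \<Longrightarrow> \<sigma> ` {..<n'} \<subseteq> {..<n} \<Longrightarrow> inj_on \<tau> {..<n''} \<Longrightarrow>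
      \<tau> ` {..<n''} \<subseteq> {..<n'} \<Longrightarrow> R n n' \<sigma> (R n' n'' \<tau> \<phi>) = R n n'' (\<sigma> \<circ> \<tau>) \<phi>"
    and R_id: "\<And>n \<phi>. \<phi> \<in> V n \<Longrightarrow> R n n id \<phi> = \<phi>"
    and R_cong: "\<And>n n' \<sigma> \<tau>. (\<And>i. i < n' \<Longrightarrow> \<sigma> i = \<tau> i) \<Longrightarrow> R n n' \<sigma> = R n n' \<tau>"
    and st_R_forget: "\<And>n n' \<sigma> \<phi>. \<phi> \<in> V n' \<Longrightarrow> inj_on \<sigma> {..<n'} \<Longrightarrow> \<sigma> ` {..<n'} \<subseteq> {..<n} \<Longrightarrow> st n (R (Suc n) n' \<sigma> \<phi>) = R n n' \<sigma> \<phi>"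
    and st_R: "\<And>n n' \<sigma> \<phi>. \<phi> \<in> V (Suc n') \<Longrightarrow> inj_on \<sigma> {..<Suc n'} \<Longrightarrow> \<sigma> n' = n \<Longrightarrow> \<sigma> ` {..<n'} \<subseteq> {..<n} \<Longrightarrow>
      st n (R (Suc n) (Suc n') \<sigma> \<phi>) = R n n' \<sigma> (st n' \<phi>)"
begin

lemma quot: "quot (V n) {\<lambda>s. 0} (bs n)"
  using V[of n] basis[of n] subsp_zero_space subsp_zero[OF V[of n]] by unfold_locales auto

definition chi :: "nat \<Rightarrow> (nat \<Rightarrow> nat) \<Rightarrow> rat" where "chi n w = qtr {\<lambda>s. 0} (bs n) (R n n w)"

lemma perm_sub: "v permutes {m..<n} \<Longrightarrow> v permutes {..<n}" for m n :: nat
  by (rule permutes_subset) auto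

lemma permutes_lt: "w permutes {..<n} \<Longrightarrow> inj_on w {..<n}" "w permutes {..<n} \<Longrightarrow> w ` {..<n} \<subseteq> {..<n}"
  using permutes_inj_on permutes_image[of w "{..<n}"] by auto

lemma R_comp_perm:
  assumes "\<phi> \<in> V n" "v permutes {..<n}" "w permutes {..<n}"
  shows "R n n v (R n n w \<phi>) = R n n (v \<circ> w) \<phi>"
  by (rule R_comp[OF assms(1)]) (use permutes_lt(1,2)[OF assms(2)] permutes_lt(1,2)[OF assms(3)] in auto)

lemma chi_conj:
  assumes s: "\<sigma> permutes {..<n}" and w: "w permutes {..<n}"
  shows "chi n (\<sigma> \<circ> w \<circ> inv_into UNIV \<sigma>) = chi n w"
proof -
  interpret q: quot "V n" "{\<lambda>s. 0}" "bs n" by (rule quot)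
  have i: "inv_into UNIV \<sigma> permutes {..<n}" by (rule permutes_inv[OF s])
  have wi: "w \<circ> inv_into UNIV \<sigma> permutes {..<n}" by (rule permutes_compose[OF i w])
  have e: "w \<circ> inv_into UNIV \<sigma> \<circ> \<sigma> = w" using permutes_inv_o(2)[OF s] by (simp add: comp_assoc)
  have "chi n (\<sigma> \<circ> w \<circ> inv_into UNIV \<sigma>) = qtr {\<lambda>s. 0} (bs n) (\<lambda>z. R n n \<sigma> (R n n (w \<circ> inv_into UNIV \<sigma>) z))"
    unfolding chi_def by (rule q.qtr_cong) (simp add: R_comp_perm[OF _ s wi] comp_assoc)
  also have "\<dots> = qtr {\<lambda>s. 0} (bs n) (\<lambda>z. R n n (w \<circ> inv_into UNIV \<sigma>) (R n n \<sigma> z))"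
    by (rule qtr_cyclic[OF quot quot plin_qlin plin_qlin]) (auto intro: R_plin R_V)
  also have "\<dots> = chi n w"
    unfolding chi_def by (rule q.qtr_cong) (simp add: R_comp_perm[OF _ wi s] e)
  finally show ?thesis .
qed

definition Inv :: "nat \<Rightarrow> nat \<Rightarrow> ('s \<Rightarrow> rat) set"
  where "Inv m n = {\<phi> \<in> V n. \<forall>v. v permutes {m..<n} \<longrightarrow> R n n v \<phi> = \<phi>}"

lemma InvD: "\<phi> \<in> Inv m n \<Longrightarrow> \<phi> \<in> V n" "\<phi> \<in> Inv m n \<Longrightarrow> v permutes {m..<n} \<Longrightarrow> R n n v \<phi> = \<phi>"
  by (auto simp: Inv_def)

lemma subsp_Inv: "subsp (Inv m n)"
  using V[of n] plin_zero[OF R_plin] plinD[OF R_plin] by (simp add: subsp_def Inv_def)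

lemma st_Inv: "\<phi> \<in> Inv m (Suc n) \<Longrightarrow> st n \<phi> \<in> Inv m n"
proof -
  assume \<phi>: "\<phi> \<in> Inv m (Suc n)"
  have "R n n v (st n \<phi>) = st n \<phi>" if v: "v permutes {m..<n}" for v
  proof -
    have v': "v permutes {m..<Suc n}" by (rule permutes_subset[OF v]) auto
    have "st n (R (Suc n) (Suc n) v \<phi>) = R n n v (st n \<phi>)"
      by (rule st_R[OF InvD(1)[OF \<phi>]]) (use permutes_lt(1)[OF perm_sub[OF v']] permutes_lt(2)[OF perm_sub[OF v]] permutes_not_in[OF v, of n] in auto)
    then show ?thesis using InvD(2)[OF \<phi> v'] by simp
  qed
  then show ?thesis using st_V[OF InvD(1)[OF \<phi>]] by (simp add: Inv_def)
qed

abbreviation "tp \<equiv> Transposition.transpose"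

text \<open>The transfer sums over the point b that is forgotten: on labels below n the
  transposition \<open>tp b n\<close> takes every value up to n except b, with n standing in for
  b.\<close>

definition tr :: "nat \<Rightarrow> nat \<Rightarrow> ('s \<Rightarrow> rat) \<Rightarrow> ('s \<Rightarrow> rat)"
  where "tr m n \<phi> = (\<lambda>s. \<Sum>b\<in>{m..n}. R (Suc n) n (tp b n) \<phi> s)"

lemma tp_perm: "b \<in> {m..n} \<Longrightarrow> tp b n permutes {m..<Suc n}"
  by (rule permutes_swap_id) auto

lemma tp_lt: "b \<le> n \<Longrightarrow> inj_on (tp b n) {..<n}" "b \<le> n \<Longrightarrow> tp b n ` {..<n} \<subseteq> {..<Suc n}"
  by (auto simp: Transposition.transpose_def inj_on_def)

text \<open>A permutation v of {m..n} carries the summand forgetting b to the one forgetting v b.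
  The two differ by a permutation \<tau> that fixes n, and \<phi> is invariant under it.\<close>

lemma tr_Inv:
  assumes \<phi>: "\<phi> \<in> Inv m n"
  shows "tr m n \<phi> \<in> Inv m (Suc n)"
proof -
  have \<phi>V: "\<phi> \<in> V n" by (rule InvD(1)[OF \<phi>])
  have "R (Suc n) (Suc n) v (tr m n \<phi>) = tr m n \<phi>" if v: "v permutes {m..<Suc n}" for v
  proof -
    have vl: "inj_on v {..<Suc n}" "v ` {..<Suc n} \<subseteq> {..<Suc n}" using permutes_lt(1,2)[OF perm_sub[OF v]] by auto
    have *: "R (Suc n) (Suc n) v (R (Suc n) n (tp b n) \<phi>) = R (Suc n) n (tp (v b) n) \<phi>" if b: "b \<in> {m..n}" for b
    proof -
      have vb: "v b \<in> {m..n}" using permutes_in_image[OF v, of b] b by auto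
      define \<tau> where "\<tau> = tp (v b) n \<circ> v \<circ> tp b n"
      have "\<tau> permutes {m..<Suc n}" unfolding \<tau>_def
        by (intro permutes_compose tp_perm b vb v)
      moreover have "\<tau> n = n" by (simp add: \<tau>_def)
      ultimately have t: "\<tau> permutes {m..<n}" by (auto simp: permutes_def) (metis le_less_Suc_eq nat_less_le not_less)
      have tl: "inj_on \<tau> {..<n}" "\<tau> ` {..<n} \<subseteq> {..<n}" using permutes_lt(1,2)[OF perm_sub[OF t]] by auto
      have e: "v \<circ> tp b n = tp (v b) n \<circ> \<tau>" unfolding \<tau>_def comp_assoc[symmetric] by (simp add: fun_eq_iff)
      have "R (Suc n) (Suc n) v (R (Suc n) n (tp b n) \<phi>) = R (Suc n) n (v \<circ> tp b n) \<phi>"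
        by (rule R_comp[OF \<phi>V vl]) (use tp_lt[of b n] b in auto)
      also have "\<dots> = R (Suc n) n (tp (v b) n) (R n n \<tau> \<phi>)"
        unfolding e by (rule R_comp[OF \<phi>V _ _ tl, symmetric]) (use tp_lt[of "v b" n] vb in auto)
      finally show ?thesis using InvD(2)[OF \<phi> t] by simp
    qed
    have "R (Suc n) (Suc n) v (tr m n \<phi>) = (\<lambda>s. \<Sum>b\<in>{m..n}. R (Suc n) n (tp (v b) n) \<phi> s)"
      unfolding tr_def plin_sum[OF R_plin] using * by (intro ext sum.cong) auto
    also have "\<dots> = tr m n \<phi>"
    proof
      fix s
      have "bij_betw v {m..n} {m..n}" using permutes_imp_bij[OF v] by (simp add: atLeastLessThanSuc_atLeastAtMost)
      then show "(\<Sum>b\<in>{m..n}. R (Suc n) n (tp (v b) n) \<phi> s) = tr m n \<phi> s"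
        unfolding tr_def by (rule sum.reindex_bij_betw)
    qed
    finally show ?thesis .
  qed
  moreover have "tr m n \<phi> \<in> V (Suc n)" unfolding tr_def by (rule subsp_sum[OF _ V]) (auto intro: R_V \<phi>V)
  ultimately show ?thesis by (simp add: Inv_def)
qed

lemma st_R_id: "\<phi> \<in> V n \<Longrightarrow> st n (R (Suc n) n (tp n n) \<phi>) = \<phi>"
proof -
  assume "\<phi> \<in> V n"
  moreover have "tp n n = id" by (simp add: fun_eq_iff)
  ultimately show ?thesis using st_R_forget[of \<phi> n id n] R_id by simp
qed

lemma st_tr_base: "\<phi> \<in> Inv m m \<Longrightarrow> st m (tr m m \<phi>) = \<phi>"
  using st_R_id[OF InvD(1)] by (simp add: tr_def)

text \<open>The added far point has label k + 1. The summand forgetting that very point returns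
  \<phi>. A summand forgetting another b keeps the far point, which takes over a label of \<phi>,
  and so becomes the corresponding summand of the transfer of \<open>st k \<phi>\<close>.\<close>

lemma st_tr:
  assumes \<phi>: "\<phi> \<in> Inv m (Suc k)" and m: "m \<le> k"
  shows "st (Suc k) (tr m (Suc k) \<phi>) = (\<lambda>s. \<phi> s + tr m k (st k \<phi>) s)"
proof -
  have \<phi>V: "\<phi> \<in> V (Suc k)" by (rule InvD(1)[OF \<phi>])
  have *: "st (Suc k) (R (Suc (Suc k)) (Suc k) (tp b (Suc k)) \<phi>) = R (Suc k) k (tp b k) (st k \<phi>)" if b: "b \<in> {m..k}" for b
  proof -
    have p: "tp b k permutes {m..<Suc k}" by (rule tp_perm[OF b])
    \<comment> \<open>Composing with \<open>tp b k\<close> changes nothing by invariance and makes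
      the injection send k to k + 1, the shape that \<open>st_R\<close> asks for.\<close>
    let ?s = "tp b (Suc k) \<circ> tp b k"
    have "R (Suc (Suc k)) (Suc k) (tp b (Suc k)) \<phi> = R (Suc (Suc k)) (Suc k) (tp b (Suc k)) (R (Suc k) (Suc k) (tp b k) \<phi>)"
      using InvD(2)[OF \<phi> p] by simp
    also have "\<dots> = R (Suc (Suc k)) (Suc k) ?s \<phi>"
      by (rule R_comp[OF \<phi>V]) (use tp_lt[of b "Suc k"] b permutes_lt(1,2)[OF perm_sub[OF p]] in auto)
    finally have "st (Suc k) (R (Suc (Suc k)) (Suc k) (tp b (Suc k)) \<phi>) = st (Suc k) (R (Suc (Suc k)) (Suc k) ?s \<phi>)" by simp
    also have "\<dots> = R (Suc k) k ?s (st k \<phi>)"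
    proof (rule st_R[OF \<phi>V])
      show "inj_on ?s {..<Suc k}" by (rule inj_on_subset[of _ UNIV]) (simp_all add: inj_compose)
      show "?s k = Suc k" by simp
      show "?s ` {..<k} \<subseteq> {..<Suc k}" using b by (auto simp: Transposition.transpose_def)
    qed
    also have "R (Suc k) k ?s = R (Suc k) k (tp b k)"
      by (rule R_cong) (auto simp: Transposition.transpose_def)
    finally show ?thesis .
  qed
  have "st (Suc k) (tr m (Suc k) \<phi>) = (\<lambda>s. \<Sum>b\<in>{m..Suc k}. st (Suc k) (R (Suc (Suc k)) (Suc k) (tp b (Suc k)) \<phi>) s)"
    unfolding tr_def by (rule plin_sum[OF st_plin])
  also have "\<dots> = (\<lambda>s. st (Suc k) (R (Suc (Suc k)) (Suc k) (tp (Suc k) (Suc k)) \<phi>) s + (\<Sum>b\<in>{m..k}. st (Suc k) (R (Suc (Suc k)) (Suc k) (tp b (Suc k)) \<phi>) s))"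
    using m by (intro ext) (simp add: atLeastAtMostSuc_conv)
  also have "\<dots> = (\<lambda>s. \<phi> s + tr m k (st k \<phi>) s)"
    unfolding st_R_id[OF \<phi>V] tr_def using * by (intro ext) simp
  finally show ?thesis .
qed

text \<open>The shift by t makes the induction go through: the identity \<open>st tr = 1 + tr st\<close> (one level down)
  raises t by one at each step, and at the bottom level \<open>st tr\<close> is the identity.\<close>

lemma st_tr_shift_surj:
  assumes "m \<le> n" "y \<in> Inv m n"
  shows "\<exists>x\<in>Inv m n. (\<lambda>s. st n (tr m n x) s + rat_of_nat t * x s) = y"
  using assms
proof (induction n arbitrary: y t rule: dec_induct)
  case base
  let ?x = "\<lambda>s. (1 / (1 + of_nat t)) * y s"
  have x: "?x \<in> Inv m m" by (rule subsp_scale[OF subsp_Inv base])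
  have p: "(1 + rat_of_nat t) \<noteq> 0" by (metis of_nat_Suc of_nat_eq_0_iff nat.distinct(1))
  have "(\<lambda>s. st m (tr m m ?x) s + rat_of_nat t * ?x s) = y"
    unfolding st_tr_base[OF x] using p by (auto simp: fun_eq_iff divide_simps) (simp add: algebra_simps)
  then show ?case using x by blast
next
  case (step k)
  have p: "(1 + rat_of_nat t) \<noteq> 0" by (metis of_nat_Suc of_nat_eq_0_iff nat.distinct(1))
  obtain w where w: "w \<in> Inv m k" "(\<lambda>s. st k (tr m k w) s + rat_of_nat (Suc t) * w s) = st k y"
    using step.IH[OF st_Inv[OF step.prems]] by blast
  \<comment> \<open>Arranged so that \<open>st k x\<close> equals w; by \<open>st_tr\<close> the
    left side then becomes (1 + t) x plus the transfer of w, which is y.\<close>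
  define x where "x = (\<lambda>s. (1 / (1 + rat_of_nat t)) * (y s - tr m k w s))"
  have x: "x \<in> Inv m (Suc k)" unfolding x_def by (rule subsp_scale[OF subsp_Inv subsp_diff[OF subsp_Inv step.prems tr_Inv[OF w(1)]]])
  have "st k x = (\<lambda>s. (1 / (1 + rat_of_nat t)) * (st k y s - st k (tr m k w) s))"
    unfolding x_def plin_scale[OF st_plin] plin_diff[OF st_plin] ..
  also have "\<dots> = w" using p by (simp add: w(2)[symmetric] fun_eq_iff)
  finally have sx: "st k x = w" .
  have "st (Suc k) (tr m (Suc k) x) s + rat_of_nat t * x s = y s" for s
  proof -
    have "(1 + rat_of_nat t) * x s = y s - tr m k w s" using p by (simp add: x_def)
    then show ?thesis using st_tr[OF x step.hyps(1)] sx by (simp add: algebra_simps)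
  qed
  then show ?case using x by blast
qed

lemma st_surj: "m \<le> n \<Longrightarrow> y \<in> Inv m n \<Longrightarrow> \<exists>x\<in>Inv m (Suc n). st n x = y"
  using st_tr_shift_surj[of m n y 0] tr_Inv by auto

text \<open>The averaging projection onto \<open>Inv m n\<close>.\<close>

definition ev :: "nat \<Rightarrow> nat \<Rightarrow> ('s \<Rightarrow> rat) \<Rightarrow> ('s \<Rightarrow> rat)"
  where "ev m n \<phi> = (\<lambda>s. (1 / fact (n - m)) * (\<Sum>v | v permutes {m..<n}. R n n v \<phi> s))"

lemma ev_plin: "plin (ev m n)"
  unfolding plin_def ev_def plinD[OF R_plin] by (simp add: sum.distrib sum_distrib_left algebra_simps)

lemma ev_Inv: "\<phi> \<in> V n \<Longrightarrow> ev m n \<phi> \<in> Inv m n"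
proof -
  assume \<phi>: "\<phi> \<in> V n"
  have "R n n w (ev m n \<phi>) = ev m n \<phi>" if w: "w permutes {m..<n}" for w
  proof
    fix s
    have "R n n w (ev m n \<phi>) s = (1 / fact (n - m)) * (\<Sum>v | v permutes {m..<n}. R n n (w \<circ> v) \<phi> s)"
      unfolding ev_def plin_scale[OF R_plin] plin_sum[OF R_plin]
      by (intro arg_cong2[where f="(*)"] refl sum.cong) (simp add: R_comp_perm[OF \<phi> perm_sub[OF w] perm_sub])
    also have "(\<Sum>v | v permutes {m..<n}. R n n (w \<circ> v) \<phi> s) = (\<Sum>v | v permutes {m..<n}. R n n v \<phi> s)"
      using setum_permutations_compose_left[OF w, of "\<lambda>v. R n n v \<phi> s"] by simp
    finally show "R n n w (ev m n \<phi>) s = ev m n \<phi> s" by (simp add: ev_def)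
  qed
  moreover have "ev m n \<phi> \<in> V n" unfolding ev_def
    by (rule subsp_scale[OF V subsp_sum[OF _ V]]) (auto intro: finite_permutations R_V \<phi>)
  ultimately show ?thesis by (simp add: Inv_def)
qed

lemma ev_id: "\<phi> \<in> Inv m n \<Longrightarrow> ev m n \<phi> = \<phi>"
  unfolding ev_def using InvD(2)[of \<phi> m n] card_permutations[of "{m..<n}" "n - m"] by (simp add: fun_eq_iff)

lemma R_Inv:
  assumes u: "u permutes {..<m}" "m \<le> n" and \<phi>: "\<phi> \<in> Inv m n"
  shows "R n n u \<phi> \<in> Inv m n"
proof -
  have u': "u permutes {..<n}" by (rule permutes_subset[OF u(1)]) (use u(2) in auto)
  have "R n n v (R n n u \<phi>) = R n n u \<phi>" if v: "v permutes {m..<n}" for v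
  proof -
    have "v \<circ> u = u \<circ> v"
    proof
      fix i show "(v \<circ> u) i = (u \<circ> v) i"
        using permutes_not_in[OF u(1), of i] permutes_not_in[OF v, of i] permutes_not_in[OF u(1), of "v i"] permutes_not_in[OF v, of "u i"]
          permutes_in_image[OF u(1), of i] permutes_in_image[OF v, of i] by (cases "i < m"; cases "i < n") auto
    qed
    then show ?thesis
      using R_comp_perm[OF InvD(1)[OF \<phi>] perm_sub[OF v] u'] R_comp_perm[OF InvD(1)[OF \<phi>] u' perm_sub[OF v]] InvD(2)[OF \<phi> v] by simp
  qed
  then show ?thesis using R_V[OF InvD(1)[OF \<phi>]] by (simp add: Inv_def)
qed

text \<open>For a permutation u of {..<m} this is the trace of u on \<open>Inv m n\<close>:
  averaging over v inserts the projection \<open>ev m n\<close>, see \<open>avg_qtr\<close>.\<close>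

definition avg :: "nat \<Rightarrow> nat \<Rightarrow> (nat \<Rightarrow> nat) \<Rightarrow> rat"
  where "avg m n u = (1 / fact (n - m)) * (\<Sum>v | v permutes {m..<n}. chi n (u \<circ> v))"

lemma avg_qtr:
  assumes u: "u permutes {..<m}" "m \<le> n"
  shows "avg m n u = qtr {\<lambda>s. 0} (bs n) (\<lambda>z. R n n u (ev m n z))"
proof -
  interpret q: quot "V n" "{\<lambda>s. 0}" "bs n" by (rule quot)
  have u': "u permutes {..<n}" by (rule permutes_subset[OF u(1)]) (use u(2) in auto)
  have "avg m n u = qtr {\<lambda>s. 0} (bs n) (\<lambda>z s. (1 / fact (n - m)) * (\<Sum>v | v permutes {m..<n}. R n n (u \<circ> v) z s))"
    unfolding avg_def chi_def by (rule q.qtr_sum[symmetric]) (auto intro: finite_permutations R_V)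
  also have "\<dots> = qtr {\<lambda>s. 0} (bs n) (\<lambda>z. R n n u (ev m n z))"
  proof (rule q.qtr_cong, rule ext)
    fix z s assume z: "z \<in> V n"
    show "(1 / fact (n - m)) * (\<Sum>v | v permutes {m..<n}. R n n (u \<circ> v) z s) = R n n u (ev m n z) s"
      unfolding ev_def plin_scale[OF R_plin] plin_sum[OF R_plin]
      by (intro arg_cong2[where f="(*)"] refl sum.cong) (simp add: R_comp_perm[OF z u' perm_sub])
  qed
  finally show ?thesis .
qed

text \<open>The injectivity hypothesis and \<open>st_surj\<close> make \<open>st n\<close> an
  isomorphism between the two spaces of invariants, and it commutes with u. The rest is cyclicity of
  the trace, with the inverse \<open>L\<close> as one of the two factors.\<close>

lemma avg_stable:
  assumes u: "u permutes {..<m}" and m: "m \<le> n"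
    and inj: "\<And>\<phi>. \<phi> \<in> Inv m (Suc n) \<Longrightarrow> st n \<phi> = (\<lambda>s. 0) \<Longrightarrow> \<phi> = (\<lambda>s. 0)"
  shows "avg m n u = avg m (Suc n) u"
proof -
  define L where "L = (\<lambda>y. SOME x. x \<in> Inv m (Suc n) \<and> st n x = y)"
  have L: "L y \<in> Inv m (Suc n)" "st n (L y) = y" if "y \<in> Inv m n" for y
    using someI_ex[of "\<lambda>x. x \<in> Inv m (Suc n) \<and> st n x = y"] st_surj[OF m that] unfolding L_def by blast+
  have uniq: "x = x'" if "x \<in> Inv m (Suc n)" "x' \<in> Inv m (Suc n)" "st n x = st n x'" for x x'
  proof -
    have "(\<lambda>s. x s - x' s) = (\<lambda>s. 0)"
      by (rule inj[OF subsp_diff[OF subsp_Inv that(1,2)]]) (simp add: plin_diff[OF st_plin] that(3))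
    then show ?thesis by (simp add: fun_eq_iff)
  qed
  have u2: "u permutes {..<n}" by (rule permutes_subset[OF u]) (use m in auto)
  have stu: "st n (R (Suc n) (Suc n) u z) = R n n u (st n z)" if "z \<in> V (Suc n)" for z
  proof (rule st_R[OF that])
    have u3: "u permutes {..<Suc n}" by (rule permutes_subset[OF u]) (use m in auto)
    show "inj_on u {..<Suc n}" by (rule permutes_inj_on[OF u3])
    show "u n = n" using permutes_not_in[OF u] m by simp
    show "u ` {..<n} \<subseteq> {..<n}" using permutes_image[OF u2] by simp
  qed
  \<comment> \<open>The traces are taken on the full spaces, so both factors begin with the
    averaging projection.\<close>
  let ?X = "\<lambda>z. L (ev m n z)" and ?Y = "\<lambda>z. R n n u (st n (ev m (Suc n) z))"
  have X: "qlin (V n) {\<lambda>s. 0} (V (Suc n)) {\<lambda>s. 0} ?X"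
    unfolding qlin_def
  proof (intro conjI ballI allI)
    show "?X z \<in> V (Suc n)" if "z \<in> V n" for z by (rule InvD(1)[OF L(1)[OF ev_Inv[OF that]]])
    have L0: "L (\<lambda>s. 0) = (\<lambda>s. 0)" by (rule inj[OF L(1,2)[OF subsp_zero[OF subsp_Inv]]])
    show "?X b \<in> {\<lambda>s. 0}" if "b \<in> {\<lambda>s. 0}" for b using that L0 plin_zero[OF ev_plin] by simp
    fix z z' r assume "z \<in> V n" "z' \<in> V n"
    then have e: "ev m n z \<in> Inv m n" "ev m n z' \<in> Inv m n" by (auto intro: ev_Inv)
    have c: "(\<lambda>s. ev m n z s + r * ev m n z' s) \<in> Inv m n" by (rule subsp_comb[OF subsp_Inv e])
    have "L (\<lambda>s. ev m n z s + r * ev m n z' s) = (\<lambda>s. ?X z s + r * ?X z' s)"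
      by (rule uniq[OF L(1)[OF c] subsp_comb[OF subsp_Inv L(1)[OF e(1)] L(1)[OF e(2)]]])
        (simp only: plinD[OF st_plin] L(2)[OF c] L(2)[OF e(1)] L(2)[OF e(2)])
    then show "(\<lambda>s. ?X (\<lambda>t. z t + r * z' t) s - (?X z s + r * ?X z' s)) \<in> {\<lambda>s. 0}"
      unfolding plinD[OF ev_plin] by simp
  qed
  have Y: "qlin (V (Suc n)) {\<lambda>s. 0} (V n) {\<lambda>s. 0} ?Y"
  proof (rule plin_qlin)
    show "plin ?Y" unfolding plin_def by (simp only: plinD[OF ev_plin] plinD[OF st_plin] plinD[OF R_plin] simp_thms)
    show "?Y z \<in> V n" if "z \<in> V (Suc n)" for z by (intro R_V st_V InvD(1)[OF ev_Inv] that)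
  qed
  interpret q: quot "V n" "{\<lambda>s. 0}" "bs n" by (rule quot)
  interpret q': quot "V (Suc n)" "{\<lambda>s. 0}" "bs (Suc n)" by (rule quot)
  have "avg m n u = qtr {\<lambda>s. 0} (bs n) (\<lambda>z. ?Y (?X z))"
    unfolding avg_qtr[OF u m]
  proof (rule q.qtr_cong)
    fix z assume "z \<in> V n"
    then have e: "ev m n z \<in> Inv m n" by (rule ev_Inv)
    show "R n n u (ev m n z) = ?Y (?X z)" unfolding ev_id[OF L(1)[OF e]] L(2)[OF e] ..
  qed
  also have "\<dots> = qtr {\<lambda>s. 0} (bs (Suc n)) (\<lambda>z. ?X (?Y z))" by (rule qtr_cyclic[OF quot quot X Y])
  also have "\<dots> = avg m (Suc n) u"
    unfolding avg_qtr[OF u le_SucI[OF m]]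
  proof (rule q'.qtr_cong)
    fix z assume "z \<in> V (Suc n)"
    then have e: "ev m (Suc n) z \<in> Inv m (Suc n)" by (rule ev_Inv)
    have y: "?Y z \<in> Inv m n" by (rule R_Inv[OF u m st_Inv[OF e]])
    show "?X (?Y z) = R (Suc n) (Suc n) u (ev m (Suc n) z)"
      unfolding ev_id[OF y]
      by (rule uniq[OF L(1)[OF y] R_Inv[OF u le_SucI[OF m] e]]) (simp only: L(2)[OF y] stu[OF InvD(1)[OF e]])
  qed
  finally show ?thesis .
qed

end

section \<open>Class functions of character polynomials\<close>

definition orbw :: "(nat \<Rightarrow> nat) \<Rightarrow> nat \<Rightarrow> nat set" where "orbw w x = range (\<lambda>k. (w ^^ k) x)"

definition cyc :: "(nat \<Rightarrow> nat) \<Rightarrow> nat set \<Rightarrow> nat \<Rightarrow> nat set set"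
  where "cyc w A j = {C. \<exists>x\<in>A. C = orbw w x \<and> card C = j}"

text \<open>A monomial in the cycle counts counts tuples of cycles, one for each slot; these are sorted
  by the union A of the chosen cycles.\<close>

definition slots :: "(nat \<Rightarrow>\<^sub>0 nat) \<Rightarrow> (nat \<times> nat) set"
  where "slots e = Sigma (Poly_Mapping.keys e) (\<lambda>j. {..<Poly_Mapping.lookup e j})"

definition covers :: "(nat \<Rightarrow>\<^sub>0 nat) \<Rightarrow> (nat \<Rightarrow> nat) \<Rightarrow> nat set \<Rightarrow> (nat \<times> nat \<Rightarrow> nat set) set"
  where "covers e w A = {f \<in> PiE (slots e) (\<lambda>p. cyc w A (fst p)). \<Union> (f ` slots e) = A}"

text \<open>For A stable under w it depends only on the restriction of w to A, by
  \<open>local_val_cong\<close>; this is what lets the sum over permutations factor in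
  \<open>sum_local_split\<close>.\<close>

definition local_val :: "qpoly \<Rightarrow> nat set \<Rightarrow> (nat \<Rightarrow> nat) \<Rightarrow> rat"
  where "local_val P A w = (\<Sum>e\<in>Poly_Mapping.keys P. Poly_Mapping.lookup P e * of_nat (card (covers e w A)))"

lemma finite_slots: "finite (slots e)" by (simp add: slots_def)

lemma finite_cyc: "finite A \<Longrightarrow> finite (cyc w A j)"
  by (rule finite_subset[of _ "orbw w ` A"]) (auto simp: cyc_def)

lemma finite_covers: "finite A \<Longrightarrow> finite (covers e w A)"
  unfolding covers_def by (intro finite_subset[OF _ finite_PiE[OF finite_slots finite_cyc]]) auto

lemma self_orbw: "x \<in> orbw w x"
  unfolding orbw_def by (rule range_eqI[of _ _ 0]) simp

lemma orbw_closed: "w ` A \<subseteq> A \<Longrightarrow> x \<in> A \<Longrightarrow> orbw w x \<subseteq> A"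
proof -
  assume a: "w ` A \<subseteq> A" "x \<in> A"
  have "(w ^^ k) x \<in> A" for k by (induction k) (use a in auto)
  then show ?thesis by (auto simp: orbw_def)
qed

lemma orbw_step: "y \<in> orbw w x \<Longrightarrow> w y \<in> orbw w x"
proof -
  assume "y \<in> orbw w x"
  then obtain k where "y = (w ^^ k) x" by (auto simp: orbw_def)
  then have "w y = (w ^^ Suc k) x" by simp
  then show ?thesis unfolding orbw_def by (rule range_eqI)
qed

text \<open>A product of powers of cycle counts is the number of functions from slots to cycles of
  the prescribed lengths; these functions are grouped by the union of their values.\<close>

lemma monomial_covers:
  assumes w: "w permutes {..<n}"
  shows "(\<Prod>j\<in>Poly_Mapping.keys e. (rat_of_nat (cycle_count n w j)) ^ Poly_Mapping.lookup e j) = (\<Sum>A\<in>Pow {..<n}. of_nat (card (covers e w A)))"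
proof -
  let ?F = "PiE (slots e) (\<lambda>p. cyc w {..<n} (fst p))"
  have cc: "cycle_count n w j = card (cyc w {..<n} j)" for j
    unfolding cycle_count_def cyc_def orbw_def by (rule arg_cong[where f=card]) auto
  have fin: "finite ?F" by (intro finite_PiE finite_slots finite_cyc) simp
  have wsub: "w ` {..<n} \<subseteq> {..<n}" using permutes_image[OF w] by simp
  have "(\<Prod>j\<in>Poly_Mapping.keys e. cycle_count n w j ^ Poly_Mapping.lookup e j) = (\<Prod>j\<in>Poly_Mapping.keys e. \<Prod>t<Poly_Mapping.lookup e j. card (cyc w {..<n} j))"
    by (simp add: cc)
  also have "\<dots> = (\<Prod>p\<in>slots e. card (cyc w {..<n} (fst p)))"
    unfolding slots_def by (subst prod.Sigma) (auto simp: case_prod_unfold)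
  also have "\<dots> = card ?F" by (simp add: card_PiE finite_slots)
  also have "\<dots> = (\<Sum>A\<in>Pow {..<n}. card (covers e w A))"
  proof -
    have "(\<Sum>A\<in>Pow {..<n}. \<Sum>f | f \<in> ?F \<and> \<Union> (f ` slots e) = A. 1) = (\<Sum>f\<in>?F. 1::nat)"
    proof (rule sum.group[OF fin])
      show "(\<lambda>f. \<Union> (f ` slots e)) ` ?F \<subseteq> Pow {..<n}"
      proof (clarify, rename_tac y f j t)
        fix f j t y assume f: "f \<in> ?F" and p: "(j, t) \<in> slots e" and y: "y \<in> f (j, t)"
        have "f (j, t) \<in> cyc w {..<n} j" using PiE_mem[OF f p] by simp
        then obtain x where "x < n" "f (j, t) = orbw w x" by (auto simp: cyc_def)
        then show "y < n" using orbw_closed[OF wsub, of x] y by auto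
      qed
    qed simp
    moreover have "{f. f \<in> ?F \<and> \<Union> (f ` slots e) = A} = covers e w A" if A: "A \<subseteq> {..<n}" for A
    proof -
      have "f p \<in> cyc w A (fst p)" if f: "f \<in> ?F" "\<Union> (f ` slots e) = A" and p: "p \<in> slots e" for f p
      proof -
        have "f p \<in> cyc w {..<n} (fst p)" using f p by (auto simp: PiE_iff)
        then obtain x where x: "f p = orbw w x" "card (f p) = fst p" by (auto simp: cyc_def)
        have "x \<in> A" using self_orbw[of x w] x f(2) p by blast
        then show ?thesis using x by (auto simp: cyc_def)
      qed
      moreover have "cyc w A j \<subseteq> cyc w {..<n} j" for j using A by (auto simp: cyc_def)
      ultimately show ?thesis unfolding covers_def PiE_iff by blast
    qed
    ultimately show ?thesis by (simp add: card_eq_sum[symmetric])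
  qed
  finally have "rat_of_nat (\<Prod>j\<in>Poly_Mapping.keys e. cycle_count n w j ^ Poly_Mapping.lookup e j) = rat_of_nat (\<Sum>A\<in>Pow {..<n}. card (covers e w A))" by (simp only:)
  then show ?thesis by simp
qed

lemma char_poly_val_local:
  assumes "w permutes {..<n}"
  shows "char_poly_val P n w = (\<Sum>A\<in>Pow {..<n}. local_val P A w)"
  unfolding char_poly_val_def local_val_def monomial_covers[OF assms] sum_distrib_left by (rule sum.swap)

text \<open>A union of cycles is stable, and the cycle in a slot (j, t) has j elements, so the union
  has at most the weighted degree of the monomial.\<close>

lemma covers_support:
  assumes f: "f \<in> covers e w A" and w: "inj w" and A: "finite A"
  shows "w ` A = A" "card A \<le> (\<Sum>j\<in>Poly_Mapping.keys e. j * Poly_Mapping.lookup e j)"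
proof -
  have fA: "\<Union> (f ` slots e) = A" and fc: "\<And>p. p \<in> slots e \<Longrightarrow> f p \<in> cyc w A (fst p)"
    using f by (auto simp: covers_def)
  have "w ` A \<subseteq> A"
  proof
    fix z assume "z \<in> w ` A"
    then obtain y p where y: "z = w y" "p \<in> slots e" "y \<in> f p" using fA by blast
    then obtain x where "f p = orbw w x" using fc[OF y(2)] by (auto simp: cyc_def)
    then have "z \<in> f p" using orbw_step[of y w x] y by simp
    then show "z \<in> A" using fA y(2) by blast
  qed
  then show "w ` A = A" using A inj_on_subset[OF w subset_UNIV] by (intro endo_inj_surj)
  have "card A \<le> (\<Sum>p\<in>slots e. card (f p))" unfolding fA[symmetric] by (rule card_UN_le[OF finite_slots])
  also have "\<dots> = (\<Sum>p\<in>slots e. fst p)" using fc by (intro sum.cong) (auto simp: cyc_def)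
  also have "\<dots> = (\<Sum>j\<in>Poly_Mapping.keys e. \<Sum>t<Poly_Mapping.lookup e j. j)"
    unfolding slots_def by (subst sum.Sigma) (auto simp: case_prod_unfold)
  finally show "card A \<le> (\<Sum>j\<in>Poly_Mapping.keys e. j * Poly_Mapping.lookup e j)" by (simp add: mult.commute)
qed

lemma local_val_support:
  assumes "local_val P A w \<noteq> 0" "inj w" "finite A"
  shows "w ` A = A" "card A \<le> wdeg P"
proof -
  obtain e where e: "e \<in> Poly_Mapping.keys P" "card (covers e w A) \<noteq> 0"
    using assms(1) unfolding local_val_def by (rule sum.not_neutral_contains_not_neutral) simp
  then obtain f where f: "f \<in> covers e w A" by (metis all_not_in_conv card.empty)
  show "w ` A = A" by (rule covers_support(1)[OF f assms(2,3)])
  have "card A \<le> (\<Sum>j\<in>Poly_Mapping.keys e. j * Poly_Mapping.lookup e j)" by (rule covers_support(2)[OF f assms(2,3)])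
  also have "\<dots> \<le> wdeg P" unfolding wdeg_def using e by (intro Max_ge) auto
  finally show "card A \<le> wdeg P" .
qed

lemma local_val_cong:
  assumes "w ` A \<subseteq> A" "\<And>x. x \<in> A \<Longrightarrow> w x = w' x"
  shows "local_val P A w = local_val P A w'"
proof -
  have "(w ^^ k) x \<in> A \<and> (w' ^^ k) x = (w ^^ k) x" if "x \<in> A" for k x
    by (induction k) (use assms that in auto)
  then have "orbw w x = orbw w' x" if "x \<in> A" for x using that by (simp add: orbw_def)
  then have "cyc w A = cyc w' A" by (auto simp: cyc_def fun_eq_iff)
  then show ?thesis by (simp add: local_val_def covers_def)
qed

text \<open>Conjugation by s carries cycles to cycles injectively; the reverse inequality comes from
  the inverse of s.\<close>

lemma card_covers_conj_le:
  assumes s: "bij s" and A: "finite A"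
  shows "card (covers e w A) \<le> card (covers e (s \<circ> w \<circ> inv_into UNIV s) (s ` A))"
proof (rule card_inj_on_le)
  let ?w = "s \<circ> w \<circ> inv_into UNIV s"
  let ?\<Psi> = "\<lambda>f. restrict (\<lambda>p. s ` f p) (slots e)"
  have inj: "inj s" using s by (simp add: bij_def)
  have pw: "(?w ^^ k) (s x) = s ((w ^^ k) x)" for k x by (induction k) (simp_all add: inv_f_f[OF inj])
  have orb: "orbw ?w (s x) = s ` orbw w x" for x unfolding orbw_def pw by auto
  show "finite (covers e ?w (s ` A))" by (rule finite_covers) (use A in simp)
  show "inj_on ?\<Psi> (covers e w A)"
  proof (rule inj_onI)
    fix f g assume fg: "f \<in> covers e w A" "g \<in> covers e w A" and eq: "?\<Psi> f = ?\<Psi> g"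
    show "f = g"
    proof (rule PiE_ext)
      show "f \<in> PiE (slots e) (\<lambda>p. cyc w A (fst p))" "g \<in> PiE (slots e) (\<lambda>p. cyc w A (fst p))" using fg by (auto simp: covers_def)
      fix p assume "p \<in> slots e"
      then have "s ` f p = s ` g p" using fun_cong[OF eq, of p] by simp
      then show "f p = g p" using inj by (simp add: inj_image_eq_iff)
    qed
  qed
  show "?\<Psi> ` covers e w A \<subseteq> covers e ?w (s ` A)"
  proof (rule image_subsetI)
    fix f assume f: "f \<in> covers e w A"
    have "s ` f p \<in> cyc ?w (s ` A) (fst p)" if p: "p \<in> slots e" for p
    proof -
      have "f p \<in> cyc w A (fst p)" using f p by (auto simp: covers_def)
      then obtain x where "x \<in> A" "f p = orbw w x" "card (f p) = fst p" by (auto simp: cyc_def)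
      then show ?thesis using orb[of x] card_image[OF inj_on_subset[OF inj subset_UNIV], of "f p"] by (auto simp: cyc_def)
    qed
    moreover have "\<Union> (?\<Psi> f ` slots e) = s ` \<Union> (f ` slots e)" by (simp add: image_UN)
    ultimately show "?\<Psi> f \<in> covers e ?w (s ` A)" using f by (simp add: covers_def)
  qed
qed

lemma local_val_conj:
  assumes s: "bij s" and A: "finite A"
  shows "local_val P (s ` A) (s \<circ> w \<circ> inv_into UNIV s) = local_val P A w"
proof -
  have inj: "inj s" and surj: "surj s" using s by (auto simp: bij_def)
  have "card (covers e (s \<circ> w \<circ> inv_into UNIV s) (s ` A)) = card (covers e w A)" for e
  proof (rule antisym[OF _ card_covers_conj_le[OF s A]])
    let ?i = "inv_into UNIV s"
    have "?i ` s ` A = A" using inj by (simp add: image_comp)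
    moreover have "?i \<circ> (s \<circ> w \<circ> ?i) \<circ> inv_into UNIV ?i = w"
      using inj surj by (simp add: inv_inv_eq[OF s] fun_eq_iff)
    ultimately show "card (covers e (s \<circ> w \<circ> ?i) (s ` A)) \<le> card (covers e w A)"
      using card_covers_conj_le[OF bij_imp_bij_inv[OF s], of "s ` A" e "s \<circ> w \<circ> ?i"] A by simp
  qed
  then show ?thesis by (simp add: local_val_def)
qed

section \<open>Averaging local contributions over the symmetric group\<close>

lemma permutes_onto:
  assumes A: "A \<subseteq> {..<n::nat}"
  obtains s where "s permutes {..<n}" "s ` {..<card A} = A"
proof -
  have fA: "finite A" using A by (rule finite_subset) simp
  have cA: "card A \<le> n" using card_mono[OF _ A] by simp
  obtain f where f: "bij_betw f {..<card A} A" using finite_same_card_bij[of "{..<card A}" A] fA by auto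
  have "card ({..<n} - {..<card A}) = card ({..<n} - A)"
    using A fA cA by (simp add: card_Diff_subset)
  then obtain g where g: "bij_betw g ({..<n} - {..<card A}) ({..<n} - A)"
    using finite_same_card_bij[of "{..<n} - {..<card A}" "{..<n} - A"] by auto
  define s where "s i = (if i < card A then f i else if i < n then g i else i)" for i
  have f': "bij_betw s {..<card A} A" using f by (rule bij_betw_cong[THEN iffD1, rotated]) (simp add: s_def)
  have g': "bij_betw s ({..<n} - {..<card A}) ({..<n} - A)" using g by (rule bij_betw_cong[THEN iffD1, rotated]) (simp add: s_def)
  have "bij_betw s ({..<card A} \<union> ({..<n} - {..<card A})) (A \<union> ({..<n} - A))" by (rule bij_betw_combine[OF f' g']) auto
  moreover have "{..<card A} \<union> ({..<n} - {..<card A}) = {..<n}" "A \<union> ({..<n} - A) = {..<n}" using cA A by auto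
  ultimately have "bij_betw s {..<n} {..<n}" by simp
  then have "s permutes {..<n}" by (rule bij_imp_permutes) (use cA in \<open>auto simp: s_def\<close>)
  then show thesis using that f' by (auto simp: bij_betw_def)
qed

text \<open>Conjugating the summation variable by a permutation that takes {..<card A} onto A
  changes neither the local value nor the class function.\<close>

lemma sum_local_conj:
  assumes chi: "\<And>s w. s permutes {..<n} \<Longrightarrow> w permutes {..<n} \<Longrightarrow> ch (s \<circ> w \<circ> inv_into UNIV s) = ch w"
    and A: "A \<subseteq> {..<n}"
  shows "(\<Sum>w | w permutes {..<n}. local_val P A w * ch w) = (\<Sum>w | w permutes {..<n}. local_val P {..<card A} w * ch w)"
proof -
  obtain s where s: "s permutes {..<n}" "s ` {..<card A} = A" by (rule permutes_onto[OF A])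
  let ?i = "inv_into UNIV s"
  have i: "?i permutes {..<n}" by (rule permutes_inv[OF s(1)])
  have io: "s (?i x) = x" "?i (s x) = x" for x using permutes_inverses[OF s(1)] by auto
  show ?thesis
  proof (rule sum.reindex_bij_witness[where i="\<lambda>w. s \<circ> w \<circ> ?i" and j="\<lambda>w. ?i \<circ> w \<circ> s"])
    fix w assume w: "w \<in> {w. w permutes {..<n}}"
    show "s \<circ> (?i \<circ> w \<circ> s) \<circ> ?i = w" "?i \<circ> (s \<circ> w \<circ> ?i) \<circ> s = w" by (auto simp: fun_eq_iff io)
    have j: "?i \<circ> w \<circ> s permutes {..<n}" using w i s(1) by (intro permutes_compose) auto
    then show "?i \<circ> w \<circ> s \<in> {w. w permutes {..<n}}" by simp
    show "s \<circ> w \<circ> ?i \<in> {w. w permutes {..<n}}" using w i s(1) permutes_compose by blast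
    have e: "s \<circ> (?i \<circ> w \<circ> s) \<circ> ?i = w" by (auto simp: fun_eq_iff io)
    show "local_val P {..<card A} (?i \<circ> w \<circ> s) * ch (?i \<circ> w \<circ> s) = local_val P A w * ch w"
      using chi[OF s(1) j] local_val_conj[OF permutes_bij[OF s(1)], of "{..<card A}" P "?i \<circ> w \<circ> s"] unfolding e s(2) by simp
  qed
qed

text \<open>Only permutations that preserve {..<m} have a nonzero local value. Each of them is
  uniquely a permutation u of {..<m} composed with a permutation v of {m..<n}, and the local value
  sees u alone.\<close>

lemma sum_local_split:
  assumes m: "m \<le> n"
  shows "(\<Sum>w | w permutes {..<n}. local_val P {..<m} w * ch w) =
    (\<Sum>u | u permutes {..<m}. local_val P {..<m} u * (\<Sum>v | v permutes {m..<n}. ch (u \<circ> v)))"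
proof -
  let ?T = "{w. w permutes {..<n} \<and> w ` {..<m} = {..<m}}"
  let ?U = "{u. u permutes {..<m}} \<times> {v. v permutes {m..<n}}"
  have fin: "finite {w. w permutes {..<n}}" by (simp add: finite_permutations)
  have "(\<Sum>w | w permutes {..<n}. local_val P {..<m} w * ch w) = (\<Sum>w\<in>?T. local_val P {..<m} w * ch w)"
  proof (rule sum.mono_neutral_right[OF fin])
    show "\<forall>w\<in>{w. w permutes {..<n}} - ?T. local_val P {..<m} w * ch w = 0"
      using local_val_support(1)[of P "{..<m}"] permutes_inj by fastforce
  qed auto
  also have "\<dots> = (\<Sum>(u, v)\<in>?U. local_val P {..<m} u * ch (u \<circ> v))"
  proof (rule sum.reindex_bij_witness[where i="\<lambda>(u, v). u \<circ> v" and j="\<lambda>w. (\<lambda>i. if i < m then w i else i, \<lambda>i. if i < m then i else w i)"])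
    fix w assume w: "w \<in> ?T"
    then have wp: "w permutes {..<n}" and wm: "w ` {..<m} = {..<m}" by auto
    have winj: "inj w" by (rule permutes_inj[OF wp])
    have wlt: "w i < m \<longleftrightarrow> i < m" for i
      using wm inj_image_mem_iff[OF winj, of i "{..<m}"] by auto
    have e: "(\<lambda>i. if i < m then w i else i) \<circ> (\<lambda>i. if i < m then i else w i) = w"
      by (auto simp: fun_eq_iff wlt)
    show "(case (\<lambda>i. if i < m then w i else i, \<lambda>i. if i < m then i else w i) of (u, v) \<Rightarrow> u \<circ> v) = w" using e by simp
    have u: "(\<lambda>i. if i < m then w i else i) permutes {..<m}"
    proof (rule bij_imp_permutes)
      have "bij_betw w {..<m} {..<m}" using wm inj_on_subset[OF winj subset_UNIV] by (simp add: bij_betw_def)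
      then show "bij_betw (\<lambda>i. if i < m then w i else i) {..<m} {..<m}" by (rule bij_betw_cong[THEN iffD1, rotated]) simp
    qed simp
    have v: "(\<lambda>i. if i < m then i else w i) permutes {m..<n}"
    proof (rule bij_imp_permutes)
      have "w ` ({..<n} - {..<m}) = {..<n} - {..<m}" unfolding image_set_diff[OF winj] permutes_image[OF wp] wm ..
      moreover have "{..<n} - {..<m} = {m..<n}" by auto
      ultimately have "w ` {m..<n} = {m..<n}" by (simp only:)
      then have "bij_betw w {m..<n} {m..<n}" using inj_on_subset[OF winj subset_UNIV] by (simp add: bij_betw_def)
      then show "bij_betw (\<lambda>i. if i < m then i else w i) {m..<n} {m..<n}" by (rule bij_betw_cong[THEN iffD1, rotated]) simp
      show "(if i < m then i else w i) = i" if "i \<notin> {m..<n}" for i using that permutes_not_in[OF wp, of i] by auto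
    qed
    show "(\<lambda>i. if i < m then w i else i, \<lambda>i. if i < m then i else w i) \<in> ?U" using u v by simp
    have "local_val P {..<m} w = local_val P {..<m} (\<lambda>i. if i < m then w i else i)"
      by (rule local_val_cong) (use wm in auto)
    then show "(case (\<lambda>i. if i < m then w i else i, \<lambda>i. if i < m then i else w i) of (u, v) \<Rightarrow> local_val P {..<m} u * ch (u \<circ> v)) = local_val P {..<m} w * ch w"
      using e by simp
  next
    fix b assume b: "b \<in> ?U"
    obtain u v where uv: "b = (u, v)" "u permutes {..<m}" "v permutes {m..<n}" using b by auto
    have u': "u permutes {..<n}" by (rule permutes_subset[OF uv(2)]) (use m in auto)
    have v': "v permutes {..<n}" by (rule permutes_subset[OF uv(3)]) auto
    have vid: "v i = i" if "i < m" for i using permutes_not_in[OF uv(3), of i] that by simp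
    have vge: "\<not> v i < m" if "\<not> i < m" for i
      using permutes_in_image[OF uv(3), of i] permutes_not_in[OF uv(3), of i] that by (cases "i < n") auto
    have "(u \<circ> v) ` {..<m} = u ` {..<m}" using vid by (auto simp: image_def)
    then show "(case b of (u, v) \<Rightarrow> u \<circ> v) \<in> ?T" using uv permutes_compose[OF v' u'] permutes_image[OF uv(2)] by simp
    have uid: "u i = i" if "\<not> i < m" for i using permutes_not_in[OF uv(2), of i] that by simp
    have "(\<lambda>i. if i < m then (u \<circ> v) i else i) = u" using vid uid by (auto simp: fun_eq_iff)
    moreover have "(\<lambda>i. if i < m then i else (u \<circ> v) i) = v" using vid uid vge by (auto simp: fun_eq_iff)
    ultimately show "(\<lambda>i. if i < m then (case b of (u, v) \<Rightarrow> u \<circ> v) i else i, \<lambda>i. if i < m then i else (case b of (u, v) \<Rightarrow> u \<circ> v) i) = b"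
      unfolding uv(1) split_conv by (rule arg_cong2[where f=Pair])
  qed
  also have "\<dots> = (\<Sum>u | u permutes {..<m}. local_val P {..<m} u * (\<Sum>v | v permutes {m..<n}. ch (u \<circ> v)))"
    by (simp add: sum.cartesian_product[symmetric] sum_distrib_left)
  finally show ?thesis .
qed

text \<open>All A of the same size m contribute equally, and sizes above \<open>wdeg P\<close>
  contribute nothing. Since (n choose m) / n! equals 1 / (m! (n - m)!), the dependence on n is
  confined to the averages over v.\<close>

lemma inner_expansion:
  assumes chi: "\<And>s w. s permutes {..<n} \<Longrightarrow> w permutes {..<n} \<Longrightarrow> ch (s \<circ> w \<circ> inv_into UNIV s) = ch w"
    and n: "wdeg P \<le> n"
  shows "Sn_inner n (char_poly_val P n) ch = (\<Sum>m\<le>wdeg P. (1 / fact m) * (\<Sum>u | u permutes {..<m}. local_val P {..<m} u *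
    ((1 / fact (n - m)) * (\<Sum>v | v permutes {m..<n}. ch (u \<circ> v)))))"
proof -
  define h where "h m = (\<Sum>w | w permutes {..<n}. local_val P {..<m} w * ch w)" for m
  have "(\<Sum>w | w permutes {..<n}. char_poly_val P n w * ch w) = (\<Sum>w | w permutes {..<n}. \<Sum>A\<in>Pow {..<n}. local_val P A w * ch w)"
    by (rule sum.cong) (simp_all add: char_poly_val_local sum_distrib_right)
  also have "\<dots> = (\<Sum>A\<in>Pow {..<n}. \<Sum>w | w permutes {..<n}. local_val P A w * ch w)" by (rule sum.swap)
  also have "\<dots> = (\<Sum>A\<in>Pow {..<n}. h (card A))"
    unfolding h_def
  proof (rule sum.cong[OF refl])
    fix A assume "A \<in> Pow {..<n}"
    then have A: "A \<subseteq> {..<n}" by simp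
    show "(\<Sum>w | w permutes {..<n}. local_val P A w * ch w) = (\<Sum>w | w permutes {..<n}. local_val P {..<card A} w * ch w)"
      by (rule sum_local_conj[where ch=ch, OF _ A]) (rule chi)
  qed
  also have "\<dots> = (\<Sum>m\<le>n. \<Sum>A | A \<in> Pow {..<n} \<and> card A = m. h (card A))"
    by (rule sum.group[symmetric]) (use card_mono[of "{..<n}"] in auto)
  also have "\<dots> = (\<Sum>m\<le>n. of_nat (n choose m) * h m)"
  proof (rule sum.cong[OF refl])
    fix m
    have "(\<Sum>A | A \<in> Pow {..<n} \<and> card A = m. h (card A)) = (\<Sum>A | A \<in> Pow {..<n} \<and> card A = m. h m)" by (rule sum.cong) auto
    then show "(\<Sum>A | A \<in> Pow {..<n} \<and> card A = m. h (card A)) = of_nat (n choose m) * h m"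
      using n_subsets[of "{..<n}" m] by simp
  qed
  also have "\<dots> = (\<Sum>m\<le>wdeg P. of_nat (n choose m) * h m)"
  proof (rule sum.mono_neutral_right)
    show "\<forall>m\<in>{..n} - {..wdeg P}. of_nat (n choose m) * h m = 0"
    proof
      fix m assume "m \<in> {..n} - {..wdeg P}"
      then have "local_val P {..<m} w = 0" if "w permutes {..<n}" for w
        using local_val_support(2)[of P "{..<m}" w] permutes_inj[OF that] by (cases "local_val P {..<m} w = 0") auto
      then show "of_nat (n choose m) * h m = 0" by (simp add: h_def)
    qed
  qed (use n in auto)
  finally have "Sn_inner n (char_poly_val P n) ch = (\<Sum>m\<le>wdeg P. of_nat (n choose m) * h m) / fact n"
    by (simp add: Sn_inner_def)
  also have "\<dots> = (\<Sum>m\<le>wdeg P. (1 / fact m) * (\<Sum>u | u permutes {..<m}. local_val P {..<m} u *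
    ((1 / fact (n - m)) * (\<Sum>v | v permutes {m..<n}. ch (u \<circ> v)))))"
    unfolding sum_divide_distrib
  proof (rule sum.cong[OF refl])
    fix m assume "m \<in> {..wdeg P}"
    then have m: "m \<le> n" using n by simp
    have "of_nat (n choose m) * h m / fact n = (1 / fact m) * ((1 / fact (n - m)) * h m)"
      using m by (simp add: binomial_fact)
    also have "(1 / fact (n - m)) * h m = (\<Sum>u | u permutes {..<m}. local_val P {..<m} u *
      ((1 / fact (n - m)) * (\<Sum>v | v permutes {m..<n}. ch (u \<circ> v))))"
      unfolding h_def sum_local_split[OF m] sum_distrib_left by (intro sum.cong refl) (simp add: sum_distrib_left mult.left_commute)
    finally show "of_nat (n choose m) * h m / fact n = (1 / fact m) * (\<Sum>u | u permutes {..<m}. local_val P {..<m} u *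
      ((1 / fact (n - m)) * (\<Sum>v | v permutes {m..<n}. ch (u \<circ> v))))" .
  qed
  finally show ?thesis .
qed

section \<open>Stability for configuration spaces\<close>

text \<open>There is just one empty configuration, so this is the homology of a point: infinite
  cyclic in degree 0 and trivial otherwise.\<close>

lemma conf_empty_class:
  "\<exists>T. finite T \<and> T \<subseteq> carrier (HC d q {}) \<and>
    (\<forall>\<phi>. additive (HC d q {}) \<phi> \<longrightarrow> (\<forall>t\<in>T. \<phi> t = 0) \<longrightarrow> (\<forall>z\<in>carrier (HC d q {}). \<phi> z = 0))"
proof -
  have top: "topspace (conf d {}) = {\<lambda>x. undefined}" by (simp add: conf_def)
  show ?thesis
  proof (cases "q = 0")
    case False
    have "carrier (HC d q {}) = {\<one>\<^bsub>HC d q {}\<^esub>}"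
      using homology_dimension_axiom[OF top False] unfolding trivial_group_def by blast
    then show ?thesis using additive_one[OF _ group_relative_homology_group] by (intro exI[of _ "{}"]) auto
  next
    case True
    have "homology_group 0 (conf d {}) \<cong> integer_group" by (rule homology_coefficients[OF top])
    then obtain h where h: "h \<in> iso integer_group (HC d q {})"
      using group.iso_sym[OF group_relative_homology_group] True unfolding is_iso_def by blast
    have hh: "h \<in> hom integer_group (HC d q {})" and hs: "carrier (HC d q {}) = range h"
      using h by (auto simp: iso_def bij_betw_def)
    have "\<phi> z = 0" if \<phi>: "additive (HC d q {}) \<phi>" and h1: "\<phi> (h 1) = 0" and z: "z \<in> carrier (HC d q {})" for \<phi> z
    proof -
      have a: "additive integer_group (\<lambda>k. \<phi> (h k))" by (rule additive_comp[OF \<phi> hh])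
      have add: "\<phi> (h (k + l)) = \<phi> (h k) + \<phi> (h l)" for k l using additiveD[OF a, of k l] by simp
      have h0: "\<phi> (h 0) = 0" using add[of 0 0] by simp
      have "\<phi> (h k) = 0" for k
      proof (induction k rule: int_induct[where k=0])
        case (step1 i)
        then show ?case using add[of i 1] h1 by simp
      next
        case (step2 i)
        then show ?case using add[of "i - 1" 1] h1 by simp
      qed (rule h0)
      then show ?thesis using z hs by auto
    qed
    moreover have "h 1 \<in> carrier (HC d q {})" using hs by simp
    ultimately show ?thesis by (intro exI[of _ "{h 1}"]) auto
  qed
qed

text \<open>Far and orbit classes of finitely many classes on S separate the functionals on one more
  point, by \<open>conf_generation'\<close>. A separating set is the input that
  \<open>quot_basis_exists\<close> takes, so traces are defined.\<close>

lemma conf_finite_separating: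
  assumes "finite S" "d > 0"
  shows "\<exists>T. finite T \<and> T \<subseteq> carrier (HC d q S) \<and>
    (\<forall>\<phi>. additive (HC d q S) \<phi> \<longrightarrow> (\<forall>t\<in>T. \<phi> t = 0) \<longrightarrow> (\<forall>z\<in>carrier (HC d q S). \<phi> z = 0))"
  using assms(1)
proof (induction S arbitrary: q rule: finite_induct)
  case empty
  show ?case by (rule conf_empty_class)
next
  case (insert a S)
  obtain q0 where q: "q = q0 + int d - 1" by (rule that[of "q - int d + 1"]) simp
  obtain T where T: "finite T" "T \<subseteq> carrier (HC d q S)"
    "\<And>\<phi> z. additive (HC d q S) \<phi> \<Longrightarrow> (\<forall>t\<in>T. \<phi> t = 0) \<Longrightarrow> z \<in> carrier (HC d q S) \<Longrightarrow> \<phi> z = 0"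
    using insert.IH[of q] by metis
  obtain T0 where T0: "finite T0" "T0 \<subseteq> carrier (HC d q0 S)"
    "\<And>\<phi> z. additive (HC d q0 S) \<phi> \<Longrightarrow> (\<forall>t\<in>T0. \<phi> t = 0) \<Longrightarrow> z \<in> carrier (HC d q0 S) \<Longrightarrow> \<phi> z = 0"
    using insert.IH[of q0] by metis
  let ?U = "sH d q S a ` T \<union> (\<Union>j\<in>S. oH d q0 S a j ` T0)"
  have "finite ?U" using T(1) T0(1) insert.hyps(1) by blast
  moreover have "?U \<subseteq> carrier (HC d q (insert a S))"
    using sH_carrier[of d q S a] oH_carrier[of d q0 S a] q by blast
  moreover have "\<phi> z = 0" if \<phi>: "additive (HC d q (insert a S)) \<phi>" and U: "\<forall>t\<in>?U. \<phi> t = 0" and z: "z \<in> carrier (HC d q (insert a S))" for \<phi> z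
  proof (rule conf_generation'[OF insert.hyps assms(2) \<phi> _ _ z])
    show "\<phi> (sH d q S a u) = 0" if "u \<in> carrier (HC d q S)" for u
      by (rule T(3)[OF additive_comp[OF \<phi> sH_hom] _ that]) (use U in blast)
    fix q1 j u assume q1: "q = q1 + int d - 1" and j: "j \<in> S" and u: "u \<in> carrier (HC d q1 S)"
    have [simp]: "q1 = q0" using q q1 by simp
    show "\<phi> (oH d q1 S a j u) = 0"
    proof -
      have "additive (HC d q0 S) (\<lambda>u. \<phi> (oH d q0 S a j u))"
        by (rule additive_comp[OF _ oH_hom]) (use \<phi> in \<open>simp only: q\<close>)
      moreover have "\<forall>t\<in>T0. \<phi> (oH d q0 S a j t) = 0" using U j by blast
      ultimately show ?thesis using T0(3)[of "\<lambda>u. \<phi> (oH d q0 S a j u)" u] u by simp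
    qed
  qed
  ultimately show ?case by (intro exI[of _ ?U] conjI allI impI ballI)
qed

definition Phi :: "nat \<Rightarrow> int \<Rightarrow> nat \<Rightarrow> ((nat \<Rightarrow> nat \<Rightarrow> real) chain set \<Rightarrow> rat) set"
  where "Phi d q n = hmf q (conf d {..<n})"

definition Rn :: "nat \<Rightarrow> int \<Rightarrow> nat \<Rightarrow> nat \<Rightarrow> (nat \<Rightarrow> nat) \<Rightarrow> ((nat \<Rightarrow> nat \<Rightarrow> real) chain set \<Rightarrow> rat) \<Rightarrow> (nat \<Rightarrow> nat \<Rightarrow> real) chain set \<Rightarrow> rat"
  where "Rn d q n n' \<sigma> = pbh q (conf d {..<n}) (conf d {..<n'}) (ren \<sigma> {..<n'})"

definition stn :: "nat \<Rightarrow> int \<Rightarrow> nat \<Rightarrow> ((nat \<Rightarrow> nat \<Rightarrow> real) chain set \<Rightarrow> rat) \<Rightarrow> (nat \<Rightarrow> nat \<Rightarrow> real) chain set \<Rightarrow> rat"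
  where "stn d q n = pbh q (conf d {..<n}) (conf d {..<Suc n}) (addfar n {..<n})"

definition Phi_basis :: "nat \<Rightarrow> int \<Rightarrow> nat \<Rightarrow> ((nat \<Rightarrow> nat \<Rightarrow> real) chain set \<Rightarrow> rat) list"
  where "Phi_basis d q n = (SOME bs. quot_basis (Phi d q n) {\<lambda>s. 0} bs)"

lemma Rn_apply: "Rn d q n n' \<sigma> \<phi> h = (if h \<in> carrier (HC d q {..<n}) then \<phi> (rH d q {..<n} {..<n'} \<sigma> h) else 0)"
  by (simp add: Rn_def pbh_def rH_def)

lemma stn_apply: "stn d q n \<phi> h = (if h \<in> carrier (HC d q {..<n}) then \<phi> (sH d q {..<n} n h) else 0)"
  by (simp add: stn_def pbh_def sH_def lessThan_Suc)

lemma Phi_basis: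
  assumes "d > 0"
  shows "quot_basis (Phi d q n) {\<lambda>s. 0} (Phi_basis d q n)"
proof -
  obtain T where T: "finite T" "T \<subseteq> carrier (HC d q {..<n})"
    "\<And>\<phi> z. additive (HC d q {..<n}) \<phi> \<Longrightarrow> (\<forall>t\<in>T. \<phi> t = 0) \<Longrightarrow> z \<in> carrier (HC d q {..<n}) \<Longrightarrow> \<phi> z = 0"
    using conf_finite_separating[OF finite_lessThan[of n] assms, of q] by metis
  have "\<exists>bs. quot_basis (Phi d q n) {\<lambda>s. 0} bs"
  proof (rule quot_basis_exists[OF T(1)])
    show "subsp (Phi d q n)" unfolding Phi_def by (rule subsp_hmf)
    fix f assume "f \<in> Phi d q n" and "\<And>t. t \<in> T \<Longrightarrow> f t = 0"
    then show "f = (\<lambda>s. 0)" using T(3)[of f] by (auto simp: Phi_def hmf_def fun_eq_iff)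
  qed
  then show ?thesis unfolding Phi_basis_def by (rule someI_ex)
qed

lemma fi_sharp_conf:
  assumes d: "d > 0"
  shows "fi_sharp (Phi d q) (Phi_basis d q) (Rn d q) (stn d q)"
proof
  have less: "{..<Suc n} = insert n {..<n}" for n :: nat by (rule lessThan_Suc)
  show "subsp (Phi d q n)" for n unfolding Phi_def by (rule subsp_hmf)
  show "quot_basis (Phi d q n) {\<lambda>s. 0} (Phi_basis d q n)" for n by (rule Phi_basis[OF d])
  show "Rn d q n n' \<sigma> \<phi> \<in> Phi d q n" if "\<phi> \<in> Phi d q n'" for n n' \<sigma> \<phi>
    using that unfolding Phi_def Rn_def by (rule pbh_hmf)
  show "plin (Rn d q n n' \<sigma>)" for n n' \<sigma> unfolding plin_def Rn_def pbh_comb by simp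
  show "stn d q n \<phi> \<in> Phi d q n" if "\<phi> \<in> Phi d q (Suc n)" for n \<phi>
    using that unfolding Phi_def stn_def by (rule pbh_hmf)
  show "plin (stn d q n)" for n unfolding plin_def stn_def pbh_comb by simp
  show "Rn d q n n' \<sigma> (Rn d q n' n'' \<tau> \<phi>) = Rn d q n n'' (\<sigma> \<circ> \<tau>) \<phi>"
    if "inj_on \<sigma> {..<n'}" "\<sigma> ` {..<n'} \<subseteq> {..<n}" "inj_on \<tau> {..<n''}" "\<tau> ` {..<n''} \<subseteq> {..<n'}" for n n' n'' \<sigma> \<tau> \<phi>
    unfolding fun_eq_iff Rn_apply rH_comp[OF that] using rH_carrier by simp
  show "Rn d q n n id \<phi> = \<phi>" if "\<phi> \<in> Phi d q n" for n \<phi>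
    using that by (auto simp: fun_eq_iff Rn_apply rH_id Phi_def hmf_def)
  show "Rn d q n n' \<sigma> = Rn d q n n' \<tau>" if "\<And>i. i < n' \<Longrightarrow> \<sigma> i = \<tau> i" for n n' \<sigma> \<tau>
    unfolding fun_eq_iff Rn_apply using rH_cong[of "{..<n'}" \<sigma> \<tau> d q "{..<n}"] that by simp
  show "stn d q n (Rn d q (Suc n) n' \<sigma> \<phi>) = Rn d q n n' \<sigma> \<phi>"
    if "inj_on \<sigma> {..<n'}" "\<sigma> ` {..<n'} \<subseteq> {..<n}" for n n' \<sigma> \<phi>
    using sH_carrier[of d q "{..<n}" n] rH_forget_sH[OF finite_lessThan d _ that, of n q]
    unfolding fun_eq_iff Rn_apply stn_apply less by simp
  show "stn d q n (Rn d q (Suc n) (Suc n') \<sigma> \<phi>) = Rn d q n n' \<sigma> (stn d q n' \<phi>)"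
    if "inj_on \<sigma> {..<Suc n'}" "\<sigma> n' = n" "\<sigma> ` {..<n'} \<subseteq> {..<n}" for n n' \<sigma> \<phi>
    using sH_carrier[of d q "{..<n}" n] rH_carrier[of d q "{..<n}" "{..<n'}" \<sigma>]
      rH_sH[OF finite_lessThan _ finite_lessThan _ d that(1)[unfolded less] that(2,3), of q]
    unfolding fun_eq_iff Rn_apply stn_apply less by simp
qed

section \<open>The stable range\<close>

text \<open>Invariance allows any label in {m..n} to be exchanged with n. Hence a functional that
  vanishes when point n is far is primitive for all n + 1 - m labels, and
  \<open>primitive_vanishes\<close> applies.\<close>

lemma st_injective:
  assumes d: "d \<ge> 2" and \<phi>: "\<phi> \<in> fi_sharp.Inv (Phi d q) (Rn d q) m (Suc n)" and z: "stn d q n \<phi> = (\<lambda>s. 0)"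
    and m: "m \<le> n" and q: "q < (int d - 1) * (int (Suc n - m) - (if odd d then 0 else 1))"
  shows "\<phi> = (\<lambda>s. 0)"
proof -
  have d0: "d > 0" using d by simp
  interpret fi_sharp "Phi d q" "Phi_basis d q" "Rn d q" "stn d q" by (rule fi_sharp_conf[OF d0])
  let ?S = "{..<Suc n}" and ?R = "{m..<Suc n}"
  have add: "additive (HC d q ?S) \<phi>" using InvD(1)[OF \<phi>] by (simp add: Phi_def hmf_def)
  have inv: "\<phi> (rH d q ?S ?S v x) = \<phi> x" if "v permutes ?R" "x \<in> carrier (HC d q ?S)" for v x
    using fun_cong[OF InvD(2)[OF \<phi> that(1)], of x] that(2) by (simp add: Rn_apply)
  have sym: "sym_on d q ?S ?R \<phi>" unfolding sym_on_def using inv by blast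
  have pr: "primitive d q ?S ?R \<phi>"
    unfolding primitive_def
  proof (intro allI impI ballI)
    fix b T u assume b: "b \<in> ?R" "b \<notin> T" "?S = insert b T" and u: "u \<in> carrier (HC d q T)"
    have Tf: "finite T" using b(3) finite_lessThan[of "Suc n"] by simp
    have T: "T = ?S - {b}" using b by auto
    have bn: "b \<le> n" using b(1) by simp
    have p: "tp b n permutes ?R" by (rule tp_perm) (use b(1) in auto)
    have ne: "tp b n x \<noteq> b" if "x < n" for x
    proof
      assume "tp b n x = b"
      then have "tp b n (tp b n x) = n" by (simp only: Transposition.transpose_apply_first)
      then have "x = n" by simp
      then show False using \<open>x < n\<close> by simp
    qed
    have i: "tp b n ` {..<n} \<subseteq> T"
    proof (rule image_subsetI)
      fix x assume x: "x \<in> {..<n}"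
      show "tp b n x \<in> T" unfolding T
        by (rule DiffI[OF subsetD[OF tp_lt(2)[OF bn] imageI[OF x]]]) (use ne[of x] x in simp)
    qed
    have "\<phi> (sH d q T b u) = \<phi> (rH d q ?S ?S (tp b n) (sH d q T b u))"
      by (rule inv[OF p, symmetric]) (use sH_carrier[of d q T b u] in \<open>simp only: b(3)\<close>)
    also have "rH d q ?S ?S (tp b n) (sH d q T b u) = rH d q (insert b T) (insert n {..<n}) (tp b n) (sH d q T b u)"
      by (simp only: b(3)[symmetric] lessThan_Suc[symmetric])
    also have "\<dots> = sH d q {..<n} n (rH d q T {..<n} (tp b n) u)"
      by (rule rH_sH[OF Tf b(2) finite_lessThan _ d0 inj_on_subset[OF inj_transpose subset_UNIV] _ i]) simp_all
    also have "\<phi> \<dots> = 0"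
      using fun_cong[OF z, of "rH d q T {..<n} (tp b n) u"] rH_carrier[of d q T "{..<n}" "tp b n" u] by (simp add: stn_apply)
    finally show "\<phi> (sH d q T b u) = 0" .
  qed
  have "\<phi> x = 0" if "x \<in> carrier (HC d q ?S)" for x
    by (rule primitive_vanishes[OF d finite_lessThan _ add sym pr _ that]) (use q in auto)
  then show ?thesis using InvD(1)[OF \<phi>] by (auto simp: Phi_def hmf_def fun_eq_iff)
qed

lemma Conf_eq_conf: "Conf n d = conf d {..<n}"
  unfolding Conf_def conf_def by (rule arg_cong[where f="subtopology _"]) (auto simp: inj_on_def)

lemma conf_char_chi:
  assumes d: "d > 0" and w: "w permutes {..<n}"
  shows "conf_char p n d w = fi_sharp.chi (Phi_basis d (int p)) (Rn d (int p)) n w"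
proof -
  interpret fi_sharp "Phi d (int p)" "Phi_basis d (int p)" "Rn d (int p)" "stn d (int p)" by (rule fi_sharp_conf[OF d])
  have pa: "perm_action n w = ren w {..<n}" by (simp add: perm_action_def[abs_def] ren_def[abs_def])
  have "continuous_map (conf d {..<n}) (conf d {..<n}) (ren w {..<n})"
    by (rule cont_ren) (use permutes_lt[OF w] in auto)
  then show ?thesis
    unfolding conf_char_def Conf_eq_conf pa chi_def Rn_def
    by (rule cohom_trace_eq) (rule Phi_basis[OF d, unfolded Phi_def])
qed

lemma Sn_inner_cong: "(\<And>w. w permutes {..<n} \<Longrightarrow> g w = h w) \<Longrightarrow> Sn_inner n f g = Sn_inner n f h"
  unfolding Sn_inner_def by (intro arg_cong2[where f="(/)"] sum.cong) auto

text \<open>By \<open>inner_expansion\<close> the dependence on n sits in the traces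
  \<open>avg\<close>, and these agree for n and n + 1 by \<open>avg_stable\<close>.\<close>

lemma inner_step:
  assumes d: "d \<ge> 2" and n: "n \<ge> wdeg P + i + (if odd d then 0 else 1)"
  shows "Sn_inner n (char_poly_val P n) (conf_char (i * (d - 1)) n d)
    = Sn_inner (Suc n) (char_poly_val P (Suc n)) (conf_char (i * (d - 1)) (Suc n) d)"
proof -
  define q where "q = int (i * (d - 1))"
  have d0: "d > 0" using d by simp
  interpret fi_sharp "Phi d q" "Phi_basis d q" "Rn d q" "stn d q" by (rule fi_sharp_conf[OF d0])
  have char: "Sn_inner k (char_poly_val P k) (conf_char (i * (d - 1)) k d) =
     (\<Sum>m\<le>wdeg P. (1 / fact m) * (\<Sum>u | u permutes {..<m}. local_val P {..<m} u * avg m k u))" if k: "wdeg P \<le> k" for k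
  proof -
    have "Sn_inner k (char_poly_val P k) (conf_char (i * (d - 1)) k d) = Sn_inner k (char_poly_val P k) (chi k)"
      by (rule Sn_inner_cong) (simp only: conf_char_chi[OF d0] q_def)
    also have "\<dots> = (\<Sum>m\<le>wdeg P. (1 / fact m) * (\<Sum>u | u permutes {..<m}. local_val P {..<m} u *
        ((1 / fact (k - m)) * (\<Sum>v | v permutes {m..<k}. chi k (u \<circ> v)))))"
      by (rule inner_expansion[OF _ k]) (rule chi_conj)
    finally show ?thesis unfolding avg_def .
  qed
  have "avg m n u = avg m (Suc n) u" if m: "m \<le> wdeg P" and u: "u permutes {..<m}" for m u
  proof (rule avg_stable[OF u])
    show mn: "m \<le> n" using m n by simp
    fix \<phi> assume \<phi>: "\<phi> \<in> Inv m (Suc n)" "stn d q n \<phi> = (\<lambda>s. 0)"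
    show "\<phi> = (\<lambda>s. 0)"
    proof (rule st_injective[OF d \<phi> mn])
      \<comment> \<open>Injectivity is used at level n + 1, which has n + 1 - m freely permuted
        points. With m at most \<open>wdeg P\<close> they exceed i for odd d and i + 1 for even d as
        soon as n reaches the stated bound; the strict inequality comes from this step up by
        one.\<close>
      have "int i < int (Suc n - m) - (if odd d then 0 else 1)" using m n by (simp split: if_splits)
      then have "(int d - 1) * int i < (int d - 1) * (int (Suc n - m) - (if odd d then 0 else 1))"
        using d by (intro mult_strict_left_mono) auto
      moreover have "q = (int d - 1) * int i" unfolding q_def using d by (simp add: of_nat_diff mult.commute)
      ultimately show "q < (int d - 1) * (int (Suc n - m) - (if odd d then 0 else 1))" by simp
    qed
  qed
  then show ?thesis unfolding char[of n, OF order_trans[OF _ n, of "wdeg P", simplified]] char[of "Suc n", OF order_trans[OF _ le_SucI[OF n], of "wdeg P", simplified]]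
    by (intro sum.cong arg_cong2[where f="(*)"] refl) auto
qed

theorem mainTheorem16:
  fixes P :: qpoly and d i :: nat
  assumes "\<forall>e\<in>Poly_Mapping.keys P. Poly_Mapping.lookup e 0 = 0"
    and "d \<ge> 2" and "i \<ge> 1"
  shows "\<forall>n m.
    n \<ge> max (2 * wdeg P) (wdeg P + i + (if odd d then 0 else 1)) \<longrightarrow>
    m \<ge> max (2 * wdeg P) (wdeg P + i + (if odd d then 0 else 1)) \<longrightarrow>
    Sn_inner n (char_poly_val P n) (conf_char (i * (d - 1)) n d)
      = Sn_inner m (char_poly_val P m) (conf_char (i * (d - 1)) m d)"
proof (intro allI impI)
  let ?N = "wdeg P + i + (if odd d then 0 else 1)"
  let ?f = "\<lambda>n. Sn_inner n (char_poly_val P n) (conf_char (i * (d - 1)) n d)"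
  have const: "?f n = ?f ?N" if "?N \<le> n" for n
    using that
  proof (induction n rule: dec_induct)
    case (step n)
    then show ?case using inner_step[OF assms(2) step.hyps(1)] by (simp only:)
  qed (rule refl)
  fix n m assume "n \<ge> max (2 * wdeg P) ?N" "m \<ge> max (2 * wdeg P) ?N"
  then show "?f n = ?f m" using const[of n] const[of m] by (simp only: max.bounded_iff)
qed

end
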